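(* For every $\varepsilon>0$ there exists $\delta>0$ (depending only on $\varepsilon$ and on the pressure $p$) such that the following holds. Let $(n,u,\phi)$ be an $L^2$-compact solution of the Euler–Poisson system $$\partial_t n=-\partial_x((1+n)u),\qquad \partial_t u=-\partial_x\left(\tfrac12u^2+w(n)+\phi\right),\qquad -\partial_x^2\phi+q(\phi)=n,$$ with associated center $y\in C^1(\mathbb{R},\mathbb{R})$, which conserves the energy $E$ and satisfies $$\sup_{t\in\mathbb{R}}\|u(t)\|_{L^2}<\infty,\qquad \sup_{t\in\mathbb{R}}\|n(t)\|_{L^2\cap L^\infty}<\delta,\qquad \sup_{t\in\mathbb{R}}|\dot y(t)|<\frac{k}{\sqrt{1+k}}-\varepsilon .$$ Then $(n,u,\phi)=0$ identically.
   Context: Fix $p\in C^\infty((0,\infty),\mathbb{R})$ with $p'(s)>0$ and $p''(s)\ge 0$ for all $s>0$, and put $k:=p'(1)>0$. Define $w:(-1,\infty)\to\mathbb{R}$ by $w'(s)=(1+s)^{-1}p'(1+s)$, $w(0)=0$ (so $w'(0)=k$), and $q(s)=e^s-1$. The unknowns are $n:\mathbb{R}\times\mathbb{R}\to(-1,\infty)$, $u,\phi:\mathbb{R}\times\mathbb{R}\to\mathbb{R}$, functions of $(t,x)$, with boundary condition $(n,u,\phi)\to(0,0,0)$ as $|x|\to\infty$. A global classical solution is one defined for all $t\in\mathbb{R}$, for which the derivatives in the equations exist in the classical sense and the equations hold pointwise. $\|f\|_{L^2\cap L^\infty}=\|f\|_{L^2}+\|f\|_{L^\infty}$; norms are over $x\in\mathbb{R}$;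 $\dot y=dy/dt$. Energy: $E[n,u,\phi]=\int_{\mathbb{R}}\left(\frac12(1+n)u^2+W(n)+\frac12(\partial_x\phi)^2+R(\phi)\right)dx$, where $W(n)=\int_0^n w(s)\,ds$ and $R(\phi)=\phi q(\phi)-\int_0^\phi q(s)\,ds$. A solution conserves the energy if $E[n(t),u(t),\phi(t)]$ is finite and independent of $t$. A global classical solution $(n,u,\phi)$ is $L^2$-compact if there exists $y\in C^1(\mathbb{R},\mathbb{R})$ (the associated center) such that for all $\epsilon>0$ there is $R>0$ with $\sup_{t\in\mathbb{R}}\int_{|x-y(t)|>R}(n(t,x)^2+u(t,x)^2)\,dx<\epsilon$. *)

theory Defs
  imports "HOL-Analysis.Analysis" "HOL-Probability.Essential_Supremum"
begin

section \<open>Pressure law\<close>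

text \<open>Functions on \<open>(0,\<infinity>)\<close> or \<open>(-1,\<infinity>)\<close> are total functions here;
  their values outside these intervals are never used.\<close>

definition smooth_on_pos :: "(real \<Rightarrow> real) \<Rightarrow> bool" where
  "smooth_on_pos p \<longleftrightarrow> (\<forall>m. \<forall>s>0. (deriv ^^ m) p differentiable (at s))"

definition pressure_law :: "(real \<Rightarrow> real) \<Rightarrow> bool" where
  "pressure_law p \<longleftrightarrow> smooth_on_pos p \<and> (\<forall>s>0. deriv p s > 0) \<and> (\<forall>s>0. deriv (deriv p) s \<ge> 0)"

text \<open>The function \<open>w\<close> with \<open>w' s = p' (1 + s) / (1 + s)\<close> on \<open>(-1,\<infinity>)\<close> and \<open>w 0 = 0\<close>; these two
  properties are lemmas \<open>enthalpy_0\<close> and \<open>enthalpy_has_derivative\<close> below. The interval integral is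
  oriented, so that its sign is also right for \<open>s < 0\<close>.\<close>

definition enthalpy :: "(real \<Rightarrow> real) \<Rightarrow> real \<Rightarrow> real" where
  "enthalpy p s = (LBINT r=0..s. deriv p (1 + r) / (1 + r))"

lemma enthalpy_0: "enthalpy p 0 = 0"
  by (simp add: enthalpy_def zero_ereal_def[symmetric])

lemma enthalpy_has_derivative:
  assumes "pressure_law p" "s > -1"
  shows "(enthalpy p has_real_derivative deriv p (1 + s) / (1 + s)) (at s)"
proof -
  define a where "a = (min 0 s - 1) / 2"
  define b where "b = max 0 s + 1"
  have ab: "-1 < a" "a < 0" "a < s" "s < b" "0 < b"
    using assms(2) by (auto simp: a_def b_def min_def max_def)
  have "isCont (deriv p) t" if "t > 0" for t
  proof -
    have "(deriv ^^ 1) p differentiable (at t)"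
      using assms(1) that unfolding pressure_law_def smooth_on_pos_def by blast
    then show ?thesis
      by (auto intro: differentiable_imp_continuous_within)
  qed
  then have "continuous_on {0<..} (deriv p)"
    by (simp add: continuous_at_imp_continuous_on)
  then have "continuous_on {a..b} (\<lambda>r. deriv p (1 + r))"
    by (rule continuous_on_compose2) (use ab in \<open>auto intro!: continuous_intros\<close>)
  then have cont: "continuous_on {a..b} (\<lambda>r. deriv p (1 + r) / (1 + r))"
    using ab by (auto intro!: continuous_intros)
  have "((\<lambda>v. LBINT r=ereal 0..v. deriv p (1 + r) / (1 + r))
      has_vector_derivative deriv p (1 + s) / (1 + s)) (at s within {a..b})"
    by (rule interval_integral_FTC2[OF _ _ cont]) (use ab in auto)
  then have "(enthalpy p has_real_derivative deriv p (1 + s) / (1 + s)) (at s within {a..b})"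
    unfolding enthalpy_def has_real_derivative_iff_has_vector_derivative
    by (simp add: zero_ereal_def)
  moreover have "at s within {a..b} = at s"
    using ab by (simp add: at_within_Icc_at)
  ultimately show ?thesis by simp
qed

section \<open>The Euler--Poisson system\<close>

definition q :: "real \<Rightarrow> real" where
  "q s = exp s - 1"

text \<open>Unknowns are written \<open>n t x\<close>, \<open>u t x\<close>, \<open>\<phi> t x\<close>. Derivatives are pointwise limits of
  difference quotients; since \<open>deriv\<close> is total, their existence is required separately.\<close>

definition classical_solution ::
  "(real \<Rightarrow> real) \<Rightarrow> (real \<Rightarrow> real \<Rightarrow> real) \<Rightarrow> (real \<Rightarrow> real \<Rightarrow> real) \<Rightarrow> (real \<Rightarrow> real \<Rightarrow> real) \<Rightarrow> bool" where
  "classical_solution p n u \<phi> \<longleftrightarrow>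
     (\<forall>t x. n t x > -1) \<and>
     (\<forall>t x. (\<lambda>s. n s x) differentiable (at t) \<and> n t differentiable (at x)) \<and>
     (\<forall>t x. (\<lambda>s. u s x) differentiable (at t) \<and> u t differentiable (at x)) \<and>
     (\<forall>t x. \<phi> t differentiable (at x) \<and> deriv (\<phi> t) differentiable (at x)) \<and>
     (\<forall>t x. deriv (\<lambda>s. n s x) t = - deriv (\<lambda>z. (1 + n t z) * u t z) x) \<and>
     (\<forall>t x. deriv (\<lambda>s. u s x) t
              = - deriv (\<lambda>z. (u t z)\<^sup>2 / 2 + enthalpy p (n t z) + \<phi> t z) x) \<and>
     (\<forall>t x. - deriv (deriv (\<phi> t)) x + q (\<phi> t x) = n t x) \<and>
     (\<forall>t. (n t \<longlongrightarrow> 0) at_infinity \<and> (u t \<longlongrightarrow> 0) at_infinity \<and> (\<phi> t \<longlongrightarrow> 0) at_infinity)"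

definition W :: "(real \<Rightarrow> real) \<Rightarrow> real \<Rightarrow> real" where
  "W p v = (LBINT s=0..v. enthalpy p s)"

definition R :: "real \<Rightarrow> real" where
  "R v = v * q v - (LBINT s=0..v. q s)"

definition energy_density ::
  "(real \<Rightarrow> real) \<Rightarrow> (real \<Rightarrow> real) \<Rightarrow> (real \<Rightarrow> real) \<Rightarrow> (real \<Rightarrow> real) \<Rightarrow> real \<Rightarrow> real" where
  "energy_density p n u \<phi> x =
     (1 + n x) * (u x)\<^sup>2 / 2 + W p (n x) + (deriv \<phi> x)\<^sup>2 / 2 + R (\<phi> x)"

definition energy ::
  "(real \<Rightarrow> real) \<Rightarrow> (real \<Rightarrow> real) \<Rightarrow> (real \<Rightarrow> real) \<Rightarrow> (real \<Rightarrow> real) \<Rightarrow> real" where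
  "energy p n u \<phi> = (LBINT x. energy_density p n u \<phi> x)"

definition conserves_energy ::
  "(real \<Rightarrow> real) \<Rightarrow> (real \<Rightarrow> real \<Rightarrow> real) \<Rightarrow> (real \<Rightarrow> real \<Rightarrow> real) \<Rightarrow> (real \<Rightarrow> real \<Rightarrow> real) \<Rightarrow> bool" where
  "conserves_energy p n u \<phi> \<longleftrightarrow>
     (\<forall>t. integrable lborel (energy_density p (n t) (u t) (\<phi> t))) \<and>
     (\<forall>s t. energy p (n s) (u s) (\<phi> s) = energy p (n t) (u t) (\<phi> t))"

section \<open>Norms and compactness\<close>

definition L2_norm :: "(real \<Rightarrow> real) \<Rightarrow> ennreal" where
  "L2_norm f = (let I = (\<integral>\<^sup>+x. ennreal ((f x)\<^sup>2) \<partial>lborel)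
                in if I = \<infinity> then \<infinity> else ennreal (sqrt (enn2real I)))"

definition Linf_norm :: "(real \<Rightarrow> real) \<Rightarrow> ennreal" where
  "Linf_norm f = esssup lborel (\<lambda>x. ennreal \<bar>f x\<bar>)"

definition L2_Linf_norm :: "(real \<Rightarrow> real) \<Rightarrow> ennreal" where
  "L2_Linf_norm f = L2_norm f + Linf_norm f"

definition associated_center ::
  "(real \<Rightarrow> real \<Rightarrow> real) \<Rightarrow> (real \<Rightarrow> real \<Rightarrow> real) \<Rightarrow> (real \<Rightarrow> real) \<Rightarrow> bool" where
  "associated_center n u y \<longleftrightarrow>
     y C1_differentiable_on UNIV \<and>
     (\<forall>\<epsilon>>0. \<exists>r>0.
        (SUP t. \<integral>\<^sup>+x\<in>{x. \<bar>x - y t\<bar> > r}. ennreal ((n t x)\<^sup>2 + (u t x)\<^sup>2) \<partial>lborel) < ennreal \<epsilon>)"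

text \<open>\<open>(n, u, \<phi>)\<close> is an \<open>L\<^sup>2\<close>-compact solution with associated center \<open>y\<close>.\<close>

definition L2_compact_solution ::
  "(real \<Rightarrow> real) \<Rightarrow> (real \<Rightarrow> real \<Rightarrow> real) \<Rightarrow> (real \<Rightarrow> real \<Rightarrow> real) \<Rightarrow> (real \<Rightarrow> real \<Rightarrow> real)
     \<Rightarrow> (real \<Rightarrow> real) \<Rightarrow> bool" where
  "L2_compact_solution p n u \<phi> y \<longleftrightarrow> classical_solution p n u \<phi> \<and> associated_center n u y"

end

theory Submission
  imports Defs "HOL-Probability.Probability"
begin

text \<open>The solution is localised around its center, so it is enough to show that a nonzero solution would have to move: the proof
is a virial argument. Let \<open>X\<close> be a bounded increasing function with derivative \<open>\<omega>\<close>, an integrable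
bump of width \<open>A\<close>, and let \<open>a\<close> be the solution of \<open>\<partial>\<^sub>x a = n - a\<close> that is bounded. With \<open>\<theta> = 1 / (1 + k)\<close> put
\<open>J t = \<integral> X (x - y t) n u dx + \<theta> / 2 * \<integral> \<omega> (x - y t) a u dx\<close>.
The first integral is the localised momentum. The quadratic part of its time derivative contains \<open>- (\<partial>\<^sub>x \<phi>)\<^sup>2 / 2\<close> and is not definite;
the second integral trades the fraction \<open>\<theta>\<close> of the kinetic term \<open>u\<^sup>2 / 2\<close> for a positive multiple of \<open>n\<^sup>2\<close>. Once the Poisson
equation has been used to cancel \<open>(\<partial>\<^sub>x \<phi>)\<^sup>2\<close>, the quadratic form is positive definite because
\<open>(y' t)\<^sup>2 \<le> k\<^sup>2 / (1 + k)\<close>; this is the role of the speed bound. All other terms are cubic, hence of relative size \<open>\<delta>\<close>, or contain \<open>\<omega>'\<close>, hence of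
relative size \<open>1 / A\<close>. So \<open>J' t \<ge> c * \<integral> \<omega> (x - y t) (u\<^sup>2 + n\<^sup>2) dx\<close> with \<open>c > 0\<close> (\<open>virial_static\<close>). As \<open>J\<close> is bounded, the
right-hand side cannot stay away from zero (\<open>growth_contradiction\<close>, \<open>euler_poisson_local_decay\<close>). By compactness the total
\<open>L\<^sup>2\<close> mass becomes arbitrarily small at suitable times, hence so does the energy; it is conserved and coercive, so it
vanishes and with it the solution (\<open>small_compact_solution_vanishes\<close>).

A second, independent difficulty is regularity. The solution is only assumed to have partial derivatives at each point; they
need not be continuous, and not even joint continuity of \<open>n\<close> and \<open>u\<close> is part of the hypotheses, so \<open>J\<close> cannot be
differentiated under the integral sign. The remedy has three steps. First, the Riemann invariants \<open>u \<plusminus> \<sigma> n\<close> satisfy scalar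
transport equations, for which a maximum principle needs nothing but pointwise derivatives. With a Baire category argument this
yields joint continuity (\<open>wave_pair_continuous\<close>). Second, once the
coefficients are continuous, the same maximum principle in thin cones shows that a function satisfying a transport equation
pointwise is Frechet differentiable (\<open>transport_total_derivative\<close>). Third, for Frechet differentiable \<open>f\<close> and \<open>g\<close> with
\<open>\<partial>\<^sub>t f + \<partial>\<^sub>x g = h\<close> the integral form of this law over rectangles follows by Goursat's bisection argument
(\<open>flux_defect_eq_0\<close>), without integrability of the separate partial derivatives; cutoffs extend it to the line and to
half lines (\<open>balance_law_line\<close>, \<open>balance_law_half_line\<close>).\<close>


section \<open>Maximum principles along characteristics\<close>

text \<open>The square of the positive part is a one-sided penalty that is still differentiable, which makes it usable as a barrier.\<close>

lemma has_derivative_pos_part_sq: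
  "((\<lambda>x::real. (max 0 x)\<^sup>2) has_real_derivative 2 * max 0 x) (at x)"
proof -
  consider "x < 0" | "x > 0" | "x = 0" by linarith
  then show ?thesis
  proof cases
    case 1
    have "((\<lambda>x::real. 0) has_real_derivative 0) (at x)" by simp
    then have "((\<lambda>x::real. (max 0 x)\<^sup>2) has_real_derivative 0) (at x)"
      by (rule has_field_derivative_transform_within_open[where S="{..<0}"]) (use 1 in \<open>auto simp: max_def\<close>)
    then show ?thesis using 1 by (simp add: max_def)
  next
    case 2
    have "((\<lambda>x::real. x\<^sup>2) has_real_derivative 2*x) (at x)" by (auto intro!: derivative_eq_intros)
    then have "((\<lambda>x::real. (max 0 x)\<^sup>2) has_real_derivative 2*x) (at x)"
      by (rule has_field_derivative_transform_within_open[where S="{0<..}"]) (use 2 in \<open>auto simp: max_def\<close>)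
    then show ?thesis using 2 by (simp add: max_def)
  next
    case 3
    have "((\<lambda>h::real. (max 0 h)\<^sup>2 / h) \<longlongrightarrow> 0) (at 0)"
    proof (rule Lim_null_comparison)
      show "\<forall>\<^sub>F h in at (0::real). norm ((max 0 h)\<^sup>2 / h) \<le> \<bar>h\<bar>"
        by (rule always_eventually) (auto simp: max_def power2_eq_square)
      show "((\<lambda>h::real. \<bar>h\<bar>) \<longlongrightarrow> 0) (at 0)" by (rule tendsto_eq_intros | simp)+
    qed
    then show ?thesis using 3 by (simp add: DERIV_def)
  qed
qed

lemmas pos_part_sq_chain = DERIV_chain'[OF _ has_derivative_pos_part_sq]

text \<open>The maximum is taken over the past only, so the time derivative gets a sign instead of vanishing.\<close>

lemma first_order_at_max:
  fixes F :: "real \<Rightarrow> real \<Rightarrow> real"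
  assumes "((\<lambda>s. F s x) has_real_derivative Ft) (at t)" "(F t has_real_derivative Fx) (at x)" "d > 0"
    and "\<And>s. t - d < s \<Longrightarrow> s \<le> t \<Longrightarrow> F s x \<le> F t x"
    and "\<And>z. \<bar>x - z\<bar> < d \<Longrightarrow> F t z \<le> F t x"
  shows "Fx = 0" "Ft \<ge> 0"
proof -
  show "Fx = 0" using DERIV_local_max[OF assms(2,3)] assms(5) by blast
  show "Ft \<ge> 0"
  proof (rule ccontr)
    assume "\<not> Ft \<ge> 0"
    then obtain e where e: "e > 0" "\<And>h. h > 0 \<Longrightarrow> h < e \<Longrightarrow> F t x < F (t - h) x"
      using DERIV_neg_dec_left[OF assms(1)] by force
    define h where "h = min d e / 2"
    have "h > 0" "h < e" "h < d" using e assms(3) by (auto simp: h_def)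
    then show False using e(2)[of h] assms(4)[of "t-h"] by force
  qed
qed

text \<open>Continuity may fail at the corner \<open>(0,0)\<close>. If \<open>r\<close> is nevertheless far from its boundary values at \<open>(\<tau>, xs)\<close>, then the
deviation must have travelled from the corner along the characteristic of speed close to \<open>\<Lambda>\<close>: otherwise a quadratic barrier that
moves with this speed would give an interior maximum that contradicts the transport inequality.\<close>

lemma barrier_corner:
  fixes r lam :: "real \<Rightarrow> real \<Rightarrow> real"
  assumes pos: "0 < \<tau>" "0 < xs" "xs < h" "0 < \<eta>"
    and der: "\<And>t x. 0 < t \<Longrightarrow> t \<le> \<tau> \<Longrightarrow> 0 < x \<Longrightarrow> x < h \<Longrightarrow>
        \<exists>rt rx. ((\<lambda>s. r s x) has_real_derivative rt) (at t) \<and> (r t has_real_derivative rx) (at x)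
          \<and> \<bar>rt + lam t x * rx\<bar> \<le> B"
    and cont: "continuous_on ({0..\<tau>} \<times> {0..h} - {(0,0)}) (\<lambda>z. r (fst z) (snd z))"
    and left: "\<And>t. 0 < t \<Longrightarrow> t \<le> \<tau> \<Longrightarrow> \<bar>r t 0 - r0\<bar> \<le> \<eta>"
    and right: "\<And>t. 0 \<le> t \<Longrightarrow> t \<le> \<tau> \<Longrightarrow> \<bar>r t h - r0\<bar> \<le> \<eta>"
    and init: "\<And>x. 0 < x \<Longrightarrow> x \<le> h \<Longrightarrow> \<bar>r 0 x - r0\<bar> \<le> \<eta>"
    and small: "2 * B * \<tau> < \<eta>"
    and dev: "\<bar>r \<tau> xs - r0\<bar> \<ge> 2 * \<eta>"
    and speed: "\<And>t x. 0 < t \<Longrightarrow> t \<le> \<tau> \<Longrightarrow> 0 < x \<Longrightarrow> x < h \<Longrightarrow> \<bar>r t x - r \<tau> xs\<bar> < \<eta>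
        \<Longrightarrow> \<bar>lam t x - \<Lambda>\<bar> \<le> \<kappa>"
  shows "\<bar>xs - \<Lambda> * \<tau>\<bar> \<le> \<kappa> * \<tau>"
proof (rule ccontr)
  assume neg: "\<not> \<bar>xs - \<Lambda> * \<tau>\<bar> \<le> \<kappa> * \<tau>"
  define \<rho> where "\<rho> = r \<tau> xs"
  define d where "d = (\<bar>xs - \<Lambda> * \<tau>\<bar> - \<kappa> * \<tau>) / 4"
  have d: "d > 0" using neg by (simp add: d_def)
  have B0: "0 \<le> B" using der[of \<tau> xs] pos by force
  define C where "C = (2 * B / \<eta> + 1 / \<tau>) / 2"
  have "2 * B / \<eta> < 1 / \<tau>" using small pos by (simp add: field_simps)
  then have C1: "C > 2 * B / \<eta>" and C2: "C * \<tau> < 1" using pos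
    by (auto simp: C_def field_simps)
  have C0: "C > 0" using C1 B0 pos by (meson divide_nonneg_pos le_less_trans mult_nonneg_nonneg zero_le_numeral)
  define v1 where "v1 t x = (x - xs - \<Lambda> * (t - \<tau>)) - \<kappa> * (\<tau> - t)" for t x :: real
  define v2 where "v2 t x = - (x - xs - \<Lambda> * (t - \<tau>)) - \<kappa> * (\<tau> - t)" for t x :: real
  define K where "K = 1 / (2 * d\<^sup>2)"
  have K: "K > 0" using d by (simp add: K_def)
  define G where "G t x = K * ((max 0 (v1 t x - d))\<^sup>2 + (max 0 (v2 t x - d))\<^sup>2)" for t x
  define th where "th t x = 1 - ((r t x - \<rho>) / \<eta>)\<^sup>2" for t x
  define \<Psi> where "\<Psi> t x = th t x + C * (\<tau> - t) - G t x" for t x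
  define D where "D = ({0..\<tau>} \<times> {0..h}) \<inter> {z. v1 (fst z) (snd z) \<le> 3 * d} \<inter> {z. v2 (fst z) (snd z) \<le> 3 * d}"
  have "compact D" unfolding D_def v1_def v2_def
    by (intro compact_Int_closed compact_Times compact_Icc closed_Collect_le continuous_intros)
  have G0: "G t x \<ge> 0" for t x using K by (simp add: G_def)
  have Gbig: "G t x \<ge> 2" if "v1 t x \<ge> 3 * d \<or> v2 t x \<ge> 3 * d" for t x
  proof -
    have "(2 * d)\<^sup>2 \<le> (max 0 (v1 t x - d))\<^sup>2 + (max 0 (v2 t x - d))\<^sup>2"
      using that
    proof
      assume "3 * d \<le> v1 t x"
      then have "(2*d)\<^sup>2 \<le> (max 0 (v1 t x - d))\<^sup>2" using d by (intro power_mono) auto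
      then show ?thesis by (simp add: add_increasing2)
    next
      assume "3 * d \<le> v2 t x"
      then have "(2*d)\<^sup>2 \<le> (max 0 (v2 t x - d))\<^sup>2" using d by (intro power_mono) auto
      then show ?thesis by (simp add: add_increasing)
    qed
    then have "K * (2*d)\<^sup>2 \<le> G t x" unfolding G_def using K by (simp add: mult_left_mono)
    moreover have "K * (2*d)\<^sup>2 = 2" using d by (simp add: K_def power2_eq_square)
    ultimately show ?thesis by simp
  qed
  have corner: "(0,0) \<notin> D"
  proof -
    have "v1 0 0 = 4 * d \<or> v2 0 0 = 4 * d"
      by (auto simp: v1_def v2_def d_def abs_if algebra_simps split: if_splits)
    then show ?thesis using d by (auto simp: D_def)
  qed
  have star: "(\<tau>, xs) \<in> D" using pos d by (auto simp: D_def v1_def v2_def)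
  have contD: "continuous_on D (\<lambda>z. \<Psi> (fst z) (snd z))"
  proof -
    have "continuous_on D (\<lambda>z. r (fst z) (snd z))"
      by (rule continuous_on_subset[OF cont]) (use corner in \<open>auto simp: D_def\<close>)
    then show ?thesis unfolding \<Psi>_def th_def G_def v1_def v2_def
      by (intro continuous_intros) (use pos in auto)
  qed
  obtain z where z: "z \<in> D" "\<And>w. w \<in> D \<Longrightarrow> \<Psi> (fst w) (snd w) \<le> \<Psi> (fst z) (snd z)"
    using continuous_attains_sup[OF \<open>compact D\<close> _ contD] star by blast
  obtain t x where tx: "z = (t, x)" by (cases z)
  have txD: "0 \<le> t" "t \<le> \<tau>" "0 \<le> x" "x \<le> h" "v1 t x \<le> 3 * d" "v2 t x \<le> 3 * d"
    using z(1) by (auto simp: D_def tx)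
  have "\<Psi> \<tau> xs = 1" using d by (simp add: \<Psi>_def th_def G_def v1_def v2_def \<rho>_def)
  then have ge1: "\<Psi> t x \<ge> 1" using z(2)[OF star] by (simp add: tx)
  have Ct: "C * (\<tau> - t) < 1"
  proof -
    have "C * (\<tau> - t) \<le> C * \<tau>" using C0 txD by (intro mult_left_mono) auto
    then show ?thesis using C2 by simp
  qed
  have th1: "th t x \<le> 1" by (simp add: th_def)
  have v3: "v1 t x < 3 * d" "v2 t x < 3 * d"
    using Gbig[of t x] ge1 th1 Ct by (auto simp: \<Psi>_def not_less[symmetric])
  have th0: "th t x > 0" using ge1 Ct G0[of t x] by (simp add: \<Psi>_def)
  have near: "\<bar>r t x - \<rho>\<bar> < \<eta>"
  proof (rule ccontr)
    assume "\<not> \<bar>r t x - \<rho>\<bar> < \<eta>"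
    then have "1 \<le> \<bar>(r t x - \<rho>) / \<eta>\<bar>" using pos by (simp add: field_simps)
    then have "1 \<le> ((r t x - \<rho>) / \<eta>)\<^sup>2"
      by (metis one_le_power power2_abs)
    then show False using th0 by (simp add: th_def)
  qed
  then have far: "\<bar>r t x - r0\<bar> > \<eta>" using dev by (simp add: \<rho>_def)
  have "(t,x) \<noteq> (0,0)" using z(1) tx corner by auto
  have x0: "x \<noteq> 0"
  proof
    assume "x = 0"
    then have "t > 0" using \<open>(t,x) \<noteq> (0,0)\<close> txD by auto
    then show False using left[of t] far txD \<open>x = 0\<close> by auto
  qed
  have xh: "x \<noteq> h" using right[of t] far txD by auto
  have t0: "t \<noteq> 0" using init[of x] far txD x0 by auto
  have in_reg: "0 < t" "t \<le> \<tau>" "0 < x" "x < h" using txD x0 xh t0 by auto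
  obtain rt rx where R: "((\<lambda>s. r s x) has_real_derivative rt) (at t)" "(r t has_real_derivative rx) (at x)"
    "\<bar>rt + lam t x * rx\<bar> \<le> B" using der[OF in_reg] by blast
  define tht where "tht = - 2 * ((r t x - \<rho>) / \<eta>) * (rt / \<eta>)"
  define thx where "thx = - 2 * ((r t x - \<rho>) / \<eta>) * (rx / \<eta>)"
  have T: "((\<lambda>s. th s x) has_real_derivative tht) (at t)" "(th t has_real_derivative thx) (at x)"
  proof -
    have sq: "((\<lambda>s. 1 - (f s)\<^sup>2) has_real_derivative - 2 * f z * f') (at z)"
      if "(f has_real_derivative f') (at z)" for f f' z
      by (rule derivative_eq_intros that | simp)+
    have "((\<lambda>s. (r s x - \<rho>) / \<eta>) has_real_derivative rt / \<eta>) (at t)"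
      "((\<lambda>z. (r t z - \<rho>) / \<eta>) has_real_derivative rx / \<eta>) (at x)"
      using DERIV_cdivide[OF DERIV_diff[OF R(1) DERIV_const]] DERIV_cdivide[OF DERIV_diff[OF R(2) DERIV_const]] by simp_all
    from this[THEN sq] show "((\<lambda>s. th s x) has_real_derivative tht) (at t)" "(th t has_real_derivative thx) (at x)"
      unfolding th_def tht_def thx_def by simp_all
  qed
  define g1 where "g1 = 2 * max 0 (v1 t x - d)"
  define g2 where "g2 = 2 * max 0 (v2 t x - d)"
  have g: "g1 \<ge> 0" "g2 \<ge> 0" by (auto simp: g1_def g2_def)
  have V: "((\<lambda>s. v1 s x - d) has_real_derivative (- \<Lambda> + \<kappa>)) (at t)" "((\<lambda>z. v1 t z - d) has_real_derivative 1) (at x)"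
     "((\<lambda>s. v2 s x - d) has_real_derivative (\<Lambda> + \<kappa>)) (at t)" "((\<lambda>z. v2 t z - d) has_real_derivative -1) (at x)"
    unfolding v1_def v2_def by (auto intro!: derivative_eq_intros)
  have Gt: "((\<lambda>s. G s x) has_real_derivative K * (g1 * (- \<Lambda> + \<kappa>) + g2 * (\<Lambda> + \<kappa>))) (at t)"
    unfolding G_def g1_def g2_def
    by (rule DERIV_cmult DERIV_add pos_part_sq_chain[THEN DERIV_cong] V | simp add: algebra_simps)+
  have Gx: "((\<lambda>z. G t z) has_real_derivative K * (g1 * 1 + g2 * (-1))) (at x)"
    unfolding G_def g1_def g2_def
    by (rule DERIV_cmult DERIV_add pos_part_sq_chain[THEN DERIV_cong] V | simp)+
  define Pt where "Pt = tht - C - K * (g1 * (- \<Lambda> + \<kappa>) + g2 * (\<Lambda> + \<kappa>))"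
  define Px where "Px = thx - K * (g1 - g2)"
  have P: "((\<lambda>s. \<Psi> s x) has_real_derivative Pt) (at t)" "(\<Psi> t has_real_derivative Px) (at x)"
    unfolding \<Psi>_def Pt_def Px_def by (auto intro!: derivative_eq_intros T Gt Gx)
  obtain e where e: "e > 0" "\<And>w. dist w (t,x) < e \<Longrightarrow> v1 (fst w) (snd w) < 3*d \<and> v2 (fst w) (snd w) < 3*d \<and> 0 < fst w \<and> 0 < snd w \<and> snd w < h"
  proof -
    have "open {w. v1 (fst w) (snd w) < 3*d \<and> v2 (fst w) (snd w) < 3*d \<and> 0 < fst w \<and> 0 < snd w \<and> snd w < h}"
      unfolding v1_def v2_def by (intro open_Collect_conj open_Collect_less continuous_intros)
    moreover have "(t,x) \<in> {w. v1 (fst w) (snd w) < 3*d \<and> v2 (fst w) (snd w) < 3*d \<and> 0 < fst w \<and> 0 < snd w \<and> snd w < h}"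
      using v3 in_reg by auto
    ultimately show ?thesis using that unfolding open_dist by blast
  qed
  have memD: "(s,y) \<in> D" if "dist (s,y) (t,x) < e" "s \<le> \<tau>" for s y
    using e(2)[OF that(1)] that(2) by (auto simp: D_def)
  have mt: "\<Psi> s x \<le> \<Psi> t x" if "t - e < s" "s \<le> t" for s
    using z(2)[OF memD[of s x]] in_reg that by (auto simp: tx dist_Pair_Pair dist_real_def)
  have mx: "\<Psi> t y \<le> \<Psi> t x" if "\<bar>x - y\<bar> < e" for y
    using z(2)[OF memD[of t y]] in_reg that by (auto simp: tx dist_Pair_Pair dist_real_def)
  have "Px = 0" "Pt \<ge> 0"
    using first_order_at_max[OF P e(1) mt mx] by auto
  then have "0 \<le> Pt + lam t x * Px" by simp
  also have "\<dots> = (tht + lam t x * thx) - C - K * (g1 * (\<kappa> + (lam t x - \<Lambda>)) + g2 * (\<kappa> - (lam t x - \<Lambda>)))"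
    by (simp add: Pt_def Px_def algebra_simps)
  also have "\<dots> \<le> (tht + lam t x * thx) - C"
  proof -
    have "\<bar>lam t x - \<Lambda>\<bar> \<le> \<kappa>" using speed[OF in_reg] near by (simp add: \<rho>_def)
    then have "0 \<le> \<kappa> + (lam t x - \<Lambda>)" "0 \<le> \<kappa> - (lam t x - \<Lambda>)" by linarith+
    then have "0 \<le> g1 * (\<kappa> + (lam t x - \<Lambda>)) + g2 * (\<kappa> - (lam t x - \<Lambda>))"
      using g by simp
    then show ?thesis using K by (simp add: mult_nonneg_nonneg)
  qed
  also have "tht + lam t x * thx = - 2 * ((r t x - \<rho>) / \<eta>) * ((rt + lam t x * rx) / \<eta>)"
    using pos(4) by (simp add: tht_def thx_def field_simps)
  also have "\<dots> \<le> 2 * 1 * (B / \<eta>)"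
  proof -
    have a: "\<bar>(r t x - \<rho>) / \<eta>\<bar> \<le> 1" using near pos(4) by (simp add: field_simps)
    have b: "\<bar>(rt + lam t x * rx) / \<eta>\<bar> \<le> B / \<eta>" using R(3) pos(4) by (simp add: divide_right_mono)
    have "\<bar>- 2 * ((r t x - \<rho>) / \<eta>) * ((rt + lam t x * rx) / \<eta>)\<bar> \<le> 2 * 1 * (B / \<eta>)"
      unfolding abs_mult by (intro mult_mono a b) auto
    then show ?thesis by linarith
  qed
  finally show False using C1 by simp
qed

text \<open>Subtracting \<open>(B + 1) * (t - a)\<close> makes the transport inequality strict, which excludes an interior maximum: the
space derivative vanishes there, so the speed \<open>lam\<close> drops out.\<close>

lemma transport_max_principle:
  fixes r lam :: "real \<Rightarrow> real \<Rightarrow> real"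
  assumes ab: "a < b" "c < d"
    and der: "\<And>t x. a < t \<Longrightarrow> t \<le> b \<Longrightarrow> c < x \<Longrightarrow> x < d \<Longrightarrow>
        \<exists>rt rx. ((\<lambda>s. r s x) has_real_derivative rt) (at t) \<and> (r t has_real_derivative rx) (at x)
          \<and> rt + lam t x * rx \<le> B"
    and cont: "continuous_on ({a..b} \<times> {c..d}) (\<lambda>z. r (fst z) (snd z))"
    and left: "\<And>t. a \<le> t \<Longrightarrow> t \<le> b \<Longrightarrow> r t c \<le> m"
    and right: "\<And>t. a \<le> t \<Longrightarrow> t \<le> b \<Longrightarrow> r t d \<le> m"
    and init: "\<And>x. c \<le> x \<Longrightarrow> x \<le> d \<Longrightarrow> r a x \<le> m"
    and B: "0 \<le> B" and tx: "a \<le> t" "t \<le> b" "c \<le> x" "x \<le> d"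
  shows "r t x \<le> m + (B + 1) * (t - a)"
proof -
  define \<Psi> where "\<Psi> t x = r t x - (B + 1) * (t - a)" for t x
  have contP: "continuous_on ({a..b} \<times> {c..d}) (\<lambda>z. \<Psi> (fst z) (snd z))"
    unfolding \<Psi>_def by (intro continuous_intros cont)
  obtain z where z: "z \<in> {a..b} \<times> {c..d}" "\<And>w. w \<in> {a..b} \<times> {c..d} \<Longrightarrow> \<Psi> (fst w) (snd w) \<le> \<Psi> (fst z) (snd z)"
    using continuous_attains_sup[OF compact_Times[OF compact_Icc compact_Icc] _ contP] tx by auto
  obtain s y where sy: "z = (s, y)" by (cases z)
  have reg: "a \<le> s" "s \<le> b" "c \<le> y" "y \<le> d" using z(1) sy by auto
  have max: "\<Psi> s' y' \<le> \<Psi> s y" if "a \<le> s'" "s' \<le> b" "c \<le> y'" "y' \<le> d" for s' y'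
    using z(2)[of "(s',y')"] that by (simp add: sy)
  have "\<Psi> s y \<le> m"
  proof (cases "s = a \<or> y = c \<or> y = d")
    case True
    have "r s y \<le> m" using True left right init reg by auto
    moreover have "0 \<le> (B + 1) * (s - a)" using B reg by simp
    ultimately show ?thesis by (simp add: \<Psi>_def)
  next
    case False
    then have reg': "a < s" "s \<le> b" "c < y" "y < d" using reg by auto
    obtain rt rx where R: "((\<lambda>s. r s y) has_real_derivative rt) (at s)" "(r s has_real_derivative rx) (at y)"
      "rt + lam s y * rx \<le> B" using der[OF reg'] by blast
    have P: "((\<lambda>s. \<Psi> s y) has_real_derivative (rt - (B + 1))) (at s)" "(\<Psi> s has_real_derivative rx) (at y)"
      unfolding \<Psi>_def by (auto intro!: derivative_eq_intros R)
    define e where "e = min (s - a) (min (y - c) (d - y))"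
    have e: "e > 0" using reg' by (simp add: e_def)
    have mt: "\<Psi> s' y \<le> \<Psi> s y" if "s - e < s'" "s' \<le> s" for s'
      by (rule max) (use that reg' in \<open>auto simp: e_def\<close>)
    have mx: "\<Psi> s y' \<le> \<Psi> s y" if "\<bar>y - y'\<bar> < e" for y'
      by (rule max) (use that reg' in \<open>auto simp: e_def\<close>)
    have "rx = 0" "rt - (B + 1) \<ge> 0"
      using first_order_at_max[OF P e mt mx] by auto
    then show ?thesis using R(3) by simp
  qed
  then show ?thesis using max[OF tx] by (simp add: \<Psi>_def)
qed

text \<open>Finite speed of propagation: a barrier supported in \<open>\<bar>y\<bar> + L * s \<ge> 2 * \<rho>\<close> replaces the lateral boundary values in \<open>transport_max_principle\<close>.\<close>

lemma transport_cone_bound: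
  fixes r lam :: "real \<Rightarrow> real \<Rightarrow> real"
  assumes pos: "0 < \<rho>" "0 \<le> L" "0 \<le> B" "L * t \<le> \<rho>" "\<bar>x\<bar> \<le> \<rho>" "0 \<le> t"
    and der: "\<And>s y. 0 < s \<Longrightarrow> s \<le> t \<Longrightarrow> \<bar>y\<bar> < 3 * \<rho> \<Longrightarrow>
        \<exists>rt rx. ((\<lambda>s. r s y) has_real_derivative rt) (at s) \<and> (r s has_real_derivative rx) (at y)
          \<and> rt + lam s y * rx \<le> B \<and> \<bar>lam s y\<bar> \<le> L"
    and cont: "continuous_on ({0..t} \<times> {-3*\<rho>..3*\<rho>}) (\<lambda>z. r (fst z) (snd z))"
    and init: "\<And>y. \<bar>y\<bar> \<le> 3 * \<rho> \<Longrightarrow> r 0 y \<le> m"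
  shows "r t x \<le> m + (B + 1) * t"
proof (cases "t = 0")
  case True then show ?thesis using init[of x] pos by simp
next
  case False
  then have t: "t > 0" using pos by simp
  have "bounded ((\<lambda>z. r (fst z) (snd z)) ` ({0..t} \<times> {-3*\<rho>..3*\<rho>}))"
    by (intro compact_imp_bounded compact_continuous_image cont compact_Times compact_Icc)
  then obtain M0 where M0: "\<And>s y. 0 \<le> s \<Longrightarrow> s \<le> t \<Longrightarrow> \<bar>y\<bar> \<le> 3 * \<rho> \<Longrightarrow> \<bar>r s y\<bar> \<le> M0"
    unfolding bounded_iff by force
  define K where "K = (\<bar>M0\<bar> + \<bar>m\<bar>) / \<rho>\<^sup>2"
  have K: "K \<ge> 0" by (simp add: K_def)
  define G where "G s y = K * ((max 0 ((y + L * s) - 2 * \<rho>))\<^sup>2 + (max 0 ((- y + L * s) - 2 * \<rho>))\<^sup>2)" for s y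
  define g1 where "g1 s y = 2 * max 0 ((y + L * s) - 2 * \<rho>)" for s y
  define g2 where "g2 s y = 2 * max 0 ((- y + L * s) - 2 * \<rho>)" for s y
  have G0: "G s y \<ge> 0" for s y using K by (simp add: G_def)
  define R where "R s y = r s y - G s y" for s y
  have Gside: "G s y \<ge> \<bar>M0\<bar> + \<bar>m\<bar>" if "0 \<le> s" "\<bar>y\<bar> = 3 * \<rho>" for s y
  proof -
    have "0 \<le> L * s" using that pos by simp
    have "\<rho>\<^sup>2 \<le> (max 0 ((y + L * s) - 2 * \<rho>))\<^sup>2 + (max 0 ((- y + L * s) - 2 * \<rho>))\<^sup>2"
    proof (cases "y \<ge> 0")
      case True
      then have "\<rho>\<^sup>2 \<le> (max 0 ((y + L * s) - 2 * \<rho>))\<^sup>2"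
        using that pos \<open>0 \<le> L * s\<close> by (intro power_mono) auto
      then show ?thesis by (simp add: add_increasing2)
    next
      case False
      then have "\<rho>\<^sup>2 \<le> (max 0 ((- y + L * s) - 2 * \<rho>))\<^sup>2"
        using that pos \<open>0 \<le> L * s\<close> by (intro power_mono) auto
      then show ?thesis by (simp add: add_increasing)
    qed
    then have "K * \<rho>\<^sup>2 \<le> G s y" unfolding G_def using K by (simp add: mult_left_mono)
    then show ?thesis using pos by (simp add: K_def)
  qed
  have "R t x \<le> m + (B + 1) * (t - 0)"
  proof (rule transport_max_principle[where r=R and lam=lam and c="-3*\<rho>" and d="3*\<rho>" and b=t])
    show "(0::real) < t" "- 3 * \<rho> < 3 * \<rho>" "0 \<le> B" "0 \<le> t" "t \<le> t" "-3*\<rho> \<le> x" "x \<le> 3 * \<rho>" using t pos by auto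
    show "continuous_on ({0..t} \<times> {- 3 * \<rho>..3 * \<rho>}) (\<lambda>z. R (fst z) (snd z))"
      unfolding R_def G_def by (intro continuous_intros cont)
    fix s y :: real
    assume s: "0 < s" "s \<le> t" "-3*\<rho> < y" "y < 3*\<rho>"
    then obtain rt rx where r: "((\<lambda>s. r s y) has_real_derivative rt) (at s)" "(r s has_real_derivative rx) (at y)"
      "rt + lam s y * rx \<le> B" "\<bar>lam s y\<bar> \<le> L" using der[of s y] by force
    have Gt: "((\<lambda>s. G s y) has_real_derivative K * (g1 s y * L + g2 s y * L)) (at s)"
      unfolding G_def g1_def g2_def
      by (rule DERIV_cmult DERIV_add pos_part_sq_chain[THEN DERIV_cong] | (auto intro!: derivative_eq_intros)[1] | simp add: algebra_simps)+
    have Gx: "((\<lambda>z. G s z) has_real_derivative K * (g1 s y * 1 + g2 s y * (-1))) (at y)"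
      unfolding G_def g1_def g2_def
      by (rule DERIV_cmult DERIV_add pos_part_sq_chain[THEN DERIV_cong] | (auto intro!: derivative_eq_intros)[1] | simp)+
    have L: "0 \<le> L + lam s y" "0 \<le> L - lam s y" using r(4) by auto
    have g: "0 \<le> g1 s y" "0 \<le> g2 s y" by (auto simp: g1_def g2_def)
    have "0 \<le> K * (g1 s y * (L + lam s y) + g2 s y * (L - lam s y))"
      using L g K by simp
    then have "(rt - K * (g1 s y * L + g2 s y * L)) + lam s y * (rx - K * (g1 s y * 1 + g2 s y * (-1))) \<le> B"
      using r(3) by (simp add: algebra_simps)
    then show "\<exists>rt rx. ((\<lambda>s. R s y) has_real_derivative rt) (at s) \<and> (R s has_real_derivative rx) (at y)
          \<and> rt + lam s y * rx \<le> B"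
      unfolding R_def using DERIV_diff[OF r(1) Gt] DERIV_diff[OF r(2) Gx] by blast
  next
    fix s assume "0 \<le> s" "s \<le> t"
    then show "R s (-3*\<rho>) \<le> m" "R s (3*\<rho>) \<le> m"
      using M0[of s "-3*\<rho>"] M0[of s "3*\<rho>"] Gside[of s "-3*\<rho>"] Gside[of s "3*\<rho>"] pos by (auto simp: R_def)
  next
    fix y assume "-3*\<rho> \<le> y" "y \<le> 3*\<rho>"
    then have "\<bar>y\<bar> \<le> 3 * \<rho>" by linarith
    from init[OF this] show "R 0 y \<le> m" using G0[of 0 y] by (simp add: R_def)
  qed
  moreover have "G t x = 0" using pos by (auto simp: G_def)
  ultimately show ?thesis by (simp add: R_def)
qed

section \<open>Continuity of Riemann invariants\<close>

text \<open>The Riemann invariants of a one-dimensional hyperbolic system with unit-order nonlinearity: two functions transported with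
speeds \<open>u \<plusminus> c\<close> up to a bounded source. The local sound speed \<open>cc\<close> is a nondecreasing Lipschitz function of the difference
\<open>rp - rm\<close>, and it stays near a constant \<open>c0\<close>. The sign \<open>g\<close> makes the class invariant under reflection of time or space.\<close>

definition wave_pair :: "real \<Rightarrow> real \<Rightarrow> real \<Rightarrow> real \<Rightarrow> (real \<Rightarrow> real \<Rightarrow> real) \<Rightarrow> (real \<Rightarrow> real \<Rightarrow> real)
    \<Rightarrow> (real \<Rightarrow> real \<Rightarrow> real) \<Rightarrow> bool" where
  "wave_pair g c0 L B rp rm cc \<longleftrightarrow>
    (\<forall>t x. \<exists>rt rx. ((\<lambda>s. rp s x) has_real_derivative rt) (at t) \<and> (rp t has_real_derivative rx) (at x)
      \<and> \<bar>rt + g * ((rp t x + rm t x) / 2 + cc t x) * rx\<bar> \<le> B) \<and>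
    (\<forall>t x. \<exists>rt rx. ((\<lambda>s. rm s x) has_real_derivative rt) (at t) \<and> (rm t has_real_derivative rx) (at x)
      \<and> \<bar>rt + g * ((rp t x + rm t x) / 2 - cc t x) * rx\<bar> \<le> B) \<and>
    (\<forall>t x. \<bar>rp t x - rm t x\<bar> \<le> c0 / 10 \<and> 95 / 100 * c0 \<le> cc t x \<and> cc t x \<le> 105 / 100 * c0) \<and>
    (\<forall>t x t' x'. rp t x - rm t x \<le> rp t' x' - rm t' x' \<longrightarrow>
       cc t x \<le> cc t' x' \<and> cc t' x' \<le> cc t x + L * ((rp t' x' - rm t' x') - (rp t x - rm t x))) \<and>
    (g = 1 \<or> g = -1) \<and> c0 > 0 \<and> L \<ge> 0 \<and> B \<ge> 0"

lemma wave_pairD: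
  assumes "wave_pair g c0 L B rp rm cc"
  shows "\<exists>rt rx. ((\<lambda>s. rp s x) has_real_derivative rt) (at t) \<and> (rp t has_real_derivative rx) (at x)
      \<and> \<bar>rt + g * ((rp t x + rm t x) / 2 + cc t x) * rx\<bar> \<le> B"
    "\<exists>rt rx. ((\<lambda>s. rm s x) has_real_derivative rt) (at t) \<and> (rm t has_real_derivative rx) (at x)
      \<and> \<bar>rt + g * ((rp t x + rm t x) / 2 - cc t x) * rx\<bar> \<le> B"
    "\<bar>rp t x - rm t x\<bar> \<le> c0 / 10" "95 / 100 * c0 \<le> cc t x" "cc t x \<le> 105 / 100 * c0"
    "rp t x - rm t x \<le> rp t' x' - rm t' x' \<Longrightarrow> cc t x \<le> cc t' x'"
    "\<bar>cc t x - cc t' x'\<bar> \<le> L * \<bar>(rp t x - rm t x) - (rp t' x' - rm t' x')\<bar>"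
    "g = 1 \<or> g = -1" "c0 > 0" "L \<ge> 0" "B \<ge> 0"
proof -
  show "\<bar>cc t x - cc t' x'\<bar> \<le> L * \<bar>(rp t x - rm t x) - (rp t' x' - rm t' x')\<bar>"
  proof (cases "rp t x - rm t x \<le> rp t' x' - rm t' x'")
    case True
    then have "cc t x \<le> cc t' x'" "cc t' x' \<le> cc t x + L * ((rp t' x' - rm t' x') - (rp t x - rm t x))"
      using assms unfolding wave_pair_def by blast+
    then show ?thesis using True by (simp add: abs_minus_commute)
  next
    case False
    then have "cc t' x' \<le> cc t x" "cc t x \<le> cc t' x' + L * ((rp t x - rm t x) - (rp t' x' - rm t' x'))"
      using assms unfolding wave_pair_def by (meson le_cases)+
    then show ?thesis using False by simp
  qed
qed (use assms in \<open>unfold wave_pair_def, blast+\<close>)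

lemma wave_pair_cont_slices:
  assumes "wave_pair g c0 L B rp rm cc"
  shows "isCont (\<lambda>s. rp s x) t" "isCont (rp t) x" "isCont (\<lambda>s. rm s x) t" "isCont (rm t) x"
  using wave_pairD(1,2)[OF assms, of x t] by (auto dest: DERIV_isCont)

text \<open>Reflecting the velocity exchanges the two families, so each statement needs a proof for one of them only.\<close>

lemma wave_pair_swap:
  assumes "wave_pair g c0 L B rp rm cc"
  shows "wave_pair (- g) c0 L B (\<lambda>t x. - rm t x) (\<lambda>t x. - rp t x) cc"
proof -
  have 1: "\<exists>rt rx. ((\<lambda>s. - rm s x) has_real_derivative rt) (at t) \<and> ((\<lambda>x. - rm t x) has_real_derivative rx) (at x)
      \<and> \<bar>rt + (-g) * ((- rm t x + - rp t x) / 2 + cc t x) * rx\<bar> \<le> B" for t x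
  proof -
    obtain rt rx where "((\<lambda>s. rm s x) has_real_derivative rt) (at t)" "(rm t has_real_derivative rx) (at x)"
      "\<bar>rt + g * ((rp t x + rm t x) / 2 - cc t x) * rx\<bar> \<le> B" using wave_pairD(2)[OF assms] by blast
    moreover have "- rt + (-g) * ((- rm t x + - rp t x) / 2 + cc t x) * (- rx) = - (rt + g * ((rp t x + rm t x) / 2 - cc t x) * rx)"
      by (simp add: field_simps)
    ultimately show ?thesis
      by (intro exI[of _ "-rt"] exI[of _ "-rx"]) (simp only: DERIV_minus abs_minus_cancel simp_thms)
  qed
  have 2: "\<exists>rt rx. ((\<lambda>s. - rp s x) has_real_derivative rt) (at t) \<and> ((\<lambda>x. - rp t x) has_real_derivative rx) (at x)
      \<and> \<bar>rt + (-g) * ((- rm t x + - rp t x) / 2 - cc t x) * rx\<bar> \<le> B" for t x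
  proof -
    obtain rt rx where "((\<lambda>s. rp s x) has_real_derivative rt) (at t)" "(rp t has_real_derivative rx) (at x)"
      "\<bar>rt + g * ((rp t x + rm t x) / 2 + cc t x) * rx\<bar> \<le> B" using wave_pairD(1)[OF assms] by blast
    moreover have "- rt + (-g) * ((- rm t x + - rp t x) / 2 - cc t x) * (- rx) = - (rt + g * ((rp t x + rm t x) / 2 + cc t x) * rx)"
      by (simp add: field_simps)
    ultimately show ?thesis
      by (intro exI[of _ "-rt"] exI[of _ "-rx"]) (simp only: DERIV_minus abs_minus_cancel simp_thms)
  qed
  have e: "- rm t x - - rp t x = rp t x - rm t x" for t x by simp
  show ?thesis unfolding wave_pair_def e
    using 1 2 assms unfolding wave_pair_def by auto
qed

lemma wave_pair_affine:
  assumes W: "wave_pair g c0 L B rp rm cc" and e: "e1 = 1 \<or> e1 = -1" "e2 = 1 \<or> e2 = -1"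
  shows "wave_pair (g * e1 * e2) c0 L B (\<lambda>t x. rp (t0 + e1 * t) (x0 + e2 * x)) (\<lambda>t x. rm (t0 + e1 * t) (x0 + e2 * x))
     (\<lambda>t x. cc (t0 + e1 * t) (x0 + e2 * x))"
proof -
  have chain: "((\<lambda>s. f (c + e * s)) has_real_derivative e * D) (at z)" if "(f has_real_derivative D) (at (c + e * z))" for f :: "real \<Rightarrow> real" and c e D z
  proof -
    have "((\<lambda>s. c + e * s) has_real_derivative e) (at z)" by (auto intro!: derivative_eq_intros)
    from DERIV_chain2[OF that this] show ?thesis by (simp add: mult.commute)
  qed
  have gen: "\<exists>rt rx. ((\<lambda>s. r (t0 + e1 * s) (x0 + e2 * x)) has_real_derivative rt) (at t) \<and> ((\<lambda>x. r (t0 + e1 * t) (x0 + e2 * x)) has_real_derivative rx) (at x)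
      \<and> \<bar>rt + g * e1 * e2 * \<mu> * rx\<bar> \<le> B"
    if ex: "\<exists>rt rx. ((\<lambda>s. r s (x0 + e2 * x)) has_real_derivative rt) (at (t0 + e1 * t)) \<and> (r (t0 + e1 * t) has_real_derivative rx) (at (x0 + e2 * x))
      \<and> \<bar>rt + g * \<mu> * rx\<bar> \<le> B" for t x \<mu> and r :: "real \<Rightarrow> real \<Rightarrow> real"
  proof -
    obtain rt rx where R: "((\<lambda>s. r s (x0 + e2 * x)) has_real_derivative rt) (at (t0 + e1 * t))" "(r (t0 + e1 * t) has_real_derivative rx) (at (x0 + e2 * x))"
      "\<bar>rt + g * \<mu> * rx\<bar> \<le> B" using ex by blast
    have "e1 * rt + g * e1 * e2 * \<mu> * (e2 * rx) = e1 * (rt + g * \<mu> * rx)" using e by auto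
    then have "\<bar>e1 * rt + g * e1 * e2 * \<mu> * (e2 * rx)\<bar> \<le> B" using R(3) e by (auto simp: abs_mult)
    then show ?thesis using chain[OF R(1)] chain[OF R(2)] by blast
  qed
  have ge: "g * e1 * e2 = 1 \<or> g * e1 * e2 = -1" using e wave_pairD(8)[OF W] by auto
  show ?thesis unfolding wave_pair_def
    using gen[OF wave_pairD(1)[OF W]] gen[OF wave_pairD(2)[OF W]] ge W
    unfolding wave_pair_def by auto
qed

abbreviation jcont :: "(real \<Rightarrow> real \<Rightarrow> real) \<Rightarrow> real \<times> real \<Rightarrow> bool" where
  "jcont f z \<equiv> isCont (\<lambda>z. f (fst z) (snd z)) z"

lemma near_of_isCont:
  assumes "isCont (f :: real \<Rightarrow> real) a" "e > 0"
  shows "\<exists>d>0. \<forall>s. \<bar>s - a\<bar> \<le> d \<longrightarrow> \<bar>f s - f a\<bar> \<le> e"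
proof -
  obtain d where d: "d > 0" "\<And>s. \<bar>s - a\<bar> < d \<Longrightarrow> \<bar>f s - f a\<bar> < e"
    using assms unfolding continuous_at_eps_delta dist_real_def by blast
  then show ?thesis by (intro exI[of _ "d/2"]) (force intro: less_imp_le)
qed

text \<open>By \<open>barrier_corner\<close> a deviation of either invariant stays near its own characteristic through the corner. The two
speeds differ by about \<open>2 * c0\<close>, so at most one invariant deviates at a given point, and the points where \<open>rp\<close> deviates form a
fan in which \<open>x / t\<close> is close to the speed at \<open>(t, x)\<close>. On a time slice \<open>rp\<close> returns to its undisturbed value
on both sides of the fan. On one of these sides the speed would have to grow while \<open>rp\<close> moves in the direction that lowers
it, because the speed is a monotone function of \<open>rp\<close>; this excludes a large deviation.\<close>

lemma wave_corner_plus: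
  assumes W: "wave_pair g c0 L B rp rm cc" and h: "h > 0" and \<eta>: "\<eta> > 0"
    and C: "\<And>t x. 0 \<le> t \<Longrightarrow> t \<le> h \<Longrightarrow> 0 \<le> x \<Longrightarrow> x \<le> h \<Longrightarrow> (t,x) \<noteq> (0,0) \<Longrightarrow> jcont rp (t,x) \<and> jcont rm (t,x)"
  shows "\<exists>d>0. \<forall>t x. 0 \<le> t \<longrightarrow> t \<le> d \<longrightarrow> 0 \<le> x \<longrightarrow> x \<le> d \<longrightarrow> \<bar>rp t x - rp 0 0\<bar> \<le> 4 * \<eta>"
proof -
  note WD = wave_pairD[OF W]
  have c0: "c0 > 0" and L: "L \<ge> 0" and B: "B \<ge> 0" using WD by auto
  define e where "e = min (\<eta> / (9 + 10 * L)) (c0 / 4)"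
  have e: "e > 0" using \<eta> c0 L by (simp add: e_def add_pos_nonneg)
  have e4: "e \<le> c0 / 4" unfolding e_def by (rule min.cobounded2)
  have "e \<le> \<eta> / (9 + 10 * L)" by (simp add: e_def)
  then have eL: "(9 + 10 * L) * e \<le> \<eta>" using L by (simp add: field_simps)
  have Le: "L * e \<ge> 0" using L e by simp
  have e9: "9 * e \<le> \<eta>" using eL Le by (simp add: algebra_simps)
  have near: "\<exists>d>0. \<forall>s. \<bar>s - a\<bar> \<le> d \<longrightarrow> \<bar>f s - f a\<bar> \<le> e / 2" if "isCont f a" for f :: "real \<Rightarrow> real" and a
    by (rule near_of_isCont[OF that half_gt_zero[OF e]])
  obtain h1 where h1: "0 < h1" "h1 \<le> h"
    "\<And>s. 0 \<le> s \<Longrightarrow> s \<le> h1 \<Longrightarrow> \<bar>rp s 0 - rp 0 0\<bar> \<le> e/2 \<and> \<bar>rp 0 s - rp 0 0\<bar> \<le> e/2 \<and> \<bar>rm s 0 - rm 0 0\<bar> \<le> e/2 \<and> \<bar>rm 0 s - rm 0 0\<bar> \<le> e/2"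
  proof -
    from near[OF wave_pair_cont_slices(1)[OF W, of 0 0]] near[OF wave_pair_cont_slices(2)[OF W, of 0 0]]
      near[OF wave_pair_cont_slices(3)[OF W, of 0 0]] near[OF wave_pair_cont_slices(4)[OF W, of 0 0]]
    obtain d1 d2 d3 d4 where D: "d1 > 0" "\<forall>s. \<bar>s - 0\<bar> \<le> d1 \<longrightarrow> \<bar>rp s 0 - rp 0 0\<bar> \<le> e / 2"
      "d2 > 0" "\<forall>s. \<bar>s - 0\<bar> \<le> d2 \<longrightarrow> \<bar>rp 0 s - rp 0 0\<bar> \<le> e / 2"
      "d3 > 0" "\<forall>s. \<bar>s - 0\<bar> \<le> d3 \<longrightarrow> \<bar>rm s 0 - rm 0 0\<bar> \<le> e / 2"
      "d4 > 0" "\<forall>s. \<bar>s - 0\<bar> \<le> d4 \<longrightarrow> \<bar>rm 0 s - rm 0 0\<bar> \<le> e / 2" by blast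
    define H where "H = min (min d1 d2) (min (min d3 d4) h)"
    have H: "0 < H" "H \<le> d1" "H \<le> d2" "H \<le> d3" "H \<le> d4" "H \<le> h" using D h by (simp_all add: H_def)
    have "\<bar>rp s 0 - rp 0 0\<bar> \<le> e/2 \<and> \<bar>rp 0 s - rp 0 0\<bar> \<le> e/2 \<and> \<bar>rm s 0 - rm 0 0\<bar> \<le> e/2 \<and> \<bar>rm 0 s - rm 0 0\<bar> \<le> e/2"
      if "0 \<le> s" "s \<le> H" for s
    proof -
      have "\<bar>s - 0\<bar> \<le> d1" "\<bar>s - 0\<bar> \<le> d2" "\<bar>s - 0\<bar> \<le> d3" "\<bar>s - 0\<bar> \<le> d4" using that H by linarith+
      then show ?thesis using D(2,4,6,8) by blast
    qed
    then show ?thesis using that[of H] H by blast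
  qed
  obtain \<tau> where \<tau>: "0 < \<tau>" "\<tau> \<le> h1" "2 * B * \<tau> < e"
    "\<And>t. 0 \<le> t \<Longrightarrow> t \<le> \<tau> \<Longrightarrow> \<bar>rp t h1 - rp 0 0\<bar> \<le> e \<and> \<bar>rm t h1 - rm 0 0\<bar> \<le> e"
  proof -
    from near[OF wave_pair_cont_slices(1)[OF W, of 0 h1]]
    obtain d1 where D1: "d1 > 0" "\<forall>s. \<bar>s - 0\<bar> \<le> d1 \<longrightarrow> \<bar>rp s h1 - rp 0 h1\<bar> \<le> e / 2" by (elim exE conjE)
    from near[OF wave_pair_cont_slices(3)[OF W, of 0 h1]]
    obtain d2 where D2: "d2 > 0" "\<forall>s. \<bar>s - 0\<bar> \<le> d2 \<longrightarrow> \<bar>rm s h1 - rm 0 h1\<bar> \<le> e / 2" by (elim exE conjE)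
    note D = D1 D2
    define T where "T = min (min d1 d2) (min h1 (e / (4 * (B + 1))))"
    have pos: "0 < e / (4 * (B + 1))" using e B by (intro divide_pos_pos) auto
    have "0 < T" unfolding T_def min_less_iff_conj using D(1,3) h1(1) pos by blast
    moreover have "T \<le> d1" "T \<le> d2" "T \<le> h1" "T \<le> e / (4 * (B + 1))" unfolding T_def by linarith+
    ultimately have T: "0 < T" "T \<le> d1" "T \<le> d2" "T \<le> h1" "T \<le> e / (4 * (B + 1))" by blast+
    have "T * (4 * (B + 1)) \<le> e" using T(5) B by (subst (asm) pos_le_divide_eq) auto
    then have "4 * (B * T) + 4 * T \<le> e" by (simp add: algebra_simps)
    moreover have "0 \<le> B * T" using T(1) B by simp
    ultimately have "2 * (B * T) < e" using T(1) e by linarith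
    then have "2 * B * T < e" by (simp only: mult.assoc)
    have "\<bar>rp t h1 - rp 0 0\<bar> \<le> e \<and> \<bar>rm t h1 - rm 0 0\<bar> \<le> e" if "0 \<le> t" "t \<le> T" for t
    proof -
      have "\<bar>t - 0\<bar> \<le> d1" "\<bar>t - 0\<bar> \<le> d2" using that T by linarith+
      then have "\<bar>rp t h1 - rp 0 h1\<bar> \<le> e / 2" "\<bar>rm t h1 - rm 0 h1\<bar> \<le> e / 2" using D by blast+
      moreover have "\<bar>rp 0 h1 - rp 0 0\<bar> \<le> e / 2" "\<bar>rm 0 h1 - rm 0 0\<bar> \<le> e / 2" using h1(3)[OF less_imp_le[OF h1(1)] order_refl] by blast+
      ultimately show ?thesis by linarith
    qed
    then show ?thesis by (rule that[OF T(1,4) \<open>2 * B * T < e\<close>])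
  qed
  define vp where "vp t x = g * ((rp t x + rm t x) / 2 + cc t x)" for t x
  define vm where "vm t x = g * ((rp t x + rm t x) / 2 - cc t x)" for t x
  have gabs: "\<bar>g * a\<bar> = \<bar>a\<bar>" for a using WD(8) by (auto simp: abs_mult)
  have contp: "continuous_on ({0..t} \<times> {0..h1} - {(0, 0)}) (\<lambda>z. rp (fst z) (snd z))"
    and contm: "continuous_on ({0..t} \<times> {0..h1} - {(0, 0)}) (\<lambda>z. rm (fst z) (snd z))" if "t \<le> \<tau>" for t
  proof -
    have "jcont rp z \<and> jcont rm z" if "z \<in> {0..t} \<times> {0..h1} - {(0, 0)}" for z
      using that C[of "fst z" "snd z"] \<tau> h1 \<open>t \<le> \<tau>\<close> by (cases z) auto
    then show "continuous_on ({0..t} \<times> {0..h1} - {(0, 0)}) (\<lambda>z. rp (fst z) (snd z))"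
      "continuous_on ({0..t} \<times> {0..h1} - {(0, 0)}) (\<lambda>z. rm (fst z) (snd z))"
      by (auto intro!: continuous_at_imp_continuous_on)
  qed
  have half: "e / 2 \<le> e" using e by simp
  have sides: "\<bar>rp t 0 - rp 0 0\<bar> \<le> e" "\<bar>rm t 0 - rm 0 0\<bar> \<le> e" if "0 \<le> t" "t \<le> \<tau>" for t
    using h1(3)[of t] that \<tau>(2) half by linarith+
  have inits: "\<bar>rp 0 x - rp 0 0\<bar> \<le> e" "\<bar>rm 0 x - rm 0 0\<bar> \<le> e" if "0 \<le> x" "x \<le> h1" for x
    using h1(3)[of x] that half by linarith+
  have smallB: "2 * B * t < e" if "0 < t" "t \<le> \<tau>" for t
  proof -
    have "2 * B * t \<le> 2 * B * \<tau>" using that B by (intro mult_left_mono) auto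
    then show ?thesis using \<tau>(3) by linarith
  qed
  have slowp: "\<bar>x - \<Lambda> * t\<bar> \<le> \<kappa> * t" if tx: "0 < t" "t \<le> \<tau>" "0 < x" "x < h1" "\<bar>rp t x - rp 0 0\<bar> \<ge> 2 * e"
    and sp: "\<And>s y. 0 < s \<Longrightarrow> s \<le> t \<Longrightarrow> 0 < y \<Longrightarrow> y < h1 \<Longrightarrow> \<bar>rp s y - rp t x\<bar> < e \<Longrightarrow> \<bar>vp s y - \<Lambda>\<bar> \<le> \<kappa>" for t x \<Lambda> \<kappa>
  proof (rule barrier_corner[OF tx(1,3,4) e _ contp[OF tx(2)] _ _ _ smallB[OF tx(1,2)] tx(5) sp])
    show "\<exists>rt rx. ((\<lambda>s. rp s y) has_real_derivative rt) (at s) \<and> (rp s has_real_derivative rx) (at y) \<and> \<bar>rt + vp s y * rx\<bar> \<le> B" for s y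
      unfolding vp_def by (rule WD(1))
    show "\<bar>rp s 0 - rp 0 0\<bar> \<le> e" if "0 < s" "s \<le> t" for s using sides(1)[of s] that tx(2) by linarith
    show "\<bar>rp s h1 - rp 0 0\<bar> \<le> e" if "0 \<le> s" "s \<le> t" for s using \<tau>(4)[of s] that tx(2) by linarith
    show "\<bar>rp 0 y - rp 0 0\<bar> \<le> e" if "0 < y" "y \<le> h1" for y using inits(1)[of y] that by linarith
  qed
  have slowm: "\<bar>x - \<Lambda> * t\<bar> \<le> \<kappa> * t" if tx: "0 < t" "t \<le> \<tau>" "0 < x" "x < h1" "\<bar>rm t x - rm 0 0\<bar> \<ge> 2 * e"
    and sp: "\<And>s y. 0 < s \<Longrightarrow> s \<le> t \<Longrightarrow> 0 < y \<Longrightarrow> y < h1 \<Longrightarrow> \<bar>rm s y - rm t x\<bar> < e \<Longrightarrow> \<bar>vm s y - \<Lambda>\<bar> \<le> \<kappa>" for t x \<Lambda> \<kappa>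
  proof (rule barrier_corner[OF tx(1,3,4) e _ contm[OF tx(2)] _ _ _ smallB[OF tx(1,2)] tx(5) sp])
    show "\<exists>rt rx. ((\<lambda>s. rm s y) has_real_derivative rt) (at s) \<and> (rm s has_real_derivative rx) (at y) \<and> \<bar>rt + vm s y * rx\<bar> \<le> B" for s y
      unfolding vm_def by (rule WD(2))
    show "\<bar>rm s 0 - rm 0 0\<bar> \<le> e" if "0 < s" "s \<le> t" for s using sides(2)[of s] that tx(2) by linarith
    show "\<bar>rm s h1 - rm 0 0\<bar> \<le> e" if "0 \<le> s" "s \<le> t" for s using \<tau>(4)[of s] that tx(2) by linarith
    show "\<bar>rm 0 y - rm 0 0\<bar> \<le> e" if "0 < y" "y \<le> h1" for y using inits(2)[of y] that by linarith
  qed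
  have not_both: "\<bar>rp t x - rp 0 0\<bar> < 2 * e \<or> \<bar>rm t x - rm 0 0\<bar> < 2 * e"
    if tx: "0 < t" "t \<le> \<tau>" "0 < x" "x < h1" for t x
  proof (rule ccontr)
    assume n: "\<not> ?thesis"
    have 1: "\<bar>x - vp t x * t\<bar> \<le> (45/100 * c0) * t"
    proof (rule slowp[OF tx])
      fix s y assume "\<bar>rp s y - rp t x\<bar> < e"
      then have "\<bar>((rp s y + rm s y) / 2 + cc s y) - ((rp t x + rm t x) / 2 + cc t x)\<bar> \<le> 45/100 * c0"
        using WD(3,4,5)[of s y] WD(3,4,5)[of t x] e4 unfolding add_divide_distrib by linarith
      then show "\<bar>vp s y - vp t x\<bar> \<le> 45/100 * c0"
        unfolding vp_def right_diff_distrib[symmetric] gabs .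
    next
      show "2 * e \<le> \<bar>rp t x - rp 0 0\<bar>" using n by linarith
    qed
    have 2: "\<bar>x - vm t x * t\<bar> \<le> (45/100 * c0) * t"
    proof (rule slowm[OF tx])
      fix s y assume "\<bar>rm s y - rm t x\<bar> < e"
      then have "\<bar>((rp s y + rm s y) / 2 - cc s y) - ((rp t x + rm t x) / 2 - cc t x)\<bar> \<le> 45/100 * c0"
        using WD(3,4,5)[of s y] WD(3,4,5)[of t x] e4 unfolding add_divide_distrib by linarith
      then show "\<bar>vm s y - vm t x\<bar> \<le> 45/100 * c0"
        unfolding vm_def right_diff_distrib[symmetric] gabs .
    next
      show "2 * e \<le> \<bar>rm t x - rm 0 0\<bar>" using n by linarith
    qed
    have "\<bar>vp t x * t - vm t x * t\<bar> \<le> (90/100 * c0) * t" using 1 2 by linarith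
    moreover have "vp t x * t - vm t x * t = g * (2 * cc t x * t)" by (simp add: vp_def vm_def algebra_simps)
    ultimately have "\<bar>2 * cc t x * t\<bar> \<le> (90/100 * c0) * t" by (simp only: gabs)
    then have "(2 * cc t x) * t \<le> (90/100 * c0) * t" using abs_ge_self order_trans by blast
    then have "2 * cc t x \<le> 90/100 * c0" using tx(1) by (rule mult_right_le_imp_le)
    then show False using WD(4)[of t x] c0 by linarith
  qed
  define \<kappa> where "\<kappa> = (3 + 5 * L) * e"
  have fan: "\<bar>x - vp t x * t\<bar> \<le> \<kappa> * t" and rm_fan: "\<bar>rm t x - rm 0 0\<bar> < 2 * e"
    if tx: "0 < t" "t \<le> \<tau>" "0 < x" "x < h1" and big: "\<bar>rp t x - rp 0 0\<bar> \<ge> 2 * \<eta>" for t x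
  proof -
    show m1: "\<bar>rm t x - rm 0 0\<bar> < 2 * e" using not_both[OF tx] big e9 e by linarith
    show "\<bar>x - vp t x * t\<bar> \<le> \<kappa> * t"
    proof (rule slowp[OF tx])
      fix s y assume sy: "0 < s" "s \<le> t" "0 < y" "y < h1" and n: "\<bar>rp s y - rp t x\<bar> < e"
      have m2: "\<bar>rm s y - rm 0 0\<bar> < 2 * e" using not_both[of s y] sy tx(2) n big e9 e by linarith
      have d: "\<bar>(rp s y - rm s y) - (rp t x - rm t x)\<bar> \<le> 5 * e" using n m1 m2 by linarith
      have "\<bar>cc s y - cc t x\<bar> \<le> L * \<bar>(rp s y - rm s y) - (rp t x - rm t x)\<bar>" by (rule WD(7))
      also have "\<dots> \<le> L * (5 * e)" using d L by (rule mult_left_mono)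
      finally have "\<bar>cc s y - cc t x\<bar> \<le> 5 * (L * e)" by simp
      then have "\<bar>((rp s y + rm s y) / 2 + cc s y) - ((rp t x + rm t x) / 2 + cc t x)\<bar> \<le> \<kappa>"
        using n m1 m2 e unfolding \<kappa>_def add_divide_distrib distrib_right mult.assoc by linarith
      then show "\<bar>vp s y - vp t x\<bar> \<le> \<kappa>"
        unfolding vp_def right_diff_distrib[symmetric] gabs .
    next
      show "2 * e \<le> \<bar>rp t x - rp 0 0\<bar>" using big e9 e by linarith
    qed
  qed
  have main: "\<bar>rp t x - rp 0 0\<bar> \<le> 4 * \<eta>" if tx: "0 < t" "t \<le> \<tau>" "0 < x" "x < h1" for t x
  proof (rule ccontr)
    assume n: "\<not> ?thesis"
    define \<sigma> where "\<sigma> = sgn (rp t x - rp 0 0)"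
    have \<sigma>: "\<sigma> = 1 \<or> \<sigma> = -1" using n \<eta> by (auto simp: \<sigma>_def sgn_if)
    define f where "f y = \<sigma> * (rp t y - rp 0 0)" for y
    have fx: "f x = \<bar>rp t x - rp 0 0\<bar>" by (simp add: f_def \<sigma>_def sgn_if)
    have fabs: "\<bar>f y\<bar> = \<bar>rp t y - rp 0 0\<bar>" for y using \<sigma> by (auto simp: f_def abs_mult)
    have f0: "f 0 \<le> 2 * \<eta>" using sides(1)[of t] fabs[of 0] tx e9 e by linarith
    have fh: "f h1 \<le> 2 * \<eta>" using \<tau>(4)[of t] fabs[of h1] tx e9 e by linarith
    have contf: "isCont f y" for y unfolding f_def by (intro continuous_intros wave_pair_cont_slices[OF W])
    have gs: "g * \<sigma> = 1 \<or> g * \<sigma> = -1" using \<sigma> WD(8) by auto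
    have "\<exists>y. 0 \<le> y \<and> y \<le> h1 \<and> f y = 2 * \<eta> \<and> g * \<sigma> * (y - x) \<ge> 0"
    proof (cases "g * \<sigma> = 1")
      case True
      have "\<exists>y\<ge>x. y \<le> h1 \<and> f y = 2 * \<eta>"
        by (rule IVT2) (use fh fx n tx \<eta> contf in auto)
      then obtain y where "x \<le> y" "y \<le> h1" "f y = 2 * \<eta>" by blast
      then show ?thesis using True tx by (intro exI[of _ y]) simp
    next
      case False
      have "\<exists>y\<ge>0. y \<le> x \<and> f y = 2 * \<eta>"
        by (rule IVT) (use f0 fx n tx \<eta> contf in auto)
      then obtain y where "0 \<le> y" "y \<le> x" "f y = 2 * \<eta>" by blast
      then show ?thesis using False gs tx by (intro exI[of _ y]) simp
    qed
    then obtain y where y: "0 \<le> y" "y \<le> h1" "f y = 2 * \<eta>" "g * \<sigma> * (y - x) \<ge> 0" by blast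
    have "y \<noteq> 0" "y \<noteq> h1" using sides(1)[of t] \<tau>(4)[of t] fabs[of 0] fabs[of h1] tx e9 e y(3) by auto
    then have ty: "0 < t" "t \<le> \<tau>" "0 < y" "y < h1" using y tx by auto
    have bigy: "\<bar>rp t y - rp 0 0\<bar> \<ge> 2 * \<eta>" using fabs[of y] y(3) by simp
    have bigx: "\<bar>rp t x - rp 0 0\<bar> \<ge> 2 * \<eta>" using n \<eta> by linarith
    note fx1 = fan[OF tx bigx] and fy1 = fan[OF ty bigy]
    note mx1 = rm_fan[OF tx bigx] and my1 = rm_fan[OF ty bigy]
    have d1: "\<sigma> * (rp t x - rp t y) \<ge> 2 * \<eta>" using fx n y(3) by (simp add: f_def algebra_simps)
    have d2: "\<bar>\<sigma> * (rm t x - rm t y)\<bar> \<le> 4 * e" using mx1 my1 \<sigma> by auto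
    have d3: "\<sigma> * (cc t x - cc t y) \<ge> 0"
    proof -
      have "\<sigma> * ((rp t x - rm t x) - (rp t y - rm t y)) \<ge> 0"
        using d1 d2 e9 e by (simp add: algebra_simps abs_le_iff)
      then show ?thesis using \<sigma> WD(6)[of t x t y] WD(6)[of t y t x] by auto
    qed
    have "g * \<sigma> * (vp t x - vp t y) = \<sigma> * (rp t x - rp t y) / 2 + \<sigma> * (rm t x - rm t y) / 2 + \<sigma> * (cc t x - cc t y)"
      using WD(8) by (auto simp: vp_def field_simps)
    then have d4: "g * \<sigma> * (vp t x - vp t y) \<ge> \<eta> - 2 * e" using d1 d2 d3 by linarith
    have "g * \<sigma> * (vp t x - vp t y) * t \<le> g * \<sigma> * (x - y) + 2 * \<kappa> * t"
      using gs fx1 fy1 by (elim disjE) (simp_all add: algebra_simps abs_le_iff)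
    then have "(\<eta> - 2 * e) * t \<le> 2 * \<kappa> * t"
      using mult_right_mono[OF d4, of t] tx y(4) by (simp add: algebra_simps)
    then have "\<eta> - 2 * e \<le> 2 * \<kappa>" using tx by simp
    then show False using eL e by (simp add: \<kappa>_def algebra_simps)
  qed
  have eta4: "e \<le> 4 * \<eta>" using e9 e by linarith
  show ?thesis
  proof (intro exI[of _ "min \<tau> (h1/2)"] conjI allI impI)
    show "0 < min \<tau> (h1 / 2)" using \<tau> h1 by simp
    fix t x assume "0 \<le> t" "t \<le> min \<tau> (h1/2)" "0 \<le> x" "x \<le> min \<tau> (h1/2)"
    then have tx: "0 \<le> t" "t \<le> \<tau>" "0 \<le> x" "x < h1" using h1 by auto
    show "\<bar>rp t x - rp 0 0\<bar> \<le> 4 * \<eta>"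
    proof (cases "t = 0 \<or> x = 0")
      case True
      then show ?thesis using sides(1)[of t] inits(1)[of x] tx eta4 by auto
    next
      case False
      then show ?thesis using main tx by simp
    qed
  qed
qed

lemma wave_corner:
  assumes W: "wave_pair g c0 L B rp rm cc" and e: "e1 = 1 \<or> e1 = -1" "e2 = 1 \<or> e2 = -1"
    and h: "h > 0" and \<eta>: "\<eta> > 0"
    and C: "\<And>t x. 0 \<le> t \<Longrightarrow> t \<le> h \<Longrightarrow> 0 \<le> x \<Longrightarrow> x \<le> h \<Longrightarrow> (t,x) \<noteq> (0,0) \<Longrightarrow>
       jcont rp (t0 + e1 * t, x0 + e2 * x) \<and> jcont rm (t0 + e1 * t, x0 + e2 * x)"
  shows "\<exists>d>0. \<forall>t x. 0 \<le> t \<longrightarrow> t \<le> d \<longrightarrow> 0 \<le> x \<longrightarrow> x \<le> d \<longrightarrow>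
     \<bar>rp (t0 + e1 * t) (x0 + e2 * x) - rp t0 x0\<bar> \<le> \<eta> \<and> \<bar>rm (t0 + e1 * t) (x0 + e2 * x) - rm t0 x0\<bar> \<le> \<eta>"
proof -
  define rp' where "rp' t x = rp (t0 + e1 * t) (x0 + e2 * x)" for t x
  define rm' where "rm' t x = rm (t0 + e1 * t) (x0 + e2 * x)" for t x
  define cc' where "cc' t x = cc (t0 + e1 * t) (x0 + e2 * x)" for t x
  have W': "wave_pair (g * e1 * e2) c0 L B rp' rm' cc'"
    unfolding rp'_def rm'_def cc'_def by (rule wave_pair_affine[OF W e])
  have comp: "jcont (\<lambda>t x. f (t0 + e1 * t) (x0 + e2 * x)) (t,x)" if "jcont f (t0 + e1 * t, x0 + e2 * x)" for f t x
    using isCont_o2[where f="\<lambda>z. (t0 + e1 * fst z, x0 + e2 * snd z)" and a="(t,x)" and g="\<lambda>z. f (fst z) (snd z)"] that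
    by (auto intro!: continuous_intros)
  have C': "jcont rp' (t,x) \<and> jcont rm' (t,x)" if "0 \<le> t" "t \<le> h" "0 \<le> x" "x \<le> h" "(t,x) \<noteq> (0,0)" for t x
    using C[OF that] comp unfolding rp'_def rm'_def by blast
  have C'': "jcont (\<lambda>t x. - rm' t x) (t,x) \<and> jcont (\<lambda>t x. - rp' t x) (t,x)" if "0 \<le> t" "t \<le> h" "0 \<le> x" "x \<le> h" "(t,x) \<noteq> (0,0)" for t x
    using C'[OF that] by (auto intro!: continuous_intros)
  obtain d1 where d1: "d1 > 0" "\<And>t x. 0 \<le> t \<Longrightarrow> t \<le> d1 \<Longrightarrow> 0 \<le> x \<Longrightarrow> x \<le> d1 \<Longrightarrow> \<bar>rp' t x - rp' 0 0\<bar> \<le> 4 * (\<eta>/4)"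
    using wave_corner_plus[OF W' h _ C', of "\<eta>/4"] \<eta> by auto
  obtain d2 where d2: "d2 > 0" "\<And>t x. 0 \<le> t \<Longrightarrow> t \<le> d2 \<Longrightarrow> 0 \<le> x \<Longrightarrow> x \<le> d2 \<Longrightarrow> \<bar>- rm' t x - - rm' 0 0\<bar> \<le> 4 * (\<eta>/4)"
    using wave_corner_plus[OF wave_pair_swap[OF W'] h _ C'', of "\<eta>/4"] \<eta> by auto
  show ?thesis
  proof (intro exI[of _ "min d1 d2"] conjI allI impI)
    show "0 < min d1 d2" using d1 d2 by simp
    fix t x assume a: "0 \<le> t" "t \<le> min d1 d2" "0 \<le> x" "x \<le> min d1 d2"
    show "\<bar>rp (t0 + e1 * t) (x0 + e2 * x) - rp t0 x0\<bar> \<le> \<eta>" using d1(2)[of t x] a by (simp add: rp'_def)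
    show "\<bar>rm (t0 + e1 * t) (x0 + e2 * x) - rm t0 x0\<bar> \<le> \<eta>" using d2(2)[of t x] a by (simp add: rm'_def abs_minus_commute)
  qed
qed

lemma quadrant_continuous_within:
  fixes f :: "real \<Rightarrow> real \<Rightarrow> real" and e1 e2 t0 x0 :: real
  assumes e: "e1 = 1 \<or> e1 = -1" "e2 = 1 \<or> e2 = -1"
    and Q: "\<And>t x. (t,x) \<in> Q \<Longrightarrow> 0 \<le> e1 * (t - t0) \<and> 0 \<le> e2 * (x - x0)"
    and lim: "\<And>\<eta>. \<eta> > 0 \<Longrightarrow> \<exists>d>0. \<forall>t x. 0 \<le> t \<longrightarrow> t \<le> d \<longrightarrow> 0 \<le> x \<longrightarrow> x \<le> d \<longrightarrow>
     \<bar>f (t0 + e1 * t) (x0 + e2 * x) - f t0 x0\<bar> \<le> \<eta>"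
  shows "continuous (at (t0,x0) within Q) (\<lambda>z. f (fst z) (snd z))"
  unfolding continuous_within_eps_delta
proof (intro allI impI)
  fix \<eta> :: real assume "\<eta> > 0"
  then obtain d where d: "d > 0" "\<And>t x. 0 \<le> t \<Longrightarrow> t \<le> d \<Longrightarrow> 0 \<le> x \<Longrightarrow> x \<le> d \<Longrightarrow>
     \<bar>f (t0 + e1 * t) (x0 + e2 * x) - f t0 x0\<bar> \<le> \<eta>/2" using lim[of "\<eta>/2"] by auto
  show "\<exists>d>0. \<forall>x'\<in>Q. dist x' (t0, x0) < d \<longrightarrow> dist (f (fst x') (snd x')) (f (fst (t0, x0)) (snd (t0, x0))) < \<eta>"
  proof (intro exI[of _ d] conjI ballI impI d(1))
    fix z assume z: "z \<in> Q" "dist z (t0,x0) < d"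
    obtain t x where tx: "z = (t,x)" by (cases z)
    have "dist t t0 \<le> dist z (t0,x0)" "dist x x0 \<le> dist z (t0,x0)"
      unfolding tx dist_Pair_Pair by (rule real_sqrt_sum_squares_ge1 real_sqrt_sum_squares_ge2)+
    then have "\<bar>t - t0\<bar> \<le> d" "\<bar>x - x0\<bar> \<le> d" using z(2) by (auto simp: dist_real_def)
    then have "e1 * (t - t0) \<le> d" "e2 * (x - x0) \<le> d" using e by auto
    then have "\<bar>f (t0 + e1 * (e1 * (t - t0))) (x0 + e2 * (e2 * (x - x0))) - f t0 x0\<bar> \<le> \<eta>/2"
      using d(2) Q z tx by blast
    moreover have "t0 + e1 * (e1 * (t - t0)) = t" "x0 + e2 * (e2 * (x - x0)) = x" using e by auto
    ultimately show "dist (f (fst z) (snd z)) (f (fst (t0, x0)) (snd (t0, x0))) < \<eta>"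
      using \<open>\<eta> > 0\<close> by (simp add: tx dist_real_def)
  qed
qed

lemma wave_continuous_rect:
  assumes W: "wave_pair g c0 L B rp rm cc" and ab: "a < b" "c < d"
    and C: "\<And>t x. a \<le> t \<Longrightarrow> t \<le> b \<Longrightarrow> c \<le> x \<Longrightarrow> x \<le> d \<Longrightarrow> \<not> ((t = a \<or> t = b) \<and> (x = c \<or> x = d)) \<Longrightarrow>
       jcont rp (t, x) \<and> jcont rm (t, x)"
  shows "continuous_on ({a..b} \<times> {c..d}) (\<lambda>z. rp (fst z) (snd z))"
    and "continuous_on ({a..b} \<times> {c..d}) (\<lambda>z. rm (fst z) (snd z))"
proof -
  define h where "h = min (b - a) (d - c) / 2"
  have h: "h > 0" "h < b - a" "h < d - c" using ab by (auto simp: h_def)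
  have "continuous (at (t0,x0) within {a..b} \<times> {c..d}) (\<lambda>z. rp (fst z) (snd z))
      \<and> continuous (at (t0,x0) within {a..b} \<times> {c..d}) (\<lambda>z. rm (fst z) (snd z))"
    if t0: "a \<le> t0" "t0 \<le> b" and x0: "c \<le> x0" "x0 \<le> d" for t0 x0
  proof (cases "(t0 = a \<or> t0 = b) \<and> (x0 = c \<or> x0 = d)")
    case False
    then show ?thesis using C[OF t0 x0] by (auto intro: continuous_at_imp_continuous_within)
  next
    case True
    define e1 :: real where "e1 = (if t0 = a then 1 else -1)"
    define e2 :: real where "e2 = (if x0 = c then 1 else -1)"
    have e: "e1 = 1 \<or> e1 = -1" "e2 = 1 \<or> e2 = -1" by (auto simp: e1_def e2_def)
    have Q: "0 \<le> e1 * (t - t0) \<and> 0 \<le> e2 * (x - x0)" if "(t,x) \<in> {a..b} \<times> {c..d}" for t x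
      using that True by (auto simp: e1_def e2_def)
    have C': "jcont rp (t0 + e1 * t, x0 + e2 * x) \<and> jcont rm (t0 + e1 * t, x0 + e2 * x)"
      if "0 \<le> t" "t \<le> h" "0 \<le> x" "x \<le> h" "(t,x) \<noteq> (0,0)" for t x
      by (rule C) (use that h True in \<open>auto simp: e1_def e2_def\<close>)
    have lim: "\<exists>d>0. \<forall>t x. 0 \<le> t \<longrightarrow> t \<le> d \<longrightarrow> 0 \<le> x \<longrightarrow> x \<le> d \<longrightarrow>
     \<bar>rp (t0 + e1 * t) (x0 + e2 * x) - rp t0 x0\<bar> \<le> \<eta> \<and> \<bar>rm (t0 + e1 * t) (x0 + e2 * x) - rm t0 x0\<bar> \<le> \<eta>" if "\<eta> > 0" for \<eta>
      by (rule wave_corner[OF W e h(1) that C'])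
    show ?thesis
      by (intro conjI quadrant_continuous_within[OF e Q]) (use lim in meson)+
  qed
  then show "continuous_on ({a..b} \<times> {c..d}) (\<lambda>z. rp (fst z) (snd z))"
    "continuous_on ({a..b} \<times> {c..d}) (\<lambda>z. rm (fst z) (snd z))"
    by (auto simp: continuous_on_eq_continuous_within)
qed

text \<open>Continuity may fail at the corners of the rectangle; there \<open>wave_corner\<close> supplies it.\<close>

lemma wave_rect_bound:
  assumes W: "wave_pair g c0 L B rp rm cc" and ab: "a < b" "c < d"
    and C: "\<And>t x. a \<le> t \<Longrightarrow> t \<le> b \<Longrightarrow> c \<le> x \<Longrightarrow> x \<le> d \<Longrightarrow> \<not> ((t = a \<or> t = b) \<and> (x = c \<or> x = d)) \<Longrightarrow>
       jcont rp (t, x) \<and> jcont rm (t, x)"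
    and init: "\<And>x. c \<le> x \<Longrightarrow> x \<le> d \<Longrightarrow> \<bar>rp a x - p0\<bar> \<le> \<eta> \<and> \<bar>rm a x - m0\<bar> \<le> \<eta>"
    and sides: "\<And>t. a \<le> t \<Longrightarrow> t \<le> b \<Longrightarrow> \<bar>rp t c - p0\<bar> \<le> \<eta> \<and> \<bar>rm t c - m0\<bar> \<le> \<eta> \<and> \<bar>rp t d - p0\<bar> \<le> \<eta> \<and> \<bar>rm t d - m0\<bar> \<le> \<eta>"
    and tx: "a \<le> t" "t \<le> b" "c \<le> x" "x \<le> d"
  shows "\<bar>rp t x - p0\<bar> \<le> \<eta> + (B + 1) * (t - a) \<and> \<bar>rm t x - m0\<bar> \<le> \<eta> + (B + 1) * (t - a)"
proof -
  have B: "B \<ge> 0" using wave_pairD(11)[OF W] .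
  have two_sided: "\<bar>r t x - r0\<bar> \<le> \<eta> + (B + 1) * (t - a)"
    if D: "\<And>t x. \<exists>rt rx. ((\<lambda>s. r s x) has_real_derivative rt) (at t) \<and> (r t has_real_derivative rx) (at x)
      \<and> \<bar>rt + lam t x * rx\<bar> \<le> B"
    and cont: "continuous_on ({a..b} \<times> {c..d}) (\<lambda>z. r (fst z) (snd z))"
    and i: "\<And>x. c \<le> x \<Longrightarrow> x \<le> d \<Longrightarrow> \<bar>r a x - r0\<bar> \<le> \<eta>"
    and s: "\<And>t. a \<le> t \<Longrightarrow> t \<le> b \<Longrightarrow> \<bar>r t c - r0\<bar> \<le> \<eta>" "\<And>t. a \<le> t \<Longrightarrow> t \<le> b \<Longrightarrow> \<bar>r t d - r0\<bar> \<le> \<eta>"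
    for r lam :: "real \<Rightarrow> real \<Rightarrow> real" and r0
  proof -
    have "r t x \<le> (r0 + \<eta>) + (B + 1) * (t - a)"
    proof (rule transport_max_principle[where r=r and t=t and x=x and lam=lam and c=c and d=d and b=b])
      show "\<exists>rt rx. ((\<lambda>s. r s x) has_real_derivative rt) (at t) \<and> (r t has_real_derivative rx) (at x)
        \<and> rt + lam t x * rx \<le> B" for t x using D[of x t] by (meson abs_le_D1)
      show "r a y \<le> r0 + \<eta>" if "c \<le> y" "y \<le> d" for y using i[OF that] by linarith
      show "r s c \<le> r0 + \<eta>" "r s d \<le> r0 + \<eta>" if "a \<le> s" "s \<le> b" for s using s[OF that] by linarith+
    qed (use ab cont B tx in auto)
    moreover have "- r t x \<le> (- r0 + \<eta>) + (B + 1) * (t - a)"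
    proof (rule transport_max_principle[where r="\<lambda>t x. - r t x" and t=t and x=x and lam=lam and c=c and d=d and b=b])
      show "\<exists>rt rx. ((\<lambda>s. - r s x) has_real_derivative rt) (at t) \<and> ((\<lambda>x. - r t x) has_real_derivative rx) (at x)
        \<and> rt + lam t x * rx \<le> B" for t x
      proof -
        obtain rt rx where R: "((\<lambda>s. r s x) has_real_derivative rt) (at t)" "(r t has_real_derivative rx) (at x)"
          "\<bar>rt + lam t x * rx\<bar> \<le> B" using D by blast
        have "- rt + lam t x * (- rx) \<le> B" using R(3) by (simp add: abs_le_iff)
        then show ?thesis using DERIV_minus[OF R(1)] DERIV_minus[OF R(2)] by blast
      qed
      show "- r a y \<le> - r0 + \<eta>" if "c \<le> y" "y \<le> d" for y using i[OF that] by linarith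
      show "- r s c \<le> - r0 + \<eta>" "- r s d \<le> - r0 + \<eta>" if "a \<le> s" "s \<le> b" for s using s[OF that] by linarith+
    qed (use ab cont B tx in \<open>auto intro: continuous_on_minus\<close>)
    ultimately show ?thesis by linarith
  qed
  note cr = wave_continuous_rect[OF W ab C]
  show ?thesis
    using two_sided[OF wave_pairD(1)[OF W] cr(1)] two_sided[OF wave_pairD(2)[OF W] cr(2)] init sides by blast
qed

lemma gap_left:
  fixes P :: "real set"
  assumes "compact P" "0 \<in> P" "0 < t" "t \<notin> P"
  shows "\<exists>\<alpha>\<in>P. 0 \<le> \<alpha> \<and> \<alpha> < t \<and> (\<forall>s\<in>P. s \<le> t \<longrightarrow> s \<le> \<alpha>)"
proof -
  have "compact (P \<inter> {0..t})" using assms by (intro compact_Int_closed) auto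
  moreover have "P \<inter> {0..t} \<noteq> {}" using assms by auto
  ultimately obtain \<alpha> where "\<alpha> \<in> P \<inter> {0..t}" "\<forall>s\<in>P \<inter> {0..t}. s \<le> \<alpha>"
    using compact_attains_sup by metis
  then have a: "\<alpha> \<in> P" "0 \<le> \<alpha>" "\<alpha> \<le> t" "\<forall>s\<in>P. 0 \<le> s \<longrightarrow> s \<le> t \<longrightarrow> s \<le> \<alpha>" by auto
  then have "\<alpha> < t" using assms(4) by (metis order_le_less)
  moreover have "s \<le> \<alpha>" if "s \<in> P" "s \<le> t" for s using a that by (cases "0 \<le> s") auto
  ultimately show ?thesis using a(1,2) by blast
qed

lemma gap_right:
  fixes P :: "real set"
  assumes "compact P" "p \<in> P" "t < p" "t \<notin> P"
  shows "\<exists>\<beta>\<in>P. t < \<beta> \<and> \<beta> \<le> p \<and> (\<forall>s\<in>P. t \<le> s \<longrightarrow> \<beta> \<le> s)"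
proof -
  have "compact (P \<inter> {t..p})" using assms by (intro compact_Int_closed) auto
  moreover have "P \<inter> {t..p} \<noteq> {}" using assms by auto
  ultimately obtain \<beta> where "\<beta> \<in> P \<inter> {t..p}" "\<forall>s\<in>P \<inter> {t..p}. \<beta> \<le> s"
    using compact_attains_inf by metis
  then have b: "\<beta> \<in> P" "t \<le> \<beta>" "\<beta> \<le> p" "\<forall>s\<in>P. t \<le> s \<longrightarrow> s \<le> p \<longrightarrow> \<beta> \<le> s" by auto
  then have "t < \<beta>" using assms(4) by (metis order_le_less)
  moreover have "\<beta> \<le> s" if "s \<in> P" "t \<le> s" for s using b that by (cases "s \<le> p") auto
  ultimately show ?thesis using b(1,3) by blast
qed

lemma abs_triangle_chain:
  fixes a b c d e p q :: real
  assumes "\<bar>a - b\<bar> \<le> p" "p \<le> e / 8" "\<bar>c - b\<bar> \<le> q" "q \<le> e / 8" "\<bar>c - d\<bar> \<le> e / 8"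
  shows "\<bar>a - d\<bar> \<le> e / 2"
  using assms by linarith

text \<open>The invariants are continuous off \<open>F\<close> and vary in a Lipschitz way along the horizontal and vertical lines through points of
\<open>F\<close>. A point off \<open>F\<close> lies between such lines, or the origin is the only point to consider and \<open>wave_corner\<close> applies; in the first case \<open>wave_rect_bound\<close> transfers the bound from its
boundary to its interior.\<close>

lemma wave_quadrant_limit:
  assumes W: "wave_pair g c0 L B rp rm cc" and F: "closed F" "(0,0) \<in> F"
    and C: "\<And>z. z \<notin> F \<Longrightarrow> jcont rp z \<and> jcont rm z"
    and l0: "l0 > 0" and N: "N \<ge> 0"
    and lipt: "\<And>t x s. (t,x) \<in> F \<Longrightarrow> 0 \<le> t \<Longrightarrow> t \<le> l0 \<Longrightarrow> 0 \<le> x \<Longrightarrow> x \<le> l0 \<Longrightarrow> \<bar>s - t\<bar> \<le> l0 \<Longrightarrow>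
       \<bar>rp s x - rp t x\<bar> \<le> N * \<bar>s - t\<bar> \<and> \<bar>rm s x - rm t x\<bar> \<le> N * \<bar>s - t\<bar>"
    and lipx: "\<And>t x s. (t,x) \<in> F \<Longrightarrow> 0 \<le> t \<Longrightarrow> t \<le> l0 \<Longrightarrow> 0 \<le> x \<Longrightarrow> x \<le> l0 \<Longrightarrow> \<bar>s - x\<bar> \<le> l0 \<Longrightarrow>
       \<bar>rp t s - rp t x\<bar> \<le> N * \<bar>s - x\<bar> \<and> \<bar>rm t s - rm t x\<bar> \<le> N * \<bar>s - x\<bar>"
    and \<eta>: "\<eta> > 0"
  shows "\<exists>d>0. \<forall>t x. 0 \<le> t \<longrightarrow> t \<le> d \<longrightarrow> 0 \<le> x \<longrightarrow> x \<le> d \<longrightarrow>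
     \<bar>rp t x - rp 0 0\<bar> \<le> \<eta> \<and> \<bar>rm t x - rm 0 0\<bar> \<le> \<eta>"
proof -
  have B: "B \<ge> 0" using wave_pairD(11)[OF W] .
  define l where "l = min l0 (min (\<eta> / (8 * (N + 1))) (\<eta> / (4 * (B + 1))))"
  have l: "l > 0" "l \<le> l0" using \<eta> B N l0 by (auto simp: l_def)
  have lN: "N * l \<le> \<eta> / 8"
  proof -
    have "(N + 1) * l \<le> (N + 1) * (\<eta> / (8 * (N + 1)))" using N by (intro mult_left_mono) (auto simp: l_def)
    also have "\<dots> = \<eta> / 8" using N by (simp add: field_simps)
    finally show ?thesis using l by (simp add: algebra_simps)
  qed
  have lB: "(B + 1) * l \<le> \<eta> / 4"
  proof -
    have "(B + 1) * l \<le> (B + 1) * (\<eta> / (4 * (B + 1)))" using B by (intro mult_left_mono) (auto simp: l_def)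
    also have "\<dots> = \<eta> / 4" using B by (simp add: field_simps)
    finally show ?thesis .
  qed
  have small: "N * \<bar>s\<bar> \<le> \<eta> / 8" if "\<bar>s\<bar> \<le> l" for s
    using mult_left_mono[OF that N] lN by linarith
  define FS where "FS = F \<inter> ({0..l} \<times> {0..l})"
  define P where "P = fst ` FS"
  define P' where "P' = snd ` FS"
  have "compact FS" unfolding FS_def by (intro closed_Int_compact F compact_Times compact_Icc)
  then have cP: "compact P" "compact P'" unfolding P_def P'_def
    by (auto intro!: compact_continuous_image continuous_intros)
  have zero: "0 \<in> P" "0 \<in> P'" using F l by (force simp: P_def P'_def FS_def)+
  have Psub: "0 \<le> s \<and> s \<le> l" if "s \<in> P \<or> s \<in> P'" for s using that by (auto simp: P_def P'_def FS_def)
  define good where "good \<epsilon> t x \<longleftrightarrow> \<bar>rp t x - rp 0 0\<bar> \<le> \<epsilon> \<and> \<bar>rm t x - rm 0 0\<bar> \<le> \<epsilon>" for \<epsilon> t x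
  have base_t: "good (\<eta>/8) t 0" if "0 \<le> t" "t \<le> l" for t
    using lipt[OF F(2), of t] small[of t] that l unfolding good_def by force
  have base_x: "good (\<eta>/8) 0 x" if "0 \<le> x" "x \<le> l" for x
    using lipx[OF F(2), of x] small[of x] that l unfolding good_def by force
  have on_P: "good (\<eta>/2) t x" if t: "t \<in> P" and x: "0 \<le> x" "x \<le> l" for t x
  proof -
    obtain x' where x': "(t,x') \<in> F" "0 \<le> t" "t \<le> l" "0 \<le> x'" "x' \<le> l" using t by (auto simp: P_def FS_def)
    have d: "\<bar>x - x'\<bar> \<le> l" "\<bar>0 - x'\<bar> \<le> l" using x x' by auto
    then have d': "\<bar>x - x'\<bar> \<le> l0" "\<bar>0 - x'\<bar> \<le> l0" "t \<le> l0" "x' \<le> l0" using l x' by linarith+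
    note l1 = lipx[OF x'(1,2) d'(3) x'(4) d'(4,1)] and l2 = lipx[OF x'(1,2) d'(3) x'(4) d'(4,2)]
    note ch = abs_triangle_chain[OF _ small[OF d(1)] _ small[OF d(2)]]
    show ?thesis unfolding good_def
      using ch[OF l1[THEN conjunct1] l2[THEN conjunct1]] ch[OF l1[THEN conjunct2] l2[THEN conjunct2]]
        base_t[OF x'(2,3)] unfolding good_def by blast
  qed
  have on_P': "good (\<eta>/2) t x" if x: "x \<in> P'" and t: "0 \<le> t" "t \<le> l" for t x
  proof -
    obtain t' where t': "(t',x) \<in> F" "0 \<le> t'" "t' \<le> l" "0 \<le> x" "x \<le> l" using x by (auto simp: P'_def FS_def)
    have d: "\<bar>t - t'\<bar> \<le> l" "\<bar>0 - t'\<bar> \<le> l" using t t' by auto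
    then have d': "\<bar>t - t'\<bar> \<le> l0" "\<bar>0 - t'\<bar> \<le> l0" "t' \<le> l0" "x \<le> l0" using l t' by linarith+
    note l1 = lipt[OF t'(1,2) d'(3) t'(4) d'(4,1)] and l2 = lipt[OF t'(1,2) d'(3) t'(4) d'(4,2)]
    note ch = abs_triangle_chain[OF _ small[OF d(1)] _ small[OF d(2)]]
    show ?thesis unfolding good_def
      using ch[OF l1[THEN conjunct1] l2[THEN conjunct1]] ch[OF l1[THEN conjunct2] l2[THEN conjunct2]]
        base_x[OF t'(4,5)] unfolding good_def by blast
  qed
  have core: "good \<eta> t x"
    if \<alpha>: "\<alpha> \<in> P" "\<alpha> < \<beta>" "\<beta> \<le> l" "\<And>s. s \<in> P \<Longrightarrow> s \<le> \<alpha> \<or> \<beta> \<le> s"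
      and \<gamma>: "\<gamma> \<in> P'" "\<gamma> < \<delta>" "\<delta> \<le> l" "\<And>s. s \<in> P' \<Longrightarrow> s \<le> \<gamma> \<or> \<delta> \<le> s"
      and right: "\<And>s. \<alpha> \<le> s \<Longrightarrow> s \<le> \<beta> \<Longrightarrow> good (\<eta>/2) s \<delta>"
      and tx: "\<alpha> \<le> t" "t \<le> \<beta>" "\<gamma> \<le> x" "x \<le> \<delta>" for \<alpha> \<beta> \<gamma> \<delta> t x
  proof -
    have a0: "0 \<le> \<alpha>" "0 \<le> \<gamma>" using \<alpha> \<gamma> Psub by auto
    have C': "jcont rp (s, y) \<and> jcont rm (s, y)"
      if sy: "\<alpha> \<le> s" "s \<le> \<beta>" "\<gamma> \<le> y" "y \<le> \<delta>" "\<not> ((s = \<alpha> \<or> s = \<beta>) \<and> (y = \<gamma> \<or> y = \<delta>))" for s y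
    proof (rule C, rule)
      assume "(s,y) \<in> F"
      then have "(s,y) \<in> FS" using sy a0 \<alpha> \<gamma> by (auto simp: FS_def)
      then have "s \<in> P" "y \<in> P'" unfolding P_def P'_def by force+
      then show False using \<alpha>(4)[of s] \<gamma>(4)[of y] sy by auto
    qed
    have "\<bar>rp t x - rp 0 0\<bar> \<le> \<eta>/2 + (B + 1) * (t - \<alpha>) \<and> \<bar>rm t x - rm 0 0\<bar> \<le> \<eta>/2 + (B + 1) * (t - \<alpha>)"
    proof (rule wave_rect_bound[OF W \<alpha>(2) \<gamma>(2) C' _ _ tx])
      show "\<bar>rp \<alpha> y - rp 0 0\<bar> \<le> \<eta> / 2 \<and> \<bar>rm \<alpha> y - rm 0 0\<bar> \<le> \<eta> / 2" if "\<gamma> \<le> y" "y \<le> \<delta>" for y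
        using on_P[OF \<alpha>(1), of y] that a0 \<gamma>(3) by (simp add: good_def)
      show "\<bar>rp s \<gamma> - rp 0 0\<bar> \<le> \<eta>/2 \<and> \<bar>rm s \<gamma> - rm 0 0\<bar> \<le> \<eta>/2 \<and> \<bar>rp s \<delta> - rp 0 0\<bar> \<le> \<eta>/2 \<and> \<bar>rm s \<delta> - rm 0 0\<bar> \<le> \<eta>/2"
        if "\<alpha> \<le> s" "s \<le> \<beta>" for s
        using on_P'[OF \<gamma>(1), of s] right[OF that] that a0 \<alpha>(3) by (simp add: good_def)
    qed auto
    moreover have "(B + 1) * (t - \<alpha>) \<le> (B + 1) * l" using B tx a0 \<alpha>(3) by (intro mult_left_mono) auto
    ultimately show ?thesis using lB unfolding good_def by linarith
  qed
  define gap where "gap X b t \<longleftrightarrow> (\<exists>\<alpha> \<beta>. \<alpha> \<in> X \<and> \<alpha> < \<beta> \<and> \<beta> \<le> b \<and> \<beta> \<le> l \<and> (\<forall>s\<in>X. s \<le> \<alpha> \<or> \<beta> \<le> s) \<and> \<alpha> \<le> t \<and> t \<le> \<beta>)" for X b t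
  define gap' where "gap' X b t \<longleftrightarrow> (\<exists>\<alpha> \<beta>. \<alpha> \<in> X \<and> \<alpha> < \<beta> \<and> \<beta> \<le> b \<and> \<beta> \<le> l \<and> \<beta> \<in> X \<and> (\<forall>s\<in>X. s \<le> \<alpha> \<or> \<beta> \<le> s) \<and> \<alpha> \<le> t \<and> t \<le> \<beta>)" for X b t
  have gaps: "\<exists>dT>0. dT \<le> l \<and> (\<forall>t. 0 \<le> t \<longrightarrow> t \<le> dT \<longrightarrow> t \<notin> X \<longrightarrow>
gap' X b t)"
    if X: "compact X" "0 \<in> X" "\<And>s. s \<in> X \<Longrightarrow> 0 \<le> s \<and> s \<le> l" and acc: "\<And>h. h > 0 \<Longrightarrow> X \<inter> {0<..<h} \<noteq> {}" and b: "b > 0" for X b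
  proof -
    obtain p where p: "p \<in> X" "0 < p" "p < min b l" 
    proof -
      have "0 < min b l" using b l by simp
      from acc[OF this] obtain p where "p \<in> X \<inter> {0<..<min b l}" by blast
      then show ?thesis using that[of p] by simp
    qed
    show ?thesis
    proof (rule exI[of _ p], intro conjI allI impI)
      fix t assume t: "0 \<le> t" "t \<le> p" "t \<notin> X"
      have "t \<noteq> 0" "t \<noteq> p" using t(3) X(2) p(1) by auto
      then have t': "0 < t" "t < p" using t(1,2) by linarith+
      obtain \<alpha> where a: "\<alpha> \<in> X" "0 \<le> \<alpha>" "\<alpha> < t" "\<forall>s\<in>X. s \<le> t \<longrightarrow> s \<le> \<alpha>"
        using gap_left[OF X(1,2) t'(1) t(3)] by blast
      obtain \<beta> where \<beta>: "\<beta> \<in> X" "t < \<beta>" "\<beta> \<le> p" "\<forall>s\<in>X. t \<le> s \<longrightarrow> \<beta> \<le> s"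
        using gap_right[OF X(1) p(1) t'(2) t(3)] by blast
      have "s \<le> \<alpha> \<or> \<beta> \<le> s" if "s \<in> X" for s
        using a(4) \<beta>(4) that by (cases "s \<le> t") auto
      moreover have "\<alpha> < \<beta>" "\<beta> \<le> b" "\<beta> \<le> l" "\<alpha> \<le> t" "t \<le> \<beta>" using a(3) \<beta>(2,3) p(3) by linarith+
      ultimately show "gap' X b t"
        unfolding gap'_def using a(1) \<beta>(1) by blast
    next
      show "0 < p" "p \<le> l" using p by linarith+
    qed
  qed
  have isolated: "\<exists>dT>0. dT \<le> l \<and> (\<forall>s\<in>X. s \<le> 0 \<or> dT \<le> s)"
    if "h > 0" "X \<inter> {0<..<h} = {}" for X :: "real set" and h
  proof (intro exI[of _ "min h l"] conjI ballI)
    show "0 < min h l" "min h l \<le> l" using that(1) l by simp_all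
    fix s assume "s \<in> X"
    then have "\<not> (0 < s \<and> s < h)" using that(2) by auto
    then show "s \<le> 0 \<or> min h l \<le> s" by linarith
  qed
  define isoT where "isoT \<longleftrightarrow> (\<exists>h>0. P \<inter> {0<..<h} = {})"
  define isoX where "isoX \<longleftrightarrow> (\<exists>h>0. P' \<inter> {0<..<h} = {})"
  have goal: ?thesis if "d1 > 0" "d2 > 0" "d1 \<le> l" "d2 \<le> l" "\<And>t x. 0 \<le> t \<Longrightarrow> t \<le> d1 \<Longrightarrow> 0 \<le> x \<Longrightarrow> x \<le> d2 \<Longrightarrow> t \<notin> P \<Longrightarrow> x \<notin> P' \<Longrightarrow> good \<eta> t x" for d1 d2
  proof (intro exI[of _ "min d1 d2"] conjI allI impI)
    show "0 < min d1 d2" using that by simp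
    fix t x assume a: "0 \<le> t" "t \<le> min d1 d2" "0 \<le> x" "x \<le> min d1 d2"
    have "good \<eta> t x"
    proof (cases "t \<in> P \<or> x \<in> P'")
      case True
      have "t \<le> l" "x \<le> l" using a that(3,4) by linarith+
      then have "good (\<eta>/2) t x" using True on_P[of t x] on_P'[of x t] a by blast
      then show ?thesis unfolding good_def using \<eta> by linarith
    next
      case False
      have "t \<le> d1" "x \<le> d2" using a by linarith+
      then show ?thesis using False that(5)[of t x] a by blast
    qed
    then show "\<bar>rp t x - rp 0 0\<bar> \<le> \<eta>" "\<bar>rm t x - rm 0 0\<bar> \<le> \<eta>" unfolding good_def by blast+
  qed
  have accI: "\<exists>dT>0. dT \<le> l \<and> (\<forall>t. 0 \<le> t \<longrightarrow> t \<le> dT \<longrightarrow> t \<notin> P \<longrightarrow> gap' P b t)" if "\<not> isoT" "b > 0" for b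
    by (rule gaps[OF cP(1) zero(1)]) (use Psub that in \<open>auto simp: isoT_def\<close>)
  show ?thesis
  proof (cases isoX)
    case False
    have "\<exists>dX>0. dX \<le> l \<and> (\<forall>x. 0 \<le> x \<longrightarrow> x \<le> dX \<longrightarrow> x \<notin> P' \<longrightarrow> gap' P' 1 x)"
      by (rule gaps[OF cP(2) zero(2)]) (use Psub False in \<open>auto simp: isoX_def\<close>)
    then obtain dX where dX: "dX > 0" "dX \<le> l" and gX: "\<And>x. 0 \<le> x \<Longrightarrow> x \<le> dX \<Longrightarrow> x \<notin> P' \<Longrightarrow> gap' P' 1 x" by blast
    have "\<exists>dT>0. dT \<le> l \<and> (\<forall>t. 0 \<le> t \<longrightarrow> t \<le> dT \<longrightarrow> t \<notin> P \<longrightarrow> gap P l t)"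
    proof (cases isoT)
      case True
      then obtain dT where dT: "dT > 0" "dT \<le> l" "\<forall>s\<in>P. s \<le> 0 \<or> dT \<le> s" using isolated unfolding isoT_def by blast
      then have "gap P l t" if "0 \<le> t" "t \<le> dT" for t
        unfolding gap_def using that zero by (intro exI[of _ 0] exI[of _ dT]) simp
      then show ?thesis using dT(1,2) by blast
    next
      case False
      have "gap P l t" if "gap' P l t" for t using that unfolding gap_def gap'_def by blast
      then show ?thesis using accI[OF False l(1)] by blast
    qed
    then obtain dT where dT: "dT > 0" "dT \<le> l" and gT: "\<And>t. 0 \<le> t \<Longrightarrow> t \<le> dT \<Longrightarrow> t \<notin> P \<Longrightarrow> gap P l t" by blast
    show ?thesis
    proof (rule goal[OF dT(1) dX(1) dT(2) dX(2)])
      fix t x assume a: "0 \<le> t" "t \<le> dT" "0 \<le> x" "x \<le> dX" "t \<notin> P" "x \<notin> P'"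
      obtain \<alpha> \<beta> where A: "\<alpha> \<in> P" "\<alpha> < \<beta>" "\<beta> \<le> l" "\<forall>s\<in>P. s \<le> \<alpha> \<or> \<beta> \<le> s" "\<alpha> \<le> t" "t \<le> \<beta>"
        using gT[OF a(1,2,5)] unfolding gap_def by blast
      obtain \<gamma> \<delta> where G: "\<gamma> \<in> P'" "\<gamma> < \<delta>" "\<delta> \<le> l" "\<delta> \<in> P'" "\<forall>s\<in>P'. s \<le> \<gamma> \<or> \<delta> \<le> s" "\<gamma> \<le> x" "x \<le> \<delta>"
        using gX[OF a(3,4,6)] unfolding gap'_def by blast
      show "good \<eta> t x"
      proof (rule core[OF A(1,2,3) _ G(1,2,3) _ _ A(5,6) G(6,7)])
        show "s \<le> \<alpha> \<or> \<beta> \<le> s" if "s \<in> P" for s using A(4) that by blast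
        show "s \<le> \<gamma> \<or> \<delta> \<le> s" if "s \<in> P'" for s using G(5) that by blast
        have "0 \<le> \<alpha>" using Psub A(1) by blast
        then show "good (\<eta>/2) s \<delta>" if "\<alpha> \<le> s" "s \<le> \<beta>" for s
          using on_P'[OF G(4), of s] that A(3) by linarith
      qed
    qed
  next
    case True
    then obtain dX where dX: "dX > 0" "dX \<le> l" "\<forall>s\<in>P'. s \<le> 0 \<or> dX \<le> s" using isolated unfolding isoX_def by blast
    show ?thesis
    proof (cases isoT)
      case False
      have eta4: "\<eta> / 4 > 0" using \<eta> by simp
      obtain b1 where b1: "b1 > 0" "\<forall>s. \<bar>s - 0\<bar> \<le> b1 \<longrightarrow> \<bar>rp s dX - rp 0 dX\<bar> \<le> \<eta>/4"
        using near_of_isCont[OF wave_pair_cont_slices(1)[OF W, of 0 dX] eta4] by blast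
      obtain b2 where b2: "b2 > 0" "\<forall>s. \<bar>s - 0\<bar> \<le> b2 \<longrightarrow> \<bar>rm s dX - rm 0 dX\<bar> \<le> \<eta>/4"
        using near_of_isCont[OF wave_pair_cont_slices(3)[OF W, of 0 dX] eta4] by blast
      define b where "b = min b1 b2"
      have b: "b > 0" using b1 b2 by (simp add: b_def)
      have bx: "good (\<eta>/8) 0 dX" using base_x[of dX] dX(1,2) by linarith
      have nearX: "good (\<eta>/2) s dX" if "0 \<le> s" "s \<le> b" for s
      proof -
        have "\<bar>s - 0\<bar> \<le> b1" "\<bar>s - 0\<bar> \<le> b2" using that unfolding b_def by linarith+
        then have d: "\<bar>rp s dX - rp 0 dX\<bar> \<le> \<eta>/4" "\<bar>rm s dX - rm 0 dX\<bar> \<le> \<eta>/4" using b1(2) b2(2) by blast+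
        have x: "\<bar>rp 0 dX - rp 0 0\<bar> \<le> \<eta>/8" "\<bar>rm 0 dX - rm 0 0\<bar> \<le> \<eta>/8" using bx unfolding good_def by blast+
        have "\<bar>rp s dX - rp 0 0\<bar> \<le> \<eta>/2" using d(1) x(1) by linarith
        moreover have "\<bar>rm s dX - rm 0 0\<bar> \<le> \<eta>/2" using d(2) x(2) by linarith
        ultimately show ?thesis unfolding good_def by blast
      qed
      obtain dT where dT: "dT > 0" "dT \<le> l" and gT: "\<And>t. 0 \<le> t \<Longrightarrow> t \<le> dT \<Longrightarrow> t \<notin> P \<Longrightarrow> gap' P b t"
        using accI[OF False b] by blast
      show ?thesis
      proof (rule goal[OF dT(1) dX(1) dT(2) dX(2)])
        fix t x assume a: "0 \<le> t" "t \<le> dT" "0 \<le> x" "x \<le> dX" "t \<notin> P" "x \<notin> P'"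
        obtain \<alpha> \<beta> where A: "\<alpha> \<in> P" "\<alpha> < \<beta>" "\<beta> \<le> b" "\<beta> \<le> l" "\<forall>s\<in>P. s \<le> \<alpha> \<or> \<beta> \<le> s" "\<alpha> \<le> t" "t \<le> \<beta>"
          using gT[OF a(1,2,5)] unfolding gap'_def by blast
        show "good \<eta> t x"
        proof (rule core[OF A(1,2,4) _ zero(2) dX(1,2) _ _ A(6,7) a(3,4)])
          show "s \<le> \<alpha> \<or> \<beta> \<le> s" if "s \<in> P" for s using A(5) that by blast
          show "s \<le> 0 \<or> dX \<le> s" if "s \<in> P'" for s using dX(3) that by blast
          have "0 \<le> \<alpha>" using Psub A(1) by blast
          then show "good (\<eta>/2) s dX" if "\<alpha> \<le> s" "s \<le> \<beta>" for s
            using nearX[of s] that A(3) by linarith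
        qed
      qed
    next
      case True
      then obtain dT where dT: "dT > 0" "dT \<le> l" "\<forall>s\<in>P. s \<le> 0 \<or> dT \<le> s" using isolated unfolding isoT_def by blast
      define h where "h = min dT dX / 2"
      have h: "h > 0" "h < dT" "h < dX" using dT(1) dX(1) unfolding h_def by linarith+
      have C': "jcont rp (0 + 1 * t, 0 + 1 * x) \<and> jcont rm (0 + 1 * t, 0 + 1 * x)"
        if tx: "0 \<le> t" "t \<le> h" "0 \<le> x" "x \<le> h" "(t,x) \<noteq> (0,0)" for t x
      proof (rule C, rule)
        assume "(0 + 1 * t, 0 + 1 * x) \<in> F"
        then have "(t,x) \<in> F" by simp
        moreover have "t \<le> l" "x \<le> l" using tx h dT(2) dX(2) by linarith+
        ultimately have "(t,x) \<in> FS" using tx(1,3) unfolding FS_def by auto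
        then have "t \<in> P" "x \<in> P'" unfolding P_def P'_def by force+
        then have "t \<le> 0 \<or> dT \<le> t" "x \<le> 0 \<or> dX \<le> x" using dT(3) dX(3) by blast+
        then have "t = 0" "x = 0" using tx h by linarith+
        then show False using tx(5) by simp
      qed
      have one: "(1::real) = 1 \<or> (1::real) = -1" by simp
      show ?thesis using wave_corner[OF W one one h(1) \<eta> C'] by simp
    qed
  qed
qed

lemma pointwise_lipschitz_of_derivative:
  fixes f :: "real \<Rightarrow> real"
  assumes "(f has_real_derivative D) (at a)"
  shows "\<exists>N::nat. \<forall>s. \<bar>s - a\<bar> * (real N + 1) < 1 \<longrightarrow> \<bar>f s - f a\<bar> \<le> (real N + 1) * \<bar>s - a\<bar>"
proof -
  have "((\<lambda>s. (f s - f a) / (s - a)) \<longlongrightarrow> D) (at a)"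
    using assms by (simp add: has_field_derivative_iff)
  then have "\<forall>\<^sub>F s in at a. dist ((f s - f a) / (s - a)) D < 1" by (rule tendstoD) simp
  then obtain d where d: "d > 0" "\<And>s. s \<noteq> a \<Longrightarrow> dist s a < d \<Longrightarrow> dist ((f s - f a) / (s - a)) D < 1"
    unfolding eventually_at by auto
  obtain N :: nat where N: "real N > max (1 / d) (\<bar>D\<bar> + 1)" using reals_Archimedean2 by blast
  show ?thesis
  proof (intro exI[of _ N] allI impI)
    fix s assume s: "\<bar>s - a\<bar> * (real N + 1) < 1"
    show "\<bar>f s - f a\<bar> \<le> (real N + 1) * \<bar>s - a\<bar>"
    proof (cases "s = a")
      case False
      have "\<bar>s - a\<bar> < 1 / (real N + 1)" using s by (simp add: field_simps)
      also have "\<dots> < d" using N d(1) by (simp add: field_simps)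
      finally have "dist ((f s - f a) / (s - a)) D < 1" using d(2)[of s] False by (simp add: dist_real_def)
      moreover have "\<bar>D\<bar> + 1 < real N" using N by simp
      ultimately have "\<bar>(f s - f a) / (s - a)\<bar> \<le> real N + 1" unfolding dist_real_def by linarith
      then show ?thesis using False by (simp add: abs_divide divide_le_eq)
    qed simp
  qed
qed

text \<open>A Lipschitz bound along the two coordinate lines through one point, on an interval whose length is tied to the constant; one
parameter therefore quantifies the strength of the condition, as a Baire argument requires.\<close>

definition cross_lip :: "(real \<Rightarrow> real \<Rightarrow> real) \<Rightarrow> real \<Rightarrow> real \<Rightarrow> real \<Rightarrow> bool" where
  "cross_lip f M t x \<longleftrightarrow> (\<forall>s. \<bar>s - t\<bar> * M < 1 \<longrightarrow> \<bar>f s x - f t x\<bar> \<le> M * \<bar>s - t\<bar>) \<and>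
     (\<forall>s. \<bar>s - x\<bar> * M < 1 \<longrightarrow> \<bar>f t s - f t x\<bar> \<le> M * \<bar>s - x\<bar>)"

lemma cross_lip_mono:
  assumes "cross_lip f M t x" "M \<le> M'" "0 \<le> M"
  shows "cross_lip f M' t x"
proof -
  have 1: "\<bar>a\<bar> * M < 1" if "\<bar>a\<bar> * M' < 1" for a :: real
    using mult_left_mono[OF assms(2), of "\<bar>a\<bar>"] that by linarith
  have 2: "b \<le> M' * \<bar>a\<bar>" if "b \<le> M * \<bar>a\<bar>" for a b :: real
    using mult_right_mono[OF assms(2), of "\<bar>a\<bar>"] that by linarith
  show ?thesis unfolding cross_lip_def
  proof (intro conjI allI impI)
    fix s :: real
    show "\<bar>f s x - f t x\<bar> \<le> M' * \<bar>s - t\<bar>" if "\<bar>s - t\<bar> * M' < 1"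
      using assms(1) 1[OF that] unfolding cross_lip_def by (intro 2) blast
    show "\<bar>f t s - f t x\<bar> \<le> M' * \<bar>s - x\<bar>" if "\<bar>s - x\<bar> * M' < 1"
      using assms(1) 1[OF that] unfolding cross_lip_def by (intro 2) blast
  qed
qed

lemma cross_lip_limit:
  assumes sep: "\<And>t x. isCont (\<lambda>s. f s x) t" "\<And>t x. isCont (f t) x"
    and L: "\<And>j. cross_lip f M (tj j) (xj j)" and lim: "tj \<longlonglongrightarrow> t" "xj \<longlonglongrightarrow> x" and M: "M > 0"
  shows "cross_lip f M t x"
proof -
  have small: "\<forall>\<^sub>F j in sequentially. \<bar>s - sj j\<bar> * M < 1" if "sj \<longlonglongrightarrow> s'" "\<bar>s - s'\<bar> * M < 1" for sj s s'
  proof -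
    have "(\<lambda>j. \<bar>s - sj j\<bar> * M) \<longlonglongrightarrow> \<bar>s - s'\<bar> * M" by (intro tendsto_intros that)
    then show ?thesis using that(2) by (rule order_tendstoD)
  qed
  have Lt: "\<bar>s - tj j\<bar> * M < 1 \<Longrightarrow> \<bar>f s (xj j) - f (tj j) (xj j)\<bar> \<le> M * \<bar>s - tj j\<bar>"
    and Lx: "\<bar>s - xj j\<bar> * M < 1 \<Longrightarrow> \<bar>f (tj j) s - f (tj j) (xj j)\<bar> \<le> M * \<bar>s - xj j\<bar>" for s j
    using L[of j] unfolding cross_lip_def by blast+
  have zero: "(\<lambda>j. M * \<bar>s - sj j\<bar>) \<longlonglongrightarrow> M * \<bar>s - s'\<bar>" if "sj \<longlonglongrightarrow> s'" for sj s s'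
    by (intro tendsto_intros that)
  have ft: "(\<lambda>j. f (tj j) y) \<longlonglongrightarrow> f t y" for y
    using isCont_tendsto_compose[OF sep(1)] lim by blast
  have fx: "(\<lambda>j. f s (xj j)) \<longlonglongrightarrow> f s x" for s
    using isCont_tendsto_compose[OF sep(2)] lim by blast
  have main: "(\<lambda>j. f (tj j) (xj j)) \<longlonglongrightarrow> f t x"
  proof -
    have "\<forall>\<^sub>F j in sequentially. \<bar>f (tj j) x - f (tj j) (xj j)\<bar> \<le> M * \<bar>x - xj j\<bar>"
    proof -
      have "\<forall>\<^sub>F j in sequentially. \<bar>x - xj j\<bar> * M < 1" by (rule small[OF lim(2)]) simp
      then show ?thesis by (rule eventually_mono) (rule Lx)
    qed
    then have ev: "\<forall>\<^sub>F j in sequentially. norm (f (tj j) x - f (tj j) (xj j)) \<le> M * \<bar>x - xj j\<bar>" by simp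
    have "(\<lambda>j. M * \<bar>x - xj j\<bar>) \<longlonglongrightarrow> 0" using zero[OF lim(2), of x] by simp
    with ev have "(\<lambda>j. f (tj j) x - f (tj j) (xj j)) \<longlonglongrightarrow> 0" by (rule Lim_null_comparison)
    from tendsto_diff[OF ft[of x] this] show ?thesis by simp
  qed
  have A: "\<bar>f s x - f t x\<bar> \<le> M * \<bar>s - t\<bar>" if "\<bar>s - t\<bar> * M < 1" for s
  proof (rule tendsto_le[OF sequentially_bot])
    show "(\<lambda>j. M * \<bar>s - tj j\<bar>) \<longlonglongrightarrow> M * \<bar>s - t\<bar>" by (rule zero[OF lim(1)])
    show "(\<lambda>j. \<bar>f s (xj j) - f (tj j) (xj j)\<bar>) \<longlonglongrightarrow> \<bar>f s x - f t x\<bar>"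
      by (intro tendsto_intros fx main)
    show "\<forall>\<^sub>F j in sequentially. \<bar>f s (xj j) - f (tj j) (xj j)\<bar> \<le> M * \<bar>s - tj j\<bar>"
      using small[OF lim(1) that] by (rule eventually_mono) (rule Lt)
  qed
  have B: "\<bar>f t s - f t x\<bar> \<le> M * \<bar>s - x\<bar>" if "\<bar>s - x\<bar> * M < 1" for s
  proof (rule tendsto_le[OF sequentially_bot])
    show "(\<lambda>j. M * \<bar>s - xj j\<bar>) \<longlonglongrightarrow> M * \<bar>s - x\<bar>" by (rule zero[OF lim(2)])
    show "(\<lambda>j. \<bar>f (tj j) s - f (tj j) (xj j)\<bar>) \<longlonglongrightarrow> \<bar>f t s - f t x\<bar>"
      by (intro tendsto_intros ft main)
    show "\<forall>\<^sub>F j in sequentially. \<bar>f (tj j) s - f (tj j) (xj j)\<bar> \<le> M * \<bar>s - xj j\<bar>"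
      using small[OF lim(2) that] by (rule eventually_mono) (rule Lx)
  qed
  show ?thesis using A B by (simp add: cross_lip_def)
qed

lemma jcont_of_quadrants:
  fixes f :: "real \<Rightarrow> real \<Rightarrow> real"
  assumes "\<And>e1 e2 \<eta>. e1 \<in> {1,-1::real} \<Longrightarrow> e2 \<in> {1,-1::real} \<Longrightarrow> \<eta> > 0 \<Longrightarrow>
     \<exists>d>0. \<forall>t x. 0 \<le> t \<longrightarrow> t \<le> d \<longrightarrow> 0 \<le> x \<longrightarrow> x \<le> d \<longrightarrow> \<bar>f (t0 + e1 * t) (x0 + e2 * x) - f t0 x0\<bar> \<le> \<eta>"
  shows "jcont f (t0, x0)"
proof -
  define Q where "Q e1 e2 = {z. 0 \<le> e1 * (fst z - t0) \<and> 0 \<le> e2 * (snd z - x0)}" for e1 e2 :: real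
  have C: "continuous (at (t0,x0) within Q e1 e2) (\<lambda>z. f (fst z) (snd z))" if "e1 \<in> {1,-1}" "e2 \<in> {1,-1}" for e1 e2
  proof (rule quadrant_continuous_within)
    show "e1 = 1 \<or> e1 = - 1" "e2 = 1 \<or> e2 = -1" using that by auto
    show "0 \<le> e1 * (t - t0) \<and> 0 \<le> e2 * (x - x0)" if "(t, x) \<in> Q e1 e2" for t x using that by (simp add: Q_def)
  qed (use assms[OF that] in blast)
  have "Q 1 1 \<union> Q 1 (-1) \<union> (Q (-1) 1 \<union> Q (-1) (-1)) = UNIV" 
  proof (intro equalityI subsetI UNIV_I)
    fix z :: "real \<times> real"
    show "z \<in> Q 1 1 \<union> Q 1 (-1) \<union> (Q (-1) 1 \<union> Q (-1) (-1))"
      by (cases "t0 \<le> fst z"; cases "x0 \<le> snd z") (simp_all add: Q_def)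
  qed
  moreover have "continuous (at (t0,x0) within Q 1 1 \<union> Q 1 (-1) \<union> (Q (-1) 1 \<union> Q (-1) (-1))) (\<lambda>z. f (fst z) (snd z))"
    using C unfolding continuous_within by (intro Lim_Un) simp_all
  ultimately show ?thesis by simp
qed

text \<open>Suppose that the closed set \<open>F\<close> of points near which continuity fails were nonempty. Differentiability gives a bound
\<open>cross_lip\<close> at every point with some constant, and for each constant the set of such points is closed in \<open>F\<close>. By Baire's theorem one
constant works on a relatively open part of \<open>F\<close>, and \<open>wave_quadrant_limit\<close> in the four quadrants shows that the invariants are
continuous there after all.\<close>

proposition wave_pair_continuous:
  assumes W: "wave_pair g c0 L B rp rm cc"
  shows "jcont rp z \<and> jcont rm z"
proof (rule ccontr)
  assume n: "\<not> ?thesis"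
  define G where "G = interior {z. jcont rp z \<and> jcont rm z}"
  define F where "F = - G"
  have Fclosed: "closed F" unfolding F_def G_def by (rule closed_Compl[OF open_interior])
  have offF: "jcont rp z \<and> jcont rm z" if "z \<notin> F" for z
    using that interior_subset unfolding F_def G_def by blast
  have zF: "z \<in> F" using n offF by blast
  define FN where "FN N = {z \<in> F. cross_lip rp (real N + 1) (fst z) (snd z) \<and> cross_lip rm (real N + 1) (fst z) (snd z)}" for N :: nat
  note sl = wave_pair_cont_slices[OF W]
  have FNclosed: "closed (FN N)" for N
    unfolding closed_sequential_limits
  proof (intro allI impI, elim conjE)
    fix w l assume w: "\<forall>j. w j \<in> FN N" "w \<longlonglongrightarrow> l"
    have l: "(\<lambda>j. fst (w j)) \<longlonglongrightarrow> fst l" "(\<lambda>j. snd (w j)) \<longlonglongrightarrow> snd l" using w(2) by (auto intro: tendsto_intros)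
    have "l \<in> F" using Fclosed w unfolding closed_sequential_limits FN_def by blast
    moreover have "cross_lip rp (real N + 1) (fst l) (snd l)"
      by (rule cross_lip_limit[OF sl(1,2) _ l]) (use w in \<open>auto simp: FN_def\<close>)
    moreover have "cross_lip rm (real N + 1) (fst l) (snd l)"
      by (rule cross_lip_limit[OF sl(3,4) _ l]) (use w in \<open>auto simp: FN_def\<close>)
    ultimately show "l \<in> FN N" by (simp add: FN_def)
  qed
  have cover: "\<exists>N. w \<in> FN N" if "w \<in> F" for w
  proof -
    obtain t x where tx: "w = (t,x)" by (cases w)
    have cl: "\<exists>N::nat. cross_lip r (real N + 1) t x" if ex: "\<exists>rt rx. ((\<lambda>s. r s x) has_real_derivative rt) (at t) \<and> (r t has_real_derivative rx) (at x) \<and> P rt rx"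
      for r :: "real \<Rightarrow> real \<Rightarrow> real" and P
    proof -
      obtain rt rx where R: "((\<lambda>s. r s x) has_real_derivative rt) (at t)" "(r t has_real_derivative rx) (at x)" using ex by blast
      obtain N1 N2 where N: "\<forall>s. \<bar>s - t\<bar> * (real N1 + 1) < 1 \<longrightarrow> \<bar>r s x - r t x\<bar> \<le> (real N1 + 1) * \<bar>s - t\<bar>"
        "\<forall>s. \<bar>s - x\<bar> * (real N2 + 1) < 1 \<longrightarrow> \<bar>r t s - r t x\<bar> \<le> (real N2 + 1) * \<bar>s - x\<bar>"
        using pointwise_lipschitz_of_derivative[OF R(1)] pointwise_lipschitz_of_derivative[OF R(2)] by blast
      define N where "N = max N1 N2"
      have 1: "\<bar>a\<bar> * (real N1 + 1) < 1" "\<bar>a\<bar> * (real N2 + 1) < 1" if "\<bar>a\<bar> * (real N + 1) < 1" for a :: real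
        using mult_left_mono[of "real N1 + 1" "real N + 1" "\<bar>a\<bar>"] mult_left_mono[of "real N2 + 1" "real N + 1" "\<bar>a\<bar>"] that
        by (simp_all add: N_def)
      have 2: "(real N1 + 1) * \<bar>a\<bar> \<le> (real N + 1) * \<bar>a\<bar>" "(real N2 + 1) * \<bar>a\<bar> \<le> (real N + 1) * \<bar>a\<bar>" for a :: real
        by (intro mult_right_mono; simp add: N_def)+
      have "cross_lip r (real N + 1) t x" unfolding cross_lip_def
      proof (intro conjI allI impI)
        fix s :: real
        show "\<bar>r s x - r t x\<bar> \<le> (real N + 1) * \<bar>s - t\<bar>" if "\<bar>s - t\<bar> * (real N + 1) < 1"
          by (rule order_trans[OF N(1)[rule_format, OF 1(1)[OF that]] 2(1)])
        show "\<bar>r t s - r t x\<bar> \<le> (real N + 1) * \<bar>s - x\<bar>" if "\<bar>s - x\<bar> * (real N + 1) < 1"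
          by (rule order_trans[OF N(2)[rule_format, OF 1(2)[OF that]] 2(2)])
      qed
      then show ?thesis by blast
    qed
    obtain N1 N2 where N: "cross_lip rp (real N1 + 1) t x" "cross_lip rm (real N2 + 1) t x"
      using cl[OF wave_pairD(1)[OF W]] cl[OF wave_pairD(2)[OF W]] by blast
    have "cross_lip rp (real (max N1 N2) + 1) t x" "cross_lip rm (real (max N1 N2) + 1) t x"
      by (rule cross_lip_mono[OF N(1)] cross_lip_mono[OF N(2)]; simp)+
    then show ?thesis using that tx by (auto simp: FN_def)
  qed
  have "\<exists>N. \<not> F \<subseteq> closure (F - FN N)"
  proof (rule ccontr)
    assume "\<not> ?thesis"
    then have dense: "F \<subseteq> closure (F - FN N)" for N by blast
    have "F \<subseteq> closure (\<Inter>N. F - FN N)"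
    proof (rule Baire[OF Fclosed])
      show "countable (range (\<lambda>N. F - FN N))" by simp
      fix T assume "T \<in> range (\<lambda>N. F - FN N)"
      then obtain N where T: "T = F - FN N" by blast
      have "openin (top_of_set F) (F \<inter> (- FN N))" using FNclosed by (intro openin_open_Int) auto
      then show "openin (top_of_set F) T \<and> F \<subseteq> closure T" using dense T by (simp add: Diff_eq)
    qed
    moreover have "(\<Inter>N. F - FN N) = {}" using cover by blast
    ultimately have "F \<subseteq> closure {}" by (simp only:)
    then show False using zF by simp
  qed
  then obtain N z1 where z1: "z1 \<in> F" "z1 \<notin> closure (F - FN N)" by blast
  then obtain \<rho> where \<rho>: "\<rho> > 0" "\<And>w. dist w z1 < \<rho> \<Longrightarrow> w \<in> F \<Longrightarrow> w \<in> FN N"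
    unfolding closure_approachable by blast
  define M where "M = real N + 1"
  have M: "M \<ge> 1" by (simp add: M_def)
  have contU: "jcont rp w \<and> jcont rm w" if w: "dist w z1 < \<rho>" for w
  proof (cases "w \<in> F")
    case False then show ?thesis by (rule offF)
  next
    case True
    obtain t0 x0 where w0: "w = (t0,x0)" by (cases w)
    define l0 where "l0 = min ((\<rho> - dist w z1) / 4) (1 / (2 * M))"
    have l0: "l0 > 0" "4 * l0 \<le> \<rho> - dist w z1" "l0 * M < 1"
    proof -
      show "l0 > 0" using w M by (simp add: l0_def)
      show "4 * l0 \<le> \<rho> - dist w z1" by (simp add: l0_def min_def)
      have "l0 * M \<le> 1 / (2 * M) * M" using M by (intro mult_right_mono) (auto simp: l0_def)
      then show "l0 * M < 1" using M by simp
    qed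
    have small: "\<bar>s\<bar> * M < 1" if "\<bar>s\<bar> \<le> l0" for s :: real
      using mult_right_mono[OF that, of M] M l0(3) by linarith
    have Q: "\<exists>d>0. \<forall>t x. 0 \<le> t \<longrightarrow> t \<le> d \<longrightarrow> 0 \<le> x \<longrightarrow> x \<le> d \<longrightarrow>
       \<bar>rp (t0 + e1 * t) (x0 + e2 * x) - rp t0 x0\<bar> \<le> \<eta> \<and> \<bar>rm (t0 + e1 * t) (x0 + e2 * x) - rm t0 x0\<bar> \<le> \<eta>"
      if e: "e1 \<in> {1,-1::real}" "e2 \<in> {1,-1::real}" and \<eta>: "\<eta> > 0" for e1 e2 \<eta>
    proof -
      have e': "e1 = 1 \<or> e1 = -1" "e2 = 1 \<or> e2 = -1" using e by auto
      have ea: "\<bar>e1 * a - e1 * b\<bar> = \<bar>a - b\<bar>" "\<bar>e2 * a - e2 * b\<bar> = \<bar>a - b\<bar>" for a b using e' by auto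
      define \<Phi> where "\<Phi> z = (t0 + e1 * fst z, x0 + e2 * snd z)" for z :: "real \<times> real"
      define F' where "F' = \<Phi> -` F"
      have contPhi: "continuous_on UNIV \<Phi>" unfolding \<Phi>_def by (intro continuous_intros)
      have F'c: "closed F'" unfolding F'_def using closed_vimage[OF Fclosed contPhi] .
      have zero: "(0,0) \<in> F'" using True w0 by (simp add: F'_def \<Phi>_def)
      have C': "jcont (\<lambda>t x. rp (t0 + e1 * t) (x0 + e2 * x)) v \<and> jcont (\<lambda>t x. rm (t0 + e1 * t) (x0 + e2 * x)) v" if "v \<notin> F'" for v
      proof -
        have "isCont \<Phi> v" unfolding \<Phi>_def by (intro continuous_intros)
        moreover have "jcont rp (\<Phi> v) \<and> jcont rm (\<Phi> v)" using that offF by (auto simp: F'_def)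
        ultimately show ?thesis
          using isCont_o2[of v \<Phi> "\<lambda>z. rp (fst z) (snd z)"] isCont_o2[of v \<Phi> "\<lambda>z. rm (fst z) (snd z)"]
          by (simp add: \<Phi>_def)
      qed
      have inFN: "cross_lip rp M (t0 + e1 * t) (x0 + e2 * x) \<and> cross_lip rm M (t0 + e1 * t) (x0 + e2 * x)"
        if "(t,x) \<in> F'" "0 \<le> t" "t \<le> l0" "0 \<le> x" "x \<le> l0" for t x
      proof -
        have "dist (\<Phi> (t,x)) w \<le> \<bar>e1 * t\<bar> + \<bar>e2 * x\<bar>"
          unfolding w0 \<Phi>_def dist_Pair_Pair by (simp add: dist_real_def sqrt_sum_squares_le_sum_abs)
        also have "\<dots> \<le> 2 * l0" using e' that by auto
        finally have "dist (\<Phi> (t,x)) z1 < \<rho>" using dist_triangle[of "\<Phi> (t,x)" z1 w] l0 by linarith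
        then have "\<Phi> (t,x) \<in> FN N" using \<rho>(2) that by (simp add: F'_def)
        then show ?thesis by (simp add: FN_def \<Phi>_def M_def)
      qed
      have lt: "\<bar>r (t0 + e1 * s) (x0 + e2 * x) - r (t0 + e1 * t) (x0 + e2 * x)\<bar> \<le> M * \<bar>s - t\<bar>"
        if "cross_lip r M (t0 + e1 * t) (x0 + e2 * x)" "\<bar>s - t\<bar> \<le> l0" for r :: "real \<Rightarrow> real \<Rightarrow> real" and t x s
      proof -
        have "\<bar>(t0 + e1 * s) - (t0 + e1 * t)\<bar> = \<bar>s - t\<bar>" by (simp only: add_diff_cancel_left ea)
        then show ?thesis using that(1) small[OF that(2)] unfolding cross_lip_def by metis
      qed
      have lx: "\<bar>r (t0 + e1 * t) (x0 + e2 * s) - r (t0 + e1 * t) (x0 + e2 * x)\<bar> \<le> M * \<bar>s - x\<bar>"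
        if "cross_lip r M (t0 + e1 * t) (x0 + e2 * x)" "\<bar>s - x\<bar> \<le> l0" for r :: "real \<Rightarrow> real \<Rightarrow> real" and t x s
      proof -
        have "\<bar>(x0 + e2 * s) - (x0 + e2 * x)\<bar> = \<bar>s - x\<bar>" by (simp only: add_diff_cancel_left ea)
        then show ?thesis using that(1) small[OF that(2)] unfolding cross_lip_def by metis
      qed
      have M0: "0 \<le> M" using M by simp
      have lt2: "\<bar>rp (t0 + e1 * s) (x0 + e2 * x) - rp (t0 + e1 * t) (x0 + e2 * x)\<bar> \<le> M * \<bar>s - t\<bar> \<and>
          \<bar>rm (t0 + e1 * s) (x0 + e2 * x) - rm (t0 + e1 * t) (x0 + e2 * x)\<bar> \<le> M * \<bar>s - t\<bar>"
        if "(t,x) \<in> F'" "0 \<le> t" "t \<le> l0" "0 \<le> x" "x \<le> l0" "\<bar>s - t\<bar> \<le> l0" for t x s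
        using inFN[OF that(1-5)] lt[OF _ that(6)] by blast
      have lx2: "\<bar>rp (t0 + e1 * t) (x0 + e2 * s) - rp (t0 + e1 * t) (x0 + e2 * x)\<bar> \<le> M * \<bar>s - x\<bar> \<and>
          \<bar>rm (t0 + e1 * t) (x0 + e2 * s) - rm (t0 + e1 * t) (x0 + e2 * x)\<bar> \<le> M * \<bar>s - x\<bar>"
        if "(t,x) \<in> F'" "0 \<le> t" "t \<le> l0" "0 \<le> x" "x \<le> l0" "\<bar>s - x\<bar> \<le> l0" for t x s
        using inFN[OF that(1-5)] lx[OF _ that(6)] by blast
      define rp' where "rp' t x = rp (t0 + e1 * t) (x0 + e2 * x)" for t x
      define rm' where "rm' t x = rm (t0 + e1 * t) (x0 + e2 * x)" for t x
      define cc' where "cc' t x = cc (t0 + e1 * t) (x0 + e2 * x)" for t x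
      have W': "wave_pair (g * e1 * e2) c0 L B rp' rm' cc'"
        unfolding rp'_def rm'_def cc'_def by (rule wave_pair_affine[OF W e'])
      have "\<exists>d>0. \<forall>t x. 0 \<le> t \<longrightarrow> t \<le> d \<longrightarrow> 0 \<le> x \<longrightarrow> x \<le> d \<longrightarrow>
         \<bar>rp' t x - rp' 0 0\<bar> \<le> \<eta> \<and> \<bar>rm' t x - rm' 0 0\<bar> \<le> \<eta>"
        by (rule wave_quadrant_limit[OF W' F'c zero C'[folded rp'_def rm'_def] l0(1) M0
              lt2[folded rp'_def rm'_def] lx2[folded rp'_def rm'_def] \<eta>])
      then show ?thesis by (simp only: rp'_def rm'_def mult_zero_right add_0_right)
    qed
    have "jcont rp (t0,x0)" by (rule jcont_of_quadrants) (use Q in meson)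
    moreover have "jcont rm (t0,x0)" by (rule jcont_of_quadrants) (use Q in meson)
    ultimately show ?thesis using w0 by simp
  qed
  have "ball z1 \<rho> \<subseteq> {z. jcont rp z \<and> jcont rm z}" using contU by (auto simp: dist_commute)
  then have "z1 \<in> G" unfolding G_def using \<rho>(1) by (meson centre_in_ball interiorI open_ball)
  then show False using z1 by (simp add: F_def)
qed

section \<open>Total differentiability\<close>

lemma jcont_box:
  assumes "jcont f (t0,x0)" "e > 0"
  shows "\<exists>d>0. \<forall>t x. \<bar>t - t0\<bar> \<le> d \<longrightarrow> \<bar>x - x0\<bar> \<le> d \<longrightarrow> \<bar>f t x - f t0 x0\<bar> \<le> e"
proof -
  obtain d where d: "d > 0" "\<And>z. dist z (t0,x0) < d \<Longrightarrow> dist (f (fst z) (snd z)) (f t0 x0) < e"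
    using assms unfolding continuous_at_eps_delta by fastforce
  show ?thesis
  proof (intro exI[of _ "d/3"] conjI allI impI)
    show "d / 3 > 0" using d(1) by simp
    fix t x assume a: "\<bar>t - t0\<bar> \<le> d/3" "\<bar>x - x0\<bar> \<le> d/3"
    have "dist (t,x) (t0,x0) \<le> \<bar>t - t0\<bar> + \<bar>x - x0\<bar>"
      unfolding dist_Pair_Pair by (simp add: dist_real_def sqrt_sum_squares_le_sum_abs)
    then have "dist (t,x) (t0,x0) < d" using a d(1) by linarith
    from d(2)[OF this] show "\<bar>f t x - f t0 x0\<bar> \<le> e" by (simp add: dist_real_def)
  qed
qed

text \<open>The affine Taylor polynomial solves the transport equation with frozen coefficients up to a small error, so the remainder is
controlled by \<open>transport_cone_bound\<close> in a thin cone.\<close>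

lemma transport_forward_estimate:
  fixes r rt rx lam s :: "real \<Rightarrow> real \<Rightarrow> real"
  assumes D: "\<And>t x. ((\<lambda>s. r s x) has_real_derivative rt t x) (at t)" "\<And>t x. (r t has_real_derivative rx t x) (at x)"
    and eq: "\<And>t x. rt t x + lam t x * rx t x = s t x"
    and C: "\<And>z. jcont r z" "jcont lam (0,0)" "jcont s (0,0)" and e: "e > 0"
  shows "\<exists>d>0. \<forall>t x. 0 \<le> t \<longrightarrow> t \<le> d \<longrightarrow> \<bar>x\<bar> \<le> d \<longrightarrow>
     \<bar>r t x - r 0 0 - (rt 0 0 * t + rx 0 0 * x)\<bar> \<le> e * (\<bar>t\<bar> + \<bar>x\<bar>)"
proof -
  define b where "b = rx 0 0"
  define L where "L = \<bar>lam 0 0\<bar> + 1"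
  have L: "L \<ge> 1" by (simp add: L_def)
  define e' where "e' = e / (5 * L)"
  have e': "e' > 0" using e L by (simp add: e'_def)
  obtain d1 where d1: "d1 > 0" "\<forall>t x. \<bar>t - 0\<bar> \<le> d1 \<longrightarrow> \<bar>x - 0\<bar> \<le> d1 \<longrightarrow> \<bar>lam t x - lam 0 0\<bar> \<le> min 1 (e' / (2 * (\<bar>b\<bar> + 1)))"
    using jcont_box[OF C(2), of "min 1 (e' / (2 * (\<bar>b\<bar> + 1)))"] e' by auto
  obtain d2 where d2: "d2 > 0" "\<forall>t x. \<bar>t - 0\<bar> \<le> d2 \<longrightarrow> \<bar>x - 0\<bar> \<le> d2 \<longrightarrow> \<bar>s t x - s 0 0\<bar> \<le> e' / 2"
    using jcont_box[OF C(3), of "e' / 2"] e' by auto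
  have "\<exists>d>0. \<forall>x. norm (x - 0) < d \<longrightarrow> norm (r 0 x - r 0 0 - b * (x - 0)) \<le> e' * norm (x - 0)"
    using D(2)[of 0 0, folded b_def] e' unfolding has_field_derivative_def has_derivative_at_alt by blast
  then obtain d3 where d3: "d3 > 0" "\<And>x. \<bar>x\<bar> < d3 \<Longrightarrow> \<bar>r 0 x - r 0 0 - b * x\<bar> \<le> e' * \<bar>x\<bar>" by auto
  define d0 where "d0 = min d1 (min d2 (d3/2))"
  have d0: "d0 > 0" "d0 \<le> d1" "d0 \<le> d2" "d0 < d3" using d1(1) d2(1) d3(1) unfolding d0_def by linarith+
  define rr where "rr t x = (r t x - r 0 0 - (rt 0 0 * t + b * x)) / e'" for t x
  have DR: "((\<lambda>s. rr s x) has_real_derivative (rt t x - rt 0 0) / e') (at t)"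
    "(rr t has_real_derivative (rx t x - b) / e') (at x)" for t x
  proof -
    have "((\<lambda>s. r s x - r 0 0 - (rt 0 0 * s + b * x)) has_real_derivative rt t x - rt 0 0) (at t)"
      by (auto intro!: derivative_eq_intros D)
    from DERIV_cdivide[OF this] show "((\<lambda>s. rr s x) has_real_derivative (rt t x - rt 0 0) / e') (at t)"
      unfolding rr_def .
    have "((\<lambda>x. r t x - r 0 0 - (rt 0 0 * t + b * x)) has_real_derivative rx t x - b) (at x)"
      by (auto intro!: derivative_eq_intros D)
    from DERIV_cdivide[OF this] show "(rr t has_real_derivative (rx t x - b) / e') (at x)"
      unfolding rr_def .
  qed
  have contR: "jcont rr z" for z unfolding rr_def by (intro continuous_intros C) (use e' in simp)
  have src: "\<bar>(rt t x - rt 0 0) / e' + lam t x * ((rx t x - b) / e')\<bar> \<le> 1" "\<bar>lam t x\<bar> \<le> L" if "\<bar>t\<bar> \<le> d0" "\<bar>x\<bar> \<le> d0" for t x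
  proof -
    have l: "\<bar>lam t x - lam 0 0\<bar> \<le> 1" "\<bar>lam t x - lam 0 0\<bar> \<le> e' / (2 * (\<bar>b\<bar> + 1))"
      using d1(2)[rule_format, of t x] that d0 by simp_all
    then show "\<bar>lam t x\<bar> \<le> L" unfolding L_def by linarith
    have "\<bar>(lam t x - lam 0 0) * b\<bar> \<le> e' / (2 * (\<bar>b\<bar> + 1)) * (\<bar>b\<bar> + 1)"
      unfolding abs_mult by (intro mult_mono l) (use e' in auto)
    also have "\<dots> = e' / 2"
    proof -
      have "\<bar>b\<bar> + 1 \<noteq> 0" by linarith
      then show ?thesis by (simp only: divide_divide_eq_left[symmetric] nonzero_eq_divide_eq times_divide_eq_left) simp
    qed
    finally have 1: "\<bar>(lam t x - lam 0 0) * b\<bar> \<le> e' / 2" .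
    have 2: "\<bar>s t x - s 0 0\<bar> \<le> e' / 2" using d2(2)[rule_format, of t x] that d0 by simp
    have "(rt t x - rt 0 0) + lam t x * (rx t x - b) = (s t x - s 0 0) - (lam t x - lam 0 0) * b"
      using eq[of t x] eq[of 0 0] by (simp add: algebra_simps b_def)
    then have "\<bar>(rt t x - rt 0 0) + lam t x * (rx t x - b)\<bar> \<le> e'" using 1 2 by linarith
    moreover have "(rt t x - rt 0 0) / e' + lam t x * ((rx t x - b) / e') = ((rt t x - rt 0 0) + lam t x * (rx t x - b)) / e'"
      by (simp add: add_divide_distrib)
    ultimately show "\<bar>(rt t x - rt 0 0) / e' + lam t x * ((rx t x - b) / e')\<bar> \<le> 1"
      using e' by (simp add: abs_divide)
  qed
  define d where "d = d0 / (3 * (1 + L))"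
  have d: "d > 0" using d0 L by (simp add: d_def)
  have "3 * (1 + L) \<noteq> 0" using L by simp
  then have "d * (3 * (1 + L)) = d0" unfolding d_def times_divide_eq_left by (rule nonzero_mult_div_cancel_right)
  then have dL: "3 * (d + L * d) = d0" by (simp add: algebra_simps)
  show ?thesis
  proof (intro exI[of _ d] conjI allI impI d)
    fix t x assume tx: "0 \<le> t" "t \<le> d" "\<bar>x\<bar> \<le> d"
    define \<rho> where "\<rho> = \<bar>x\<bar> + L * t"
    have Lt: "t \<le> L * t" using tx L mult_right_mono[of 1 L t] by simp
    show "\<bar>r t x - r 0 0 - (rt 0 0 * t + rx 0 0 * x)\<bar> \<le> e * (\<bar>t\<bar> + \<bar>x\<bar>)"
    proof (cases "\<rho> = 0")
      case True
      then have "t = 0" "x = 0" using tx Lt unfolding \<rho>_def by linarith+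
      then show ?thesis by simp
    next
      case False
      then have \<rho>: "\<rho> > 0" using tx Lt unfolding \<rho>_def by linarith
      have "L * t \<le> L * d" using tx L by (intro mult_left_mono) auto
      then have \<rho>d: "3 * \<rho> \<le> d0" using tx dL unfolding \<rho>_def distrib_left by linarith
      have td: "t \<le> d0" using \<rho>d Lt tx(1) unfolding \<rho>_def distrib_left by linarith
      have x\<rho>: "\<bar>x\<bar> \<le> \<rho>" "L * t \<le> \<rho>" using tx Lt unfolding \<rho>_def by linarith+
      have init: "\<bar>rr 0 y\<bar> \<le> 3 * \<rho>" if "\<bar>y\<bar> \<le> 3 * \<rho>" for y
      proof -
        have "\<bar>y\<bar> < d3" using that \<rho>d d0 by linarith
        then have "\<bar>r 0 y - r 0 0 - b * y\<bar> \<le> e' * \<bar>y\<bar>" by (rule d3(2))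
        then have "\<bar>rr 0 y\<bar> \<le> \<bar>y\<bar>" using e' by (simp add: rr_def abs_divide divide_le_eq mult.commute)
        then show ?thesis using that by linarith
      qed
      have "rr t x \<le> 3 * \<rho> + (1 + 1) * t"
      proof (rule transport_cone_bound[where r=rr and t=t and x=x and B=1 and m="3 * \<rho>" and L=L and lam=lam and \<rho>=\<rho>])
        show "\<exists>rt rx. ((\<lambda>s. rr s y) has_real_derivative rt) (at s) \<and> (rr s has_real_derivative rx) (at y)
          \<and> rt + lam s y * rx \<le> 1 \<and> \<bar>lam s y\<bar> \<le> L" if "0 < s" "s \<le> t" "\<bar>y\<bar> < 3 * \<rho>" for s y
        proof -
          have "\<bar>s\<bar> \<le> d0" "\<bar>y\<bar> \<le> d0" using that td \<rho>d by linarith+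
          from src[OF this] show ?thesis using DR by (meson abs_le_D1)
        qed
        show "rr 0 y \<le> 3 * \<rho>" if "\<bar>y\<bar> \<le> 3 * \<rho>" for y using init[OF that] by linarith
        show "continuous_on ({0..t} \<times> {-3*\<rho>..3*\<rho>}) (\<lambda>z. rr (fst z) (snd z))"
          using contR by (simp add: continuous_at_imp_continuous_on)
      qed (use \<rho> L x\<rho> tx in auto)
      moreover have "- rr t x \<le> 3 * \<rho> + (1 + 1) * t"
      proof (rule transport_cone_bound[where r="\<lambda>t x. - rr t x" and t=t and x=x and B=1 and m="3 * \<rho>" and L=L and lam=lam and \<rho>=\<rho>])
        show "\<exists>rt rx. ((\<lambda>s. - rr s y) has_real_derivative rt) (at s) \<and> ((\<lambda>y. - rr s y) has_real_derivative rx) (at y)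
          \<and> rt + lam s y * rx \<le> 1 \<and> \<bar>lam s y\<bar> \<le> L" if "0 < s" "s \<le> t" "\<bar>y\<bar> < 3 * \<rho>" for s y
        proof -
          have "\<bar>s\<bar> \<le> d0" "\<bar>y\<bar> \<le> d0" using that td \<rho>d by linarith+
          note S = src[OF this]
          have "- ((rt s y - rt 0 0) / e') + lam s y * (- ((rx s y - b) / e')) \<le> 1"
            using S(1) by (simp only: mult_minus_right abs_le_iff) linarith
          then show ?thesis using DERIV_minus[OF DR(1)[of y s]] DERIV_minus[OF DR(2)[of s y]] S(2) by blast
        qed
        show "- rr 0 y \<le> 3 * \<rho>" if "\<bar>y\<bar> \<le> 3 * \<rho>" for y using init[OF that] by linarith
        show "continuous_on ({0..t} \<times> {-3*\<rho>..3*\<rho>}) (\<lambda>z. - rr (fst z) (snd z))"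
          using contR by (intro continuous_on_minus) (simp add: continuous_at_imp_continuous_on)
      qed (use \<rho> L x\<rho> tx in auto)
      ultimately have "\<bar>rr t x\<bar> \<le> 5 * \<rho>" using Lt unfolding \<rho>_def distrib_left one_add_one by linarith
      then have "\<bar>r t x - r 0 0 - (rt 0 0 * t + b * x)\<bar> \<le> 5 * \<rho> * e'"
        using e' by (simp add: rr_def abs_divide divide_le_eq)
      also have "\<dots> \<le> 5 * (L * (\<bar>t\<bar> + \<bar>x\<bar>)) * e'"
      proof -
        have "\<rho> \<le> L * (\<bar>t\<bar> + \<bar>x\<bar>)" using mult_right_mono[OF L, of "\<bar>x\<bar>"] tx(1) by (simp add: \<rho>_def distrib_left)
        then show ?thesis using e' by (intro mult_right_mono mult_left_mono) auto
      qed
      also have "\<dots> = e * (\<bar>t\<bar> + \<bar>x\<bar>)" using L by (simp add: e'_def)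
      finally show ?thesis by (simp add: b_def)
    qed
  qed
qed

text \<open>Partial differentiability alone does not give a total derivative. Here the equation propagates the first-order expansion
from the line \<open>t = t0\<close>, where it is the derivative in space, to both sides in time.\<close>

proposition transport_total_derivative:
  fixes r rt rx lam s :: "real \<Rightarrow> real \<Rightarrow> real"
  assumes D: "\<And>t x. ((\<lambda>s. r s x) has_real_derivative rt t x) (at t)" "\<And>t x. (r t has_real_derivative rx t x) (at x)"
    and eq: "\<And>t x. rt t x + lam t x * rx t x = s t x"
    and C: "\<And>z. jcont r z" "\<And>z. jcont lam z" "\<And>z. jcont s z"
  shows "((\<lambda>z. r (fst z) (snd z)) has_derivative (\<lambda>z. rt t0 x0 * fst z + rx t0 x0 * snd z)) (at (t0,x0))"
proof -
  have dir: "\<exists>d>0. \<forall>t x. 0 \<le> t \<longrightarrow> t \<le> d \<longrightarrow> \<bar>x\<bar> \<le> d \<longrightarrow>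
     \<bar>r (t0 + \<sigma> * t) (x0 + x) - r t0 x0 - (\<sigma> * rt t0 x0 * t + rx t0 x0 * x)\<bar> \<le> e * (\<bar>t\<bar> + \<bar>x\<bar>)"
    if \<sigma>: "\<sigma> = 1 \<or> \<sigma> = -1" and e: "e > 0" for \<sigma> e :: real
  proof -
    have comp: "jcont (\<lambda>t x. f (t0 + \<sigma> * t) (x0 + x)) z" if "\<And>z. jcont f z" for f z
      using isCont_o2[of z "\<lambda>z. (t0 + \<sigma> * fst z, x0 + snd z)" "\<lambda>z. f (fst z) (snd z)"] that
      by (simp add: continuous_intros)
    have c1: "((\<lambda>s. r (t0 + \<sigma> * s) (x0 + x)) has_real_derivative \<sigma> * rt (t0 + \<sigma> * t) (x0 + x)) (at t)" for t x
    proof -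
      have "((\<lambda>s. t0 + \<sigma> * s) has_real_derivative \<sigma>) (at t)" by (auto intro!: derivative_eq_intros)
      from DERIV_chain2[OF D(1) this] show ?thesis by (simp add: mult.commute)
    qed
    have c2: "((\<lambda>x. r (t0 + \<sigma> * t) (x0 + x)) has_real_derivative rx (t0 + \<sigma> * t) (x0 + x)) (at x)" for t x
    proof -
      have "((\<lambda>x. x0 + x) has_real_derivative 1) (at x)" by (auto intro!: derivative_eq_intros)
      from DERIV_chain2[OF D(2) this] show ?thesis by simp
    qed
    have c3: "\<sigma> * rt (t0 + \<sigma> * t) (x0 + x) + \<sigma> * lam (t0 + \<sigma> * t) (x0 + x) * rx (t0 + \<sigma> * t) (x0 + x) = \<sigma> * s (t0 + \<sigma> * t) (x0 + x)" for t x
      unfolding eq[symmetric] by (simp add: algebra_simps)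
    have lamc: "jcont (\<lambda>t x. \<sigma> * lam (t0 + \<sigma> * t) (x0 + x)) (0,0)" and sc: "jcont (\<lambda>t x. \<sigma> * s (t0 + \<sigma> * t) (x0 + x)) (0,0)"
      by (intro continuous_intros comp C)+
    from transport_forward_estimate[OF c1 c2 c3 comp[OF C(1)] lamc sc e] show ?thesis by simp
  qed
  show ?thesis
    unfolding has_derivative_at_alt
  proof (intro conjI allI impI)
    show "bounded_linear (\<lambda>z. rt t0 x0 * fst z + rx t0 x0 * snd z)"
      by (intro bounded_linear_add bounded_linear_const_mult bounded_linear_fst bounded_linear_snd)
    fix e :: real assume "e > 0"
    then have e2: "e / 2 > 0" by simp
    obtain d1 where d1: "d1 > 0" "\<forall>t x. 0 \<le> t \<longrightarrow> t \<le> d1 \<longrightarrow> \<bar>x\<bar> \<le> d1 \<longrightarrow>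
     \<bar>r (t0 + 1 * t) (x0 + x) - r t0 x0 - (1 * rt t0 x0 * t + rx t0 x0 * x)\<bar> \<le> e / 2 * (\<bar>t\<bar> + \<bar>x\<bar>)"
      using dir[of 1, OF _ e2] by blast
    obtain d2 where d2: "d2 > 0" "\<forall>t x. 0 \<le> t \<longrightarrow> t \<le> d2 \<longrightarrow> \<bar>x\<bar> \<le> d2 \<longrightarrow>
     \<bar>r (t0 + -1 * t) (x0 + x) - r t0 x0 - (-1 * rt t0 x0 * t + rx t0 x0 * x)\<bar> \<le> e / 2 * (\<bar>t\<bar> + \<bar>x\<bar>)"
      using dir[of "-1", OF _ e2] by blast
    show "\<exists>d>0. \<forall>y. norm (y - (t0, x0)) < d \<longrightarrow>
       norm (r (fst y) (snd y) - r (fst (t0, x0)) (snd (t0, x0)) - (rt t0 x0 * fst (y - (t0, x0)) + rx t0 x0 * snd (y - (t0, x0))))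
         \<le> e * norm (y - (t0, x0))"
    proof (intro exI[of _ "min d1 d2"] conjI allI impI)
      show "min d1 d2 > 0" using d1 d2 by simp
      fix y :: "real \<times> real" assume y: "norm (y - (t0,x0)) < min d1 d2"
      define t where "t = fst y - t0"
      define x where "x = snd y - x0"
      have n: "\<bar>t\<bar> \<le> norm (y - (t0,x0))" "\<bar>x\<bar> \<le> norm (y - (t0,x0))"
      proof -
        have "y - (t0,x0) = (t, x)" by (simp add: t_def x_def prod_eq_iff)
        then show "\<bar>t\<bar> \<le> norm (y - (t0,x0))" "\<bar>x\<bar> \<le> norm (y - (t0,x0))"
          using norm_fst_le[of t x] norm_snd_le[of x t] by simp_all
      qed
      have b: "\<bar>t\<bar> \<le> d1" "\<bar>t\<bar> \<le> d2" "\<bar>x\<bar> \<le> d1" "\<bar>x\<bar> \<le> d2" using n y by linarith+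
      have "\<bar>r (t0 + t) (x0 + x) - r t0 x0 - (rt t0 x0 * t + rx t0 x0 * x)\<bar> \<le> e / 2 * (\<bar>t\<bar> + \<bar>x\<bar>)"
      proof (cases "t \<ge> 0")
        case True then show ?thesis using d1(2)[rule_format, of t x] b by simp
      next
        case False then show ?thesis using d2(2)[rule_format, of "-t" x] b by simp
      qed
      also have "\<dots> \<le> e / 2 * (2 * norm (y - (t0,x0)))" using n e2 by (intro mult_left_mono) auto
      finally show "norm (r (fst y) (snd y) - r (fst (t0, x0)) (snd (t0, x0)) - (rt t0 x0 * fst (y - (t0, x0)) + rx t0 x0 * snd (y - (t0, x0))))
         \<le> e * norm (y - (t0, x0))" by (simp add: t_def x_def)
    qed
  qed
qed

section \<open>Integrated balance laws\<close>

text \<open>The failure of the integral balance law on a rectangle. It is additive under subdivision, as a contour integral is.\<close>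

definition flux_defect :: "(real \<Rightarrow> real \<Rightarrow> real) \<Rightarrow> (real \<Rightarrow> real \<Rightarrow> real) \<Rightarrow> (real \<Rightarrow> real \<Rightarrow> real) \<Rightarrow>
    real \<Rightarrow> real \<Rightarrow> real \<Rightarrow> real \<Rightarrow> real" where
  "flux_defect f g h a b c d = integral {c..d} (\<lambda>x. f b x - f a x) + integral {a..b} (\<lambda>t. g t d - g t c)
     - integral {a..b} (\<lambda>t. integral {c..d} (h t))"

lemma jcont_slices:
  assumes "\<And>z. jcont f z"
  shows "continuous_on S (f t)" "continuous_on S (\<lambda>t. f t x)"
proof -
  have c: "continuous_on UNIV (\<lambda>z. f (fst z) (snd z))" using assms by (simp add: continuous_at_imp_continuous_on)
  show "continuous_on S (f t)"
    using continuous_on_compose2[OF c, of S "\<lambda>x. (t,x)"] by (simp add: continuous_intros)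
  show "continuous_on S (\<lambda>t. f t x)"
    using continuous_on_compose2[OF c, of S "\<lambda>t. (t,x)"] by (simp add: continuous_intros)
qed

lemma jcont_integral_param:
  assumes "\<And>z. jcont h z"
  shows "continuous_on S (\<lambda>t. integral {c..d} (h t))"
proof -
  have c: "continuous_on (S \<times> cbox c d) (\<lambda>(t, x). h t x)"
    using assms by (auto intro!: continuous_at_imp_continuous_on simp: case_prod_beta)
  from integral_continuous_on_param[OF c] show ?thesis by simp
qed

lemma flux_defect_split:
  assumes f: "\<And>z. jcont f z" and g: "\<And>z. jcont g z" and h: "\<And>z. jcont h z"
    and m: "a \<le> m" "m \<le> b" "c \<le> n" "n \<le> d"
  shows "flux_defect f g h a b c d = flux_defect f g h a m c n + flux_defect f g h a m n d
     + flux_defect f g h m b c n + flux_defect f g h m b n d"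
proof -
  have I: "F integrable_on {l..u}" if "continuous_on UNIV F" for F :: "real \<Rightarrow> real" and l u
    using that by (meson continuous_on_subset integrable_continuous_real subset_UNIV)
  note sl = jcont_slices[OF f, of UNIV] jcont_slices[OF g, of UNIV] jcont_slices[OF h, of UNIV]
  have comb: "integral {l..u} F = integral {l..k} F + integral {k..u} F" if "continuous_on UNIV F" "l \<le> k" "k \<le> u" for F :: "real \<Rightarrow> real" and l k u
    using Henstock_Kurzweil_Integration.integral_combine[OF that(2,3) I[OF that(1)]] by simp
  have fdiff: "continuous_on UNIV (\<lambda>x. f b x - f a x)" for a b by (intro continuous_intros sl)
  have gdiff: "continuous_on UNIV (\<lambda>t. g t d - g t c)" for c d by (intro continuous_intros sl)
  have hi: "continuous_on UNIV (\<lambda>t. integral {c..d} (h t))" for c d by (rule jcont_integral_param[OF h])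
  have x1: "integral {c..d} (\<lambda>x. f b x - f a x) = integral {c..n} (\<lambda>x. f b x - f a x) + integral {n..d} (\<lambda>x. f b x - f a x)" for a b
    by (rule comb[OF fdiff m(3,4)])
  have x2: "integral {l..u} (\<lambda>x. f b x - f a x) = integral {l..u} (\<lambda>x. f b x - f m x) + integral {l..u} (\<lambda>x. f m x - f a x)" for l u
    by (subst integral_add[symmetric]) (auto intro!: I fdiff)
  have y1: "integral {a..b} (\<lambda>t. g t d - g t c) = integral {a..m} (\<lambda>t. g t d - g t c) + integral {m..b} (\<lambda>t. g t d - g t c)" for c d
    by (rule comb[OF gdiff m(1,2)])
  have y2: "integral {l..u} (\<lambda>t. g t d - g t c) = integral {l..u} (\<lambda>t. g t d - g t n) + integral {l..u} (\<lambda>t. g t n - g t c)" for l u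
    by (subst integral_add[symmetric]) (auto intro!: I gdiff)
  have z1: "integral {a..b} (\<lambda>t. integral {c..d} (h t)) = integral {a..m} (\<lambda>t. integral {c..d} (h t)) + integral {m..b} (\<lambda>t. integral {c..d} (h t))" for c d
    by (rule comb[OF hi m(1,2)])
  have z2: "integral {l..u} (\<lambda>t. integral {c..d} (h t)) = integral {l..u} (\<lambda>t. integral {c..n} (h t)) + integral {l..u} (\<lambda>t. integral {n..d} (h t))" for l u
    by (subst integral_add[symmetric]) (auto intro!: I hi simp: comb[OF sl(5) m(3,4)])
  show ?thesis unfolding flux_defect_def
    unfolding x1[of b a] x2[of c n] x2[of n d] y1[of d c] y2[of a m] y2[of m b] z1[of c d] z2[of a m] z2[of m b] by linarith
qed

lemma integral_near_constant:
  fixes F :: "real \<Rightarrow> real"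
  assumes "a \<le> b" "continuous_on {a..b} F" "\<And>t. a \<le> t \<Longrightarrow> t \<le> b \<Longrightarrow> \<bar>F t - K\<bar> \<le> e"
  shows "\<bar>integral {a..b} F - K * (b - a)\<bar> \<le> e * (b - a)"
proof -
  have "integral {a..b} (\<lambda>t. F t - K) = integral {a..b} F - integral {a..b} (\<lambda>t. K)"
    by (rule integral_diff) (auto intro!: integrable_continuous_real assms)
  moreover have "integral {a..b} (\<lambda>t. K) = K * (b - a)" using assms(1) by simp
  moreover have "norm (integral {a..b} (\<lambda>t. F t - K)) \<le> e * (b - a)"
    by (rule integral_bound) (use assms in \<open>auto intro!: continuous_intros\<close>)
  ultimately show ?thesis by (simp only: real_norm_def)
qed

lemma flux_defect_local:
  fixes f g h ft fx gt gx :: "real \<Rightarrow> real \<Rightarrow> real"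
  assumes f: "\<And>z. jcont f z" and g: "\<And>z. jcont g z" and h: "\<And>z. jcont h z"
    and Df: "((\<lambda>z. f (fst z) (snd z)) has_derivative (\<lambda>z. A * fst z + A' * snd z)) (at (t0,x0))"
    and Dg: "((\<lambda>z. g (fst z) (snd z)) has_derivative (\<lambda>z. C' * fst z + C * snd z)) (at (t0,x0))"
    and eq: "A + C = h t0 x0" and e: "e > 0"
  shows "\<exists>\<delta>>0. \<forall>a b c d. a \<le> t0 \<longrightarrow> t0 \<le> b \<longrightarrow> c \<le> x0 \<longrightarrow> x0 \<le> d \<longrightarrow> b - a \<le> \<delta> \<longrightarrow> d - c \<le> \<delta> \<longrightarrow>
      \<bar>flux_defect f g h a b c d\<bar> \<le> e * ((b - a) + (d - c))\<^sup>2"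
proof -
  define e' where "e' = e / 5"
  have e': "e' > 0" using e by (simp add: e'_def)
  have approx: "\<exists>\<delta>>0. \<forall>t x. \<bar>t - t0\<bar> \<le> \<delta> \<longrightarrow> \<bar>x - x0\<bar> \<le> \<delta> \<longrightarrow> \<bar>F t x - F t0 x0 - (P * (t - t0) + Q * (x - x0))\<bar> \<le> e' * (\<bar>t - t0\<bar> + \<bar>x - x0\<bar>)"
    if D: "((\<lambda>z. F (fst z) (snd z)) has_derivative (\<lambda>z. P * fst z + Q * snd z)) (at (t0,x0))" for F :: "real \<Rightarrow> real \<Rightarrow> real" and P Q
  proof -
    obtain d where d: "d > 0" "\<And>y. norm (y - (t0,x0)) < d \<Longrightarrow>
      norm (F (fst y) (snd y) - F t0 x0 - (P * fst (y - (t0,x0)) + Q * snd (y - (t0,x0)))) \<le> e' * norm (y - (t0,x0))"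
      using D e' unfolding has_derivative_at_alt by fastforce
    show ?thesis
    proof (intro exI[of _ "d/3"] conjI allI impI)
      show "d / 3 > 0" using d by simp
      fix t x assume a: "\<bar>t - t0\<bar> \<le> d/3" "\<bar>x - x0\<bar> \<le> d/3"
      have n: "norm ((t,x) - (t0,x0)) \<le> \<bar>t - t0\<bar> + \<bar>x - x0\<bar>"
        by (simp add: norm_Pair sqrt_sum_squares_le_sum_abs)
      then have "norm ((t,x) - (t0,x0)) < d" using a d(1) by linarith
      from d(2)[OF this] have "\<bar>F t x - F t0 x0 - (P * (t - t0) + Q * (x - x0))\<bar> \<le> e' * norm ((t,x) - (t0,x0))" by simp
      also have "\<dots> \<le> e' * (\<bar>t - t0\<bar> + \<bar>x - x0\<bar>)" using n e' by (intro mult_left_mono) auto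
      finally show "\<bar>F t x - F t0 x0 - (P * (t - t0) + Q * (x - x0))\<bar> \<le> e' * (\<bar>t - t0\<bar> + \<bar>x - x0\<bar>)" .
    qed
  qed
  obtain d1 where d1: "d1 > 0" "\<forall>t x. \<bar>t - t0\<bar> \<le> d1 \<longrightarrow> \<bar>x - x0\<bar> \<le> d1 \<longrightarrow> \<bar>f t x - f t0 x0 - (A * (t - t0) + A' * (x - x0))\<bar> \<le> e' * (\<bar>t - t0\<bar> + \<bar>x - x0\<bar>)"
    using approx[OF Df] by blast
  obtain d2 where d2: "d2 > 0" "\<forall>t x. \<bar>t - t0\<bar> \<le> d2 \<longrightarrow> \<bar>x - x0\<bar> \<le> d2 \<longrightarrow> \<bar>g t x - g t0 x0 - (C' * (t - t0) + C * (x - x0))\<bar> \<le> e' * (\<bar>t - t0\<bar> + \<bar>x - x0\<bar>)"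
    using approx[OF Dg] by blast
  obtain d3 where d3: "d3 > 0" "\<forall>t x. \<bar>t - t0\<bar> \<le> d3 \<longrightarrow> \<bar>x - x0\<bar> \<le> d3 \<longrightarrow> \<bar>h t x - h t0 x0\<bar> \<le> e'"
    using jcont_box[OF h e'] by blast
  show ?thesis
  proof (intro exI[of _ "min d1 (min d2 d3)"] conjI allI impI)
    show "min d1 (min d2 d3) > 0" using d1 d2 d3 by simp
    fix a b c d assume r: "a \<le> t0" "t0 \<le> b" "c \<le> x0" "x0 \<le> d" "b - a \<le> min d1 (min d2 d3)" "d - c \<le> min d1 (min d2 d3)"
    define T where "T = b - a"
    define X where "X = d - c"
    have TX: "0 \<le> T" "0 \<le> X" "a \<le> b" "c \<le> d" using r by (auto simp: T_def X_def)
    have fb: "\<bar>f t x - f t0 x0 - (A * (t - t0) + A' * (x - x0))\<bar> \<le> e' * (T + X)" and gb: "\<bar>g t x - g t0 x0 - (C' * (t - t0) + C * (x - x0))\<bar> \<le> e' * (T + X)"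
      and hb: "\<bar>h t x - h t0 x0\<bar> \<le> e'"
      if tx: "a \<le> t" "t \<le> b" "c \<le> x" "x \<le> d" for t x
    proof -
      have n: "\<bar>t - t0\<bar> \<le> T" "\<bar>x - x0\<bar> \<le> X" using tx r unfolding T_def X_def by linarith+
      then have b: "\<bar>t - t0\<bar> \<le> d1" "\<bar>x - x0\<bar> \<le> d1" "\<bar>t - t0\<bar> \<le> d2" "\<bar>x - x0\<bar> \<le> d2" "\<bar>t - t0\<bar> \<le> d3" "\<bar>x - x0\<bar> \<le> d3"
        using r(5,6) unfolding T_def X_def by linarith+
      have m: "e' * (\<bar>t - t0\<bar> + \<bar>x - x0\<bar>) \<le> e' * (T + X)" using n e' by (intro mult_left_mono) auto
      show "\<bar>f t x - f t0 x0 - (A * (t - t0) + A' * (x - x0))\<bar> \<le> e' * (T + X)" using d1(2)[rule_format, OF b(1,2)] m by (rule order_trans)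
      show "\<bar>g t x - g t0 x0 - (C' * (t - t0) + C * (x - x0))\<bar> \<le> e' * (T + X)" using d2(2)[rule_format, OF b(3,4)] m by (rule order_trans)
      show "\<bar>h t x - h t0 x0\<bar> \<le> e'" using d3(2)[rule_format, OF b(5,6)] .
    qed
    have 1: "\<bar>integral {c..d} (\<lambda>x. f b x - f a x) - (A * T) * (d - c)\<bar> \<le> (2 * (e' * (T + X))) * (d - c)"
    proof (rule integral_near_constant[OF TX(4)])
      show "continuous_on {c..d} (\<lambda>x. f b x - f a x)" by (intro continuous_intros jcont_slices f)
      fix x assume x: "c \<le> x" "x \<le> d"
      have "(f b x - f t0 x0 - (A * (b - t0) + A' * (x - x0))) - (f a x - f t0 x0 - (A * (a - t0) + A' * (x - x0))) = f b x - f a x - A * T"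
        by (simp add: T_def algebra_simps)
      then show "\<bar>f b x - f a x - A * T\<bar> \<le> 2 * (e' * (T + X))"
        using fb[of b x] fb[of a x] x TX by linarith
    qed
    have 2: "\<bar>integral {a..b} (\<lambda>t. g t d - g t c) - (C * X) * (b - a)\<bar> \<le> (2 * (e' * (T + X))) * (b - a)"
    proof (rule integral_near_constant[OF TX(3)])
      show "continuous_on {a..b} (\<lambda>t. g t d - g t c)" by (intro continuous_intros jcont_slices g)
      fix t assume t: "a \<le> t" "t \<le> b"
      have "(g t d - g t0 x0 - (C' * (t - t0) + C * (d - x0))) - (g t c - g t0 x0 - (C' * (t - t0) + C * (c - x0))) = g t d - g t c - C * X"
        by (simp add: X_def algebra_simps)
      then show "\<bar>g t d - g t c - C * X\<bar> \<le> 2 * (e' * (T + X))"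
        using gb[of t d] gb[of t c] t TX by linarith
    qed
    have 3: "\<bar>integral {a..b} (\<lambda>t. integral {c..d} (h t)) - (h t0 x0 * X) * (b - a)\<bar> \<le> (e' * X) * (b - a)"
    proof (rule integral_near_constant[OF TX(3)])
      show "continuous_on {a..b} (\<lambda>t. integral {c..d} (h t))" by (rule jcont_integral_param[OF h])
      fix t assume t: "a \<le> t" "t \<le> b"
      have "\<bar>integral {c..d} (h t) - h t0 x0 * (d - c)\<bar> \<le> e' * (d - c)"
        by (rule integral_near_constant[OF TX(4) jcont_slices(1)[OF h] hb[OF t]])
      then show "\<bar>integral {c..d} (h t) - h t0 x0 * X\<bar> \<le> e' * X" by (simp add: X_def)
    qed
    have "h t0 x0 * X * T = A * T * X + C * X * T" unfolding eq[symmetric] by (simp add: algebra_simps)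
    then have "\<bar>flux_defect f g h a b c d\<bar> \<le> 2 * (e' * (T + X)) * X + 2 * (e' * (T + X)) * T + e' * X * T"
      using 1 2 3 unfolding flux_defect_def T_def[symmetric] X_def[symmetric] by linarith
    also have "\<dots> \<le> 5 * e' * (T + X)\<^sup>2"
    proof -
      have "0 \<le> e' * (T * X)" "0 \<le> e' * (T * T)" "0 \<le> e' * (X * X)" using e' TX by auto
      then show ?thesis by (simp add: power2_eq_square algebra_simps)
    qed
    also have "\<dots> = e * ((b - a) + (d - c))\<^sup>2" by (simp add: e'_def T_def X_def)
    finally show "\<bar>flux_defect f g h a b c d\<bar> \<le> e * ((b - a) + (d - c))\<^sup>2" .
  qed
qed

lemma nested_halving_limit:
  fixes a :: "nat \<Rightarrow> real"
  assumes T: "T \<ge> 0" and step: "\<And>k. a (Suc k) = a k \<or> a (Suc k) = a k + T / 2 ^ Suc k"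
  shows "\<exists>l. \<forall>k. a k \<le> l \<and> l \<le> a k + T / 2 ^ k"
proof -
  have up: "a k \<le> a (Suc k)" and dn: "a (Suc k) + T / 2 ^ Suc k \<le> a k + T / 2 ^ k" for k
  proof -
    have p: "0 \<le> T / 2 ^ Suc k" "T / 2 ^ Suc k + T / 2 ^ Suc k = T / 2 ^ k" using T by (simp_all add: field_simps)
    show "a k \<le> a (Suc k)" "a (Suc k) + T / 2 ^ Suc k \<le> a k + T / 2 ^ k" using step[of k] p by linarith+
  qed
  have inc: "incseq a" using up by (rule incseq_SucI)
  have dec: "decseq (\<lambda>k. a k + T / 2 ^ k)" using dn by (rule decseq_SucI)
  have ub: "a j \<le> a k + T / 2 ^ k" for j k
  proof -
    have "a j \<le> a (max j k)" using incseqD[OF inc, of j "max j k"] by simp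
    also have "\<dots> \<le> a (max j k) + T / 2 ^ max j k" using T by simp
    also have "\<dots> \<le> a k + T / 2 ^ k" using decseqD[OF dec, of k "max j k"] by simp
    finally show ?thesis .
  qed
  have bdd: "bdd_above (range a)" using ub[of _ 0] by (auto intro!: bdd_aboveI)
  have "a k \<le> (SUP j. a j)" for k using bdd by (simp add: cSUP_upper)
  moreover have "(SUP j. a j) \<le> a k + T / 2 ^ k" for k using ub by (intro cSUP_least) auto
  ultimately show ?thesis by blast
qed

text \<open>Goursat's argument: if the defect of a rectangle did not vanish, repeated subdivision into four would produce a point at
which \<open>flux_defect_local\<close>, applied to the total derivatives there, is violated.\<close>

proposition flux_defect_eq_0:
  fixes f g h ft fx gt gx :: "real \<Rightarrow> real \<Rightarrow> real"
  assumes Df: "\<And>t x. ((\<lambda>z. f (fst z) (snd z)) has_derivative (\<lambda>z. ft t x * fst z + fx t x * snd z)) (at (t,x))"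
    and Dg: "\<And>t x. ((\<lambda>z. g (fst z) (snd z)) has_derivative (\<lambda>z. gt t x * fst z + gx t x * snd z)) (at (t,x))"
    and h: "\<And>z. jcont h z" and eq: "\<And>t x. ft t x + gx t x = h t x" and ab: "a \<le> b" "c \<le> d"
  shows "flux_defect f g h a b c d = 0"
proof (rule ccontr)
  assume ne: "flux_defect f g h a b c d \<noteq> 0"
  have f: "jcont f z" and g: "jcont g z" for z
    using has_derivative_continuous[OF Df[of "fst z" "snd z"]] has_derivative_continuous[OF Dg[of "fst z" "snd z"]] by simp_all
  define T where "T = b - a"
  define X where "X = d - c"
  have TX: "0 \<le> T" "0 \<le> X" using ab by (simp_all add: T_def X_def)
  define I where "I k z = flux_defect f g h (fst z) (fst z + T / 2 ^ k) (snd z) (snd z + X / 2 ^ k)" for k and z :: "real \<times> real"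
  define \<delta> where "\<delta> = \<bar>flux_defect f g h a b c d\<bar>"
  have \<delta>: "\<delta> > 0" using ne by (simp add: \<delta>_def)
  have "\<exists>s. \<forall>k. \<bar>I k (s k)\<bar> \<ge> \<delta> / 4 ^ k \<and>
     ((fst (s (Suc k)) = fst (s k) \<or> fst (s (Suc k)) = fst (s k) + T / 2 ^ Suc k) \<and>
      (snd (s (Suc k)) = snd (s k) \<or> snd (s (Suc k)) = snd (s k) + X / 2 ^ Suc k))"
  proof (rule dependent_nat_choice)
    show "\<exists>z. \<bar>I 0 z\<bar> \<ge> \<delta> / 4 ^ 0" by (intro exI[of _ "(a,c)"]) (simp add: I_def \<delta>_def T_def X_def)
    fix z k assume z: "\<bar>I k z\<bar> \<ge> \<delta> / 4 ^ k"
    obtain t x where tx: "z = (t,x)" by (cases z)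
    define \<tau> where "\<tau> = T / 2 ^ Suc k"
    define \<xi> where "\<xi> = X / 2 ^ Suc k"
    have h0: "0 \<le> \<tau>" "0 \<le> \<xi>" using TX by (simp_all add: \<tau>_def \<xi>_def)
    have h2: "T / 2 ^ k = \<tau> + \<tau>" "X / 2 ^ k = \<xi> + \<xi>" by (simp_all add: \<tau>_def \<xi>_def field_simps)
    have Ik: "I k z = flux_defect f g h t (t + (\<tau> + \<tau>)) x (x + (\<xi> + \<xi>))" by (simp only: I_def tx fst_conv snd_conv h2)
    have Is: "I (Suc k) (s, y) = flux_defect f g h s (s + \<tau>) y (y + \<xi>)" for s y by (simp only: I_def fst_conv snd_conv \<tau>_def \<xi>_def)
    have "I k z = I (Suc k) (t,x) + I (Suc k) (t,x+\<xi>) + I (Suc k) (t+\<tau>,x) + I (Suc k) (t+\<tau>,x+\<xi>)"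
      unfolding Ik Is by (subst flux_defect_split[OF f g h, of _ "t + \<tau>" _ _ "x + \<xi>"]) (use h0 in \<open>simp_all add: add.assoc\<close>)
    moreover have "\<delta> / 4 ^ k = \<delta> / 4 ^ Suc k + \<delta> / 4 ^ Suc k + \<delta> / 4 ^ Suc k + \<delta> / 4 ^ Suc k" by simp
    ultimately have "\<bar>I (Suc k) (t,x)\<bar> \<ge> \<delta> / 4 ^ Suc k \<or> \<bar>I (Suc k) (t,x+\<xi>)\<bar> \<ge> \<delta> / 4 ^ Suc k \<or>
        \<bar>I (Suc k) (t+\<tau>,x)\<bar> \<ge> \<delta> / 4 ^ Suc k \<or> \<bar>I (Suc k) (t+\<tau>,x+\<xi>)\<bar> \<ge> \<delta> / 4 ^ Suc k"
      using z by linarith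
    then show "\<exists>y. \<bar>I (Suc k) y\<bar> \<ge> \<delta> / 4 ^ Suc k \<and>
      ((fst y = fst z \<or> fst y = fst z + T / 2 ^ Suc k) \<and> (snd y = snd z \<or> snd y = snd z + X / 2 ^ Suc k))"
      unfolding tx \<tau>_def[symmetric] \<xi>_def[symmetric] by (elim disjE) (metis fst_conv snd_conv)+
  qed
  then obtain s where s: "\<And>k. \<bar>I k (s k)\<bar> \<ge> \<delta> / 4 ^ k"
     "\<And>k. fst (s (Suc k)) = fst (s k) \<or> fst (s (Suc k)) = fst (s k) + T / 2 ^ Suc k"
     "\<And>k. snd (s (Suc k)) = snd (s k) \<or> snd (s (Suc k)) = snd (s k) + X / 2 ^ Suc k" by blast
  obtain t0 where t0: "\<And>k. fst (s k) \<le> t0 \<and> t0 \<le> fst (s k) + T / 2 ^ k"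
    using nested_halving_limit[where a="\<lambda>k. fst (s k)", OF TX(1) s(2)] by blast
  obtain x0 where x0: "\<And>k. snd (s k) \<le> x0 \<and> x0 \<le> snd (s k) + X / 2 ^ k"
    using nested_halving_limit[where a="\<lambda>k. snd (s k)", OF TX(2) s(3)] by blast
  define e where "e = \<delta> / (2 * ((T + X)\<^sup>2 + 1))"
  have e: "e > 0" using \<delta> by (simp add: e_def add_nonneg_pos)
  obtain d0 where d0: "d0 > 0" "\<And>a b c d. a \<le> t0 \<Longrightarrow> t0 \<le> b \<Longrightarrow> c \<le> x0 \<Longrightarrow> x0 \<le> d \<Longrightarrow> b - a \<le> d0 \<Longrightarrow> d - c \<le> d0 \<Longrightarrow>
      \<bar>flux_defect f g h a b c d\<bar> \<le> e * ((b - a) + (d - c))\<^sup>2"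
    using flux_defect_local[where A="ft t0 x0" and A'="fx t0 x0" and C="gx t0 x0" and C'="gt t0 x0" and f=f and g=g and h=h and ?t0.0=t0 and ?x0.0=x0,
        OF f g h Df Dg eq e] by blast
  have half: "(\<lambda>k. (1/2::real) ^ k) \<longlonglongrightarrow> 0" by (rule LIMSEQ_power_zero) simp
  have lim': "\<forall>\<^sub>F k in sequentially. Y / 2 ^ k < d0" for Y :: real
  proof -
    have "(\<lambda>k. Y * (1/2) ^ k) \<longlonglongrightarrow> Y * 0" by (rule tendsto_mult_left[OF half])
    then have "\<forall>\<^sub>F k in sequentially. Y * (1/2) ^ k < d0" by (rule order_tendstoD(2)) (simp add: d0(1))
    moreover have "Y * (1/2) ^ k = Y / 2 ^ k" for k by (simp add: power_divide)
    ultimately show ?thesis by (simp only:)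
  qed
  obtain k where k: "T / 2 ^ k < d0" "X / 2 ^ k < d0"
    using eventually_conj[OF lim'[of T] lim'[of X]] by (auto simp: eventually_sequentially)
  have "\<bar>I k (s k)\<bar> \<le> e * (T / 2 ^ k + X / 2 ^ k)\<^sup>2"
    using d0(2)[of "fst (s k)" "fst (s k) + T / 2 ^ k" "snd (s k)" "snd (s k) + X / 2 ^ k"] t0[of k] x0[of k] k
    by (simp add: I_def)
  also have "\<dots> = e * (T + X)\<^sup>2 / 4 ^ k"
    by (simp add: add_divide_distrib[symmetric] power_divide power_mult[symmetric] mult.commute[of k] power_mult)
  also have "\<dots> < \<delta> / 4 ^ k"
  proof -
    have "e * (T + X)\<^sup>2 < e * ((T + X)\<^sup>2 + 1) * 2" using e by (simp add: algebra_simps add_pos_nonneg)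
    also have "\<dots> = \<delta>"
    proof -
      have "(T + X)\<^sup>2 + 1 \<noteq> 0" using zero_le_power2[of "T + X"] by linarith
      moreover have "\<delta> / (2 * Y) * Y * 2 = \<delta>" if "Y \<noteq> 0" for Y :: real using that by simp
      ultimately show ?thesis unfolding e_def by blast
    qed
    finally show ?thesis by (simp add: divide_strict_right_mono)
  qed
  finally show False using s(1)[of k] by simp
qed

text \<open>Frechet differentiability at every point, without continuity of the derivative.\<close>

definition totdiff :: "(real \<Rightarrow> real \<Rightarrow> real) \<Rightarrow> (real \<Rightarrow> real \<Rightarrow> real) \<Rightarrow> (real \<Rightarrow> real \<Rightarrow> real) \<Rightarrow> bool" where
  "totdiff f ft fx \<longleftrightarrow>
     (\<forall>t x. ((\<lambda>z. f (fst z) (snd z)) has_derivative (\<lambda>z. ft t x * fst z + fx t x * snd z)) (at (t,x)))"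

lemma totdiff_jcont: "totdiff f ft fx \<Longrightarrow> jcont f z"
  using has_derivative_continuous[of "\<lambda>z. f (fst z) (snd z)" _ "(fst z, snd z)"] unfolding totdiff_def by (metis prod.collapse)

lemma totdiff_add:
  assumes "totdiff f ft fx" "totdiff g gt gx"
  shows "totdiff (\<lambda>t x. f t x + g t x) (\<lambda>t x. ft t x + gt t x) (\<lambda>t x. fx t x + gx t x)"
  unfolding totdiff_def
proof (intro allI)
  fix t x
  have "((\<lambda>z. f (fst z) (snd z) + g (fst z) (snd z)) has_derivative
     (\<lambda>z. (ft t x * fst z + fx t x * snd z) + (gt t x * fst z + gx t x * snd z))) (at (t,x))"
    using assms unfolding totdiff_def by (intro has_derivative_add) auto
  then show "((\<lambda>z. f (fst z) (snd z) + g (fst z) (snd z)) has_derivative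
     (\<lambda>z. (ft t x + gt t x) * fst z + (fx t x + gx t x) * snd z)) (at (t, x))"
    by (rule has_derivative_eq_rhs) (simp add: fun_eq_iff algebra_simps)
qed

lemma totdiff_mult:
  assumes "totdiff f ft fx" "totdiff g gt gx"
  shows "totdiff (\<lambda>t x. f t x * g t x) (\<lambda>t x. ft t x * g t x + f t x * gt t x) (\<lambda>t x. fx t x * g t x + f t x * gx t x)"
  unfolding totdiff_def
proof (intro allI)
  fix t x
  have "((\<lambda>z. f (fst z) (snd z) * g (fst z) (snd z)) has_derivative
     (\<lambda>z. f (fst (t,x)) (snd (t,x)) * (gt t x * fst z + gx t x * snd z) + (ft t x * fst z + fx t x * snd z) * g (fst (t,x)) (snd (t,x)))) (at (t,x))"
    using assms unfolding totdiff_def by (intro has_derivative_mult) auto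
  then show "((\<lambda>z. f (fst z) (snd z) * g (fst z) (snd z)) has_derivative
     (\<lambda>z. (ft t x * g t x + f t x * gt t x) * fst z + (fx t x * g t x + f t x * gx t x) * snd z)) (at (t, x))"
    by (rule has_derivative_eq_rhs) (simp add: fun_eq_iff algebra_simps)
qed

lemma totdiff_compose:
  assumes f: "totdiff f ft fx" and F: "\<And>t x. (F has_real_derivative F' (f t x)) (at (f t x))"
  shows "totdiff (\<lambda>t x. F (f t x)) (\<lambda>t x. F' (f t x) * ft t x) (\<lambda>t x. F' (f t x) * fx t x)"
  unfolding totdiff_def
proof (intro allI)
  fix t x
  have "((\<lambda>z. F (f (fst z) (snd z))) has_derivative (\<lambda>z. (ft t x * fst z + fx t x * snd z) * F' (f t x))) (at (t,x))"
    by (rule has_derivative_compose[where g=F])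
      (use f[unfolded totdiff_def] F[of t x] in \<open>auto simp: has_field_derivative_def mult.commute[of _ "F' (f t x)"]\<close>)
  then show "((\<lambda>z. F (f (fst z) (snd z))) has_derivative (\<lambda>z. F' (f t x) * ft t x * fst z + F' (f t x) * fx t x * snd z)) (at (t, x))"
    by (rule has_derivative_eq_rhs) (simp add: fun_eq_iff algebra_simps)
qed

lemma totdiff_of_space:
  assumes "\<And>x. (F has_real_derivative F' x) (at x)"
  shows "totdiff (\<lambda>t x. F x) (\<lambda>t x. 0) (\<lambda>t x. F' x)"
  unfolding totdiff_def
proof (intro allI)
  fix t x :: real
  have "((\<lambda>z. F (snd z)) has_derivative (\<lambda>z. F' x * snd z)) (at (t,x))"
  proof -
    have "(F has_derivative (\<lambda>h. F' x * h)) (at (snd (t,x)))"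
      using assms[of x] by (simp add: has_field_derivative_def)
    from has_derivative_compose[OF has_derivative_snd[OF has_derivative_ident] this] show ?thesis by simp
  qed
  then show "((\<lambda>z. F (snd z)) has_derivative (\<lambda>z. 0 * fst z + F' x * snd z)) (at (t, x))" by simp
qed

lemma totdiff_flux_defect:
  assumes "totdiff f ft fx" "totdiff g gt gx" "\<And>z. jcont h z" "\<And>t x. ft t x + gx t x = h t x" "a \<le> b" "c \<le> d"
  shows "flux_defect f g h a b c d = 0"
  using flux_defect_eq_0[of f ft fx g gt gx h] assms unfolding totdiff_def by blast

lemma cutoff_bounds:
  fixes L x :: real
  assumes "L > 0" "-L \<le> x" "x \<le> L"
  shows "\<bar>1 - (x/L)\<^sup>2\<bar> \<le> 1" "\<bar>- 2 * x / L\<^sup>2\<bar> \<le> 2 / L"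
proof -
  have "\<bar>x / L\<bar> \<le> 1" using assms by (simp add: abs_le_iff)
  then have "(x/L)\<^sup>2 \<le> 1" by (simp add: abs_square_le_1)
  then show "\<bar>1 - (x/L)\<^sup>2\<bar> \<le> 1" by (simp add: abs_le_iff)
  have "\<bar>- 2 * x / L\<^sup>2\<bar> = 2 * \<bar>x / L\<bar> / L" using assms by (simp add: abs_mult power2_eq_square)
  also have "\<dots> \<le> 2 * 1 / L" using \<open>\<bar>x / L\<bar> \<le> 1\<close> assms by (intro divide_right_mono mult_left_mono) auto
  finally show "\<bar>- 2 * x / L\<^sup>2\<bar> \<le> 2 / L" by simp
qed

text \<open>The cutoff \<open>1 - (x / L)\<^sup>2\<close> is smooth and its derivative is of size \<open>1 / L\<close> on \<open>[-L, L]\<close>, so the term in which it is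
differentiated disappears in the limit.\<close>

lemma cutoff_integral_limits:
  fixes F :: "real \<Rightarrow> real" and L u :: "nat \<Rightarrow> real"
  assumes L: "\<And>j. L j \<ge> 1" "filterlim L at_top sequentially" and u: "\<And>j. - L j \<le> u j" "\<And>j. u j \<le> L j"
    and S: "S \<in> sets lborel" "\<And>j. {- L j..u j} \<subseteq> S" "\<And>x. x \<in> S \<Longrightarrow> \<forall>\<^sub>F j in sequentially. x \<in> {- L j..u j}"
    and F: "continuous_on UNIV F" "set_integrable lborel S F"
  shows "(\<lambda>j. integral {- L j..u j} (\<lambda>x. (1 - (x / L j)\<^sup>2) * F x)) \<longlonglongrightarrow> (LINT x:S|lborel. F x)"
    and "(\<lambda>j. integral {- L j..u j} (\<lambda>x. (- 2 * x / (L j)\<^sup>2) * F x)) \<longlonglongrightarrow> 0"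
    and "\<bar>integral {- L j..u j} (\<lambda>x. (1 - (x / L j)\<^sup>2) * F x)\<bar> \<le> (LINT x:S|lborel. \<bar>F x\<bar>)"
    and "\<bar>integral {- L j..u j} (\<lambda>x. (- 2 * x / (L j)\<^sup>2) * F x)\<bar> \<le> 2 * (LINT x:S|lborel. \<bar>F x\<bar>)"
proof -
  have Fm: "F \<in> borel_measurable borel" using F(1) by (rule borel_measurable_continuous_onI)
  define w where "w x = indicat_real S x * \<bar>F x\<bar>" for x
  have w: "integrable lborel w" "integral\<^sup>L lborel w = (LINT x:S|lborel. \<bar>F x\<bar>)"
    using set_integrable_abs[OF F(2)] by (simp_all add: set_integrable_def set_lebesgue_integral_def w_def[abs_def])
  have S': "S \<in> sets borel" using S(1) by simp
  have conv: "integral {- L j..u j} (\<lambda>x. e x * F x) = integral\<^sup>L lborel (\<lambda>x. indicat_real {- L j..u j} x * (e x * F x))"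
    if "continuous_on UNIV e" for e j
  proof -
    have "continuous_on {- L j..u j} (\<lambda>x. e x * F x)"
      using that F(1) by (auto intro!: continuous_on_mult intro: continuous_on_subset)
    then have "set_integrable lborel {- L j..u j} (\<lambda>x. e x * F x)" by (rule borel_integrable_atLeastAtMost')
    from set_borel_integral_eq_integral(2)[OF this] show ?thesis by (simp add: set_lebesgue_integral_def)
  qed
  have c1: "continuous_on UNIV (\<lambda>x. 1 - (x / L j)\<^sup>2)" and c2: "continuous_on UNIV (\<lambda>x. - 2 * x / (L j)\<^sup>2)" for j
    using L(1)[of j] by (auto intro!: continuous_intros)
  note e1 = conv[OF c1] and e2 = conv[OF c2]
  have Lpos: "L j > 0" for j using L(1)[of j] by linarith
  have b1: "norm (indicat_real {- L j..u j} x * ((1 - (x / L j)\<^sup>2) * F x)) \<le> w x" for j x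
  proof (cases "x \<in> {- L j..u j}")
    case True
    then have "\<bar>1 - (x / L j)\<^sup>2\<bar> \<le> 1" using cutoff_bounds(1)[OF Lpos[of j], of x] u(2)[of j] by auto
    then have "\<bar>1 - (x / L j)\<^sup>2\<bar> * \<bar>F x\<bar> \<le> 1 * \<bar>F x\<bar>" by (intro mult_right_mono) auto
    then show ?thesis using True S(2)[of j] by (auto simp: w_def abs_mult)
  qed (simp add: w_def)
  have b2': "norm (indicat_real {- L j..u j} x * ((- 2 * x / (L j)\<^sup>2) * F x)) \<le> 2 / L j * w x" for j x
  proof (cases "x \<in> {- L j..u j}")
    case True
    then have "\<bar>- 2 * x / (L j)\<^sup>2\<bar> \<le> 2 / L j" using cutoff_bounds(2)[OF Lpos[of j], of x] u(2)[of j] by auto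
    then have "\<bar>- 2 * x / (L j)\<^sup>2\<bar> * \<bar>F x\<bar> \<le> 2 / L j * \<bar>F x\<bar>" by (intro mult_right_mono) auto
    moreover have "norm (indicat_real {- L j..u j} x * ((- 2 * x / (L j)\<^sup>2) * F x)) = \<bar>- 2 * x / (L j)\<^sup>2\<bar> * \<bar>F x\<bar>"
      using True by (simp only: indicator_simps mult_1_left real_norm_def abs_mult)
    moreover have "w x = \<bar>F x\<bar>" using True S(2)[of j] by (auto simp: w_def)
    ultimately show ?thesis by (simp only:)
  next
    case False then show ?thesis using Lpos[of j] by (simp add: w_def)
  qed
  have b2: "norm (indicat_real {- L j..u j} x * ((- 2 * x / (L j)\<^sup>2) * F x)) \<le> 2 * w x" for j x
  proof -
    have "2 / L j \<le> 2" using L(1)[of j] by (simp add: divide_le_eq)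
    then have "2 / L j * w x \<le> 2 * w x" by (intro mult_right_mono) (auto simp: w_def)
    then show ?thesis using b2'[of j x] by linarith
  qed
  have m1: "(\<lambda>x. indicat_real {- L j..u j} x * (e x * F x)) \<in> borel_measurable lborel" if "continuous_on UNIV e" for e j
    using borel_measurable_continuous_onI[OF that] Fm by simp
  have inv: "(\<lambda>j. 1 / L j) \<longlonglongrightarrow> 0"
    using tendsto_inverse_0_at_top[OF L(2)] by (simp add: inverse_eq_divide)
  show "(\<lambda>j. integral {- L j..u j} (\<lambda>x. (1 - (x / L j)\<^sup>2) * F x)) \<longlonglongrightarrow> (LINT x:S|lborel. F x)"
    unfolding e1 set_lebesgue_integral_def real_scaleR_def
  proof (rule integral_dominated_convergence[OF _ m1[OF c1] w(1)])
    show "(\<lambda>x. indicat_real S x * F x) \<in> borel_measurable lborel" using S' Fm by simp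
    show "AE x in lborel. (\<lambda>j. indicat_real {- L j..u j} x * ((1 - (x / L j)\<^sup>2) * F x)) \<longlonglongrightarrow> indicat_real S x * F x"
    proof (rule AE_I2)
      fix x
      show "(\<lambda>j. indicat_real {- L j..u j} x * ((1 - (x / L j)\<^sup>2) * F x)) \<longlonglongrightarrow> indicat_real S x * F x"
      proof (cases "x \<in> S")
        case True
        have "(\<lambda>j. (1 - (x * (1 / L j))\<^sup>2) * F x) \<longlonglongrightarrow> (1 - (x * 0)\<^sup>2) * F x" by (intro tendsto_intros inv)
        then have "(\<lambda>j. (1 - (x / L j)\<^sup>2) * F x) \<longlonglongrightarrow> F x" by simp
        moreover have "\<forall>\<^sub>F j in sequentially. (1 - (x / L j)\<^sup>2) * F x = indicat_real {- L j..u j} x * ((1 - (x / L j)\<^sup>2) * F x)"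
          using S(3)[OF True] by eventually_elim simp
        ultimately show ?thesis using True by (simp add: Lim_transform_eventually)
      next
        case False
        then have "x \<notin> {- L j..u j}" for j using S(2) by blast
        then show ?thesis using False by simp
      qed
    qed
    show "AE x in lborel. norm (indicat_real {- L j..u j} x * ((1 - (x / L j)\<^sup>2) * F x)) \<le> w x" for j
      using b1 by (rule AE_I2)
  qed
  have Int1: "integrable lborel (\<lambda>x. indicat_real {- L j..u j} x * ((1 - (x / L j)\<^sup>2) * F x))" for j
    by (rule Bochner_Integration.integrable_bound[OF w(1) m1[OF c1]]) (use b1 in \<open>auto intro!: AE_I2 simp: w_def\<close>)
  have Int2: "integrable lborel (\<lambda>x. indicat_real {- L j..u j} x * ((- 2 * x / (L j)\<^sup>2) * F x))" for j
    by (rule Bochner_Integration.integrable_bound[OF integrable_mult_right[OF w(1), of 2] m1[OF c2]]) (use b2 in \<open>auto intro!: AE_I2 simp: w_def\<close>)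
  show "\<bar>integral {- L j..u j} (\<lambda>x. (1 - (x / L j)\<^sup>2) * F x)\<bar> \<le> (LINT x:S|lborel. \<bar>F x\<bar>)" for j
    using Bochner_Integration.integral_norm_bound_integral[OF Int1 w(1) b1, of j]
    unfolding e1 w(2)[symmetric] real_norm_def .
  have Q: "\<bar>integral {- L j..u j} (\<lambda>x. (- 2 * x / (L j)\<^sup>2) * F x)\<bar> \<le> 2 / L j * (LINT x:S|lborel. \<bar>F x\<bar>)" for j
    using Bochner_Integration.integral_norm_bound_integral[OF Int2 integrable_mult_right[OF w(1)] b2', of j]
    unfolding e2 w(2)[symmetric] real_norm_def by simp
  show "\<bar>integral {- L j..u j} (\<lambda>x. (- 2 * x / (L j)\<^sup>2) * F x)\<bar> \<le> 2 * (LINT x:S|lborel. \<bar>F x\<bar>)" for j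
    using Bochner_Integration.integral_norm_bound_integral[OF Int2 integrable_mult_right[OF w(1)] b2, of j]
    unfolding e2 w(2)[symmetric] real_norm_def by simp
  show "(\<lambda>j. integral {- L j..u j} (\<lambda>x. (- 2 * x / (L j)\<^sup>2) * F x)) \<longlonglongrightarrow> 0"
  proof (rule Lim_null_comparison)
    show "\<forall>\<^sub>F j in sequentially. norm (integral {- L j..u j} (\<lambda>x. (- 2 * x / (L j)\<^sup>2) * F x)) \<le> 2 * (1 / L j) * (LINT x:S|lborel. \<bar>F x\<bar>)"
      using Q by (intro always_eventually) simp
    have "(\<lambda>j. 2 * (1 / L j) * (LINT x:S|lborel. \<bar>F x\<bar>)) \<longlonglongrightarrow> 2 * 0 * (LINT x:S|lborel. \<bar>F x\<bar>)"
      by (intro tendsto_intros inv)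
    then show "(\<lambda>j. 2 * (1 / L j) * (LINT x:S|lborel. \<bar>F x\<bar>)) \<longlonglongrightarrow> 0" by simp
  qed
qed

text \<open>The common core of the laws on the line and on a half line: apply the rectangle law to the product with a cutoff and let the
cutoff exhaust \<open>S\<close>. The function \<open>\<beta>\<close> is the flux through the boundary of \<open>S\<close> that survives.\<close>

lemma weighted_balance_limit:
  fixes f g h \<zeta> :: "real \<Rightarrow> real \<Rightarrow> real" and L u :: "nat \<Rightarrow> real"
  assumes f: "totdiff f ft fx" and g: "totdiff g gt gx" and \<zeta>: "totdiff \<zeta> zt zx"
    and h: "\<And>z. jcont h z" "\<And>z. jcont zt z" "\<And>z. jcont zx z" and eq: "\<And>t x. ft t x + gx t x = h t x"
    and t12: "t1 \<le> t2"
    and L: "\<And>j. L j \<ge> 1" "filterlim L at_top sequentially" and u: "\<And>j. - L j \<le> u j" "\<And>j. u j \<le> L j"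
    and S: "S \<in> sets lborel" "\<And>j. {- L j..u j} \<subseteq> S" "\<And>x. x \<in> S \<Longrightarrow> \<forall>\<^sub>F j in sequentially. x \<in> {- L j..u j}"
    and k_def: "\<And>t x. k t x = zt t x * f t x + zx t x * g t x + \<zeta> t x * h t x"
    and int: "\<And>t. t1 \<le> t \<Longrightarrow> t \<le> t2 \<Longrightarrow> set_integrable lborel S (\<lambda>x. \<zeta> t x * f t x)"
      "\<And>t. t1 \<le> t \<Longrightarrow> t \<le> t2 \<Longrightarrow> set_integrable lborel S (\<lambda>x. \<zeta> t x * g t x)"
      "\<And>t. t1 \<le> t \<Longrightarrow> t \<le> t2 \<Longrightarrow> set_integrable lborel S (k t)"
    and bd: "\<And>t. t1 \<le> t \<Longrightarrow> t \<le> t2 \<Longrightarrow> (LINT x:S|lborel. \<bar>\<zeta> t x * g t x\<bar>) \<le> M"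
      "\<And>t. t1 \<le> t \<Longrightarrow> t \<le> t2 \<Longrightarrow> (LINT x:S|lborel. \<bar>k t x\<bar>) \<le> M"
    and \<beta>: "\<And>t. t1 \<le> t \<Longrightarrow> t \<le> t2 \<Longrightarrow> (\<lambda>j. (1 - (u j / L j)\<^sup>2) * (\<zeta> t (u j) * g t (u j))) \<longlonglongrightarrow> \<beta> t"
      "\<And>t j. t1 \<le> t \<Longrightarrow> t \<le> t2 \<Longrightarrow> \<bar>(1 - (u j / L j)\<^sup>2) * (\<zeta> t (u j) * g t (u j))\<bar> \<le> M"
  shows "((\<lambda>t. (LINT x:S|lborel. k t x) - \<beta> t) has_integral
      (LINT x:S|lborel. \<zeta> t2 x * f t2 x) - (LINT x:S|lborel. \<zeta> t1 x * f t1 x)) {t1..t2}"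
proof -
  have Lpos: "L j > 0" for j using L(1)[of j] by linarith
  note jc = totdiff_jcont[OF f] totdiff_jcont[OF g] totdiff_jcont[OF \<zeta>] h
  define P where "P j t = integral {- L j..u j} (\<lambda>x. (1 - (x / L j)\<^sup>2) * k t x)" for j t
  define Q where "Q j t = integral {- L j..u j} (\<lambda>x. (- 2 * x / (L j)\<^sup>2) * (\<zeta> t x * g t x))" for j t
  define b where "b j t = (1 - (u j / L j)\<^sup>2) * (\<zeta> t (u j) * g t (u j))" for j t
  define E where "E j t = integral {- L j..u j} (\<lambda>x. (1 - (x / L j)\<^sup>2) * (\<zeta> t x * f t x))" for j t
  have kc: "jcont k z" for z unfolding k_def by (intro continuous_intros jc)
  have zg: "jcont (\<lambda>t x. \<zeta> t x * g t x) z" and zf: "jcont (\<lambda>t x. \<zeta> t x * f t x) z" for z by (intro continuous_intros jc)+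
  have ex: "jcont (\<lambda>t x. (1 - (x / L j)\<^sup>2)) z" "jcont (\<lambda>t x. - 2 * x / (L j)\<^sup>2) z" for j z
    using Lpos[of j] by (intro continuous_intros; simp)+
  have contP: "continuous_on {t1..t2} (P j)" and contQ: "continuous_on {t1..t2} (Q j)" for j
    unfolding P_def Q_def by (intro jcont_integral_param continuous_intros kc zg ex)+
  have contb: "continuous_on {t1..t2} (b j)" for j
    unfolding b_def by (intro continuous_intros jcont_slices jc)
  have bal: "((\<lambda>t. P j t + Q j t - b j t) has_integral E j t2 - E j t1) {t1..t2}" for j
  proof -
    have e: "((\<lambda>x. 1 - (x / L j)\<^sup>2) has_real_derivative - 2 * x / (L j)\<^sup>2) (at x)" for x
      using Lpos[of j] by (auto intro!: derivative_eq_intros simp: power2_eq_square field_simps)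
    note et = totdiff_of_space[where F="\<lambda>x. 1 - (x / L j)\<^sup>2", OF e]
    have F0: "flux_defect (\<lambda>t x. (1 - (x / L j)\<^sup>2) * (\<zeta> t x * f t x)) (\<lambda>t x. (1 - (x / L j)\<^sup>2) * (\<zeta> t x * g t x))
       (\<lambda>t x. (1 - (x / L j)\<^sup>2) * k t x + (- 2 * x / (L j)\<^sup>2) * (\<zeta> t x * g t x)) t1 t2 (- L j) (u j) = 0"
    proof (rule totdiff_flux_defect[OF totdiff_mult[OF et totdiff_mult[OF \<zeta> f]] totdiff_mult[OF et totdiff_mult[OF \<zeta> g]]])
      show "jcont (\<lambda>t x. (1 - (x / L j)\<^sup>2) * k t x + (- 2 * x / (L j)\<^sup>2) * (\<zeta> t x * g t x)) z" for z
        by (intro continuous_intros kc zg ex)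
      show "0 * (\<zeta> t x * f t x) + (1 - (x / L j)\<^sup>2) * (zt t x * f t x + \<zeta> t x * ft t x) +
        ((- 2 * x / (L j)\<^sup>2) * (\<zeta> t x * g t x) + (1 - (x / L j)\<^sup>2) * (zx t x * g t x + \<zeta> t x * gx t x)) =
        (1 - (x / L j)\<^sup>2) * k t x + (- 2 * x / (L j)\<^sup>2) * (\<zeta> t x * g t x)" for t x
        unfolding k_def eq[symmetric] by (simp add: algebra_simps)
    qed (use t12 u in auto)
    have I: "G integrable_on {l..r}" if "\<And>z. jcont (\<lambda>t x. G x) z" for G :: "real \<Rightarrow> real" and l r
      using jcont_slices(1)[OF that] by (rule integrable_continuous_real)
    have I2: "(\<lambda>x. G t x) integrable_on {l..r}" if "\<And>z. jcont G z" for G :: "real \<Rightarrow> real \<Rightarrow> real" and l r t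
      using jcont_slices(1)[OF that] by (rule integrable_continuous_real)
    have j1: "jcont (\<lambda>t x. (1 - (x / L j)\<^sup>2) * (\<zeta> t x * f t x)) z" "jcont (\<lambda>t x. (1 - (x / L j)\<^sup>2) * k t x) z"
      "jcont (\<lambda>t x. (- 2 * x / (L j)\<^sup>2) * (\<zeta> t x * g t x)) z" for z by (intro continuous_intros kc zg zf ex)+
    have d1: "integral {- L j..u j} (\<lambda>x. (1 - (x / L j)\<^sup>2) * (\<zeta> t2 x * f t2 x) - (1 - (x / L j)\<^sup>2) * (\<zeta> t1 x * f t1 x)) = E j t2 - E j t1"
      unfolding E_def by (rule integral_diff) (rule I2[OF j1(1)])+
    have d2: "integral {- L j..u j} (\<lambda>x. (1 - (x / L j)\<^sup>2) * k t x + (- 2 * x / (L j)\<^sup>2) * (\<zeta> t x * g t x)) = P j t + Q j t" for t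
      unfolding P_def Q_def by (rule integral_add) (rule I2[OF j1(2)] I2[OF j1(3)])+
    have d3: "(1 - (u j / L j)\<^sup>2) * (\<zeta> t (u j) * g t (u j)) - (1 - (- L j / L j)\<^sup>2) * (\<zeta> t (- L j) * g t (- L j)) = b j t" for t
      using Lpos[of j] by (simp add: b_def)
    have "E j t2 - E j t1 + integral {t1..t2} (b j) - integral {t1..t2} (\<lambda>t. P j t + Q j t) = 0"
      using F0 unfolding flux_defect_def d1 d2 d3 by (simp only: eta_contract_eq)
    moreover have "integral {t1..t2} (\<lambda>t. P j t + Q j t - b j t) = integral {t1..t2} (\<lambda>t. P j t + Q j t) - integral {t1..t2} (b j)"
      by (rule integral_diff) (auto intro!: integrable_continuous_real continuous_intros contP contQ contb)
    moreover have "(\<lambda>t. P j t + Q j t - b j t) integrable_on {t1..t2}"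
      by (auto intro!: integrable_continuous_real continuous_intros contP contQ contb)
    ultimately show ?thesis by (simp add: has_integral_integrable_integral)
  qed
  have slk: "continuous_on UNIV (k t)" for t by (rule jcont_slices(1)[OF kc])
  have slg: "continuous_on UNIV (\<lambda>x. \<zeta> t x * g t x)" for t
    by (rule continuous_on_mult[OF jcont_slices(1)[OF totdiff_jcont[OF \<zeta>]] jcont_slices(1)[OF totdiff_jcont[OF g]]])
  have slf: "continuous_on UNIV (\<lambda>x. \<zeta> t x * f t x)" for t
    by (rule continuous_on_mult[OF jcont_slices(1)[OF totdiff_jcont[OF \<zeta>]] jcont_slices(1)[OF totdiff_jcont[OF f]]])
  note sl = slk slg slf
  have lim: "(\<lambda>j. integral {- L j..u j} (\<lambda>x. (1 - (x / L j)\<^sup>2) * F x)) \<longlonglongrightarrow> (LINT x:S|lborel. F x)"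
    "(\<lambda>j. integral {- L j..u j} (\<lambda>x. (- 2 * x / (L j)\<^sup>2) * F x)) \<longlonglongrightarrow> 0"
    "\<bar>integral {- L j..u j} (\<lambda>x. (1 - (x / L j)\<^sup>2) * F x)\<bar> \<le> (LINT x:S|lborel. \<bar>F x\<bar>)"
    "\<bar>integral {- L j..u j} (\<lambda>x. (- 2 * x / (L j)\<^sup>2) * F x)\<bar> \<le> 2 * (LINT x:S|lborel. \<bar>F x\<bar>)"
    if F: "continuous_on UNIV F" "set_integrable lborel S F" for F j
    by ((rule cutoff_integral_limits(1)[of L u S F]; fact L u S F),
        (rule cutoff_integral_limits(2)[of L u S F]; fact L u S F),
        (rule cutoff_integral_limits(3)[of L u S F]; fact L u S F),
        (rule cutoff_integral_limits(4)[of L u S F]; fact L u S F))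
  have d1: "(\<lambda>t. P j t + Q j t - b j t) integrable_on {t1..t2}" for j using bal[of j] by blast
  have d2: "(\<lambda>t. 4 * M) integrable_on {t1..t2}" by (rule integrable_const_ivl)
  have d3: "norm (P j t + Q j t - b j t) \<le> 4 * M" if "t \<in> {t1..t2}" for j t
  proof -
    have t: "t1 \<le> t" "t \<le> t2" using that by auto
    have "\<bar>P j t\<bar> \<le> M" unfolding P_def using lim(3)[OF sl(1) int(3)[OF t]] bd(2)[OF t] by (rule order_trans)
    moreover have "\<bar>Q j t\<bar> \<le> 2 * M" unfolding Q_def using lim(4)[OF sl(2) int(2)[OF t], of j] bd(1)[OF t] by linarith
    moreover have "\<bar>b j t\<bar> \<le> M" unfolding b_def by (rule \<beta>(2)[OF t])
    ultimately show ?thesis unfolding real_norm_def by linarith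
  qed
  have d4: "(\<lambda>j. P j t + Q j t - b j t) \<longlonglongrightarrow> (LINT x:S|lborel. k t x) + 0 - \<beta> t" if "t \<in> {t1..t2}" for t
  proof -
    have t: "t1 \<le> t" "t \<le> t2" using that by auto
    show ?thesis unfolding P_def Q_def b_def
      by (rule tendsto_diff[OF tendsto_add[OF lim(1)[OF sl(1) int(3)[OF t]] lim(2)[OF sl(2) int(2)[OF t]]] \<beta>(1)[OF t]])
  qed
  note G = dominated_convergence[where f="\<lambda>j t. P j t + Q j t - b j t" and S="{t1..t2}" and h="\<lambda>t. 4 * M"
      and g="\<lambda>t. (LINT x:S|lborel. k t x) + 0 - \<beta> t", OF d1 d2 d3 d4]
  have "integral {t1..t2} (\<lambda>t. P j t + Q j t - b j t) = E j t2 - E j t1" for j using bal[of j] by (rule integral_unique)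
  then have "(\<lambda>j. E j t2 - E j t1) \<longlonglongrightarrow> integral {t1..t2} (\<lambda>t. (LINT x:S|lborel. k t x) + 0 - \<beta> t)" using G(2) by simp
  moreover have "(\<lambda>j. E j t2 - E j t1) \<longlonglongrightarrow> (LINT x:S|lborel. \<zeta> t2 x * f t2 x) - (LINT x:S|lborel. \<zeta> t1 x * f t1 x)"
    unfolding E_def using t12 by (intro tendsto_intros lim(1)[OF sl(3) int(1)]) auto
  ultimately have "integral {t1..t2} (\<lambda>t. (LINT x:S|lborel. k t x) + 0 - \<beta> t) = (LINT x:S|lborel. \<zeta> t2 x * f t2 x) - (LINT x:S|lborel. \<zeta> t1 x * f t1 x)"
    by (rule LIMSEQ_unique)
  then show ?thesis using G(1) by (simp add: has_integral_integrable_integral)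
qed

proposition balance_law_line:
  fixes f g h \<zeta> :: "real \<Rightarrow> real \<Rightarrow> real"
  assumes f: "totdiff f ft fx" and g: "totdiff g gt gx" and \<zeta>: "totdiff \<zeta> zt zx"
    and h: "\<And>z. jcont h z" "\<And>z. jcont zt z" "\<And>z. jcont zx z" and eq: "\<And>t x. ft t x + gx t x = h t x"
    and t12: "t1 \<le> t2"
    and k_def: "\<And>t x. k t x = zt t x * f t x + zx t x * g t x + \<zeta> t x * h t x"
    and int: "\<And>t. integrable lborel (\<lambda>x. \<zeta> t x * f t x)" "\<And>t. integrable lborel (\<lambda>x. \<zeta> t x * g t x)" "\<And>t. integrable lborel (k t)"
    and bd: "\<And>t. t1 \<le> t \<Longrightarrow> t \<le> t2 \<Longrightarrow> (LINT x|lborel. \<bar>\<zeta> t x * g t x\<bar>) \<le> M"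
      "\<And>t. t1 \<le> t \<Longrightarrow> t \<le> t2 \<Longrightarrow> (LINT x|lborel. \<bar>k t x\<bar>) \<le> M"
  shows "((\<lambda>t. LINT x|lborel. k t x) has_integral
      (LINT x|lborel. \<zeta> t2 x * f t2 x) - (LINT x|lborel. \<zeta> t1 x * f t1 x)) {t1..t2}"
proof -
  define L where "L j = real j + 1" for j
  have M: "0 \<le> M" using order_trans[OF integral_nonneg_AE bd(1)[of t1]] t12 by simp
  have "((\<lambda>t. (LINT x:UNIV|lborel. k t x) - 0) has_integral
      (LINT x:UNIV|lborel. \<zeta> t2 x * f t2 x) - (LINT x:UNIV|lborel. \<zeta> t1 x * f t1 x)) {t1..t2}"
  proof (rule weighted_balance_limit[OF f g \<zeta> h eq t12, where L=L and u=L and M=M and k=k])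
    show "k t x = zt t x * f t x + zx t x * g t x + \<zeta> t x * h t x" for t x by (rule k_def)
    show "filterlim L at_top sequentially" unfolding L_def
      by (rule filterlim_at_top_mono[OF filterlim_real_sequentially]) simp
    show "\<forall>\<^sub>F j in sequentially. x \<in> {- L j..L j}" for x
    proof -
      obtain N :: nat where "real N \<ge> \<bar>x\<bar>" using real_arch_simple by blast
      then show ?thesis unfolding eventually_sequentially L_def by (intro exI[of _ N]) auto
    qed
  qed (use int bd M in \<open>auto simp: L_def set_integrable_def set_lebesgue_integral_def\<close>)
  then show ?thesis by (simp add: set_lebesgue_integral_def)
qed

proposition balance_law_half_line:
  fixes f g h \<zeta> :: "real \<Rightarrow> real \<Rightarrow> real"
  assumes f: "totdiff f ft fx" and g: "totdiff g gt gx" and \<zeta>: "totdiff \<zeta> zt zx"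
    and h: "\<And>z. jcont h z" "\<And>z. jcont zt z" "\<And>z. jcont zx z" and eq: "\<And>t x. ft t x + gx t x = h t x"
    and t12: "t1 \<le> t2"
    and k_def: "\<And>t x. k t x = zt t x * f t x + zx t x * g t x + \<zeta> t x * h t x"
    and int: "\<And>t. set_integrable lborel {..b} (\<lambda>x. \<zeta> t x * f t x)" "\<And>t. set_integrable lborel {..b} (\<lambda>x. \<zeta> t x * g t x)"
       "\<And>t. set_integrable lborel {..b} (k t)"
    and bd: "\<And>t. t1 \<le> t \<Longrightarrow> t \<le> t2 \<Longrightarrow> (LINT x:{..b}|lborel. \<bar>\<zeta> t x * g t x\<bar>) \<le> M"
      "\<And>t. t1 \<le> t \<Longrightarrow> t \<le> t2 \<Longrightarrow> (LINT x:{..b}|lborel. \<bar>k t x\<bar>) \<le> M"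
  shows "((\<lambda>t. (LINT x:{..b}|lborel. k t x) - \<zeta> t b * g t b) has_integral
      (LINT x:{..b}|lborel. \<zeta> t2 x * f t2 x) - (LINT x:{..b}|lborel. \<zeta> t1 x * f t1 x)) {t1..t2}"
proof -
  define L where "L j = real j + 1 + \<bar>b\<bar>" for j
  have L1: "L j \<ge> 1" "b \<le> L j" "- L j \<le> b" "L j > 0" for j unfolding L_def by linarith+
  have Lt: "filterlim L at_top sequentially" unfolding L_def
    by (rule filterlim_at_top_mono[OF filterlim_real_sequentially]) simp
  have "continuous_on {t1..t2} (\<lambda>t. \<zeta> t b * g t b)"
    by (intro continuous_intros jcont_slices totdiff_jcont[OF \<zeta>] totdiff_jcont[OF g])
  then have "bounded ((\<lambda>t. \<zeta> t b * g t b) ` {t1..t2})"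
    by (intro compact_imp_bounded compact_continuous_image) auto
  then obtain M1 where M1: "\<And>t. t1 \<le> t \<Longrightarrow> t \<le> t2 \<Longrightarrow> \<bar>\<zeta> t b * g t b\<bar> \<le> M1" unfolding bounded_iff by force
  show ?thesis
  proof (rule weighted_balance_limit[OF f g \<zeta> h eq t12, where L=L and u="\<lambda>j. b" and M="max M M1" and k=k])
    show "k t x = zt t x * f t x + zx t x * g t x + \<zeta> t x * h t x" for t x by (rule k_def)
    show "filterlim L at_top sequentially" by (rule Lt)
    show "\<forall>\<^sub>F j in sequentially. x \<in> {- L j..b}" if "x \<in> {..b}" for x
    proof -
      obtain N :: nat where "real N \<ge> \<bar>x\<bar>" using real_arch_simple by blast
      then show ?thesis using that unfolding eventually_sequentially L_def by (intro exI[of _ N]) auto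
    qed
    fix t assume t: "t1 \<le> t" "t \<le> t2"
    show "(LINT x:{..b}|lborel. \<bar>\<zeta> t x * g t x\<bar>) \<le> max M M1" using bd(1)[OF t] by linarith
    show "(LINT x:{..b}|lborel. \<bar>k t x\<bar>) \<le> max M M1" using bd(2)[OF t] by linarith
    have inv: "(\<lambda>j. 1 / L j) \<longlonglongrightarrow> 0" using tendsto_inverse_0_at_top[OF Lt] by (simp add: inverse_eq_divide)
    have "(\<lambda>j. (1 - (b * (1 / L j))\<^sup>2) * (\<zeta> t b * g t b)) \<longlonglongrightarrow> (1 - (b * 0)\<^sup>2) * (\<zeta> t b * g t b)" by (intro tendsto_intros inv)
    then show "(\<lambda>j. (1 - (b / L j)\<^sup>2) * (\<zeta> t b * g t b)) \<longlonglongrightarrow> \<zeta> t b * g t b" by simp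
    fix j
    have "\<bar>1 - (b / L j)\<^sup>2\<bar> * \<bar>\<zeta> t b * g t b\<bar> \<le> 1 * M1"
      by (intro mult_mono cutoff_bounds(1) M1 t L1) auto
    then show "\<bar>(1 - (b / L j)\<^sup>2) * (\<zeta> t b * g t b)\<bar> \<le> max M M1" unfolding abs_mult by linarith
  qed (use int L1 in auto)
qed

section \<open>Weighted integrals\<close>

lemma integral_derivative_eq_0:
  fixes G g :: "real \<Rightarrow> real"
  assumes D: "\<And>x. (G has_real_derivative g x) (at x)" and c: "continuous_on UNIV g"
    and i: "integrable lborel g" and l: "(G \<longlongrightarrow> 0) at_infinity"
  shows "(LINT x|lborel. g x) = 0"
proof -
  have "(LBINT x=-\<infinity>..\<infinity>. g x) = 0 - 0"
  proof (rule interval_integral_FTC_integrable[where F=G])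
    show "(G has_vector_derivative g x) (at x)" for x
      using D[of x] by (simp add: has_real_derivative_iff_has_vector_derivative)
    show "isCont g x" for x using c by (simp add: continuous_on_eq_continuous_at)
    show "set_integrable lborel (einterval (- \<infinity>) \<infinity>) g" using i by (simp add: set_integrable_def)
    show "((G \<circ> real_of_ereal) \<longlongrightarrow> 0) (at_right (- \<infinity>))" unfolding ereal_tendsto_simps
      using l by (rule filterlim_mono) (auto simp: at_bot_le_at_infinity)
    show "((G \<circ> real_of_ereal) \<longlongrightarrow> 0) (at_left \<infinity>)" unfolding ereal_tendsto_simps
      using l by (rule filterlim_mono) (auto simp: at_top_le_at_infinity)
  qed simp
  then show ?thesis by (simp add: interval_integral_to_infinity_eq interval_lebesgue_integral_def set_lebesgue_integral_def)
qed

text \<open>Bounded continuous functions, the class in which weighted integrals exist and can be manipulated freely.\<close>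

definition bc :: "(real \<Rightarrow> real) \<Rightarrow> bool" where
  "bc F \<longleftrightarrow> continuous_on UNIV F \<and> (\<exists>C. \<forall>x. \<bar>F x\<bar> \<le> C)"

lemma bcI: "continuous_on UNIV F \<Longrightarrow> (\<And>x. \<bar>F x\<bar> \<le> C) \<Longrightarrow> bc F" by (auto simp: bc_def)

lemma bc_const: "bc (\<lambda>x. c)" by (auto simp: bc_def)

lemma bc_add: assumes "bc F" "bc G" shows "bc (\<lambda>x. F x + G x)"
proof -
  obtain C1 C2 where "\<And>x. \<bar>F x\<bar> \<le> C1" "\<And>x. \<bar>G x\<bar> \<le> C2" using assms by (auto simp: bc_def)
  then have "\<bar>F x + G x\<bar> \<le> C1 + C2" for x by (meson abs_triangle_ineq add_mono order_trans)
  then show ?thesis using assms by (intro bcI) (auto simp: bc_def intro!: continuous_intros)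
qed

lemma bc_mult: assumes "bc F" "bc G" shows "bc (\<lambda>x. F x * G x)"
proof -
  obtain C1 C2 where C: "\<And>x. \<bar>F x\<bar> \<le> C1" "\<And>x. \<bar>G x\<bar> \<le> C2" using assms by (auto simp: bc_def)
  then have "\<bar>F x * G x\<bar> \<le> C1 * C2" for x
    unfolding abs_mult by (intro mult_mono C) (use abs_ge_zero order_trans C in blast)+
  then show ?thesis using assms by (intro bcI) (auto simp: bc_def intro!: continuous_intros)
qed

lemma bc_minus: "bc F \<Longrightarrow> bc (\<lambda>x. - F x)" using bc_mult[OF bc_const[of "-1"]] by simp
lemma bc_diff: "bc F \<Longrightarrow> bc G \<Longrightarrow> bc (\<lambda>x. F x - G x)" using bc_add[OF _ bc_minus] by simp
lemma bc_power: "bc F \<Longrightarrow> bc (\<lambda>x. F x ^ n)" by (induction n) (auto intro: bc_const bc_mult)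
lemma bc_divide: "bc F \<Longrightarrow> bc (\<lambda>x. F x / c)" using bc_mult[OF bc_const[of "1/c"]] by simp
lemma bc_abs: "bc F \<Longrightarrow> bc (\<lambda>x. \<bar>F x\<bar>)" by (auto simp: bc_def intro!: continuous_intros)

lemmas bc_intros = bc_const bc_add bc_mult bc_minus bc_diff bc_power bc_divide bc_abs

text \<open>Bumps that vary slowly relative to their own size, so that integrating by parts against them costs a factor \<open>\<kappa>\<close> only.\<close>

definition weight :: "real \<Rightarrow> (real \<Rightarrow> real) \<Rightarrow> (real \<Rightarrow> real) \<Rightarrow> bool" where
  "weight \<kappa> om om' \<longleftrightarrow> (\<forall>x. 0 < om x \<and> om x \<le> 1 \<and> (om has_real_derivative om' x) (at x) \<and> \<bar>om' x\<bar> \<le> \<kappa> * om x)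
     \<and> continuous_on UNIV om' \<and> integrable lborel om \<and> (om \<longlongrightarrow> 0) at_infinity"

lemma weightD:
  assumes "weight \<kappa> om om'"
  shows "0 < om x" "0 \<le> om x" "om x \<le> 1" "(om has_real_derivative om' x) (at x)" "\<bar>om' x\<bar> \<le> \<kappa> * om x"
    "continuous_on UNIV om'" "integrable lborel om" "(om \<longlongrightarrow> 0) at_infinity" "continuous_on UNIV om" "0 \<le> \<kappa>"
    "bc om" "bc om'"
proof -
  show 1: "0 < om x" "0 \<le> om x" "om x \<le> 1" "(om has_real_derivative om' x) (at x)" "\<bar>om' x\<bar> \<le> \<kappa> * om x"
    "continuous_on UNIV om'" "integrable lborel om" "(om \<longlongrightarrow> 0) at_infinity" for x
    using assms by (auto simp: weight_def intro: less_imp_le)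
  show c: "continuous_on UNIV om" using 1(4) by (auto intro!: continuous_at_imp_continuous_on DERIV_isCont)
  have "0 \<le> \<kappa> * om x" using 1(5)[of x] by linarith
  then show k: "0 \<le> \<kappa>" using 1(1)[of x] by (simp add: zero_le_mult_iff)
  have "\<bar>om x\<bar> \<le> 1" for x using 1(2,3)[of x] by simp
  then show "bc om" using c by (rule bcI[rotated])
  have "\<bar>om' x\<bar> \<le> \<kappa> * 1" for x using 1(5)[of x] mult_left_mono[OF 1(3)[of x] k] by linarith
  then show "bc om'" using 1(6) by (rule bcI[rotated])
qed

lemma weight_integrable:
  assumes w: "weight \<kappa> om om'" and F: "bc F"
  shows "integrable lborel (\<lambda>x. om x * F x)" "integrable lborel (\<lambda>x. om' x * F x)"
proof -
  obtain C where C: "\<And>x. \<bar>F x\<bar> \<le> C" using F by (auto simp: bc_def)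
  note wd = weightD[OF w]
  have m: "F \<in> borel_measurable borel" "om \<in> borel_measurable borel" "om' \<in> borel_measurable borel"
    using F wd by (auto simp: bc_def intro: borel_measurable_continuous_onI)
  show "integrable lborel (\<lambda>x. om x * F x)"
  proof (rule Bochner_Integration.integrable_bound[OF integrable_mult_right[OF wd(7), of C]])
    show "AE x in lborel. norm (om x * F x) \<le> norm (C * om x)"
    proof (rule AE_I2)
      fix x
      have "om x * \<bar>F x\<bar> \<le> om x * C" using C wd(2) by (intro mult_left_mono) auto
      then show "norm (om x * F x) \<le> norm (C * om x)" using wd(2)[of x]
        by (simp add: abs_mult) (metis abs_ge_self abs_mult abs_of_nonneg mult.commute order_trans wd(2))
    qed
  qed (use m in simp)
  show "integrable lborel (\<lambda>x. om' x * F x)"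
  proof (rule Bochner_Integration.integrable_bound[OF integrable_mult_right[OF wd(7), of "\<kappa> * C"]])
    show "AE x in lborel. norm (om' x * F x) \<le> norm (\<kappa> * C * om x)"
    proof (rule AE_I2)
      fix x
      have "0 \<le> C" using C[of x] by linarith
      have "\<bar>om' x\<bar> * \<bar>F x\<bar> \<le> (\<kappa> * om x) * C" using C wd(5) \<open>0 \<le> C\<close> wd(2,10) by (intro mult_mono) auto
      then show "norm (om' x * F x) \<le> norm (\<kappa> * C * om x)" using wd(2)[of x] wd(10) \<open>0 \<le> C\<close>
        by (simp add: abs_mult mult_ac)
    qed
  qed (use m in simp)
qed

lemma weight_by_parts:
  assumes w: "weight \<kappa> om om'" and G: "\<And>x. (G has_real_derivative G' x) (at x)" "bc G" "bc G'"
  shows "(LINT x|lborel. om x * G' x) = - (LINT x|lborel. om' x * G x)"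
proof -
  note wd = weightD[OF w] and wi = weight_integrable[OF w]
  have "(LINT x|lborel. om' x * G x + om x * G' x) = 0"
  proof (rule integral_derivative_eq_0[where G="\<lambda>x. om x * G x"])
    show "((\<lambda>x. om x * G x) has_real_derivative om' x * G x + om x * G' x) (at x)" for x
      using DERIV_mult[OF wd(4)[of x] G(1)[of x]] by (simp add: algebra_simps)
    show "continuous_on UNIV (\<lambda>x. om' x * G x + om x * G' x)"
      using G wd by (intro continuous_intros) (auto simp: bc_def)
    show "integrable lborel (\<lambda>x. om' x * G x + om x * G' x)" using wi G by auto
    obtain C where C: "\<And>x. \<bar>G x\<bar> \<le> C" using G(2) by (auto simp: bc_def)
    show "((\<lambda>x. om x * G x) \<longlongrightarrow> 0) at_infinity"
    proof (rule Lim_null_comparison[where g="\<lambda>x. om x * C"])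
      show "\<forall>\<^sub>F x in at_infinity. norm (om x * G x) \<le> om x * C"
        using C wd(2) by (intro always_eventually) (simp add: abs_mult mult_left_mono)
      show "((\<lambda>x. om x * C) \<longlongrightarrow> 0) at_infinity" using tendsto_mult_right[OF wd(8), of C] by simp
    qed
  qed
  then show ?thesis using wi G by simp
qed

lemma weight_mono:
  assumes w: "weight \<kappa> om om'" and F: "bc F" "bc G" "\<And>x. F x \<le> G x"
  shows "(LINT x|lborel. om x * F x) \<le> (LINT x|lborel. om x * G x)"
  using weight_integrable(1)[OF w] F weightD(2)[OF w] by (intro integral_mono mult_left_mono) auto

lemma weight_nonneg:
  assumes w: "weight \<kappa> om om'" and F: "\<And>x. 0 \<le> F x"
  shows "0 \<le> (LINT x|lborel. om x * F x)"
  using F weightD(2)[OF w] by (intro integral_nonneg_AE AE_I2) simp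

lemma weight_deriv_bound:
  assumes w: "weight \<kappa> om om'" and F: "bc F" "bc G" "\<And>x. \<bar>F x\<bar> \<le> G x"
  shows "\<bar>LINT x|lborel. om' x * F x\<bar> \<le> \<kappa> * (LINT x|lborel. om x * G x)"
proof -
  note wd = weightD[OF w] and wi = weight_integrable[OF w]
  have "norm (LINT x|lborel. om' x * F x) \<le> (LINT x|lborel. \<kappa> * (om x * G x))"
  proof (rule Bochner_Integration.integral_norm_bound_integral[OF wi(2)[OF F(1)] integrable_mult_right[OF wi(1)[OF F(2)]]])
    fix x
    have "\<bar>om' x\<bar> * \<bar>F x\<bar> \<le> (\<kappa> * om x) * G x" using F(3) wd(2,5,10) by (intro mult_mono) auto
    then show "norm (om' x * F x) \<le> \<kappa> * (om x * G x)" by (simp add: abs_mult mult.assoc)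
  qed
  then show ?thesis by simp
qed

lemma weight_arith:
  assumes w: "weight \<kappa> om om'" and F: "bc F" "bc G"
  shows "(LINT x|lborel. om x * (F x + G x)) = (LINT x|lborel. om x * F x) + (LINT x|lborel. om x * G x)"
    "(LINT x|lborel. om x * (F x - G x)) = (LINT x|lborel. om x * F x) - (LINT x|lborel. om x * G x)"
proof -
  note wi = weight_integrable(1)[OF w]
  show "(LINT x|lborel. om x * (F x + G x)) = (LINT x|lborel. om x * F x) + (LINT x|lborel. om x * G x)"
    using Bochner_Integration.integral_add[OF wi[OF F(1)] wi[OF F(2)]] by (simp add: distrib_left)
  show "(LINT x|lborel. om x * (F x - G x)) = (LINT x|lborel. om x * F x) - (LINT x|lborel. om x * G x)"
    using Bochner_Integration.integral_diff[OF wi[OF F(1)] wi[OF F(2)]] by (simp add: right_diff_distrib)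
qed

lemma weight_scale: "(LINT x|lborel. om x * (c * F x)) = c * (LINT x|lborel. om x * F x)" for om F :: "real \<Rightarrow> real"
  by (simp add: mult.left_commute[of _ c])

text \<open>Multiply \<open>H' + H = f\<close> by \<open>H\<close>: the derivative of \<open>H\<^sup>2 / 2\<close> integrates to at most half of the weighted integral of \<open>H\<^sup>2\<close>.\<close>

lemma filter_weighted:
  assumes w: "weight \<kappa> om om'" "\<kappa> \<le> 1" and H: "\<And>x. (H has_real_derivative f x - H x) (at x)" "bc H" "bc f"
  shows "0 \<le> (LINT x|lborel. om x * (f x * H x))"
    "(LINT x|lborel. om x * (H x)\<^sup>2) \<le> 4 * (LINT x|lborel. om x * (f x)\<^sup>2)"
proof -
  define IH where "IH = (LINT x|lborel. om x * (H x)\<^sup>2)"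
  define IF where "IF = (LINT x|lborel. om x * (f x)\<^sup>2)"
  define IX where "IX = (LINT x|lborel. om x * (f x * H x))"
  have IH0: "0 \<le> IH" unfolding IH_def by (rule weight_nonneg[OF w(1)]) simp
  have D: "((\<lambda>x. (H x)\<^sup>2) has_real_derivative 2 * (f x * H x) - 2 * (H x)\<^sup>2) (at x)" for x
    by (rule derivative_eq_intros H | simp add: power2_eq_square algebra_simps)+
  have "(LINT x|lborel. om x * (2 * (f x * H x) - 2 * (H x)\<^sup>2)) = - (LINT x|lborel. om' x * (H x)\<^sup>2)"
    by (rule weight_by_parts[OF w(1) D]) (intro bc_intros H)+
  moreover have "(LINT x|lborel. om x * (2 * (f x * H x) - 2 * (H x)\<^sup>2)) = 2 * IX - 2 * IH"
    unfolding IX_def IH_def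
    unfolding weight_scale[symmetric]
    by (rule weight_arith(2)[OF w(1), where F="\<lambda>x. 2 * (f x * H x)" and G="\<lambda>x. 2 * (H x)\<^sup>2"]) (intro bc_intros H)+
  moreover have "\<bar>LINT x|lborel. om' x * (H x)\<^sup>2\<bar> \<le> \<kappa> * IH" unfolding IH_def
    by (rule weight_deriv_bound[OF w(1)]) (intro bc_intros H | simp)+
  moreover have "\<kappa> * IH \<le> 1 * IH" using w(2) IH0 by (rule mult_right_mono)
  ultimately have 1: "IH \<le> 2 * IX" by linarith
  then show "0 \<le> (LINT x|lborel. om x * (f x * H x))" using IH0 unfolding IX_def by linarith
  have "IX \<le> (LINT x|lborel. om x * ((f x)\<^sup>2 + 1/4 * (H x)\<^sup>2))" unfolding IX_def
  proof (rule weight_mono[OF w(1)])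
    show "f x * H x \<le> (f x)\<^sup>2 + 1/4 * (H x)\<^sup>2" for x
      using zero_le_power2[of "f x - H x / 2"] by (simp add: power2_eq_square algebra_simps)
  qed (intro bc_intros H)+
  also have "\<dots> = IF + 1/4 * IH" unfolding IF_def IH_def
    unfolding weight_scale[symmetric]
    by (rule weight_arith(1)[OF w(1), where F="\<lambda>x. (f x)\<^sup>2" and G="\<lambda>x. 1/4 * (H x)\<^sup>2"]) (intro bc_intros H)+
  finally show "(LINT x|lborel. om x * (H x)\<^sup>2) \<le> 4 * (LINT x|lborel. om x * (f x)\<^sup>2)"
    using 1 unfolding IH_def IF_def by linarith
qed

text \<open>Multiply the equation by \<open>v\<close> and integrate by parts; the errors of order \<open>\<kappa>\<close> are absorbed.\<close>

lemma elliptic_weighted: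
  assumes w: "weight \<kappa> om om'" "\<kappa> \<le> 1/4"
    and v: "\<And>x. (v has_real_derivative v' x) (at x)" "\<And>x. (v' has_real_derivative r x - f x) (at x)"
    and mono: "\<And>x. v x * r x \<ge> (v x)\<^sup>2 / 2" and b: "bc v" "bc v'" "bc r" "bc f"
  shows "(LINT x|lborel. om x * (v x)\<^sup>2) \<le> 8 * (LINT x|lborel. om x * (f x)\<^sup>2)"
    "(LINT x|lborel. om x * (v' x)\<^sup>2) \<le> 8 * (LINT x|lborel. om x * (f x)\<^sup>2)"
proof -
  define IV where "IV = (LINT x|lborel. om x * (v x)\<^sup>2)"
  define IW where "IW = (LINT x|lborel. om x * (v' x)\<^sup>2)"
  define IF where "IF = (LINT x|lborel. om x * (f x)\<^sup>2)"
  have n: "0 \<le> IV" "0 \<le> IW" unfolding IV_def IW_def by (rule weight_nonneg[OF w(1)], simp)+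
  have D: "((\<lambda>x. v x * v' x) has_real_derivative (v' x)\<^sup>2 + v x * (r x - f x)) (at x)" for x
    by (rule derivative_eq_intros v | simp add: power2_eq_square algebra_simps)+
  have 1: "(LINT x|lborel. om x * ((v' x)\<^sup>2 + v x * (r x - f x))) = - (LINT x|lborel. om' x * (v x * v' x))"
    by (rule weight_by_parts[OF w(1) D]) (intro bc_intros b)+
  have 2: "\<bar>LINT x|lborel. om' x * (v x * v' x)\<bar> \<le> \<kappa> * (LINT x|lborel. om x * (1/2 * (v x)\<^sup>2 + 1/2 * (v' x)\<^sup>2))"
  proof (rule weight_deriv_bound[OF w(1)])
    show "\<bar>v x * v' x\<bar> \<le> 1/2 * (v x)\<^sup>2 + 1/2 * (v' x)\<^sup>2" for x
      using zero_le_power2[of "v x - v' x"] zero_le_power2[of "v x + v' x"] by (simp add: power2_eq_square algebra_simps abs_le_iff)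
  qed (intro bc_intros b)+
  have 3: "(LINT x|lborel. om x * (1/2 * (v x)\<^sup>2 + 1/2 * (v' x)\<^sup>2)) = 1/2 * IV + 1/2 * IW"
    unfolding IV_def IW_def weight_scale[symmetric]
    by (rule weight_arith(1)[OF w(1), where F="\<lambda>x. 1/2 * (v x)\<^sup>2" and G="\<lambda>x. 1/2 * (v' x)\<^sup>2"]) (intro bc_intros b)+
  have "\<kappa> * (1/2 * IV + 1/2 * IW) \<le> 1/4 * (1/2 * IV + 1/2 * IW)" using w(2) n by (intro mult_right_mono) auto
  then have "\<kappa> * (1/2 * IV + 1/2 * IW) \<le> 1/8 * IV + 1/8 * IW" by (simp add: algebra_simps)
  then have 4: "(LINT x|lborel. om x * ((v' x)\<^sup>2 + v x * (r x - f x))) \<le> 1/8 * IV + 1/8 * IW" using 1 2 unfolding 3 by linarith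
  have "(LINT x|lborel. om x * (((v' x)\<^sup>2 + 3/8 * (v x)\<^sup>2) - 2 * (f x)\<^sup>2)) \<le> (LINT x|lborel. om x * ((v' x)\<^sup>2 + v x * (r x - f x)))"
  proof (rule weight_mono[OF w(1)])
    show "((v' x)\<^sup>2 + 3/8 * (v x)\<^sup>2) - 2 * (f x)\<^sup>2 \<le> (v' x)\<^sup>2 + v x * (r x - f x)" for x
    proof -
      have "v x * f x \<le> 2 * (f x)\<^sup>2 + (v x)\<^sup>2 / 8"
        using zero_le_power2[of "4 * f x - v x"] by (simp add: power2_eq_square algebra_simps)
      then show ?thesis using mono[of x] by (simp add: algebra_simps)
    qed
  qed (intro bc_intros b)+
  moreover have "(LINT x|lborel. om x * (((v' x)\<^sup>2 + 3/8 * (v x)\<^sup>2) - 2 * (f x)\<^sup>2)) = IW + 3/8 * IV - 2 * IF"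
  proof -
    have "(LINT x|lborel. om x * ((v' x)\<^sup>2 + 3/8 * (v x)\<^sup>2)) = IW + 3/8 * IV"
      unfolding IV_def IW_def weight_scale[symmetric]
      by (rule weight_arith(1)[OF w(1), where F="\<lambda>x. (v' x)\<^sup>2" and G="\<lambda>x. 3/8 * (v x)\<^sup>2"]) (intro bc_intros b)+
    moreover have "(LINT x|lborel. om x * (((v' x)\<^sup>2 + 3/8 * (v x)\<^sup>2) - 2 * (f x)\<^sup>2)) =
        (LINT x|lborel. om x * ((v' x)\<^sup>2 + 3/8 * (v x)\<^sup>2)) - 2 * IF"
      unfolding IF_def weight_scale[symmetric]
      by (rule weight_arith(2)[OF w(1), where F="\<lambda>x. (v' x)\<^sup>2 + 3/8 * (v x)\<^sup>2" and G="\<lambda>x. 2 * (f x)\<^sup>2"]) (intro bc_intros b)+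
    ultimately show ?thesis by simp
  qed
  ultimately have 5: "7/8 * IW + 1/4 * IV \<le> 2 * IF" using 4 by linarith
  then show "(LINT x|lborel. om x * (v x)\<^sup>2) \<le> 8 * (LINT x|lborel. om x * (f x)\<^sup>2)"
    using n unfolding IV_def[symmetric] IF_def[symmetric] by linarith
  show "(LINT x|lborel. om x * (v' x)\<^sup>2) \<le> 8 * (LINT x|lborel. om x * (f x)\<^sup>2)"
    using 5 n unfolding IW_def[symmetric] IF_def[symmetric] by linarith
qed

section \<open>The virial inequality on a time slice\<close>

text \<open>The quadratic form that decides the theorem. Minimising over \<open>f\<close> leaves the coefficient \<open>k * (1 + k) / (1 + 2 * k)\<close> of
\<open>n\<^sup>2\<close>, so the form is positive as long as \<open>v\<^sup>2 < 2 * k\<^sup>2 / (1 + 2 * k)\<close>, and \<open>\<theta> * k\<^sup>2\<close> lies below this value. The proof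
gives away a little of the first coefficient to obtain a simple constant.\<close>

lemma virial_main_form:
  fixes k \<theta> v n u f :: real
  assumes k: "k > 0" and \<theta>: "\<theta> * (1 + k) = 1" and v: "v\<^sup>2 \<le> \<theta> * k\<^sup>2"
  shows "(1 - \<theta>) / 2 * u\<^sup>2 - v * n * u + ((1 - \<theta>) * (2 + k) * n\<^sup>2 - 2 * (1 - \<theta>) * n * f + (2 - \<theta>) * f\<^sup>2) / 2
     \<ge> \<theta> * k / (2 * (4 * k + 5)) * (u\<^sup>2 + n\<^sup>2)"
proof -
  have \<theta>0: "\<theta> > 0" using \<theta> k by (metis add_pos_pos zero_less_mult_pos2 zero_less_one)
  have \<theta>k: "1 - \<theta> = \<theta> * k" using \<theta> by (simp add: algebra_simps)
  define \<alpha> where "\<alpha> = k / (k + 5/4)"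
  have \<alpha>: "\<alpha> > 0" using k by (simp add: \<alpha>_def)
  have 1: "2 * (v * n * u) \<le> \<alpha> * u\<^sup>2 + \<theta> * k * (k + 5/4) * n\<^sup>2"
  proof -
    have "0 \<le> (\<alpha> * u - v * n)\<^sup>2 / \<alpha>" using \<alpha> by simp
    also have "\<dots> = \<alpha> * u\<^sup>2 - 2 * (v * n * u) + v\<^sup>2 * n\<^sup>2 / \<alpha>"
      using \<alpha> by (simp add: field_simps power2_eq_square)
    finally have a: "2 * (v * n * u) \<le> \<alpha> * u\<^sup>2 + v\<^sup>2 * n\<^sup>2 / \<alpha>" by simp
    have "v\<^sup>2 * n\<^sup>2 / \<alpha> \<le> \<theta> * k\<^sup>2 * n\<^sup>2 / \<alpha>" using v \<alpha> by (intro divide_right_mono mult_right_mono) auto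
    also have "\<dots> = \<theta> * k * (k + 5/4) * n\<^sup>2" using k by (simp add: \<alpha>_def power2_eq_square)
    finally show ?thesis using a by linarith
  qed
  have 2: "\<alpha> = \<theta> * k - \<theta> * k / (4 * k + 5)"
  proof -
    have nz: "4 * k + 5 \<noteq> 0" using k by simp
    have "\<theta> * k - \<theta> * k / (4 * k + 5) = (\<theta> * (1 + k)) * (4 * k / (4 * k + 5))"
      using nz by (simp add: field_simps)
    also have "\<dots> = 4 * k / (4 * k + 5)" by (simp only: \<theta> mult_1_left)
    also have "\<dots> = \<alpha>" using k unfolding \<alpha>_def by (simp add: field_simps)
    finally show ?thesis by (rule sym)
  qed
  have 3: "(1 - \<theta>) * (2 + k) * n\<^sup>2 - 2 * (1 - \<theta>) * n * f + (2 - \<theta>) * f\<^sup>2 \<ge> \<theta> * k * (k + 3/2) * n\<^sup>2"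
  proof -
    have t2: "2 - \<theta> = \<theta> * (1 + 2 * k)" using \<theta> by (simp add: algebra_simps)
    have "(1 - \<theta>) * (2 + k) * n\<^sup>2 - 2 * (1 - \<theta>) * n * f + (2 - \<theta>) * f\<^sup>2 - \<theta> * k * (k + 3/2) * n\<^sup>2
       = \<theta> * (k / 2 * (n - 2 * f)\<^sup>2 + f\<^sup>2)"
      unfolding \<theta>k t2 by (simp add: power2_eq_square field_simps)
    moreover have "0 \<le> \<theta> * (k / 2 * (n - 2 * f)\<^sup>2 + f\<^sup>2)" using \<theta>0 k by simp
    ultimately show ?thesis by linarith
  qed
  define c where "c = \<theta> * k / (4 * k + 5)"
  have c: "c \<le> \<theta> * k / 4" unfolding c_def using \<theta>0 k by (intro divide_left_mono) auto
  have e: "\<theta> * k / (2 * (4 * k + 5)) = c / 2" by (simp add: c_def)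
  have "c * n\<^sup>2 \<le> \<theta> * k / 4 * n\<^sup>2" using c by (intro mult_right_mono) auto
  then have 4: "c * n\<^sup>2 + \<theta> * k * (k + 5/4) * n\<^sup>2 \<le> \<theta> * k * (k + 3/2) * n\<^sup>2" by (simp add: algebra_simps)
  have 5: "\<alpha> * u\<^sup>2 + c * u\<^sup>2 = (1 - \<theta>) * u\<^sup>2" unfolding \<theta>k 2 c_def[symmetric] by (simp add: algebra_simps)
  show ?thesis unfolding e using 1 3 4 5 by (simp add: field_simps)
qed

text \<open>The integrand of the virial identity. Its last line integrates to a boundary error by the Poisson equation, and the
coefficients \<open>(1 - \<theta>) / 2\<close>, \<open>- (\<theta> / 2 * k)\<close> and \<open>\<theta> / 2\<close> in it are chosen so that the terms in \<open>p\<^sup>2\<close>, \<open>n * p\<close> and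
\<open>f * p\<close> cancel when \<open>a\<close> is replaced by \<open>f - p - D\<close>. What remains of second order is \<open>virial_main_form\<close>.\<close>

lemma virial_pointwise:
  fixes k \<theta> v n u f p a D h m \<delta> C w P Rt q :: real
  assumes k: "k > 0" "k \<le> C" "C \<ge> 1" and \<theta>: "\<theta> * (1 + k) = 1" and v: "v\<^sup>2 \<le> \<theta> * k\<^sup>2"
    and \<delta>: "\<delta> > 0" "\<delta> \<le> 1/4" and n: "\<bar>n\<bar> \<le> \<delta>" "\<bar>a\<bar> \<le> \<delta>" "\<bar>f\<bar> \<le> 2 * \<delta>" and a: "a = f - p - D"
    and w: "\<bar>w - k * n\<bar> \<le> C * n\<^sup>2" and P: "\<bar>P - k * n\<^sup>2 / 2\<bar> \<le> C * \<delta> * n\<^sup>2"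
    and Rt: "\<bar>Rt - f\<^sup>2 / 2\<bar> \<le> 2 * \<delta> * f\<^sup>2" and q: "\<bar>q - f\<bar> \<le> f\<^sup>2"
  shows "- v * n * u + (u\<^sup>2 / 2 + n * u\<^sup>2 + P) + (Rt - p\<^sup>2 / 2)
      + \<theta> / 2 * (u * ((h + m) - (u + n * u)) + (n - a) * (u\<^sup>2 / 2 + w) - a * p)
      + ((1 - \<theta>) / 2 * (p\<^sup>2 + f * (q - n)) + (- (\<theta> / 2 * k)) * (n * p) + \<theta> / 2 * (f * p))
    \<ge> \<theta> * k / (2 * (4 * k + 5)) * (u\<^sup>2 + n\<^sup>2) + \<theta> / 2 * (u * h)
      - 4 * C * \<delta> * (u\<^sup>2 + n\<^sup>2 + f\<^sup>2 + p\<^sup>2 + a\<^sup>2) - 2 * C / \<delta> * (D\<^sup>2 + m\<^sup>2)"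
proof -
  have \<theta>0: "\<theta> > 0" using \<theta> k by (metis add_pos_pos zero_less_mult_pos2 zero_less_one)
  have \<theta>k: "\<theta> * k - (1 - \<theta>) = 0" using \<theta> by (simp add: algebra_simps)
  have \<theta>1: "\<theta> \<le> 1" using \<theta> \<theta>0 k by (smt (verit) mult_pos_pos distrib_left mult_cancel_left1)
  define E1 where "E1 = n * u\<^sup>2"
  define E2 where "E2 = P - k * n\<^sup>2 / 2"
  define E3 where "E3 = Rt - f\<^sup>2 / 2"
  define E4 where "E4 = (1 - \<theta>) / 2 * (f * (q - f))"
  define E5 where "E5 = \<theta> / 2 * ((w - k * n) * (n - a))"
  define E6 where "E6 = \<theta> / 2 * k * (n * D)"
  define E7 where "E7 = \<theta> / 2 * (u * m - n * u\<^sup>2)"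
  define E8 where "E8 = \<theta> / 2 * (u\<^sup>2 / 2 * (n - a))"
  define E9 where "E9 = \<theta> / 2 * (D * p)"
  define Mn where "Mn = (1 - \<theta>) / 2 * u\<^sup>2 - v * n * u + ((1 - \<theta>) * (2 + k) * n\<^sup>2 - 2 * (1 - \<theta>) * n * f + (2 - \<theta>) * f\<^sup>2) / 2"
  have id: "- v * n * u + (u\<^sup>2 / 2 + n * u\<^sup>2 + P) + (Rt - p\<^sup>2 / 2)
      + \<theta> / 2 * (u * ((h + m) - (u + n * u)) + (n - a) * (u\<^sup>2 / 2 + w) - a * p)
      + ((1 - \<theta>) / 2 * (p\<^sup>2 + f * (q - n)) + (- (\<theta> / 2 * k)) * (n * p) + \<theta> / 2 * (f * p))
    = Mn + \<theta> / 2 * (u * h) + E1 + E2 + E3 + E4 + E5 + E6 + E7 + E8 + E9 + (n\<^sup>2 - n * f / 2) * (\<theta> * k - (1 - \<theta>))"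
    unfolding a Mn_def E1_def E2_def E3_def E4_def E5_def E6_def E7_def E8_def E9_def
    by (simp add: power2_eq_square field_simps)
  have Mn: "Mn \<ge> \<theta> * k / (2 * (4 * k + 5)) * (u\<^sup>2 + n\<^sup>2)"
    unfolding Mn_def by (rule virial_main_form[OF k(1) \<theta> v])
  have sc: "\<bar>c * X\<bar> \<le> \<bar>X\<bar>" if "0 \<le> c" "c \<le> 1" for c X :: real
    using mult_right_mono[OF that(2), of "\<bar>X\<bar>"] that(1) by (simp add: abs_mult)
  have th: "0 \<le> \<theta> / 2" "\<theta> / 2 \<le> 1" "0 \<le> (1 - \<theta>) / 2" "(1 - \<theta>) / 2 \<le> 1" using \<theta>0 \<theta>1 by auto
  have na: "\<bar>n - a\<bar> \<le> 2 * \<delta>" using n by linarith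
  have young: "\<bar>x * y\<bar> \<le> \<delta> * x\<^sup>2 + y\<^sup>2 / \<delta>" for x y
  proof -
    have "0 \<le> (\<delta> * \<bar>x\<bar> - \<bar>y\<bar>)\<^sup>2 / \<delta>" using \<delta> by simp
    also have "\<dots> = \<delta> * x\<^sup>2 - 2 * \<bar>x * y\<bar> + y\<^sup>2 / \<delta>"
      using \<delta> by (simp add: field_simps power2_eq_square abs_mult)
    finally show ?thesis using abs_ge_zero[of "x * y"] by linarith
  qed
  have sq: "0 \<le> n\<^sup>2" "0 \<le> u\<^sup>2" "0 \<le> f\<^sup>2" "0 \<le> p\<^sup>2" "0 \<le> a\<^sup>2" "0 \<le> D\<^sup>2" "0 \<le> m\<^sup>2" by simp_all
  have e1: "\<bar>E1\<bar> \<le> \<delta> * u\<^sup>2" unfolding E1_def abs_mult using n(1) by (simp add: mult_right_mono)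
  have e2: "\<bar>E2\<bar> \<le> C * \<delta> * n\<^sup>2" unfolding E2_def by (rule P)
  have e3: "\<bar>E3\<bar> \<le> 2 * \<delta> * f\<^sup>2" unfolding E3_def by (rule Rt)
  have e4: "\<bar>E4\<bar> \<le> 2 * \<delta> * f\<^sup>2"
  proof -
    have "\<bar>E4\<bar> \<le> \<bar>f * (q - f)\<bar>" unfolding E4_def by (rule sc[OF th(3,4)])
    also have "\<dots> \<le> 2 * \<delta> * f\<^sup>2" unfolding abs_mult by (intro mult_mono n q) (use \<delta> in auto)
    finally show ?thesis .
  qed
  have e5: "\<bar>E5\<bar> \<le> C * \<delta> * n\<^sup>2"
  proof -
    have "\<bar>(w - k * n) * (n - a)\<bar> \<le> (C * n\<^sup>2) * (2 * \<delta>)" unfolding abs_mult by (intro mult_mono w na) (use k in auto)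
    then have "\<theta> / 2 * \<bar>(w - k * n) * (n - a)\<bar> \<le> 1 / 2 * ((C * n\<^sup>2) * (2 * \<delta>))"
      using \<theta>1 \<theta>0 by (intro mult_mono) auto
    then show ?thesis unfolding E5_def using \<theta>0 by (simp add: abs_mult mult_ac)
  qed
  have e6: "\<bar>E6\<bar> \<le> C * \<delta> * n\<^sup>2 + C * D\<^sup>2 / \<delta>"
  proof -
    have "\<bar>E6\<bar> = (\<theta> / 2 * k) * \<bar>n * D\<bar>" unfolding E6_def using \<theta>0 k by (simp add: abs_mult)
    also have "\<dots> \<le> (1 * C) * (\<delta> * n\<^sup>2 + D\<^sup>2 / \<delta>)" using th k young by (intro mult_mono) auto
    finally show ?thesis by (simp add: distrib_left mult.assoc)
  qed
  have e7: "\<bar>E7\<bar> \<le> 2 * \<delta> * u\<^sup>2 + m\<^sup>2 / \<delta>"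
  proof -
    have "\<bar>E7\<bar> \<le> \<bar>u * m - n * u\<^sup>2\<bar>" unfolding E7_def by (rule sc[OF th(1,2)])
    also have "\<dots> \<le> \<bar>u * m\<bar> + \<bar>E1\<bar>" unfolding E1_def by (rule abs_triangle_ineq4)
    finally show ?thesis using young[of u m] e1 by linarith
  qed
  have e8: "\<bar>E8\<bar> \<le> \<delta> * u\<^sup>2"
  proof -
    have "\<bar>u\<^sup>2 / 2 * (n - a)\<bar> \<le> u\<^sup>2 / 2 * (2 * \<delta>)" unfolding abs_mult using na by (intro mult_mono) auto
    moreover have "\<bar>E8\<bar> \<le> \<bar>u\<^sup>2 / 2 * (n - a)\<bar>" unfolding E8_def by (rule sc[OF th(1,2)])
    ultimately show ?thesis by (simp add: mult_ac)
  qed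
  have e9: "\<bar>E9\<bar> \<le> \<delta> * p\<^sup>2 + D\<^sup>2 / \<delta>"
  proof -
    have "\<bar>E9\<bar> \<le> \<bar>D * p\<bar>" unfolding E9_def by (rule sc[OF th(1,2)])
    then show ?thesis using young[of p D] by (simp add: mult.commute)
  qed
  define U where "U = \<delta> * u\<^sup>2"
  define N where "N = C * \<delta> * n\<^sup>2"
  define F where "F = \<delta> * f\<^sup>2"
  define Pp where "Pp = \<delta> * p\<^sup>2"
  define Aa where "Aa = C * \<delta> * a\<^sup>2"
  define DD where "DD = D\<^sup>2 / \<delta>"
  define MM where "MM = m\<^sup>2 / \<delta>"
  have pos: "0 \<le> U" "0 \<le> N" "0 \<le> F" "0 \<le> Pp" "0 \<le> Aa" "0 \<le> DD" "0 \<le> MM"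
    using \<delta> k by (auto simp: U_def N_def F_def Pp_def Aa_def DD_def MM_def)
  have C1: "X \<le> C * X" if "0 \<le> X" for X using mult_right_mono[OF k(3) that] by simp
  have S: "4 * C * \<delta> * (u\<^sup>2 + n\<^sup>2 + f\<^sup>2 + p\<^sup>2 + a\<^sup>2) = 4 * (C * U) + 4 * N + 4 * (C * F) + 4 * (C * Pp) + 4 * Aa"
    by (simp add: U_def N_def F_def Pp_def Aa_def algebra_simps)
  have T: "2 * C / \<delta> * (D\<^sup>2 + m\<^sup>2) = 2 * (C * DD) + 2 * (C * MM)"
    by (simp add: DD_def MM_def algebra_simps add_divide_distrib)
  have B: "\<bar>E1\<bar> \<le> U" "\<bar>E2\<bar> \<le> N" "\<bar>E3\<bar> \<le> 2 * F" "\<bar>E4\<bar> \<le> 2 * F" "\<bar>E5\<bar> \<le> N" "\<bar>E6\<bar> \<le> N + C * DD" "\<bar>E7\<bar> \<le> 2 * U + MM" "\<bar>E8\<bar> \<le> U" "\<bar>E9\<bar> \<le> Pp + DD"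
    using e1 e2 e3 e4 e5 e6 e7 e8 e9
    unfolding U_def N_def F_def Pp_def DD_def MM_def mult.assoc times_divide_eq_right by - (assumption+)
  have "- (E1 + E2 + E3 + E4 + E5 + E6 + E7 + E8 + E9) \<le> \<bar>E1\<bar> + \<bar>E2\<bar> + \<bar>E3\<bar> + \<bar>E4\<bar> + \<bar>E5\<bar> + \<bar>E6\<bar> + \<bar>E7\<bar> + \<bar>E8\<bar> + \<bar>E9\<bar>"
  proof -
    have gen: "- (a1 + a2 + a3 + a4 + a5 + a6 + a7 + a8 + a9) \<le> b1 + b2 + b3 + b4 + b5 + b6 + b7 + b8 + b9"
      if "- a1 \<le> b1" "- a2 \<le> b2" "- a3 \<le> b3" "- a4 \<le> b4" "- a5 \<le> b5" "- a6 \<le> b6" "- a7 \<le> b7" "- a8 \<le> b8" "- a9 \<le> b9"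
      for a1 a2 a3 a4 a5 a6 a7 a8 a9 b1 b2 b3 b4 b5 b6 b7 b8 b9 :: real
      using that by linarith
    show ?thesis by (rule gen) (rule abs_ge_minus_self)+
  qed
  also have "\<dots> \<le> 4 * U + 3 * N + 4 * F + Pp + (C * DD + DD) + MM"
  proof -
    have gen: "a1 + a2 + a3 + a4 + a5 + a6 + a7 + a8 + a9 \<le> 4 * U + 3 * N + 4 * F + Pp + (C * DD + DD) + MM"
      if "a1 \<le> U" "a2 \<le> N" "a3 \<le> 2 * F" "a4 \<le> 2 * F" "a5 \<le> N" "a6 \<le> N + C * DD" "a7 \<le> 2 * U + MM" "a8 \<le> U" "a9 \<le> Pp + DD"
      for a1 a2 a3 a4 a5 a6 a7 a8 a9 :: real
      using that by linarith
    show ?thesis by (rule gen[OF B])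
  qed
  also have "\<dots> \<le> 4 * (C * U) + 4 * N + 4 * (C * F) + 4 * (C * Pp) + 4 * Aa + (2 * (C * DD) + 2 * (C * MM))"
    using pos C1[OF pos(1)] C1[OF pos(3)] C1[OF pos(4)] C1[OF pos(6)] C1[OF pos(7)] by linarith
  finally have low: "- (E1 + E2 + E3 + E4 + E5 + E6 + E7 + E8 + E9) \<le>
      4 * C * \<delta> * (u\<^sup>2 + n\<^sup>2 + f\<^sup>2 + p\<^sup>2 + a\<^sup>2) + 2 * C / \<delta> * (D\<^sup>2 + m\<^sup>2)" unfolding S T .
  have sum: "X - b - c \<le> M + h' + E1 + E2 + E3 + E4 + E5 + E6 + E7 + E8 + E9 + z * 0"
    if "y \<le> M" "X = y + h'" "- (E1 + E2 + E3 + E4 + E5 + E6 + E7 + E8 + E9) \<le> b + c" for X b c M h' z y :: real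
    using that by simp
  show ?thesis unfolding id \<theta>k by (rule sum[OF Mn refl low])
qed

text \<open>The terms that are multiplied by the derivative of the weight.\<close>

lemma virial_boundary_pointwise:
  fixes k \<theta> v n u f p a \<delta> C w Rt :: real
  assumes k: "k > 0" "k \<le> C" "C \<ge> 1" and \<theta>: "\<theta> * (1 + k) = 1" and v: "v\<^sup>2 \<le> \<theta> * k\<^sup>2"
    and \<delta>: "\<delta> > 0" "\<delta> \<le> 1/4" and n: "\<bar>n\<bar> \<le> \<delta>" "\<bar>a\<bar> \<le> \<delta>"
    and w: "\<bar>w - k * n\<bar> \<le> C * n\<^sup>2" and Rt: "\<bar>Rt - f\<^sup>2 / 2\<bar> \<le> 2 * \<delta> * f\<^sup>2"
  shows "\<bar>\<theta> / 2 * (- v * a * u + a * (u\<^sup>2 / 2 + w)) + ((1 - \<theta>) / 2 * (f * p) + (- (\<theta> / 2 * k)) * (Rt - p\<^sup>2 / 2) + \<theta> / 2 * (f\<^sup>2 / 2))\<bar>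
    \<le> 8 * C * (u\<^sup>2 + n\<^sup>2 + f\<^sup>2 + p\<^sup>2 + a\<^sup>2)"
proof -
  have \<theta>0: "\<theta> > 0" using \<theta> k by (metis add_pos_pos zero_less_mult_pos2 zero_less_one)
  have \<theta>1: "\<theta> \<le> 1" using \<theta> \<theta>0 k by (smt (verit) mult_pos_pos distrib_left mult_cancel_left1)
  have v1: "\<bar>v\<bar> \<le> C"
  proof -
    have "\<theta> * k\<^sup>2 \<le> 1 * k\<^sup>2" using \<theta>1 by (intro mult_right_mono) auto
    then have "v\<^sup>2 \<le> k\<^sup>2" using v by linarith
    then have "\<bar>v\<bar> \<le> k" using k(1) by (simp add: abs_le_square_iff[symmetric])
    then show ?thesis using k by linarith
  qed
  have sc: "\<bar>c * X\<bar> \<le> \<bar>X\<bar>" if "0 \<le> c" "c \<le> 1" for c X :: real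
    using mult_right_mono[OF that(2), of "\<bar>X\<bar>"] that(1) by (simp add: abs_mult)
  have th: "0 \<le> \<theta> / 2" "\<theta> / 2 \<le> 1" "0 \<le> (1 - \<theta>) / 2" "(1 - \<theta>) / 2 \<le> 1" using \<theta>0 \<theta>1 by auto
  have young: "\<bar>x * y\<bar> \<le> x\<^sup>2 + y\<^sup>2" for x y :: real
  proof -
    have "0 \<le> (\<bar>x\<bar> - \<bar>y\<bar>)\<^sup>2" by simp
    also have "\<dots> = x\<^sup>2 - 2 * \<bar>x * y\<bar> + y\<^sup>2" by (simp add: power2_eq_square algebra_simps abs_mult)
    finally show ?thesis using abs_ge_zero[of "x * y"] by linarith
  qed
  have C1: "X \<le> C * X" if "0 \<le> X" for X using mult_right_mono[OF k(3) that] by simp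
  have w2: "\<bar>w\<bar> \<le> 2 * C * \<bar>n\<bar>"
  proof -
    have "C * n\<^sup>2 \<le> C * \<bar>n\<bar>"
    proof -
      have "\<bar>n\<bar> * \<bar>n\<bar> \<le> \<bar>n\<bar> * 1" using n \<delta> by (intro mult_left_mono) auto
      then show ?thesis using k by (intro mult_left_mono) (auto simp: power2_eq_square)
    qed
    moreover have "\<bar>k * n\<bar> \<le> C * \<bar>n\<bar>" using k by (simp add: abs_mult mult_right_mono)
    ultimately show ?thesis using w by linarith
  qed
  define U where "U = C * u\<^sup>2"
  define N where "N = C * n\<^sup>2"
  define F where "F = C * f\<^sup>2"
  define Pp where "Pp = C * p\<^sup>2"
  define Aa where "Aa = C * a\<^sup>2"
  have pos: "0 \<le> U" "0 \<le> N" "0 \<le> F" "0 \<le> Pp" "0 \<le> Aa" using k by (auto simp: U_def N_def F_def Pp_def Aa_def)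
  have ge: "u\<^sup>2 \<le> U" "f\<^sup>2 \<le> F" "p\<^sup>2 \<le> Pp" unfolding U_def F_def Pp_def by (rule C1, simp)+
  have 1: "\<bar>\<theta> / 2 * (v * a * u)\<bar> \<le> Aa + U"
  proof -
    have "\<bar>v\<bar> * \<bar>a * u\<bar> \<le> C * (a\<^sup>2 + u\<^sup>2)" using v1 young by (intro mult_mono) (use k in auto)
    then show ?thesis using sc[OF th(1,2), of "v * a * u"] by (simp add: abs_mult Aa_def U_def algebra_simps)
  qed
  have 2: "\<bar>\<theta> / 2 * (a * (u\<^sup>2 / 2))\<bar> \<le> U"
  proof -
    have "\<bar>a\<bar> * (u\<^sup>2 / 2) \<le> 1 * u\<^sup>2" using n \<delta> by (intro mult_mono) auto
    then show ?thesis using sc[OF th(1,2), of "a * (u\<^sup>2 / 2)"] ge by (simp add: abs_mult)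
  qed
  have 3: "\<bar>\<theta> / 2 * (a * w)\<bar> \<le> 2 * Aa + 2 * N"
  proof -
    have "\<bar>a\<bar> * \<bar>w\<bar> \<le> \<bar>a\<bar> * (2 * C * \<bar>n\<bar>)" using w2 by (intro mult_left_mono) auto
    also have "\<dots> = 2 * (C * \<bar>a * n\<bar>)" by (simp add: abs_mult mult_ac)
    also have "C * \<bar>a * n\<bar> \<le> C * (a\<^sup>2 + n\<^sup>2)" using young k by (intro mult_left_mono) auto
    finally show ?thesis using sc[OF th(1,2), of "a * w"] by (simp add: abs_mult Aa_def N_def algebra_simps)
  qed
  have 4: "\<bar>(1 - \<theta>) / 2 * (f * p)\<bar> \<le> F + Pp" using sc[OF th(3,4), of "f * p"] young[of f p] ge by linarith
  have 5: "\<bar>\<theta> / 2 * k * (Rt - p\<^sup>2 / 2)\<bar> \<le> F + Pp"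
  proof -
    have "2 * \<delta> * f\<^sup>2 \<le> 1 / 2 * f\<^sup>2" using \<delta> by (intro mult_right_mono) auto
    then have "\<bar>Rt - p\<^sup>2 / 2\<bar> \<le> f\<^sup>2 + p\<^sup>2" using Rt zero_le_power2[of p] by linarith
    moreover have "\<bar>\<theta> / 2 * k\<bar> \<le> 1 * C"
    proof -
      have "\<theta> / 2 * k \<le> 1 * C" using th k by (intro mult_mono) auto
      then show ?thesis using th(1) k(1) by (simp only: abs_mult abs_of_nonneg less_imp_le)
    qed
    ultimately have "\<bar>\<theta> / 2 * k\<bar> * \<bar>Rt - p\<^sup>2 / 2\<bar> \<le> (1 * C) * (f\<^sup>2 + p\<^sup>2)"
      using k by (intro mult_mono) auto
    then show ?thesis unfolding abs_mult[symmetric] F_def Pp_def by (simp only: mult_1_left distrib_left)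
  qed
  have 6: "\<bar>\<theta> / 2 * (f\<^sup>2 / 2)\<bar> \<le> F" using sc[OF th(1,2), of "f\<^sup>2 / 2"] ge by simp
  have "\<theta> / 2 * (- v * a * u + a * (u\<^sup>2 / 2 + w)) + ((1 - \<theta>) / 2 * (f * p) + (- (\<theta> / 2 * k)) * (Rt - p\<^sup>2 / 2) + \<theta> / 2 * (f\<^sup>2 / 2))
    = - (\<theta> / 2 * (v * a * u)) + \<theta> / 2 * (a * (u\<^sup>2 / 2)) + \<theta> / 2 * (a * w) + (1 - \<theta>) / 2 * (f * p) - \<theta> / 2 * k * (Rt - p\<^sup>2 / 2) + \<theta> / 2 * (f\<^sup>2 / 2)"
    by (simp add: algebra_simps)
  also have "\<bar>\<dots>\<bar> \<le> (Aa + U) + U + (2 * Aa + 2 * N) + (F + Pp) + (F + Pp) + F"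
  proof -
    have gen: "\<bar>- a1 + a2 + a3 + a4 - a5 + a6\<bar> \<le> b1 + b2 + b3 + b4 + b5 + b6"
      if "\<bar>a1\<bar> \<le> b1" "\<bar>a2\<bar> \<le> b2" "\<bar>a3\<bar> \<le> b3" "\<bar>a4\<bar> \<le> b4" "\<bar>a5\<bar> \<le> b5" "\<bar>a6\<bar> \<le> b6"
      for a1 a2 a3 a4 a5 a6 b1 b2 b3 b4 b5 b6 :: real
      using that unfolding abs_le_iff by linarith
    show ?thesis by (rule gen[OF 1 2 3 4 5 6])
  qed
  also have "\<dots> \<le> 8 * U + 8 * N + 8 * F + 8 * Pp + 8 * Aa" using pos by linarith
  also have "\<dots> = 8 * C * (u\<^sup>2 + n\<^sup>2 + f\<^sup>2 + p\<^sup>2 + a\<^sup>2)" by (simp add: U_def N_def F_def Pp_def Aa_def algebra_simps)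
  finally show ?thesis .
qed

lemma exp_small_bounds:
  fixes x :: real
  assumes "\<bar>x\<bar> \<le> 1/2"
  shows "\<bar>exp x - 1 - x\<bar> \<le> x\<^sup>2" "\<bar>exp x - 1 - x - x\<^sup>2 / 2\<bar> \<le> \<bar>x\<bar> * x\<^sup>2" "x * (exp x - 1) \<ge> x\<^sup>2 / 2"
    "0 \<le> exp x - 1 - x"
proof -
  have e2: "exp t \<le> 2" if "\<bar>t\<bar> \<le> \<bar>x\<bar>" for t
  proof -
    have "exp t \<le> exp (1/2)" using that assms by simp
    also have "exp (1/2::real) \<le> 1 + 1/2 + (1/2)\<^sup>2" by (rule exp_bound) auto
    finally show ?thesis by (simp add: power2_eq_square)
  qed
  obtain t1 where t1: "\<bar>t1\<bar> \<le> \<bar>x\<bar>" "exp x = (\<Sum>m<1. x ^ m / fact m) + exp t1 / fact 1 * x ^ 1"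
    using Maclaurin_exp_le by blast
  obtain t2 where t2: "\<bar>t2\<bar> \<le> \<bar>x\<bar>" "exp x = (\<Sum>m<2. x ^ m / fact m) + exp t2 / fact 2 * x ^ 2"
    using Maclaurin_exp_le by blast
  obtain t3 where t3: "\<bar>t3\<bar> \<le> \<bar>x\<bar>" "exp x = (\<Sum>m<3. x ^ m / fact m) + exp t3 / fact 3 * x ^ 3"
    using Maclaurin_exp_le by blast
  have 1: "exp x - 1 = exp t1 * x" using t1(2) by simp
  have 2: "exp x - 1 - x = exp t2 / 2 * x\<^sup>2" using t2(2) by (simp add: numeral_2_eq_2)
  have 3: "exp x - 1 - x - x\<^sup>2 / 2 = exp t3 / 6 * (x * x\<^sup>2)" using t3(2) by (simp add: eval_nat_numeral fact_numeral)
  show "0 \<le> exp x - 1 - x" unfolding 2 by simp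
  have "exp t2 / 2 * x\<^sup>2 \<le> 1 * x\<^sup>2" using e2[OF t2(1)] by (intro mult_right_mono) auto
  then show "\<bar>exp x - 1 - x\<bar> \<le> x\<^sup>2" unfolding 2 by simp
  have "\<bar>exp t3 / 6 * (x * x\<^sup>2)\<bar> = exp t3 / 6 * (\<bar>x\<bar> * x\<^sup>2)" by (simp add: abs_mult)
  also have "\<dots> \<le> 1 * (\<bar>x\<bar> * x\<^sup>2)" using e2[OF t3(1)] by (intro mult_right_mono) auto
  finally show "\<bar>exp x - 1 - x - x\<^sup>2 / 2\<bar> \<le> \<bar>x\<bar> * x\<^sup>2" unfolding 3 by simp
  have "1 + t1 \<le> exp t1" by (rule exp_ge_add_one_self)
  then have "1 / 2 \<le> exp t1" using t1(1) assms by linarith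
  then have "1 / 2 * x\<^sup>2 \<le> exp t1 * x\<^sup>2" by (intro mult_right_mono) auto
  then show "x * (exp x - 1) \<ge> x\<^sup>2 / 2" unfolding 1 by (simp add: power2_eq_square mult_ac)
qed

text \<open>The derivative of the virial functional at one time is bounded below by the localised mass. Adding a divergence brings the
integrand into the form of \<open>virial_pointwise\<close>; \<open>filter_weighted\<close> gives the sign of \<open>u * hu\<close>, and with \<open>elliptic_weighted\<close> it
bounds the remaining errors by the localised mass itself. The difference \<open>f - p - a\<close> is again a filtered quantity, with a
quadratically small source.\<close>

proposition virial_static:
  fixes n u f p a hu hn om om' X P w :: "real \<Rightarrow> real" and k \<theta> v \<delta> C \<kappa> :: real
  assumes wt: "weight \<kappa> om om'" "\<kappa> \<le> 1/4"
    and k: "k > 0" "k \<le> C" "C \<ge> 1" and \<theta>: "\<theta> * (1 + k) = 1" and v: "v\<^sup>2 \<le> \<theta> * k\<^sup>2"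
    and \<delta>: "\<delta> > 0" "\<delta> \<le> 1/4"
    and bd: "\<And>x. \<bar>n x\<bar> \<le> \<delta>" "\<And>x. \<bar>a x\<bar> \<le> \<delta>" "\<And>x. \<bar>f x\<bar> \<le> 2 * \<delta>"
    and wb: "\<And>x. \<bar>w x - k * n x\<bar> \<le> C * (n x)\<^sup>2" and Pb: "\<And>x. \<bar>P x - k * (n x)\<^sup>2 / 2\<bar> \<le> C * \<delta> * (n x)\<^sup>2"
    and D: "\<And>x. (f has_real_derivative p x) (at x)" "\<And>x. (p has_real_derivative exp (f x) - 1 - n x) (at x)"
      "\<And>x. (a has_real_derivative n x - a x) (at x)" "\<And>x. (hu has_real_derivative u x - hu x) (at x)"
      "\<And>x. (hn has_real_derivative n x * u x - hn x) (at x)" "\<And>x. (X has_real_derivative om x) (at x)"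
    and b: "bc n" "bc u" "bc f" "bc p" "bc a" "bc hu" "bc hn" "bc P" "bc w" "bc X"
    and int: "integrable lborel (\<lambda>x. n x * p x)" and lim: "(f \<longlongrightarrow> 0) at_infinity" "(p \<longlongrightarrow> 0) at_infinity"
  shows "(\<theta> * k / (2 * (4 * k + 5)) - C * (400 * \<delta> + 200 * \<kappa>)) * (LINT x|lborel. om x * ((u x)\<^sup>2 + (n x)\<^sup>2)) \<le>
     (LINT x|lborel. (- v * om x) * (n x * u x) + om x * ((u x)\<^sup>2 / 2 + n x * (u x)\<^sup>2 + P x) + X x * (- (n x * p x)))
     + \<theta> / 2 * (LINT x|lborel. (- v * om' x * a x + om x * ((hu x + hn x) - (u x + n x * u x))) * u x
        + (om' x * a x + om x * (n x - a x)) * ((u x)\<^sup>2 / 2 + w x) + (om x * a x) * (- p x))"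
    (is "?L \<le> (LINT x|lborel. ?KM x) + \<theta> / 2 * (LINT x|lborel. ?KB x)")
proof -
  note wd = weightD[OF wt(1)] and wi = weight_integrable[OF wt(1)]
  define I where "I F = (LINT x|lborel. om x * F x)" for F
  define L where "L F = (LINT x|lborel. om' x * F x)" for F
  define Rt where "Rt x = exp (f x) - 1 - f x" for x
  have fh: "\<bar>f x\<bar> \<le> 1/2" for x using bd(3)[of x] \<delta> by linarith
  note eb = exp_small_bounds[OF fh]
  have contf: "continuous_on UNIV f" using b(3) by (simp add: bc_def)
  have be: "bc (\<lambda>x. exp (f x))"
  proof (rule bcI)
    show "continuous_on UNIV (\<lambda>x. exp (f x))" by (intro continuous_intros contf)
    show "\<bar>exp (f x)\<bar> \<le> exp (1/2)" for x using fh[of x] by simp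
  qed
  have bR: "bc Rt" unfolding Rt_def by (intro bc_intros be b)
  note bb = be bR b
  define Dd where "Dd x = f x - p x - a x" for x
  define Z where "Z x = (1 - \<theta>) / 2 * ((p x)\<^sup>2 + f x * ((exp (f x) - 1) - n x)) + (- (\<theta> / 2 * k)) * (n x * p x) + \<theta> / 2 * (f x * p x)" for x
  define T1 where "T1 x = (1 - \<theta>) / 2 * (f x * p x) + (- (\<theta> / 2 * k)) * (Rt x - (p x)\<^sup>2 / 2) + \<theta> / 2 * ((f x)\<^sup>2 / 2)" for x
  define T0 where "T0 x = - v * a x * u x + a x * ((u x)\<^sup>2 / 2 + w x)" for x
  define A1 where "A1 x = - v * n x * u x + ((u x)\<^sup>2 / 2 + n x * (u x)\<^sup>2 + P x) + (Rt x - (p x)\<^sup>2 / 2)" for x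
  define B1 where "B1 x = u x * ((hu x + hn x) - (u x + n x * u x)) + (n x - a x) * ((u x)\<^sup>2 / 2 + w x) - a x * p x" for x
  define S where "S x = (u x)\<^sup>2 + (n x)\<^sup>2 + (f x)\<^sup>2 + (p x)\<^sup>2 + (a x)\<^sup>2" for x
  have bZ: "bc Z" and bT1: "bc T1" and bT0: "bc T0" and bA1: "bc A1" and bB1: "bc B1" and bS: "bc S" and bD: "bc Dd"
    unfolding Z_def T1_def T0_def A1_def B1_def S_def Dd_def by (intro bc_intros bb)+
  have DR: "((\<lambda>x. Rt x - (p x)\<^sup>2 / 2) has_real_derivative n x * p x) (at x)" for x
    unfolding Rt_def by (rule derivative_eq_intros D refl | simp add: field_simps)+
  have DT1: "(T1 has_real_derivative Z x) (at x)" for x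
    unfolding T1_def Z_def
  proof -
    have 1: "((\<lambda>x. f x * p x) has_real_derivative (p x)\<^sup>2 + f x * ((exp (f x) - 1) - n x)) (at x)"
      using DERIV_mult[OF D(1)[of x] D(2)[of x]] by (simp add: power2_eq_square algebra_simps)
    have 2: "((\<lambda>x. (f x)\<^sup>2 / 2) has_real_derivative f x * p x) (at x)"
      by (auto intro!: derivative_eq_intros D(1))
    show "((\<lambda>x. (1 - \<theta>) / 2 * (f x * p x) + (- (\<theta> / 2 * k)) * (Rt x - (p x)\<^sup>2 / 2) + \<theta> / 2 * ((f x)\<^sup>2 / 2)) has_real_derivative
       (1 - \<theta>) / 2 * ((p x)\<^sup>2 + f x * ((exp (f x) - 1) - n x)) + (- (\<theta> / 2 * k)) * (n x * p x) + \<theta> / 2 * (f x * p x)) (at x)"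
      by (rule DERIV_add[OF DERIV_add[OF DERIV_cmult[OF 1] DERIV_cmult[OF DR]] DERIV_cmult[OF 2]])
  qed
  have "(LINT x|lborel. X x * (n x * p x) + om x * (Rt x - (p x)\<^sup>2 / 2)) = 0"
  proof (rule integral_derivative_eq_0[where G="\<lambda>x. X x * (Rt x - (p x)\<^sup>2 / 2)"])
    show "((\<lambda>x. X x * (Rt x - (p x)\<^sup>2 / 2)) has_real_derivative X x * (n x * p x) + om x * (Rt x - (p x)\<^sup>2 / 2)) (at x)" for x
      using DERIV_mult[OF D(6)[of x] DR[of x]] by (simp add: algebra_simps)
    show "continuous_on UNIV (\<lambda>x. X x * (n x * p x) + om x * (Rt x - (p x)\<^sup>2 / 2))"
      using bb wd(9) by (intro continuous_intros) (auto simp: bc_def)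
    obtain CX where CX: "\<And>x. \<bar>X x\<bar> \<le> CX" using b(10) by (auto simp: bc_def)
    have iX: "integrable lborel (\<lambda>x. X x * (n x * p x))"
    proof (rule Bochner_Integration.integrable_bound[OF integrable_mult_right[OF int, of CX]])
      show "(\<lambda>x. X x * (n x * p x)) \<in> borel_measurable lborel"
        using bb by (auto simp: bc_def intro!: borel_measurable_continuous_onI continuous_intros)
      show "AE x in lborel. norm (X x * (n x * p x)) \<le> norm (CX * (n x * p x))"
        using CX by (intro AE_I2) (auto simp: abs_mult intro!: mult_right_mono intro: order_trans[OF _ abs_ge_self])
    qed
    show "integrable lborel (\<lambda>x. X x * (n x * p x) + om x * (Rt x - (p x)\<^sup>2 / 2))"
      by (intro Bochner_Integration.integrable_add iX wi(1) bc_intros bb)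
    have l0: "((\<lambda>x. Rt x - (p x)\<^sup>2 / 2) \<longlongrightarrow> (exp 0 - 1 - 0) - 0\<^sup>2 / 2) at_infinity"
      unfolding Rt_def by (intro tendsto_intros lim) simp
    show "((\<lambda>x. X x * (Rt x - (p x)\<^sup>2 / 2)) \<longlongrightarrow> 0) at_infinity"
    proof (rule Lim_null_comparison[where g="\<lambda>x. CX * \<bar>Rt x - (p x)\<^sup>2 / 2\<bar>"])
      show "\<forall>\<^sub>F x in at_infinity. norm (X x * (Rt x - (p x)\<^sup>2 / 2)) \<le> CX * \<bar>Rt x - (p x)\<^sup>2 / 2\<bar>"
        using CX by (intro always_eventually) (simp add: abs_mult mult_right_mono)
      have "((\<lambda>x. CX * \<bar>Rt x - (p x)\<^sup>2 / 2\<bar>) \<longlongrightarrow> CX * \<bar>(exp 0 - 1 - 0) - 0\<^sup>2 / 2\<bar>) at_infinity"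
        by (intro tendsto_intros l0)
      then show "((\<lambda>x. CX * \<bar>Rt x - (p x)\<^sup>2 / 2\<bar>) \<longlongrightarrow> 0) at_infinity" by simp
    qed
  qed
  moreover have iX: "integrable lborel (\<lambda>x. X x * (n x * p x))"
  proof -
    obtain CX where CX: "\<And>x. \<bar>X x\<bar> \<le> CX" using b(10) by (auto simp: bc_def)
    show ?thesis
    proof (rule Bochner_Integration.integrable_bound[OF integrable_mult_right[OF int, of CX]])
      show "(\<lambda>x. X x * (n x * p x)) \<in> borel_measurable lborel"
        using bb by (auto simp: bc_def intro!: borel_measurable_continuous_onI continuous_intros)
      show "AE x in lborel. norm (X x * (n x * p x)) \<le> norm (CX * (n x * p x))"
        using CX by (intro AE_I2) (auto simp: abs_mult intro!: mult_right_mono intro: order_trans[OF _ abs_ge_self])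
    qed
  qed
  ultimately have Z1: "(LINT x|lborel. X x * (n x * p x)) = - I (\<lambda>x. Rt x - (p x)\<^sup>2 / 2)"
    unfolding I_def
    using Bochner_Integration.integral_add[OF iX wi(1)[of "\<lambda>x. Rt x - (p x)\<^sup>2 / 2", OF bc_diff[OF bR bc_divide[OF bc_power[OF b(4)]]]]] by simp
  define A0 where "A0 x = - v * n x * u x + ((u x)\<^sup>2 / 2 + n x * (u x)\<^sup>2 + P x)" for x
  have bA0: "bc A0" unfolding A0_def by (intro bc_intros bb)
  have KM: "(LINT x|lborel. ?KM x) = I A1"
  proof -
    have "(LINT x|lborel. ?KM x) = (LINT x|lborel. om x * A0 x - X x * (n x * p x))"
      by (rule Bochner_Integration.integral_cong) (simp_all add: A0_def field_simps)
    also have "\<dots> = I A0 - (LINT x|lborel. X x * (n x * p x))" unfolding I_def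
      by (rule Bochner_Integration.integral_diff[OF wi(1)[OF bA0] iX])
    also have "\<dots> = I A0 + I (\<lambda>x. Rt x - (p x)\<^sup>2 / 2)" unfolding Z1 by simp
    also have "\<dots> = I (\<lambda>x. A0 x + (Rt x - (p x)\<^sup>2 / 2))" unfolding I_def
      by (rule weight_arith(1)[OF wt(1) bA0, symmetric]) (intro bc_intros bb)
    also have "\<dots> = I A1" by (simp only: I_def A0_def A1_def)
    finally show ?thesis .
  qed
  have KB: "(LINT x|lborel. ?KB x) = I B1 + L T0"
  proof -
    have "(LINT x|lborel. ?KB x) = (LINT x|lborel. om x * B1 x + om' x * T0 x)"
      by (rule Bochner_Integration.integral_cong) (simp_all add: B1_def T0_def field_simps)
    also have "\<dots> = I B1 + L T0" unfolding I_def L_def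
      by (rule Bochner_Integration.integral_add[OF wi(1)[OF bB1] wi(2)[OF bT0]])
    finally show ?thesis .
  qed
  have IZ: "I Z = - L T1" unfolding I_def L_def by (rule weight_by_parts[OF wt(1) DT1 bT1 bZ])
  define Ks where "Ks x = A1 x + \<theta> / 2 * B1 x + Z x" for x
  have bKs: "bc Ks" unfolding Ks_def by (intro bc_intros bA1 bB1 bZ)
  have IKs: "I Ks = I A1 + \<theta> / 2 * I B1 + I Z"
  proof -
    have "I Ks = I (\<lambda>x. A1 x + \<theta> / 2 * B1 x) + I Z" unfolding I_def Ks_def
      by (rule weight_arith(1)[OF wt(1) _ bZ]) (intro bc_intros bA1 bB1)
    also have "I (\<lambda>x. A1 x + \<theta> / 2 * B1 x) = I A1 + I (\<lambda>x. \<theta> / 2 * B1 x)" unfolding I_def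
      by (rule weight_arith(1)[OF wt(1) bA1]) (intro bc_intros bB1)
    also have "I (\<lambda>x. \<theta> / 2 * B1 x) = \<theta> / 2 * I B1" unfolding I_def by (rule weight_scale)
    finally show ?thesis .
  qed
  have LT: "L (\<lambda>x. \<theta> / 2 * T0 x + T1 x) = \<theta> / 2 * L T0 + L T1"
    unfolding L_def using wi(2)[OF bT0] wi(2)[OF bT1]
    by (simp add: distrib_left mult.left_commute[of _ "\<theta> / 2"] del: times_divide_eq_left times_divide_eq_right)
  have total: "(LINT x|lborel. ?KM x) + \<theta> / 2 * (LINT x|lborel. ?KB x) = I Ks + L (\<lambda>x. \<theta> / 2 * T0 x + T1 x)"
    unfolding KM KB IKs LT IZ by (simp add: field_simps)
  define U where "U = I (\<lambda>x. (u x)\<^sup>2)"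
  define N where "N = I (\<lambda>x. (n x)\<^sup>2)"
  have UN: "0 \<le> U" "0 \<le> N" unfolding U_def N_def I_def by (rule weight_nonneg[OF wt(1)], simp)+
  have k1: "\<kappa> \<le> 1" using wt(2) by simp
  have Fb: "I (\<lambda>x. (f x)\<^sup>2) \<le> 8 * N" "I (\<lambda>x. (p x)\<^sup>2) \<le> 8 * N"
    unfolding I_def N_def by (rule elliptic_weighted[OF wt D(1,2) eb(3)]; intro bc_intros bb)+
  have Ab: "I (\<lambda>x. (a x)\<^sup>2) \<le> 4 * N"
    unfolding I_def N_def by (rule filter_weighted(2)[OF wt(1) k1 D(3) b(5,1)])
  have hu0: "0 \<le> I (\<lambda>x. u x * hu x)"
    unfolding I_def by (rule filter_weighted(1)[OF wt(1) k1 D(4) b(6,2)])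
  have Hb: "I (\<lambda>x. (hn x)\<^sup>2) \<le> 4 * \<delta>\<^sup>2 * U"
  proof -
    have "I (\<lambda>x. (hn x)\<^sup>2) \<le> 4 * I (\<lambda>x. (n x * u x)\<^sup>2)"
      unfolding I_def by (rule filter_weighted(2)[OF wt(1) k1 D(5) b(7)]) (intro bc_intros bb)
    also have "I (\<lambda>x. (n x * u x)\<^sup>2) \<le> I (\<lambda>x. \<delta>\<^sup>2 * (u x)\<^sup>2)" unfolding I_def
    proof (rule weight_mono[OF wt(1)])
      show "(n x * u x)\<^sup>2 \<le> \<delta>\<^sup>2 * (u x)\<^sup>2" for x
        unfolding power_mult_distrib using bd(1)[of x] \<delta>(1) by (intro mult_right_mono) (simp_all add: abs_le_square_iff[symmetric])
    qed (intro bc_intros bb)+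
    also have "I (\<lambda>x. \<delta>\<^sup>2 * (u x)\<^sup>2) = \<delta>\<^sup>2 * U" unfolding I_def U_def by (rule weight_scale)
    finally show ?thesis by simp
  qed
  have Db: "I (\<lambda>x. (Dd x)\<^sup>2) \<le> 128 * \<delta>\<^sup>2 * N"
  proof -
    have dd: "(Dd has_real_derivative (f x - (exp (f x) - 1)) - Dd x) (at x)" for x
      unfolding Dd_def by (rule derivative_eq_intros D refl | simp add: algebra_simps)+
    have "I (\<lambda>x. (Dd x)\<^sup>2) \<le> 4 * I (\<lambda>x. (f x - (exp (f x) - 1))\<^sup>2)"
      unfolding I_def by (rule filter_weighted(2)[OF wt(1) k1 dd bD]) (intro bc_intros bb)
    also have "I (\<lambda>x. (f x - (exp (f x) - 1))\<^sup>2) \<le> I (\<lambda>x. (4 * \<delta>\<^sup>2) * (f x)\<^sup>2)" unfolding I_def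
    proof (rule weight_mono[OF wt(1)])
      fix x
      have "\<bar>f x - (exp (f x) - 1)\<bar> \<le> \<bar>f x\<bar> * \<bar>f x\<bar>" using eb(1)[of x] by (simp add: abs_minus_commute power2_eq_square algebra_simps)
      also have "\<dots> \<le> (2 * \<delta>) * \<bar>f x\<bar>" using bd(3)[of x] by (intro mult_right_mono) auto
      finally have "\<bar>f x - (exp (f x) - 1)\<bar>\<^sup>2 \<le> ((2 * \<delta>) * \<bar>f x\<bar>)\<^sup>2" by (intro power_mono) auto
      then show "(f x - (exp (f x) - 1))\<^sup>2 \<le> (4 * \<delta>\<^sup>2) * (f x)\<^sup>2" by (simp add: power_mult_distrib)
    qed (intro bc_intros bb)+
    also have "I (\<lambda>x. (4 * \<delta>\<^sup>2) * (f x)\<^sup>2) = (4 * \<delta>\<^sup>2) * I (\<lambda>x. (f x)\<^sup>2)" unfolding I_def by (rule weight_scale)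
    also have "\<dots> \<le> (4 * \<delta>\<^sup>2) * (8 * N)" using Fb(1) by (intro mult_left_mono) auto
    finally show ?thesis by simp
  qed
  have IS: "I S \<le> 21 * (U + N)"
  proof -
    have "I S = U + N + I (\<lambda>x. (f x)\<^sup>2) + I (\<lambda>x. (p x)\<^sup>2) + I (\<lambda>x. (a x)\<^sup>2)"
      unfolding I_def U_def N_def S_def using wi(1)[OF bc_power, of _ 2] b
      by (simp add: distrib_left)
    then show ?thesis using Fb Ab UN by simp
  qed
  have T0T1: "\<bar>L (\<lambda>x. \<theta> / 2 * T0 x + T1 x)\<bar> \<le> \<kappa> * I (\<lambda>x. 8 * C * S x)"
    unfolding L_def I_def
  proof (rule weight_deriv_bound[OF wt(1)])
    show "bc (\<lambda>x. \<theta> / 2 * T0 x + T1 x)" "bc (\<lambda>x. 8 * C * S x)" by (intro bc_intros bT0 bT1 bS)+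
    fix x
    have Rtb: "\<bar>Rt x - (f x)\<^sup>2 / 2\<bar> \<le> 2 * \<delta> * (f x)\<^sup>2"
      using eb(2)[of x] mult_right_mono[OF bd(3)[of x] zero_le_power2[of "f x"]] unfolding Rt_def by linarith
    show "\<bar>\<theta> / 2 * T0 x + T1 x\<bar> \<le> 8 * C * S x"
      unfolding T0_def T1_def S_def by (rule virial_boundary_pointwise[OF k \<theta> v \<delta> bd(1,2) wb Rtb])
  qed
  define Lw where "Lw x = (\<theta> * k / (2 * (4 * k + 5)) * ((u x)\<^sup>2 + (n x)\<^sup>2) + \<theta> / 2 * (u x * hu x) - 4 * C * \<delta> * S x)
      - 2 * C / \<delta> * ((Dd x)\<^sup>2 + (hn x)\<^sup>2)" for x
  have f1: "I Lw \<le> I Ks" unfolding I_def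
  proof (rule weight_mono[OF wt(1) _ bKs])
    show "bc Lw" unfolding Lw_def by (intro bc_intros bb bS bD)
    fix x
    have Rtb: "\<bar>Rt x - (f x)\<^sup>2 / 2\<bar> \<le> 2 * \<delta> * (f x)\<^sup>2"
      using eb(2)[of x] mult_right_mono[OF bd(3)[of x] zero_le_power2[of "f x"]] unfolding Rt_def by linarith
    have qb: "\<bar>(exp (f x) - 1) - f x\<bar> \<le> (f x)\<^sup>2" by (rule eb(1))
    have aD: "a x = f x - p x - Dd x" by (simp add: Dd_def)
    show "Lw x \<le> Ks x" unfolding Lw_def Ks_def A1_def B1_def Z_def S_def
      by (rule virial_pointwise[OF k \<theta> v \<delta> bd aD wb Pb Rtb qb])
  qed
  have f2: "I Lw = \<theta> * k / (2 * (4 * k + 5)) * (U + N) + \<theta> / 2 * I (\<lambda>x. u x * hu x) - 4 * C * \<delta> * I S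
      - 2 * C / \<delta> * (I (\<lambda>x. (Dd x)\<^sup>2) + I (\<lambda>x. (hn x)\<^sup>2))"
  proof -
    have lin: "I (\<lambda>x. c1 * (F1 x + F2 x) + c2 * F3 x - c3 * F4 x - c4 * (F5 x + F6 x)) = c1 * (I F1 + I F2) + c2 * I F3 - c3 * I F4 - c4 * (I F5 + I F6)"
      if "bc F1" "bc F2" "bc F3" "bc F4" "bc F5" "bc F6" for c1 c2 c3 c4 F1 F2 F3 F4 F5 F6
    proof -
      have "I (\<lambda>x. c1 * (F1 x + F2 x) + c2 * F3 x - c3 * F4 x - c4 * (F5 x + F6 x)) =
        (LINT x|lborel. c1 * (om x * F1 x) + c1 * (om x * F2 x) + c2 * (om x * F3 x) - c3 * (om x * F4 x) - (c4 * (om x * F5 x) + c4 * (om x * F6 x)))"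
        unfolding I_def by (rule Bochner_Integration.integral_cong) (simp_all add: algebra_simps)
      also have "\<dots> = c1 * I F1 + c1 * I F2 + c2 * I F3 - c3 * I F4 - (c4 * I F5 + c4 * I F6)"
        unfolding I_def using that[THEN wi(1)] by simp
      finally show ?thesis by (simp add: algebra_simps)
    qed
    show ?thesis unfolding Lw_def U_def N_def
      by (rule lin) (intro bc_intros bb bS bD)+
  qed
  have f3: "4 * C * \<delta> * I S \<le> 4 * C * \<delta> * (21 * (U + N))" using IS k \<delta> by (intro mult_left_mono) auto
  have f4: "2 * C / \<delta> * (I (\<lambda>x. (Dd x)\<^sup>2) + I (\<lambda>x. (hn x)\<^sup>2)) \<le> 256 * (C * \<delta>) * (U + N)"
  proof -
    have "I (\<lambda>x. (Dd x)\<^sup>2) + I (\<lambda>x. (hn x)\<^sup>2) \<le> 128 * \<delta>\<^sup>2 * (U + N)"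
    proof -
      have "4 * \<delta>\<^sup>2 * U \<le> 128 * \<delta>\<^sup>2 * U" using UN by (intro mult_right_mono) auto
      then show ?thesis using Db Hb by (simp add: algebra_simps)
    qed
    then have "2 * C / \<delta> * (I (\<lambda>x. (Dd x)\<^sup>2) + I (\<lambda>x. (hn x)\<^sup>2)) \<le> 2 * C / \<delta> * (128 * \<delta>\<^sup>2 * (U + N))"
      using k \<delta> by (intro mult_left_mono) auto
    also have "\<dots> = 256 * (C * \<delta>) * (U + N)" using \<delta> by (simp add: power2_eq_square)
    finally show ?thesis .
  qed
  have f5: "\<kappa> * I (\<lambda>x. 8 * C * S x) \<le> 168 * (C * \<kappa>) * (U + N)"
  proof -
    have "I (\<lambda>x. 8 * C * S x) = 8 * C * I S" unfolding I_def by (rule weight_scale)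
    also have "\<dots> \<le> 8 * C * (21 * (U + N))" using IS k by (intro mult_left_mono) auto
    finally have "\<kappa> * I (\<lambda>x. 8 * C * S x) \<le> \<kappa> * (8 * C * (21 * (U + N)))" using wd(10) by (intro mult_left_mono) auto
    then show ?thesis by (simp add: algebra_simps)
  qed
  have f6: "0 \<le> \<theta> / 2 * I (\<lambda>x. u x * hu x)"
  proof -
    have "\<theta> > 0" using \<theta> k by (metis add_pos_pos zero_less_mult_pos2 zero_less_one)
    then show ?thesis using hu0 by simp
  qed
  have f7: "I (\<lambda>x. (u x)\<^sup>2 + (n x)\<^sup>2) = U + N" unfolding I_def U_def N_def
    by (rule weight_arith(1)[OF wt(1)]) (intro bc_intros bb)+
  have f8: "(\<theta> * k / (2 * (4 * k + 5)) - C * (400 * \<delta> + 200 * \<kappa>)) * (U + N) \<le>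
     \<theta> * k / (2 * (4 * k + 5)) * (U + N) - 4 * C * \<delta> * (21 * (U + N)) - 256 * (C * \<delta>) * (U + N) - 168 * (C * \<kappa>) * (U + N)"
  proof -
    have "0 \<le> C * \<delta> * (U + N)" "0 \<le> C * \<kappa> * (U + N)" using k \<delta> wd(10) UN by auto
    then show ?thesis by (simp add: algebra_simps)
  qed
  have fin: "Z \<le> K + T" if "J \<le> K" "J = a1 + b1 - x1 - y1" "x1 \<le> x2" "y1 \<le> y2" "z1 \<le> z2" "0 \<le> b1"
      "Z \<le> a1 - x2 - y2 - z2" "\<bar>T\<bar> \<le> z1" for Z K T J a1 b1 x1 y1 x2 y2 z1 z2 :: real
    using that by linarith
  show ?thesis unfolding total f7[unfolded I_def] by (rule fin[OF f1 f2 f3 f4 f5 f6 f8 T0T1])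
qed

section \<open>Bounds for the pressure law\<close>

lemma lipschitz_of_continuous_derivative:
  fixes g g' :: "real \<Rightarrow> real"
  assumes D: "\<And>s. \<bar>s\<bar> \<le> 1/2 \<Longrightarrow> (g has_real_derivative g' s) (at s)" and c: "continuous_on {-1/2..1/2} g'"
  shows "\<exists>C\<ge>0. \<forall>s s'. \<bar>s\<bar> \<le> 1/2 \<longrightarrow> \<bar>s'\<bar> \<le> 1/2 \<longrightarrow> \<bar>g s - g s'\<bar> \<le> C * \<bar>s - s'\<bar>"
proof -
  have "bounded (g' ` {-1/2..1/2})" by (intro compact_imp_bounded compact_continuous_image c compact_Icc)
  then obtain C where C0: "\<forall>y \<in> g' ` {-1/2..1/2}. norm y \<le> C" unfolding bounded_iff by blast
  have C: "\<bar>g' s\<bar> \<le> C" if "\<bar>s\<bar> \<le> 1/2" for s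
  proof -
    have "s \<in> {-1/2..1/2}" using that by (auto simp: abs_le_iff)
    then show ?thesis using C0 by auto
  qed
  have "norm (g s - g s') \<le> C * norm (s - s')" if "\<bar>s\<bar> \<le> 1/2" "\<bar>s'\<bar> \<le> 1/2" for s s'
  proof (rule field_differentiable_bound[where S="{-1/2..1/2}" and f'=g'])
    show "(g has_field_derivative g' z) (at z within {-1/2..1/2})" if "z \<in> {-1/2..1/2}" for z
      using D[of z] that by (auto intro: has_field_derivative_at_within simp: abs_le_iff)
    show "norm (g' z) \<le> C" if "z \<in> {-1/2..1/2}" for z using C[of z] that by (auto simp: abs_le_iff)
  qed (use that in \<open>auto simp: abs_le_iff\<close>)
  moreover have "0 \<le> C" using C[of 0] by simp
  ultimately show ?thesis by (intro exI[of _ C]) auto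
qed

lemma mean_value_bound:
  fixes F F' :: "real \<Rightarrow> real"
  assumes D: "\<And>s. \<bar>s\<bar> \<le> 1/2 \<Longrightarrow> (F has_real_derivative F' s) (at s)" and "F 0 = 0"
    and b: "\<And>r. \<bar>r\<bar> \<le> \<bar>s\<bar> \<Longrightarrow> \<bar>F' r\<bar> \<le> K" and s: "\<bar>s\<bar> \<le> 1/2"
  shows "\<bar>F s\<bar> \<le> K * \<bar>s\<bar>"
proof -
  have "norm (F s - F 0) \<le> K * norm (s - 0)"
  proof (rule field_differentiable_bound[where S="{-\<bar>s\<bar>..\<bar>s\<bar>}" and f'=F'])
    show "(F has_field_derivative F' z) (at z within {-\<bar>s\<bar>..\<bar>s\<bar>})" if "z \<in> {-\<bar>s\<bar>..\<bar>s\<bar>}" for z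
      using D[of z] that s by (auto intro: has_field_derivative_at_within simp: abs_le_iff)
    show "norm (F' z) \<le> K" if "z \<in> {-\<bar>s\<bar>..\<bar>s\<bar>}" for z using b[of z] that by (auto simp: abs_le_iff)
  qed auto
  then show ?thesis using assms(2) by simp
qed

lemma W_has_derivative:
  assumes "pressure_law p" "\<bar>s\<bar> \<le> 1/2"
  shows "(W p has_real_derivative enthalpy p s) (at s)"
proof -
  have c: "continuous_on {-3/4..3/4} (enthalpy p)"
    using enthalpy_has_derivative[OF assms(1)] by (force intro!: continuous_at_imp_continuous_on DERIV_isCont)
  have "((\<lambda>v. LBINT r=ereal 0..v. enthalpy p r) has_vector_derivative enthalpy p s) (at s within {-3/4..3/4})"
    by (rule interval_integral_FTC2[OF _ _ c]) (use assms(2) in auto)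
  then have "(W p has_real_derivative enthalpy p s) (at s within {-3/4..3/4})"
    unfolding W_def[abs_def] has_real_derivative_iff_has_vector_derivative by (simp add: zero_ereal_def)
  moreover have "at s within {-3/4..3/4} = at s" using assms(2) by (intro at_within_Icc_at) (auto simp: abs_le_iff)
  ultimately show ?thesis by simp
qed

lemma W_0: "W p 0 = 0" by (simp add: W_def zero_ereal_def[symmetric])

lemma R_eq: "R v = v * (exp v - 1) - (exp v - 1 - v)"
proof -
  have "(LBINT s=ereal 0..ereal v. q s) = (exp v - v) - (exp 0 - 0)"
  proof (rule interval_integral_FTC_finite)
    show "continuous_on {min 0 v..max 0 v} q" unfolding q_def by (intro continuous_intros)
    show "((\<lambda>s. exp s - s) has_vector_derivative q x) (at x within {min 0 v..max 0 v})" for x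
      unfolding q_def has_real_derivative_iff_has_vector_derivative[symmetric]
      by (auto intro!: derivative_eq_intros)
  qed
  then show ?thesis by (simp add: R_def q_def zero_ereal_def)
qed

text \<open>Everything that is used about the pressure, near the equilibrium density and with one constant. Here \<open>c\<close> is the sound speed as a
function of the density perturbation, \<open>\<sigma>\<close> the function whose sum and difference with the velocity are the Riemann invariants,
and \<open>\<tau>\<close> its inverse. Monotonicity of \<open>c\<close> is the convexity of the pressure.\<close>

definition pressure_bounds :: "(real \<Rightarrow> real) \<Rightarrow> real \<Rightarrow> real \<Rightarrow> (real \<Rightarrow> real) \<Rightarrow> (real \<Rightarrow> real) \<Rightarrow> (real \<Rightarrow> real) \<Rightarrow> bool" where
  "pressure_bounds p k C c \<sigma> \<tau> \<longleftrightarrow> k > 0 \<and> C \<ge> 1 \<and> k \<le> C \<and>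
    (\<forall>s. \<bar>s\<bar> < 1/2 \<longrightarrow> c s > 0 \<and> (c s)\<^sup>2 = deriv p (1 + s) \<and> (\<sigma> has_real_derivative c s / (1 + s)) (at s)
        \<and> \<tau> (\<sigma> s) = s \<and> (\<tau> has_real_derivative (1 + s) / c s) (at (\<sigma> s))
        \<and> \<bar>\<sigma> s\<bar> \<le> C * \<bar>s\<bar> \<and> \<bar>c s - sqrt k\<bar> \<le> C * \<bar>s\<bar>
        \<and> (enthalpy p has_real_derivative (c s)\<^sup>2 / (1 + s)) (at s) \<and> (W p has_real_derivative enthalpy p s) (at s)
        \<and> \<bar>enthalpy p s - k * s\<bar> \<le> C * s\<^sup>2 \<and> \<bar>s * enthalpy p s - W p s - k * s\<^sup>2 / 2\<bar> \<le> C * \<bar>s\<bar> * s\<^sup>2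
        \<and> \<bar>W p s - k * s\<^sup>2 / 2\<bar> \<le> C * \<bar>s\<bar> * s\<^sup>2) \<and>
    (\<forall>s s'. \<bar>s\<bar> < 1/2 \<longrightarrow> \<bar>s'\<bar> < 1/2 \<longrightarrow> \<sigma> s \<le> \<sigma> s' \<longrightarrow> s \<le> s' \<and> c s \<le> c s' \<and> \<bar>c s - c s'\<bar> \<le> C * (\<sigma> s' - \<sigma> s) \<and> s' - s \<le> C * (\<sigma> s' - \<sigma> s))"

lemma pressure_bounds_exist:
  assumes p: "pressure_law p" and k: "k = deriv p 1"
  shows "\<exists>C c \<sigma> \<tau>. pressure_bounds p k C c \<sigma> \<tau>"
proof -
  have d1: "(deriv p has_real_derivative deriv (deriv p) s) (at s)" if "s > 0" for s
  proof -
    have "(deriv ^^ 1) p differentiable (at s)" using p that unfolding pressure_law_def smooth_on_pos_def by blast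
    then show ?thesis by (simp add: DERIV_deriv_iff_real_differentiable)
  qed
  have d2: "isCont (deriv (deriv p)) s" if "s > 0" for s
  proof -
    have "(deriv ^^ 2) p differentiable (at s)" using p that unfolding pressure_law_def smooth_on_pos_def by blast
    then show ?thesis by (auto simp: numeral_2_eq_2 intro: differentiable_imp_continuous_within)
  qed
  have pos: "deriv p s > 0" "deriv (deriv p) s \<ge> 0" if "s > 0" for s using p that by (auto simp: pressure_law_def)
  define g where "g s = deriv p (1 + s)" for s
  define g' where "g' s = deriv (deriv p) (1 + s)" for s
  have gD: "(g has_real_derivative g' s) (at s)" if "s > -1" for s
  proof -
    have "((\<lambda>s. 1 + s) has_real_derivative 1) (at s)" by (auto intro!: derivative_eq_intros)
    from DERIV_chain2[OF d1 this] show ?thesis using that unfolding g_def g'_def by simp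
  qed
  have g'c: "isCont g' s" if "s > -1" for s
    unfolding g'_def using isCont_o2[of s "\<lambda>s. 1 + s" "deriv (deriv p)"] d2 that by (auto intro!: continuous_intros)
  have gpos: "g s > 0" "g' s \<ge> 0" if "s > -1" for s using pos[of "1 + s"] that by (auto simp: g_def g'_def)
  have gc: "isCont g s" if "s > -1" for s using gD[OF that] by (rule DERIV_isCont)
  have g0: "g 0 = k" by (simp add: g_def k)
  have k0: "k > 0" using gpos(1)[of 0] g0 by simp
  define c where "c s = sqrt (g s)" for s
  have cD: "(c has_real_derivative inverse (c s) / 2 * g' s) (at s)" if "s > -1" for s
    using DERIV_chain2[OF DERIV_real_sqrt gD[OF that]] gpos(1)[OF that] by (simp add: c_def[abs_def])
  have cpos: "c s > 0" "(c s)\<^sup>2 = g s" if "s > -1" for s using gpos(1)[OF that] by (simp_all add: c_def)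
  have cc: "isCont c s" if "s > -1" for s using cD[OF that] by (rule DERIV_isCont)
  have contc: "continuous_on S c" "\<forall>s\<in>S. c s \<noteq> 0" "continuous_on S g'" "continuous_on S g" if "\<And>s. s \<in> S \<Longrightarrow> s > -1" for S
    using cc cpos(1) g'c gc that by (auto intro!: continuous_at_imp_continuous_on) (metis less_irrefl)
  have rng: "s > -1" if "\<bar>s\<bar> \<le> 1/2" for s :: real using that by (simp add: abs_le_iff)
  have rng': "s > -1" if "s \<in> {-1/2..1/2}" for s :: real using that by simp
  obtain C1 where C1: "C1 \<ge> 0" "\<And>s s'. \<bar>s\<bar> \<le> 1/2 \<Longrightarrow> \<bar>s'\<bar> \<le> 1/2 \<Longrightarrow> \<bar>c s - c s'\<bar> \<le> C1 * \<bar>s - s'\<bar>"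
  proof -
    have "continuous_on {-1/2..1/2} (\<lambda>s. inverse (c s) / 2 * g' s)"
      by (intro continuous_intros contc) auto
    from lipschitz_of_continuous_derivative[OF cD[OF rng] this] show ?thesis using that by blast
  qed
  define G where "G s = g s / (1 + s)" for s
  have GD: "(G has_real_derivative (g' s * (1 + s) - g s) / (1 + s)\<^sup>2) (at s)" if "s > -1" for s
  proof -
    have "((\<lambda>s. 1 + s) has_real_derivative 1) (at s)" by (auto intro!: derivative_eq_intros)
    from DERIV_divide[OF gD[OF that] this] show ?thesis using that unfolding G_def[abs_def] by (simp add: power2_eq_square)
  qed
  obtain C2 where C2: "C2 \<ge> 0" "\<And>s s'. \<bar>s\<bar> \<le> 1/2 \<Longrightarrow> \<bar>s'\<bar> \<le> 1/2 \<Longrightarrow> \<bar>G s - G s'\<bar> \<le> C2 * \<bar>s - s'\<bar>"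
  proof -
    have "continuous_on {-1/2..1/2} (\<lambda>s. (g' s * (1 + s) - g s) / (1 + s)\<^sup>2)"
      by (intro continuous_intros contc) auto
    from lipschitz_of_continuous_derivative[OF GD[OF rng] this] show ?thesis using that by blast
  qed
  have G0: "\<bar>G s - k\<bar> \<le> C2 * \<bar>s\<bar>" if "\<bar>s\<bar> \<le> 1/2" for s using C2(2)[OF that, of 0] by (simp add: G_def g0)
  have eD: "(enthalpy p has_real_derivative G s) (at s)" if "s > -1" for s
    using enthalpy_has_derivative[OF p that] by (simp add: G_def g_def)
  have e1: "\<bar>enthalpy p s - k * s\<bar> \<le> C2 * s\<^sup>2" if s: "\<bar>s\<bar> \<le> 1/2" for s
  proof -
    have "\<bar>enthalpy p s - k * s\<bar> \<le> (C2 * \<bar>s\<bar>) * \<bar>s\<bar>"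
    proof (rule mean_value_bound[where F="\<lambda>s. enthalpy p s - k * s" and F'="\<lambda>s. G s - k"])
      show "((\<lambda>s. enthalpy p s - k * s) has_real_derivative G r - k) (at r)" if "\<bar>r\<bar> \<le> 1/2" for r
        by (auto intro!: derivative_eq_intros eD rng that)
      show "\<bar>G r - k\<bar> \<le> C2 * \<bar>s\<bar>" if "\<bar>r\<bar> \<le> \<bar>s\<bar>" for r
        using G0[of r] that s mult_left_mono[OF that C2(1)] by linarith
    qed (use s enthalpy_0 in auto)
    then show ?thesis by (simp add: power2_eq_square mult.assoc)
  qed
  have e2: "\<bar>s * enthalpy p s - W p s - k * s\<^sup>2 / 2\<bar> \<le> C2 * \<bar>s\<bar> * s\<^sup>2" if s: "\<bar>s\<bar> \<le> 1/2" for s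
  proof -
    have "\<bar>s * enthalpy p s - W p s - k * s\<^sup>2 / 2\<bar> \<le> (C2 * s\<^sup>2) * \<bar>s\<bar>"
    proof (rule mean_value_bound[where F="\<lambda>s. s * enthalpy p s - W p s - k * s\<^sup>2 / 2" and F'="\<lambda>s. s * (G s - k)"])
      show "((\<lambda>s. s * enthalpy p s - W p s - k * s\<^sup>2 / 2) has_real_derivative r * (G r - k)) (at r)" if "\<bar>r\<bar> \<le> 1/2" for r
        by (auto intro!: derivative_eq_intros eD rng that W_has_derivative[OF p] simp: algebra_simps)
      show "\<bar>r * (G r - k)\<bar> \<le> C2 * s\<^sup>2" if "\<bar>r\<bar> \<le> \<bar>s\<bar>" for r
      proof -
        have "\<bar>r\<bar> * \<bar>G r - k\<bar> \<le> \<bar>s\<bar> * (C2 * \<bar>s\<bar>)"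
          using G0[of r] that s mult_left_mono[OF that C2(1)] by (intro mult_mono) auto
        then show ?thesis by (simp add: abs_mult power2_eq_square mult_ac)
      qed
    qed (use s W_0 in auto)
    then show ?thesis by (simp add: mult_ac)
  qed
  have e3: "\<bar>W p s - k * s\<^sup>2 / 2\<bar> \<le> C2 * \<bar>s\<bar> * s\<^sup>2" if s: "\<bar>s\<bar> \<le> 1/2" for s
  proof -
    have "\<bar>W p s - k * s\<^sup>2 / 2\<bar> \<le> (C2 * s\<^sup>2) * \<bar>s\<bar>"
    proof (rule mean_value_bound[where F="\<lambda>s. W p s - k * s\<^sup>2 / 2" and F'="\<lambda>s. enthalpy p s - k * s"])
      show "((\<lambda>s. W p s - k * s\<^sup>2 / 2) has_real_derivative enthalpy p r - k * r) (at r)" if "\<bar>r\<bar> \<le> 1/2" for r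
        by (auto intro!: derivative_eq_intros that W_has_derivative[OF p] simp: algebra_simps)
      show "\<bar>enthalpy p r - k * r\<bar> \<le> C2 * s\<^sup>2" if "\<bar>r\<bar> \<le> \<bar>s\<bar>" for r
      proof -
        have "r\<^sup>2 \<le> s\<^sup>2" using that by (simp add: abs_le_square_iff)
        then have "C2 * r\<^sup>2 \<le> C2 * s\<^sup>2" using C2(1) by (rule mult_left_mono)
        then show ?thesis using e1[of r] that s by linarith
      qed
    qed (use s W_0 in auto)
    then show ?thesis by (simp add: mult_ac)
  qed
  define \<sigma> where "\<sigma> s = integral {-3/4..s} (\<lambda>r. c r / (1 + r)) - integral {-3/4..0} (\<lambda>r. c r / (1 + r))" for s
  have \<sigma>D: "(\<sigma> has_real_derivative c s / (1 + s)) (at s)" if s: "\<bar>s\<bar> \<le> 1/2" for s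
  proof -
    have cont: "continuous_on {-3/4..3/4} (\<lambda>r. c r / (1 + r))"
      by (intro continuous_intros contc) auto
    have "s \<in> {-3/4..3/4}" unfolding atLeastAtMost_iff using s by linarith
    from integral_has_real_derivative[OF cont this]
    have "((\<lambda>x. integral {-3/4..x} (\<lambda>r. c r / (1 + r))) has_real_derivative c s / (1 + s)) (at s within {-3/4..3/4})" .
    moreover have "at s within {-3/4..3/4} = at s" by (intro at_within_Icc_at) (use s in linarith)+
    ultimately show ?thesis unfolding \<sigma>_def[abs_def] by (auto intro!: derivative_eq_intros)
  qed
  have \<sigma>0: "\<sigma> 0 = 0" by (simp add: \<sigma>_def)
  obtain m0 where m0: "m0 > 0" "\<And>s. \<bar>s\<bar> \<le> 1/2 \<Longrightarrow> m0 \<le> c s / (1 + s)"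
  proof -
    have "continuous_on {-1/2..1/2} (\<lambda>r. c r / (1 + r))"
      by (intro continuous_intros contc) auto
    then obtain z where z: "z \<in> {-1/2..1/2}" "\<forall>y\<in>{-1/2..1/2}. c z / (1 + z) \<le> c y / (1 + y)"
      using continuous_attains_inf[of "{-1/2..1/2::real}" "\<lambda>r. c r / (1 + r)"] by auto
    show ?thesis
    proof (rule that[of "c z / (1 + z)"])
      show "c z / (1 + z) > 0" using cpos(1)[OF rng'[OF z(1)]] rng'[OF z(1)] by simp
      show "c z / (1 + z) \<le> c s / (1 + s)" if h: "\<bar>s\<bar> \<le> 1/2" for s
      proof -
        have "s \<in> {-1/2..1/2}" unfolding atLeastAtMost_iff using h by linarith
        then show ?thesis using z(2) by blast
      qed
    qed
  qed
  have \<sigma>inc: "m0 * (s' - s) \<le> \<sigma> s' - \<sigma> s" if "\<bar>s\<bar> \<le> 1/2" "\<bar>s'\<bar> \<le> 1/2" "s \<le> s'" for s s'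
  proof (cases "s = s'")
    case False
    then have "s < s'" using that by simp
    obtain z where z: "s < z" "z < s'" "\<sigma> s' - \<sigma> s = (s' - s) * (c z / (1 + z))"
    proof -
      have "(\<sigma> has_real_derivative c z / (1 + z)) (at z)" if "s \<le> z" "z \<le> s'" for z
        by (rule \<sigma>D) (use that \<open>\<bar>s\<bar> \<le> 1/2\<close> \<open>\<bar>s'\<bar> \<le> 1/2\<close> in linarith)
      from MVT2[OF \<open>s < s'\<close> this] show thesis using that by blast
    qed
    have "\<bar>z\<bar> \<le> 1/2" using z(1,2) that by linarith
    then have "m0 \<le> c z / (1 + z)" by (rule m0(2))
    then have "(s' - s) * m0 \<le> (s' - s) * (c z / (1 + z))" using that(3) by (intro mult_left_mono) auto
    then show ?thesis unfolding z(3) by (subst mult.commute)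
  qed simp
  obtain C3 where C3: "C3 \<ge> 0" "\<And>s. \<bar>s\<bar> \<le> 1/2 \<Longrightarrow> \<bar>\<sigma> s\<bar> \<le> C3 * \<bar>s\<bar>"
  proof -
    have "continuous_on {-1/2..1/2} (\<lambda>r. c r / (1 + r))"
      by (intro continuous_intros contc) auto
    from lipschitz_of_continuous_derivative[OF \<sigma>D this] obtain C3 where "C3 \<ge> 0" and h: "\<forall>s s'. \<bar>s\<bar> \<le> 1/2 \<longrightarrow> \<bar>s'\<bar> \<le> 1/2 \<longrightarrow> \<bar>\<sigma> s - \<sigma> s'\<bar> \<le> C3 * \<bar>s - s'\<bar>" by blast
    have "\<bar>\<sigma> s - \<sigma> 0\<bar> \<le> C3 * \<bar>s - 0\<bar>" if "\<bar>s\<bar> \<le> 1/2" for s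
      using h[rule_format, OF that, of 0] by simp
    with \<open>C3 \<ge> 0\<close> show ?thesis using that[of C3] \<sigma>0 by simp
  qed
  define S where "S = {-1/2<..<1/2::real}"
  define \<tau> where "\<tau> = inv_into S \<sigma>"
  have sb: "\<bar>z\<bar> \<le> 1/2" if "z \<in> S" for z using that unfolding S_def greaterThanLessThan_iff by linarith
  have inj: "inj_on \<sigma> S"
  proof (rule linorder_inj_onI')
    fix s s' assume "s \<in> S" "s' \<in> S" "s < s'"
    then have "m0 * (s' - s) \<le> \<sigma> s' - \<sigma> s" "0 < m0 * (s' - s)" using m0(1) \<sigma>inc[OF sb sb, of s s'] by simp_all
    then show "\<sigma> s \<noteq> \<sigma> s'" by linarith
  qed
  have \<tau>\<sigma>: "\<tau> (\<sigma> s) = s" if "s \<in> S" for s unfolding \<tau>_def by (rule inv_into_f_f[OF inj that])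
  have \<tau>D: "(\<tau> has_real_derivative (1 + s) / c s) (at (\<sigma> s))" if s: "s \<in> S" for s
  proof -
    have nz: "c s > 0" "1 + s > 0" using cpos(1)[OF rng[OF sb[OF s]]] rng[OF sb[OF s]] by auto
    have "(\<tau> has_derivative (*) ((1 + s) / c s)) (at (\<sigma> s))"
    proof (rule has_derivative_inverse_strong[of S s \<sigma> \<tau> "(*) (c s / (1 + s))"])
      show "open S" by (simp add: S_def)
      show "continuous_on S \<sigma>" using \<sigma>D sb by (auto intro!: continuous_at_imp_continuous_on DERIV_isCont)
      show "(\<sigma> has_derivative (*) (c s / (1 + s))) (at s)" using \<sigma>D[OF sb[OF s]] by (simp add: has_field_derivative_def)
      show "(*) (c s / (1 + s)) \<circ> (*) ((1 + s) / c s) = id" using nz by (auto simp: fun_eq_iff)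
    qed (use s \<tau>\<sigma> in auto)
    then show ?thesis by (simp add: has_field_derivative_def)
  qed
  define C where "C = Max {1, k, C1, C2, C3, 1 / m0, C1 / m0}"
  have C: "1 \<le> C" "k \<le> C" "C1 \<le> C" "C2 \<le> C" "C3 \<le> C" "1 / m0 \<le> C" "C1 / m0 \<le> C" unfolding C_def by (rule Max_ge; simp)+
  have up: "X \<le> C * Y" if "X \<le> c * Y" "c \<le> C" "0 \<le> Y" for X Y c using mult_right_mono[OF that(2,3)] that(1) by linarith
  have "pressure_bounds p k C c \<sigma> \<tau>"
    unfolding pressure_bounds_def
  proof (intro conjI allI impI)
    show "0 < k" "1 \<le> C" "k \<le> C" by fact+
    fix s :: real assume s: "\<bar>s\<bar> < 1/2"
    then have s1: "\<bar>s\<bar> \<le> 1/2" "s > -1" and sS: "s \<in> S" unfolding S_def greaterThanLessThan_iff by linarith+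
    show "0 < c s" "(c s)\<^sup>2 = deriv p (1 + s)" using cpos[OF s1(2)] by (auto simp: g_def)
    show "(\<sigma> has_real_derivative c s / (1 + s)) (at s)" by (rule \<sigma>D[OF s1(1)])
    show "\<tau> (\<sigma> s) = s" by (rule \<tau>\<sigma>[OF sS])
    show "(\<tau> has_real_derivative (1 + s) / c s) (at (\<sigma> s))" by (rule \<tau>D[OF sS])
    show "\<bar>\<sigma> s\<bar> \<le> C * \<bar>s\<bar>" by (rule up[OF C3(2)[OF s1(1)] C(5)]) simp
    have "\<bar>c s - c 0\<bar> \<le> C1 * \<bar>s - 0\<bar>" by (rule C1(2)) (use s1 in auto)
    then show "\<bar>c s - sqrt k\<bar> \<le> C * \<bar>s\<bar>" by (intro up[OF _ C(3)]) (simp_all add: c_def g0)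
    show "(enthalpy p has_real_derivative (c s)\<^sup>2 / (1 + s)) (at s)" using eD[OF s1(2)] cpos(2)[OF s1(2)] by (simp add: G_def)
    show "(W p has_real_derivative enthalpy p s) (at s)" by (rule W_has_derivative[OF p s1(1)])
    show "\<bar>enthalpy p s - k * s\<bar> \<le> C * s\<^sup>2" by (rule up[OF e1[OF s1(1)] C(4)]) simp
    show "\<bar>s * enthalpy p s - W p s - k * s\<^sup>2 / 2\<bar> \<le> C * \<bar>s\<bar> * s\<^sup>2"
      using up[of _ C2 "\<bar>s\<bar> * s\<^sup>2"] e2[OF s1(1)] C(4) by (simp add: mult.assoc)
    show "\<bar>W p s - k * s\<^sup>2 / 2\<bar> \<le> C * \<bar>s\<bar> * s\<^sup>2"
      using up[of _ C2 "\<bar>s\<bar> * s\<^sup>2"] e3[OF s1(1)] C(4) by (simp add: mult.assoc)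
  next
    fix s s' :: real assume s: "\<bar>s\<bar> < 1/2" "\<bar>s'\<bar> < 1/2" and le: "\<sigma> s \<le> \<sigma> s'"
    have b: "\<bar>s\<bar> \<le> 1/2" "\<bar>s'\<bar> \<le> 1/2" using s by auto
    show ss: "s \<le> s'"
    proof (rule ccontr)
      assume "\<not> s \<le> s'"
      then have "m0 * (s - s') \<le> \<sigma> s - \<sigma> s'" "0 < m0 * (s - s')" using \<sigma>inc[OF b(2,1)] m0(1) by auto
      then show False using le by linarith
    qed
    show "c s \<le> c s'"
    proof (rule DERIV_nonneg_imp_nondecreasing[OF ss])
      fix z assume "s \<le> z" "z \<le> s'"
      then have "z > -1" using b by linarith
      then show "\<exists>y. (c has_real_derivative y) (at z) \<and> 0 \<le> y"
        using cD[of z] gpos(2)[of z] cpos(1)[of z] by (intro exI[of _ "inverse (c z) / 2 * g' z"]) simp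
    qed
    have d: "s' - s \<le> (\<sigma> s' - \<sigma> s) / m0" using \<sigma>inc[OF b ss] m0(1) by (simp add: field_simps)
    then show "s' - s \<le> C * (\<sigma> s' - \<sigma> s)" by (intro up[OF _ C(6)]) (use le in auto)
    have "\<bar>c s - c s'\<bar> \<le> C1 * \<bar>s - s'\<bar>" by (rule C1(2)[OF b])
    also have "\<dots> \<le> C1 * ((\<sigma> s' - \<sigma> s) / m0)" using d ss C1(1) by (intro mult_left_mono) auto
    finally show "\<bar>c s - c s'\<bar> \<le> C * (\<sigma> s' - \<sigma> s)" by (intro up[OF _ C(7)]) (use le in auto)
  qed
  then show ?thesis by blast
qed

section \<open>The Poisson equation and the one-sided filter\<close>

text \<open>The maximum principle for second-order equations: at a positive maximum the second derivative would be positive.\<close>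

lemma no_positive_maximum:
  fixes g g' s :: "real \<Rightarrow> real"
  assumes D: "\<And>x. (g has_real_derivative g' x) (at x)" "\<And>x. (g' has_real_derivative s x) (at x)"
    and s: "\<And>x. 0 < g x \<Longrightarrow> 0 < s x" and b: "\<And>x. b \<le> \<bar>x\<bar> \<Longrightarrow> g x \<le> 0"
  shows "g x \<le> 0"
proof (rule ccontr)
  assume "\<not> g x \<le> 0"
  then have x: "0 < g x" by simp
  define B where "B = max b \<bar>x\<bar>"
  have B0: "B \<ge> 0" "x \<in> {-B..B}" by (auto simp: B_def)
  have "continuous_on {-B..B} g" using D(1) by (auto intro!: continuous_at_imp_continuous_on DERIV_isCont)
  then obtain z where z: "z \<in> {-B..B}" "\<forall>y\<in>{-B..B}. g y \<le> g z"
    using continuous_attains_sup[of "{-B..B}" g] B0(1) by auto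
  have gz: "0 < g z" using z(2) B0(2) x by force
  have mx: "g y \<le> g z" for y
  proof (cases "y \<in> {-B..B}")
    case False
    then have "b \<le> \<bar>y\<bar>" by (auto simp: B_def)
    then show ?thesis using b gz by force
  qed (use z in auto)
  have z0: "g' z = 0" by (rule DERIV_local_max[OF D(1), of 1]) (use mx in auto)
  obtain d where d: "d > 0" "\<And>h. 0 < h \<Longrightarrow> h < d \<Longrightarrow> g' z < g' (z + h)"
    using DERIV_pos_inc_right[OF D(2)[of z] s[OF gz]] by auto
  obtain c where c: "z < c" "c < z + d/2" "g (z + d/2) - g z = (z + d/2 - z) * g' c"
    using MVT2[of z "z + d/2" g g'] D(1) d(1) by auto
  have "g' c > 0" using d(2)[of "c - z"] c z0 d(1) by auto
  then have "0 < (z + d/2 - z) * g' c" using d(1) by simp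
  then show False using c(3) mx[of "z + d/2"] by linarith
qed

text \<open>Landau's inequality on an interval of length one.\<close>

lemma derivative_interpolation:
  fixes g g' s :: "real \<Rightarrow> real"
  assumes D: "\<And>x. (g has_real_derivative g' x) (at x)" "\<And>x. (g' has_real_derivative s x) (at x)"
    and b: "\<bar>g x\<bar> \<le> e1" "\<bar>g (x + 1)\<bar> \<le> e1" "\<And>z. x \<le> z \<Longrightarrow> z \<le> x + 1 \<Longrightarrow> \<bar>s z\<bar> \<le> e2"
  shows "\<bar>g' x\<bar> \<le> 2 * e1 + e2"
proof -
  obtain c where c: "x < c" "c < x + 1" "g (x + 1) - g x = (x + 1 - x) * g' c" using MVT2[of x "x + 1" g g'] D(1) by auto
  obtain d where d: "x < d" "d < c" "g' c - g' x = (c - x) * s d" using MVT2[of x c g' s] D(2) c by auto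
  have "\<bar>(c - x) * s d\<bar> \<le> 1 * e2" unfolding abs_mult by (intro mult_mono) (use c d b(3)[of d] in auto)
  then have "\<bar>g' c - g' x\<bar> \<le> e2" using d(3) by simp
  moreover have "g' c = g (x + 1) - g x" using c(3) by simp
  ultimately show ?thesis using b(1,2) by linarith
qed

lemma exp_slope:
  fixes a b :: real
  assumes "\<bar>a\<bar> \<le> 1/2" "\<bar>b\<bar> \<le> 1/2"
  shows "b \<le> a \<Longrightarrow> (a - b) / 2 \<le> exp a - exp b" "\<bar>exp a - exp b\<bar> \<le> 2 * \<bar>a - b\<bar>"
proof -
  have lo: "1/2 \<le> exp z" if "\<bar>z\<bar> \<le> 1/2" for z :: real using exp_ge_add_one_self[of z] that by linarith
  have hi: "exp z \<le> 2" if "\<bar>z\<bar> \<le> 1/2" for z :: real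
  proof -
    have "z\<^sup>2 \<le> 1/4" using abs_le_square_iff[of z "1/2"] that by (simp add: power2_eq_square)
    then show ?thesis using exp_small_bounds(1)[OF that] that by linarith
  qed
  show "(a - b) / 2 \<le> exp a - exp b" if "b \<le> a"
  proof -
    have "1/2 * (a - b) \<le> exp b * (exp (a - b) - 1)"
    proof (rule mult_mono)
      show "a - b \<le> exp (a - b) - 1" using exp_ge_add_one_self[of "a - b"] by linarith
    qed (use lo[OF assms(2)] that in auto)
    also have "\<dots> = exp a - exp b" by (simp add: exp_diff field_simps)
    finally show ?thesis by simp
  qed
  have "exp x - exp y \<le> 2 * (x - y)" if "\<bar>x\<bar> \<le> 1/2" "y \<le> x" for x y :: real
  proof -
    have "exp x - exp y = exp x * (1 - exp (y - x))" by (simp add: exp_diff field_simps)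
    also have "\<dots> \<le> 2 * (x - y)"
    proof (rule mult_mono)
      show "1 - exp (y - x) \<le> x - y" using exp_ge_add_one_self[of "y - x"] by linarith
    qed (use hi[OF that(1)] that in auto)
    finally show ?thesis .
  qed
  from this[of a b] this[of b a] show "\<bar>exp a - exp b\<bar> \<le> 2 * \<bar>a - b\<bar>"
    using assms by (cases "b \<le> a") auto
qed

text \<open>The constants \<open>\<plusminus> 2 * \<delta>\<close> are a super- and a subsolution; the bounds for the gradient follow by interpolation.\<close>

lemma poisson_slice:
  fixes f p n :: "real \<Rightarrow> real"
  assumes D: "\<And>x. (f has_real_derivative p x) (at x)" "\<And>x. (p has_real_derivative exp (f x) - 1 - n x) (at x)"
    and \<delta>: "0 < \<delta>" "\<delta> \<le> 1/4" and n: "\<And>x. \<bar>n x\<bar> \<le> \<delta>" and lim: "(n \<longlongrightarrow> 0) at_infinity" "(f \<longlongrightarrow> 0) at_infinity"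
  shows "\<bar>f x\<bar> \<le> 2 * \<delta>" "\<bar>p x\<bar> \<le> 9 * \<delta>" "\<bar>exp (f x) - 1 - n x\<bar> \<le> 4 * \<delta>" "(p \<longlongrightarrow> 0) at_infinity"
proof -
  have near: "\<exists>b. \<forall>x. b \<le> \<bar>x\<bar> \<longrightarrow> \<bar>F x\<bar> < e" if "(F \<longlongrightarrow> 0) at_infinity" "e > 0" for F :: "real \<Rightarrow> real" and e
    using tendstoD[OF that] by (simp add: eventually_at_infinity)
  obtain b where b: "\<And>x. b \<le> \<bar>x\<bar> \<Longrightarrow> \<bar>f x\<bar> < 2 * \<delta>" using near[OF lim(2), of "2 * \<delta>"] \<delta> by auto
  have up: "f x \<le> 2 * \<delta>" for x
  proof -
    have "f x - 2 * \<delta> \<le> 0"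
    proof (rule no_positive_maximum[where g="\<lambda>x. f x - 2 * \<delta>" and g'=p and s="\<lambda>x. exp (f x) - 1 - n x" and b=b])
      show "0 < exp (f x) - 1 - n x" if "0 < f x - 2 * \<delta>" for x
        using exp_ge_add_one_self[of "f x"] n[of x] that \<delta> by linarith
      show "((\<lambda>x. f x - 2 * \<delta>) has_real_derivative p x) (at x)" for x by (auto intro!: derivative_eq_intros D)
      show "f x - 2 * \<delta> \<le> 0" if "b \<le> \<bar>x\<bar>" for x using b[OF that] by linarith
    qed (rule D)
    then show ?thesis by simp
  qed
  have lo: "- f x \<le> 2 * \<delta>" for x
  proof -
    have "- f x - 2 * \<delta> \<le> 0"
    proof (rule no_positive_maximum[where g="\<lambda>x. - f x - 2 * \<delta>" and g'="\<lambda>x. - p x" and s="\<lambda>x. - (exp (f x) - 1 - n x)" and b=b])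
      show "0 < - (exp (f x) - 1 - n x)" if "0 < - f x - 2 * \<delta>" for x
      proof -
        have "exp (f x) < exp (- 2 * \<delta>)" using that by simp
        moreover have "exp (- 2 * \<delta>) \<le> 1 - 2 * \<delta> + 4 * (\<delta> * \<delta>)"
          using exp_small_bounds(1)[of "-2 * \<delta>"] \<delta> by (simp add: power2_eq_square)
        moreover have "\<delta> * \<delta> \<le> 1/4 * \<delta>" using \<delta> by (intro mult_right_mono) auto
        ultimately show ?thesis using n[of x] by linarith
      qed
      show "((\<lambda>x. - f x - 2 * \<delta>) has_real_derivative - p x) (at x)" for x by (auto intro!: derivative_eq_intros D)
      show "((\<lambda>x. - p x) has_real_derivative - (exp (f x) - 1 - n x)) (at x)" for x by (rule DERIV_minus[OF D(2)])
      show "- f x - 2 * \<delta> \<le> 0" if "b \<le> \<bar>x\<bar>" for x using b[OF that] by linarith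
    qed
    then show ?thesis by simp
  qed
  have f: "\<bar>f x\<bar> \<le> 2 * \<delta>" for x using up[of x] lo[of x] by linarith
  have s: "\<bar>exp (f x) - 1 - n x\<bar> \<le> 2 * \<bar>f x\<bar> + \<bar>n x\<bar>" for x
    using exp_slope(2)[of "f x" 0] f[of x] \<delta> by simp
  show "\<bar>f x\<bar> \<le> 2 * \<delta>" by (rule f)
  have s2: "\<bar>exp (f x) - 1 - n x\<bar> \<le> 4 * \<delta>" for x
  proof -
    have "\<bar>exp (f x) - 1 - f x\<bar> \<le> \<bar>f x\<bar> * \<bar>f x\<bar>" using exp_small_bounds(1)[of "f x"] f[of x] \<delta> by (simp add: power2_eq_square)
    also have "\<dots> \<le> 1/2 * \<bar>f x\<bar>" using f[of x] \<delta> by (intro mult_right_mono) auto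
    finally show ?thesis using f[of x] n[of x] by linarith
  qed
  show "\<bar>exp (f x) - 1 - n x\<bar> \<le> 4 * \<delta>" by (rule s2)
  show "\<bar>p x\<bar> \<le> 9 * \<delta>" using derivative_interpolation[OF D f f s2, of x] \<delta> by linarith
  show "(p \<longlongrightarrow> 0) at_infinity"
  proof (rule tendstoI)
    fix e :: real assume e: "e > 0"
    obtain b1 where b1: "\<And>x. b1 \<le> \<bar>x\<bar> \<Longrightarrow> \<bar>f x\<bar> < e / 8" using near[OF lim(2), of "e/8"] e by auto
    obtain b2 where b2: "\<And>x. b2 \<le> \<bar>x\<bar> \<Longrightarrow> \<bar>n x\<bar> < e / 8" using near[OF lim(1), of "e/8"] e by auto
    have "dist (p x) 0 < e" if x: "\<bar>b1\<bar> + \<bar>b2\<bar> + 1 \<le> norm x" for x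
    proof -
      have z: "\<bar>f z\<bar> \<le> e / 8" "\<bar>n z\<bar> \<le> e / 8" if "x \<le> z" "z \<le> x + 1" for z
      proof -
        have "b1 \<le> \<bar>z\<bar>" "b2 \<le> \<bar>z\<bar>" using x that unfolding real_norm_def by linarith+
        then show "\<bar>f z\<bar> \<le> e / 8" "\<bar>n z\<bar> \<le> e / 8" using b1[of z] b2[of z] by linarith+
      qed
      have "\<bar>p x\<bar> \<le> 2 * (e / 8) + 3 * e / 8"
      proof (rule derivative_interpolation[OF D])
        show "\<bar>exp (f z) - 1 - n z\<bar> \<le> 3 * e / 8" if "x \<le> z" "z \<le> x + 1" for z using s[of z] z[OF that] by linarith
      qed (use z in auto)
      then show ?thesis using e by simp
    qed
    then show "\<forall>\<^sub>F x in at_infinity. dist (p x) 0 < e" by (auto simp: eventually_at_infinity)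
  qed
qed

text \<open>Multiply the equation by the potential and integrate.\<close>

lemma poisson_slice_L2:
  fixes f p n :: "real \<Rightarrow> real"
  assumes D: "\<And>x. (f has_real_derivative p x) (at x)" "\<And>x. (p has_real_derivative exp (f x) - 1 - n x) (at x)"
    and f: "\<And>x. \<bar>f x\<bar> \<le> 1/2" and lim: "(f \<longlongrightarrow> 0) at_infinity" "(p \<longlongrightarrow> 0) at_infinity" and c: "continuous_on UNIV n"
    and int: "integrable lborel (\<lambda>x. (n x)\<^sup>2)" "integrable lborel (\<lambda>x. (f x)\<^sup>2)" "integrable lborel (\<lambda>x. (p x)\<^sup>2)"
  shows "(LINT x|lborel. (p x)\<^sup>2) \<le> (LINT x|lborel. (n x)\<^sup>2)" "(LINT x|lborel. (f x)\<^sup>2) \<le> 4 * (LINT x|lborel. (n x)\<^sup>2)"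
proof -
  have cf: "continuous_on UNIV f" "continuous_on UNIV p" using D by (auto intro!: continuous_at_imp_continuous_on DERIV_isCont)
  define g where "g x = (p x)\<^sup>2 + f x * (exp (f x) - 1 - n x)" for x
  have cg: "continuous_on UNIV g" unfolding g_def by (intro continuous_intros cf c)
  have lo: "(p x)\<^sup>2 + (f x)\<^sup>2 / 4 - (n x)\<^sup>2 \<le> g x" for x
  proof -
    have "f x * n x \<le> (f x)\<^sup>2 / 4 + (n x)\<^sup>2" using zero_le_power2[of "f x / 2 - n x"] by (simp add: power2_eq_square algebra_simps)
    then show ?thesis unfolding g_def right_diff_distrib[of "f x" "exp (f x) - 1"] using exp_small_bounds(3)[OF f[of x]] by linarith
  qed
  have hi: "\<bar>g x\<bar> \<le> (p x)\<^sup>2 + 3 * (f x)\<^sup>2 + (n x)\<^sup>2" for x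
  proof -
    have "\<bar>exp (f x) - 1\<bar> \<le> 2 * \<bar>f x\<bar>" using exp_slope(2)[of "f x" 0] f[of x] by simp
    then have "\<bar>f x\<bar> * \<bar>exp (f x) - 1\<bar> \<le> \<bar>f x\<bar> * (2 * \<bar>f x\<bar>)" by (intro mult_left_mono) auto
    then have 1: "\<bar>f x * (exp (f x) - 1)\<bar> \<le> 2 * (f x)\<^sup>2" by (simp add: abs_mult power2_eq_square)
    have 2: "\<bar>f x * n x\<bar> \<le> (f x)\<^sup>2 + (n x)\<^sup>2"
      using zero_le_power2[of "\<bar>f x\<bar> - \<bar>n x\<bar>"] zero_le_power2[of "f x"] zero_le_power2[of "n x"]
      unfolding power2_diff power2_abs abs_mult by linarith
    show ?thesis unfolding g_def right_diff_distrib[of "f x" "exp (f x) - 1"] using 1 2 zero_le_power2[of "p x"] zero_le_power2[of "f x"] by linarith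
  qed
  have ig: "integrable lborel g"
  proof (rule Bochner_Integration.integrable_bound)
    show "integrable lborel (\<lambda>x. (p x)\<^sup>2 + 3 * (f x)\<^sup>2 + (n x)\<^sup>2)" using int by auto
    show "g \<in> borel_measurable lborel" using borel_measurable_continuous_onI[OF cg] by simp
    show "AE x in lborel. norm (g x) \<le> norm ((p x)\<^sup>2 + 3 * (f x)\<^sup>2 + (n x)\<^sup>2)"
      using hi by (intro AE_I2) (simp add: order_trans[OF hi abs_ge_self])
  qed
  have "(LINT x|lborel. g x) = 0"
  proof (rule integral_derivative_eq_0[OF _ cg ig])
    show "((\<lambda>x. f x * p x) has_real_derivative g x) (at x)" for x
      unfolding g_def by (auto intro!: derivative_eq_intros D simp: power2_eq_square algebra_simps)
    show "((\<lambda>x. f x * p x) \<longlongrightarrow> 0) at_infinity" using tendsto_mult[OF lim] by simp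
  qed
  moreover have "(LINT x|lborel. (p x)\<^sup>2 + (f x)\<^sup>2 / 4 - (n x)\<^sup>2) \<le> (LINT x|lborel. g x)"
    using int lo by (intro integral_mono ig) auto
  ultimately have "(LINT x|lborel. (p x)\<^sup>2) + (LINT x|lborel. (f x)\<^sup>2) / 4 \<le> (LINT x|lborel. (n x)\<^sup>2)"
    using int by simp
  moreover have "0 \<le> (LINT x|lborel. (p x)\<^sup>2)" "0 \<le> (LINT x|lborel. (f x)\<^sup>2)" by simp_all
  ultimately show "(LINT x|lborel. (p x)\<^sup>2) \<le> (LINT x|lborel. (n x)\<^sup>2)" "(LINT x|lborel. (f x)\<^sup>2) \<le> 4 * (LINT x|lborel. (n x)\<^sup>2)"
    by linarith+
qed

text \<open>The density is only locally uniformly continuous in time, and uniform bounds alone do not give convergence of the potential.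
The function \<open>1 + (x - x0)\<^sup>2 / 16\<close> is a supersolution that grows at infinity, so far away any
bounded difference of two densities is harmless.\<close>

lemma poisson_gradient_continuous:
  fixes f p n :: "real \<Rightarrow> real \<Rightarrow> real"
  assumes D: "\<And>t x. (f t has_real_derivative p t x) (at x)" "\<And>t x. (p t has_real_derivative exp (f t x) - 1 - n t x) (at x)"
    and \<delta>: "0 < \<delta>" "\<delta> \<le> 1/4" and n: "\<And>t x. \<bar>n t x\<bar> \<le> \<delta>"
    and lim: "\<And>t. (n t \<longlongrightarrow> 0) at_infinity" "\<And>t. (f t \<longlongrightarrow> 0) at_infinity"
    and c: "\<And>z. jcont n z"
  shows "jcont p z"
proof -
  obtain t0 x0 where z: "z = (t0,x0)" by (cases z)
  note ps = poisson_slice[OF D \<delta> n lim]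
  have fh: "\<bar>f t x\<bar> \<le> 1/2" for t x using ps(1)[of t x] \<delta> by linarith
  have slice: "\<exists>d>0. \<forall>t. \<bar>t - t0\<bar> < d \<longrightarrow> \<bar>p t x0 - p t0 x0\<bar> \<le> 9 * \<eta>" if \<eta>: "\<eta> > 0" "\<eta> \<le> 1" for \<eta>
  proof -
    \<comment> \<open>Its second derivative is \<open>1/8\<close>, less than a quarter of \<open>\<psi>\<close> itself.\<close>
    define \<psi> where "\<psi> x = 1 + (x - x0)\<^sup>2 / 16" for x
    have \<psi>1: "\<psi> x \<ge> 1" for x by (simp add: \<psi>_def)
    define X where "X = 128 / \<eta> + 1"
    have far: "1 \<le> \<eta> / 8 * \<psi> x" if "X \<le> \<bar>x - x0\<bar>" for x
    proof -
      have "1 \<le> X" "128 / \<eta> \<le> X" using \<eta> by (auto simp: X_def)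
      then have "128 / \<eta> * 1 \<le> \<bar>x - x0\<bar> * \<bar>x - x0\<bar>" using that \<eta> by (intro mult_mono) auto
      then have "128 \<le> \<eta> * (x - x0)\<^sup>2" using \<eta> by (simp add: power2_eq_square field_simps)
      then show ?thesis using \<eta> by (simp add: \<psi>_def field_simps)
    qed
    have "uniformly_continuous_on ({t0-1..t0+1} \<times> {x0-X..x0+X}) (\<lambda>z. n (fst z) (snd z))"
      using c by (intro compact_uniformly_continuous compact_Times compact_Icc continuous_at_imp_continuous_on) auto
    then obtain d where d: "d > 0" and dd: "\<And>z z'. z \<in> {t0-1..t0+1} \<times> {x0-X..x0+X} \<Longrightarrow> z' \<in> {t0-1..t0+1} \<times> {x0-X..x0+X} \<Longrightarrow> dist z' z < d
        \<Longrightarrow> dist (n (fst z') (snd z')) (n (fst z) (snd z)) < \<eta> / 8"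
      unfolding uniformly_continuous_on_def using \<eta>(1) by (metis zero_less_divide_iff zero_less_numeral)
    have main: "\<bar>p t x0 - p t0 x0\<bar> \<le> 9 * \<eta>" if t: "\<bar>t - t0\<bar> < min d 1" for t
    proof -
      have nn: "\<bar>n t x - n t0 x\<bar> \<le> \<eta> / 8 * \<psi> x" for x
      proof (cases "\<bar>x - x0\<bar> \<le> X")
        case True
        have "dist (n (fst (t,x)) (snd (t,x))) (n (fst (t0,x)) (snd (t0,x))) < \<eta> / 8"
          by (rule dd) (use t True in \<open>auto simp: abs_le_iff dist_Pair_Pair dist_real_def\<close>)
        moreover have "\<eta> / 8 * 1 \<le> \<eta> / 8 * \<psi> x" using \<eta> \<psi>1 by (intro mult_left_mono) auto
        ultimately show ?thesis by (simp add: dist_real_def)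
      next
        case False
        then show ?thesis using far[of x] n[of t x] n[of t0 x] \<delta> by linarith
      qed
      have cmp: "g * (f t x - f t0 x) \<le> \<eta> * \<psi> x" if g: "g = 1 \<or> g = -1" for g x :: real
      proof -
        have "g * (f t x - f t0 x) - \<eta> * \<psi> x \<le> 0"
        proof (rule no_positive_maximum[where g="\<lambda>x. g * (f t x - f t0 x) - \<eta> * \<psi> x"
              and g'="\<lambda>x. g * (p t x - p t0 x) - \<eta> * ((x - x0) / 8)"
              and s="\<lambda>x. g * ((exp (f t x) - 1 - n t x) - (exp (f t0 x) - 1 - n t0 x)) - \<eta> / 8" and b="\<bar>x0\<bar> + X"])
          show "((\<lambda>x. g * (f t x - f t0 x) - \<eta> * \<psi> x) has_real_derivative g * (p t x - p t0 x) - \<eta> * ((x - x0) / 8)) (at x)" for x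
            unfolding \<psi>_def by (auto intro!: derivative_eq_intros D)
          show "((\<lambda>x. g * (p t x - p t0 x) - \<eta> * ((x - x0) / 8)) has_real_derivative
              g * ((exp (f t x) - 1 - n t x) - (exp (f t0 x) - 1 - n t0 x)) - \<eta> / 8) (at x)" for x
            by (auto intro!: derivative_eq_intros D)
          show "g * (f t x - f t0 x) - \<eta> * \<psi> x \<le> 0" if "\<bar>x0\<bar> + X \<le> \<bar>x\<bar>" for x
          proof -
            have "X \<le> \<bar>x - x0\<bar>" using that by linarith
            from far[OF this] have "1 \<le> \<eta> * \<psi> x" by linarith
            then show ?thesis using fh[of t x] fh[of t0 x] g by (auto simp: abs_le_iff)
          qed
          show "0 < g * ((exp (f t x) - 1 - n t x) - (exp (f t0 x) - 1 - n t0 x)) - \<eta> / 8" if "0 < g * (f t x - f t0 x) - \<eta> * \<psi> x" for x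
          proof -
            have e: "\<eta> \<le> \<eta> * \<psi> x" using \<psi>1[of x] \<eta> by simp
            have pos: "0 < \<eta> * \<psi> x" using e \<eta>(1) by linarith
            have gg: "g * (f t x - f t0 x) / 2 \<le> g * (exp (f t x) - exp (f t0 x))"
            proof (cases "g = 1")
              case True
              have "f t0 x \<le> f t x" using that pos True by simp
              from exp_slope(1)[OF fh fh this] show ?thesis using True by simp
            next
              case False
              then have g: "g = -1" using g by simp
              have "f t x \<le> f t0 x" using that pos g by simp
              from exp_slope(1)[OF fh fh this] show ?thesis using g by simp
            qed
            have "g * (n t x - n t0 x) \<le> \<eta> / 8 * \<psi> x" using order_trans[OF _ nn[of x], of "g * (n t x - n t0 x)"] g by auto
            then have "g * (n t x - n t0 x) \<le> \<eta> * \<psi> x / 8" by simp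
            moreover have "g * ((exp (f t x) - 1 - n t x) - (exp (f t0 x) - 1 - n t0 x)) = g * (exp (f t x) - exp (f t0 x)) - g * (n t x - n t0 x)"
              by (simp add: algebra_simps)
            ultimately show ?thesis using gg that e \<eta>(1) by linarith
          qed
        qed
        then show ?thesis by simp
      qed
      have v: "\<bar>f t x - f t0 x\<bar> \<le> \<eta> * \<psi> x" for x using cmp[of 1 x] cmp[of "-1" x] by auto
      have \<psi>2: "\<eta> * \<psi> x \<le> 2 * \<eta>" if "x0 \<le> x" "x \<le> x0 + 1" for x
      proof -
        have "(x - x0)\<^sup>2 \<le> 1\<^sup>2" using that by (intro power_mono) auto
        then show ?thesis using \<eta> by (simp add: \<psi>_def)
      qed
      have "\<bar>p t x0 - p t0 x0\<bar> \<le> 2 * (2 * \<eta>) + 5 * \<eta>"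
      proof (rule derivative_interpolation[where g="\<lambda>x. f t x - f t0 x" and g'="\<lambda>x. p t x - p t0 x"
            and s="\<lambda>x. (exp (f t x) - 1 - n t x) - (exp (f t0 x) - 1 - n t0 x)"])
        show "((\<lambda>x. f t x - f t0 x) has_real_derivative p t x - p t0 x) (at x)" for x by (intro DERIV_diff D)
        show "((\<lambda>x. p t x - p t0 x) has_real_derivative (exp (f t x) - 1 - n t x) - (exp (f t0 x) - 1 - n t0 x)) (at x)" for x
          by (intro DERIV_diff D)
        show "\<bar>f t x0 - f t0 x0\<bar> \<le> 2 * \<eta>" "\<bar>f t (x0 + 1) - f t0 (x0 + 1)\<bar> \<le> 2 * \<eta>"
          using v[of x0] v[of "x0 + 1"] \<psi>2[of x0] \<psi>2[of "x0 + 1"] by linarith+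
        show "\<bar>(exp (f t z) - 1 - n t z) - (exp (f t0 z) - 1 - n t0 z)\<bar> \<le> 5 * \<eta>" if "x0 \<le> z" "z \<le> x0 + 1" for z
        proof -
          have lin: "a \<le> 4 * \<eta>" if "a \<le> 2 * b" "b \<le> 2 * \<eta>" for a b using that by linarith
          have "\<bar>exp (f t z) - exp (f t0 z)\<bar> \<le> 4 * \<eta>" 
            by (rule lin[OF exp_slope(2)[OF fh[of t z] fh[of t0 z]] order_trans[OF v[of z] \<psi>2[OF that]]])
          moreover have "\<eta> / 8 * \<psi> z \<le> \<eta>" using \<psi>2[OF that] \<eta>(1) by simp
          then have "\<bar>n t z - n t0 z\<bar> \<le> \<eta>" by (rule order_trans[OF nn])
          moreover have "\<bar>(a - 1 - b) - (a' - 1 - b')\<bar> \<le> 5 * \<eta>" if "\<bar>a - a'\<bar> \<le> 4 * \<eta>" "\<bar>b - b'\<bar> \<le> \<eta>" for a b a' b'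
            using that by linarith
          ultimately show ?thesis by blast
        qed
      qed
      then show ?thesis by simp
    qed
    then show ?thesis using d by (intro exI[of _ "min d 1"]) auto
  qed
  have lip: "\<bar>p t x - p t x'\<bar> \<le> \<bar>x - x'\<bar>" for t x x'
  proof -
    have "norm (p t x - p t x') \<le> 1 * norm (x - x')"
    proof (rule field_differentiable_bound[where S=UNIV])
      show "(p t has_field_derivative exp (f t z) - 1 - n t z) (at z within UNIV)" for z using D(2) by simp
      show "norm (exp (f t z) - 1 - n t z) \<le> 1" for z using ps(3)[of t z] \<delta> by simp
    qed auto
    then show ?thesis by simp
  qed
  show ?thesis unfolding z continuous_at_eps_delta
  proof (intro allI impI)
    fix e :: real assume e: "e > 0"
    obtain d where d: "d > 0" "\<And>t. \<bar>t - t0\<bar> < d \<Longrightarrow> \<bar>p t x0 - p t0 x0\<bar> \<le> 9 * min 1 (e / 20)"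
      using slice[of "min 1 (e/20)"] e by auto
    show "\<exists>d>0. \<forall>z'. dist z' (t0, x0) < d \<longrightarrow> dist (p (fst z') (snd z')) (p (fst (t0, x0)) (snd (t0, x0))) < e"
    proof (intro exI[of _ "min d (e/2)"] conjI allI impI)
      fix z' :: "real \<times> real" assume a: "dist z' (t0,x0) < min d (e/2)"
      have b: "\<bar>fst z' - t0\<bar> < d" "\<bar>snd z' - x0\<bar> < e/2"
        using a dist_fst_le[of z' "(t0,x0)"] dist_snd_le[of z' "(t0,x0)"] by (auto simp: dist_real_def)
      have gen: "\<bar>a - c\<bar> < e" if "\<bar>a - b\<bar> \<le> r" "r < e / 2" "\<bar>b - c\<bar> \<le> 9 * m" "m \<le> e / 20" for a b c r m :: real
        using that e by linarith
      have "\<bar>p (fst z') (snd z') - p t0 x0\<bar> < e" by (rule gen[OF lip b(2) d(2)[OF b(1)]]) simp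
      then show "dist (p (fst z') (snd z')) (p (fst (t0, x0)) (snd (t0, x0))) < e" by (simp add: dist_real_def)
    qed (use d e in auto)
  qed
qed

text \<open>The bounded solution of \<open>H' = F - H\<close>, a causal filter of the density. Written in the variable \<open>y\<close> of the kernel, the
dependence on the argument \<open>x\<close> sits in \<open>F\<close> alone.\<close>

definition Hf :: "(real \<Rightarrow> real) \<Rightarrow> real \<Rightarrow> real" where
  "Hf F x = (LINT y:{0<..}|lborel. exp (- y) * F (x - y))"

lemma exp_neg_integral:
  "set_integrable lborel {0<..} (\<lambda>y::real. exp (- y))" "(LINT y:{0<..}|lborel. exp (- y :: real)) = 1"
proof -
  define E where "E y = indicat_real {0..} y * exp (- y)" for y :: real
  have m: "E \<in> borel_measurable lborel" unfolding E_def by measurable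
  have "((\<lambda>y::real. exp (- y)) has_integral 1) {0..}" using has_integral_exp_minus_to_infinity[of 1 0] by simp
  then have "((\<lambda>y. if y \<in> {0..} then exp (- y) else 0) has_integral 1) (UNIV :: real set)" by (rule has_integral_restrict_UNIV[THEN iffD2])
  moreover have "(\<lambda>y. if y \<in> {0..} then exp (- y) else 0) = E" by (auto simp: E_def fun_eq_iff)
  ultimately have "(E has_integral 1) UNIV" by simp
  then have nn: "(\<integral>\<^sup>+y. ennreal (E y) \<partial>lborel) = ennreal 1"
    using nn_integral_has_integral_lborel[of E 1] m by (auto simp: E_def)
  have i: "integrable lborel E" by (rule integrableI_nn_integral_finite[OF m _ nn]) (auto simp: E_def)
  have "(LINT y|lborel. E y) = enn2real (\<integral>\<^sup>+y. ennreal (E y) \<partial>lborel)"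
    by (rule integral_eq_nn_integral[OF m]) (auto simp: E_def)
  then have 1: "(LINT y|lborel. E y) = 1" unfolding nn by simp
  have s: "set_integrable lborel {0..} (\<lambda>y::real. exp (- y))" using i by (simp add: set_integrable_def E_def[abs_def])
  then show "set_integrable lborel {0<..} (\<lambda>y::real. exp (- y))" by (rule set_integrable_subset) auto
  have "(LINT y:{0<..}|lborel. exp (- y :: real)) = (LINT y:{0..}|lborel. exp (- y))"
  proof (rule set_integral_cong_set)
    show "set_borel_measurable lborel {0<..} (\<lambda>y::real. exp (- y))" "set_borel_measurable lborel {0..} (\<lambda>y::real. exp (- y))"
      unfolding set_borel_measurable_def by measurable
    show "AE y in lborel. ((y::real) \<in> {0..}) = (y \<in> {0<..})" using AE_lborel_singleton[of "0::real"] by eventually_elim auto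
  qed
  then show "(LINT y:{0<..}|lborel. exp (- y :: real)) = 1" using 1[unfolded E_def[abs_def]] by (simp add: set_lebesgue_integral_def)
qed

lemma reflect_integrable:
  fixes F :: "real \<Rightarrow> real"
  assumes "integrable lborel F"
  shows "integrable lborel (\<lambda>y. F (x - y))" "(LINT y|lborel. F (x - y)) = (LINT y|lborel. F y)"
  using lborel_integrable_real_affine[OF assms, of "-1" x] lborel_integral_real_affine[of "-1" F x] by simp_all

text \<open>Young's inequality turns the \<open>L\<^sup>2\<close> bound into a tail estimate that is uniform in \<open>x\<close>.\<close>

lemma filter_tail:
  fixes F :: "real \<Rightarrow> real"
  assumes c: "continuous_on UNIV F" and i: "integrable lborel (\<lambda>x. (F x)\<^sup>2)" and J: "0 \<le> J"
  shows "set_integrable lborel {J<..} (\<lambda>y. exp (- y) * F (x - y))"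
    "\<bar>LINT y:{J<..}|lborel. exp (- y) * F (x - y)\<bar> \<le> exp (- J / 2) / 2 * (1 + (LINT x|lborel. (F x)\<^sup>2))"
proof -
  define B where "B y = exp (- J / 2) / 2 * (indicat_real {0<..} y * exp (- y) + (F (x - y))\<^sup>2)" for y
  note r = reflect_integrable[OF i, of x]
  note e = exp_neg_integral[unfolded set_integrable_def set_lebesgue_integral_def real_scaleR_def]
  have iB: "integrable lborel B" and B1: "(LINT y|lborel. B y) = exp (- J / 2) / 2 * (1 + (LINT x|lborel. (F x)\<^sup>2))"
    unfolding B_def using r e by auto
  have cF: "continuous_on UNIV (\<lambda>y. F (x - y))" by (rule continuous_on_compose2[OF c]) (auto intro!: continuous_intros)
  have m: "(\<lambda>y. indicat_real {J<..} y * (exp (- y) * F (x - y))) \<in> borel_measurable lborel"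
    using borel_measurable_continuous_onI[OF cF] by measurable
  have bd: "\<bar>indicat_real {J<..} y * (exp (- y) * F (x - y))\<bar> \<le> B y" for y
  proof (cases "y > J")
    case True
    have "exp (- y) = exp (- y / 2) * exp (- y / 2)" by (simp add: exp_add[symmetric])
    have "\<bar>exp (- y) * F (x - y)\<bar> = exp (- y / 2) * (exp (- y / 2) * \<bar>F (x - y)\<bar>)"
      by (simp add: abs_mult exp_add[symmetric] mult.assoc[symmetric])
    also have "\<dots> \<le> exp (- J / 2) * ((exp (- y) + (F (x - y))\<^sup>2) / 2)"
    proof (intro mult_mono)
      have "(exp (- y / 2))\<^sup>2 = exp (- y)" by (simp add: power2_eq_square exp_add[symmetric])
      then show "exp (- y / 2) * \<bar>F (x - y)\<bar> \<le> (exp (- y) + (F (x - y))\<^sup>2) / 2"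
        using zero_le_power2[of "exp (- y / 2) - \<bar>F (x - y)\<bar>"] unfolding power2_diff by simp
    qed (use True in auto)
    finally show ?thesis using True J by (simp add: B_def)
  qed (simp add: B_def)
  show 1: "set_integrable lborel {J<..} (\<lambda>y. exp (- y) * F (x - y))"
    unfolding set_integrable_def real_scaleR_def
    by (rule Bochner_Integration.integrable_bound[OF iB m]) (simp add: order_trans[OF bd abs_ge_self])
  show "\<bar>LINT y:{J<..}|lborel. exp (- y) * F (x - y)\<bar> \<le> exp (- J / 2) / 2 * (1 + (LINT x|lborel. (F x)\<^sup>2))"
    unfolding B1[symmetric] set_lebesgue_integral_def real_scaleR_def real_norm_def[symmetric]
    by (rule Bochner_Integration.integral_norm_bound_integral[OF 1[unfolded set_integrable_def real_scaleR_def] iB]) (use bd in simp)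
qed

lemma filter_bounds:
  assumes c: "continuous_on UNIV F" and i: "integrable lborel (\<lambda>x. (F x)\<^sup>2)"
  shows "\<bar>Hf F x\<bar> \<le> (1 + (LINT x|lborel. (F x)\<^sup>2)) / 2" "(\<And>x. \<bar>F x\<bar> \<le> C) \<Longrightarrow> \<bar>Hf F x\<bar> \<le> C"
proof -
  show "\<bar>Hf F x\<bar> \<le> (1 + (LINT x|lborel. (F x)\<^sup>2)) / 2" using filter_tail(2)[OF c i, of 0 x] by (simp add: Hf_def)
  assume b: "\<And>x. \<bar>F x\<bar> \<le> C"
  have "norm (LINT y|lborel. indicat_real {0<..} y * (exp (- y) * F (x - y))) \<le> (LINT y|lborel. C * (indicat_real {0<..} y * exp (- y)))"
  proof (rule Bochner_Integration.integral_norm_bound_integral)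
    show "integrable lborel (\<lambda>y. indicat_real {0<..} y * (exp (- y) * F (x - y)))"
      using filter_tail(1)[OF c i, of 0 x] by (simp add: set_integrable_def)
    show "integrable lborel (\<lambda>y. C * (indicat_real {0<..} y * exp (- y)))"
      using exp_neg_integral(1) by (simp add: set_integrable_def)
    show "norm (indicat_real {0<..} y * (exp (- y) * F (x - y))) \<le> C * (indicat_real {0<..} y * exp (- y))" for y
      using b[of "x - y"] by (auto simp: abs_mult mult.commute indicator_def)
  qed
  then show "\<bar>Hf F x\<bar> \<le> C" using exp_neg_integral(2) by (simp add: Hf_def set_lebesgue_integral_def)
qed

lemma filter_add:
  assumes "continuous_on UNIV F" "integrable lborel (\<lambda>x. (F x)\<^sup>2)" "continuous_on UNIV G" "integrable lborel (\<lambda>x. (G x)\<^sup>2)"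
  shows "Hf (\<lambda>x. F x + G x) x = Hf F x + Hf G x"
  using set_integral_add(2)[OF filter_tail(1)[OF assms(1,2), of 0 x] filter_tail(1)[OF assms(3,4), of 0 x]]
  by (simp add: Hf_def distrib_left)

lemma filter_past:
  assumes c: "continuous_on UNIV F" and i: "integrable lborel (\<lambda>x. (F x)\<^sup>2)"
  shows "set_integrable lborel {..<x} (\<lambda>z. exp z * F z)" "Hf F x = exp (- x) * (LINT z:{..<x}|lborel. exp z * F z)"
proof -
  define g where "g z = indicat_real {..<x} z * (exp z * F z)" for z
  have gx: "g (x - y) = exp x * (indicat_real {0<..} y * (exp (- y) * F (x - y)))" for y
    by (simp add: g_def indicator_def exp_diff exp_minus field_simps)
  have "integrable lborel (\<lambda>y. g (x - y))"
    unfolding gx using filter_tail(1)[OF c i, of 0 x] by (simp add: set_integrable_def)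
  then have "integrable lborel g" using lborel_integrable_real_affine_iff[of "-1" g x] by simp
  then show "set_integrable lborel {..<x} (\<lambda>z. exp z * F z)" by (simp add: set_integrable_def g_def[abs_def])
  have "(LINT z|lborel. g z) = (LINT y|lborel. g (x - y))" using lborel_integral_real_affine[of "-1" g x] by simp
  also have "\<dots> = exp x * Hf F x" unfolding gx Hf_def set_lebesgue_integral_def by simp
  finally show "Hf F x = exp (- x) * (LINT z:{..<x}|lborel. exp z * F z)"
    by (simp add: set_lebesgue_integral_def g_def exp_minus field_simps)
qed

lemma filter_derivative:
  assumes c: "continuous_on UNIV F" and i: "integrable lborel (\<lambda>x. (F x)\<^sup>2)"
  shows "(Hf F has_real_derivative F x - Hf F x) (at x)"
proof -
  define g where "g z = exp z * F z" for z
  have cg: "continuous_on S g" for S unfolding g_def by (intro continuous_intros continuous_on_subset[OF c]) auto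
  define K where "K = (LBINT z=-\<infinity>..ereal (x - 1). g z)"
  define \<Phi> where "\<Phi> s = (LBINT z=ereal (x - 1)..ereal s. g z)" for s
  have ii: "set_integrable lborel {..<s} g" for s unfolding g_def by (rule filter_past(1)[OF c i])
  have e: "Hf F s = exp (- s) * (K + \<Phi> s)" for s
  proof -
    have "K + \<Phi> s = (LBINT z=-\<infinity>..ereal s. g z)"
      unfolding K_def \<Phi>_def
    proof (rule interval_integral_sum)
      have mm: "min (-\<infinity>) (min (ereal (x - 1)) (ereal s)) = -\<infinity>" "max (-\<infinity>) (max (ereal (x - 1)) (ereal s)) = ereal (max (x - 1) s)"
        by (simp_all add: max_def)
      show "interval_lebesgue_integrable lborel (min (-\<infinity>) (min (ereal (x - 1)) (ereal s))) (max (-\<infinity>) (max (ereal (x - 1)) (ereal s))) g"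
        unfolding mm using ii by (simp add: interval_lebesgue_integrable_def del: ereal_max)
    qed
    also have "\<dots> = (LINT z:{..<s}|lborel. g z)" by (simp add: interval_lebesgue_integral_def)
    finally show ?thesis using filter_past(2)[OF c i, of s] by (simp add: g_def)
  qed
  have "(\<Phi> has_vector_derivative g x) (at x within {x-2..x+1})"
    unfolding \<Phi>_def by (rule interval_integral_FTC2) (auto intro: cg)
  then have \<Phi>': "(\<Phi> has_real_derivative g x) (at x)"
    by (simp add: has_real_derivative_iff_has_vector_derivative at_within_Icc_at)
  have "((\<lambda>s. exp (- s) * (K + \<Phi> s)) has_real_derivative F x - exp (- x) * (K + \<Phi> x)) (at x)"
    by (auto intro!: derivative_eq_intros \<Phi>' simp: g_def exp_minus field_simps)
  then show ?thesis unfolding e[abs_def] .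
qed

lemma filter_bc:
  assumes c: "continuous_on UNIV F" and i: "integrable lborel (\<lambda>x. (F x)\<^sup>2)"
  shows "bc (Hf F)"
proof (rule bcI)
  show "continuous_on UNIV (Hf F)" using filter_derivative[OF c i] by (auto intro!: continuous_at_imp_continuous_on DERIV_isCont)
qed (rule filter_bounds(1)[OF c i])

text \<open>By \<open>filter_tail\<close> the truncated integrals, which are continuous in their parameters, converge uniformly.\<close>

lemma filter_jcont:
  fixes F :: "real \<Rightarrow> real \<Rightarrow> real"
  assumes c: "\<And>z. jcont F z" and i: "\<And>t. integrable lborel (\<lambda>x. (F t x)\<^sup>2)" and K: "\<And>t. (LINT x|lborel. (F t x)\<^sup>2) \<le> K"
  shows "jcont (\<lambda>t. Hf (F t)) z"
proof -
  have cs: "continuous_on UNIV (F t)" for t using jcont_slices(1)[of F, OF c] by simp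
  define HJ where "HJ J z = integral {0..real J} (\<lambda>y. exp (- y) * F (fst z) (snd z - y))" for J :: nat and z :: "real \<times> real"
  have cHJ: "continuous_on UNIV (HJ J)" for J
  proof -
    have F2: "continuous_on UNIV (\<lambda>z. F (fst z) (snd z))" using c by (simp add: continuous_at_imp_continuous_on)
    have "continuous_on (UNIV \<times> cbox 0 (real J)) (\<lambda>w. F (fst (fst (fst w), snd (fst w) - snd w)) (snd (fst (fst w), snd (fst w) - snd w)))"
      by (rule continuous_on_compose2[OF F2]) (auto intro!: continuous_intros)
    then have "continuous_on (UNIV \<times> cbox 0 (real J)) (\<lambda>(z, y). exp (- y) * F (fst z) (snd z - y))"
      by (auto intro!: continuous_intros simp: case_prod_beta)
    from integral_continuous_on_param[OF this] show ?thesis unfolding HJ_def by simp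
  qed
  have K0: "0 \<le> K" using K[of 0] by (rule order_trans[rotated]) simp
  have d: "\<bar>HJ J z - Hf (F (fst z)) (snd z)\<bar> \<le> exp (- real J / 2) / 2 * (1 + K)" for J z
  proof -
    obtain t x where z: "z = (t,x)" by (cases z)
    define g where "g y = exp (- y) * F t (x - y)" for y
    have cg: "continuous_on S g" for S
      unfolding g_def by (intro continuous_intros continuous_on_compose2[OF cs]) auto
    have s: "set_integrable lborel {a<..} g" if "0 \<le> a" for a unfolding g_def by (rule filter_tail(1)[OF cs i that])
    have sJ: "set_integrable lborel {0<..real J} g" by (rule set_integrable_subset[OF s[of 0]]) auto
    have "Hf (F t) x = (LINT y:{0<..}|lborel. g y)" by (simp add: Hf_def g_def)
    also have "{0<..} = {0<..real J} \<union> {real J<..}" by auto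
    also have "(LINT y:({0<..real J} \<union> {real J<..})|lborel. g y) = (LINT y:{0<..real J}|lborel. g y) + (LINT y:{real J<..}|lborel. g y)"
      by (rule set_integral_Un[OF _ sJ s]) auto
    also have "(LINT y:{0<..real J}|lborel. g y) = integral {0<..real J} g"
      by (rule set_borel_integral_eq_integral(2)[OF sJ])
    also have "\<dots> = integral {0..real J} g"
    proof (rule integral_spike_set)
      show "negligible {y \<in> {0..real J} - {0<..real J}. g y \<noteq> 0}" by (rule negligible_subset[OF negligible_sing[of 0]]) auto
      have e: "{y \<in> {0<..real J} - {0..real J}. g y \<noteq> 0} = {}" by auto
      show "negligible {y \<in> {0<..real J} - {0..real J}. g y \<noteq> 0}" unfolding e by simp
    qed
    also have "\<dots> = HJ J z" by (simp add: HJ_def z g_def[abs_def])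
    finally have "\<bar>HJ J z - Hf (F t) x\<bar> = \<bar>LINT y:{real J<..}|lborel. g y\<bar>" by simp
    also have "\<dots> \<le> exp (- real J / 2) / 2 * (1 + (LINT x|lborel. (F t x)\<^sup>2))"
      unfolding g_def by (rule filter_tail(2)[OF cs i]) simp
    also have "\<dots> \<le> exp (- real J / 2) / 2 * (1 + K)" using K[of t] by (intro mult_left_mono) auto
    finally show ?thesis by (simp add: z)
  qed
  have "uniform_limit UNIV HJ (\<lambda>z. Hf (F (fst z)) (snd z)) sequentially"
  proof (rule uniform_limitI)
    fix e :: real assume e: "e > 0"
    have "(\<lambda>J. exp (- 1 / 2 :: real) ^ J / 2 * (1 + K)) \<longlonglongrightarrow> 0 / 2 * (1 + K)"
      by (intro tendsto_intros LIMSEQ_power_zero) simp_all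
    moreover have "exp (- 1 / 2 :: real) ^ J = exp (- real J / 2)" for J by (simp add: exp_of_nat_mult[symmetric])
    ultimately have "(\<lambda>J. exp (- real J / 2) / 2 * (1 + K)) \<longlonglongrightarrow> 0" by simp
    from order_tendstoD(2)[OF this e] show "\<forall>\<^sub>F J in sequentially. \<forall>z\<in>UNIV. dist (HJ J z) (Hf (F (fst z)) (snd z)) < e"
    proof eventually_elim
      case (elim J)
      show ?case using le_less_trans[OF d elim] by (simp add: dist_real_def)
    qed
  qed
  from uniform_limit_theorem[OF _ this] have "continuous_on UNIV (\<lambda>z. Hf (F (fst z)) (snd z))" using cHJ by simp
  then show ?thesis by (cases z) (simp add: continuous_on_eq_continuous_at)
qed

text \<open>The Lorentz profile is the derivative of a bounded function and decays so slowly that its derivative is smaller by a factor \<open>1 / A\<close> everywhere.\<close>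

lemma weight_lorentz:
  assumes A: "A > 0"
  shows "weight (1 / A) (\<lambda>x. 1 / (1 + ((x - y) / A)\<^sup>2)) (\<lambda>x. - (2 * ((x - y) / A) / A) / (1 + ((x - y) / A)\<^sup>2)\<^sup>2)"
    "(LINT x|lborel. 1 / (1 + ((x - y) / A)\<^sup>2)) = (LINT x|lborel. 1 / (1 + (x / A)\<^sup>2))"
    "((\<lambda>x. A * arctan ((x - y) / A)) has_real_derivative 1 / (1 + ((x - y) / A)\<^sup>2)) (at x)"
proof -
  have p: "1 + z\<^sup>2 > 0" "1 + z\<^sup>2 \<noteq> 0" for z :: real using zero_le_power2[of z] by linarith+
  have i1: "integrable lborel (\<lambda>x::real. inverse (1 + x\<^sup>2))" using integrable_inverse_1_plus_square by (simp add: set_integrable_def)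
  have i: "integrable lborel (\<lambda>x. 1 / (1 + ((x - y) / A)\<^sup>2))"
    using lborel_integrable_real_affine[OF i1, of "1/A" "-y/A"] A by (simp add: diff_divide_distrib inverse_eq_divide)
  have D: "((\<lambda>x. 1 / (1 + ((x - y) / A)\<^sup>2)) has_real_derivative - (2 * ((x - y) / A) / A) / (1 + ((x - y) / A)\<^sup>2)\<^sup>2) (at x)" for x
  proof -
    have "((\<lambda>x. 1 + ((x - y) / A)\<^sup>2) has_real_derivative 2 * ((x - y) / A) / A) (at x)"
      using A by (auto intro!: derivative_eq_intros)
    from DERIV_inverse'[OF this p(2)] show ?thesis by (simp add: inverse_eq_divide power2_eq_square mult_ac)
  qed
  have b: "\<bar>- (2 * z / A) / (1 + z\<^sup>2)\<^sup>2\<bar> \<le> 1 / A * (1 / (1 + z\<^sup>2))" for z :: real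
  proof -
    have "2 * \<bar>z\<bar> \<le> 1 + z\<^sup>2" using zero_le_power2[of "\<bar>z\<bar> - 1"] unfolding power2_diff by simp
    then have "2 * \<bar>z\<bar> / (A * (1 + z\<^sup>2)\<^sup>2) \<le> (1 + z\<^sup>2) / (A * (1 + z\<^sup>2)\<^sup>2)" using A by (intro divide_right_mono) auto
    also have "\<dots> = 1 / A * (1 / (1 + z\<^sup>2))" using p[of z] by (simp add: power2_eq_square)
    finally show ?thesis using A by (simp add: abs_mult)
  qed
  have l: "((\<lambda>x. 1 / (1 + ((x - y) / A)\<^sup>2)) \<longlongrightarrow> 0) at_infinity"
  proof (rule tendstoI)
    fix e :: real assume e: "e > 0"
    have "dist (1 / (1 + ((x - y) / A)\<^sup>2)) 0 < e" if x: "\<bar>y\<bar> + A * (1 / e + 1) \<le> norm x" for x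
    proof -
      have "A * (1 / e + 1) \<le> \<bar>x - y\<bar>" using x by auto
      then have z: "1 / e + 1 \<le> \<bar>(x - y) / A\<bar>" using A by (simp add: field_simps)
      then have "1 / e * 1 \<le> \<bar>(x - y) / A\<bar> * \<bar>(x - y) / A\<bar>" using e
        by (intro mult_mono) (auto intro: order_trans[rotated])
      then have "1 / e < 1 + ((x - y) / A)\<^sup>2" by (simp add: power2_eq_square)
      then have "1 / (1 + ((x - y) / A)\<^sup>2) < e" using e p[of "(x - y) / A"] by (simp add: field_simps)
      then show ?thesis using p[of "(x - y) / A"] by (simp add: dist_real_def)
    qed
    then show "\<forall>\<^sub>F x in at_infinity. dist (1 / (1 + ((x - y) / A)\<^sup>2)) 0 < e" by (auto simp: eventually_at_infinity)
  qed
  show "weight (1 / A) (\<lambda>x. 1 / (1 + ((x - y) / A)\<^sup>2)) (\<lambda>x. - (2 * ((x - y) / A) / A) / (1 + ((x - y) / A)\<^sup>2)\<^sup>2)"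
    unfolding weight_def
  proof (intro conjI allI D i l)
    show "continuous_on UNIV (\<lambda>x. - (2 * ((x - y) / A) / A) / (1 + ((x - y) / A)\<^sup>2)\<^sup>2)"
      using A p by (intro continuous_intros) auto
    fix x show "0 < 1 / (1 + ((x - y) / A)\<^sup>2)" "1 / (1 + ((x - y) / A)\<^sup>2) \<le> 1" using p[of "(x - y) / A"] by simp_all
    show "\<bar>- (2 * ((x - y) / A) / A) / (1 + ((x - y) / A)\<^sup>2)\<^sup>2\<bar> \<le> 1 / A * (1 / (1 + ((x - y) / A)\<^sup>2))" by (rule b)
  qed
  show "(LINT x|lborel. 1 / (1 + ((x - y) / A)\<^sup>2)) = (LINT x|lborel. 1 / (1 + (x / A)\<^sup>2))"
    using lborel_integral_real_affine[of 1 "\<lambda>x. 1 / (1 + ((x - y) / A)\<^sup>2)" y] by simp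
  show "((\<lambda>x. A * arctan ((x - y) / A)) has_real_derivative 1 / (1 + ((x - y) / A)\<^sup>2)) (at x)"
    using A by (auto intro!: derivative_eq_intros simp: inverse_eq_divide)
qed

lemma filter_past_closed:
  assumes c: "continuous_on UNIV F" and i: "integrable lborel (\<lambda>x. (F x)\<^sup>2)"
  shows "set_integrable lborel {..b} (\<lambda>z. exp (z - b) * F z)" "Hf F b = (LINT z:{..b}|lborel. exp (z - b) * F z)"
    "(LINT z:{..b}|lborel. \<bar>exp (z - b) * F z\<bar>) \<le> (1 + (LINT x|lborel. (F x)\<^sup>2)) / 2"
proof -
  have main: "set_integrable lborel {..b} (\<lambda>z. exp (z - b) * F z) \<and> Hf F b = (LINT z:{..b}|lborel. exp (z - b) * F z)"
    if c: "continuous_on UNIV F" and i: "integrable lborel (\<lambda>x. (F x)\<^sup>2)" for F :: "real \<Rightarrow> real"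
  proof -
    define g where "g z = exp z * F z" for z
    have cg: "continuous_on S g" for S unfolding g_def by (intro continuous_intros continuous_on_subset[OF c]) auto
    have "set_integrable lborel {b} g" using borel_integrable_atLeastAtMost'[OF cg, of b b] by simp
    then have "set_integrable lborel ({..<b} \<union> {b}) g" by (intro set_integrable_Un filter_past(1)[OF c i, folded g_def]) auto
    moreover have "{..<b} \<union> {b} = {..b}" by auto
    ultimately have s: "set_integrable lborel {..b} g" by simp
    have "(LINT z:{..<b}|lborel. g z) = (LINT z:{..b}|lborel. g z)"
    proof (rule set_integral_cong_set)
      have "g \<in> borel_measurable lborel" using borel_measurable_continuous_onI[OF cg] by simp
      then show "set_borel_measurable lborel {..<b} g" "set_borel_measurable lborel {..b} g"
        unfolding set_borel_measurable_def by measurable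
      show "AE z in lborel. (z \<in> {..b}) = (z \<in> {..<b})" using AE_lborel_singleton[of b] by eventually_elim auto
    qed
    then have "Hf F b = exp (- b) * (LINT z:{..b}|lborel. g z)" using filter_past(2)[OF c i, of b] by (simp add: g_def)
    moreover have "(\<lambda>z. exp (z - b) * F z) = (\<lambda>z. exp (- b) * g z)" by (simp add: g_def fun_eq_iff exp_diff exp_minus field_simps)
    ultimately show ?thesis using s by simp
  qed
  show "set_integrable lborel {..b} (\<lambda>z. exp (z - b) * F z)" "Hf F b = (LINT z:{..b}|lborel. exp (z - b) * F z)" using main[OF c i] by auto
  have c': "continuous_on UNIV (\<lambda>x. \<bar>F x\<bar>)" and i': "integrable lborel (\<lambda>x. \<bar>F x\<bar>\<^sup>2)" using c i by (auto intro: continuous_intros)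
  have "(LINT z:{..b}|lborel. \<bar>exp (z - b) * F z\<bar>) = Hf (\<lambda>x. \<bar>F x\<bar>) b" using main[OF c' i'] by (simp add: abs_mult)
  then show "(LINT z:{..b}|lborel. \<bar>exp (z - b) * F z\<bar>) \<le> (1 + (LINT x|lborel. (F x)\<^sup>2)) / 2"
    using filter_bounds(1)[OF c' i', of b] by simp
qed

text \<open>The conservation law on the half line \<open>{..b}\<close> with weight \<open>exp (x - b)\<close> gives the time derivative of the filtered density.
As both partial derivatives are jointly continuous, \<open>transport_total_derivative\<close> with speed zero makes it differentiable.\<close>

lemma filter_transport:
  fixes n m :: "real \<Rightarrow> real \<Rightarrow> real"
  assumes T: "totdiff n nt nx" "totdiff m mt mx" and eq: "\<And>t x. nt t x + mx t x = 0"
    and i: "\<And>t. integrable lborel (\<lambda>x. (n t x)\<^sup>2)" "\<And>t. integrable lborel (\<lambda>x. (m t x)\<^sup>2)"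
    and K: "\<And>t. (LINT x|lborel. (n t x)\<^sup>2) \<le> K" "\<And>t. (LINT x|lborel. (m t x)\<^sup>2) \<le> K"
  shows "totdiff (\<lambda>t. Hf (n t)) (\<lambda>t x. Hf (m t) x - m t x) (\<lambda>t x. n t x - Hf (n t) x)"
proof -
  note jn = totdiff_jcont[OF T(1)] and jm = totdiff_jcont[OF T(2)]
  have cs: "continuous_on S (n t)" "continuous_on S (m t)" for S t using jcont_slices(1)[of n, OF jn] jcont_slices(1)[of m, OF jm] by auto
  have ja: "jcont (\<lambda>t. Hf (n t)) z" for z by (rule filter_jcont[OF jn i(1) K(1)])
  have js: "jcont (\<lambda>t x. Hf (m t) x - m t x) z" for z by (intro continuous_intros filter_jcont[OF jm i(2) K(2)] jm)
  have law: "((\<lambda>t. Hf (m t) b - m t b) has_integral Hf (n t2) b - Hf (n t1) b) {t1..t2}" if "t1 \<le> t2" for t1 t2 b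
  proof -
    have E: "totdiff (\<lambda>t x. exp (x - b)) (\<lambda>t x. 0) (\<lambda>t x. exp (x - b))"
      by (rule totdiff_of_space) (auto intro!: derivative_eq_intros)
    have jE: "jcont (\<lambda>t x. exp (x - b)) z" for z by (intro continuous_intros)
    note fn = filter_past_closed[OF cs(1) i(1)] and fm = filter_past_closed[OF cs(2) i(2)]
    have "((\<lambda>t. (LINT x:{..b}|lborel. exp (x - b) * m t x) - exp (b - b) * m t b) has_integral
      (LINT x:{..b}|lborel. exp (x - b) * n t2 x) - (LINT x:{..b}|lborel. exp (x - b) * n t1 x)) {t1..t2}"
    proof (rule balance_law_half_line[OF T E, where h="\<lambda>t x. 0" and M="(1 + K) / 2"])
      show "(LINT x:{..b}|lborel. \<bar>exp (x - b) * m t x\<bar>) \<le> (1 + K) / 2" for t using fm(3)[of b t] K(2)[of t] unfolding add_divide_distrib by linarith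
      then show "(LINT x:{..b}|lborel. \<bar>exp (x - b) * m t x\<bar>) \<le> (1 + K) / 2" for t .
    qed (use that eq jE fn(1) fm(1) in auto)
    then show ?thesis by (simp add: fn(2) fm(2))
  qed
  have Dt: "((\<lambda>s. Hf (n s) b) has_real_derivative Hf (m t) b - m t b) (at t)" for t b
  proof -
    define g where "g s = Hf (m s) b - m s b" for s
    have cg: "continuous_on {t-1..t+1} g" unfolding g_def using jcont_slices(2)[of "\<lambda>t x. Hf (m t) x - m t x", OF js] by simp
    have "((\<lambda>s. Hf (n (t-1)) b + integral {t-1..s} g) has_real_derivative 0 + g t) (at t within {t-1..t+1})"
      by (intro DERIV_add DERIV_const integral_has_real_derivative[OF cg]) auto
    then have "((\<lambda>s. Hf (n (t-1)) b + integral {t-1..s} g) has_real_derivative g t) (at t)" by (simp add: at_within_Icc_at)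
    moreover have "Hf (n (t-1)) b + integral {t-1..s} g = Hf (n s) b" if "s \<in> {t-1<..<t+1}" for s
      using integral_unique[OF law[of "t-1" s b]] that by (simp add: g_def[abs_def])
    ultimately have "((\<lambda>s. Hf (n s) b) has_real_derivative g t) (at t)"
      using has_field_derivative_transform_within_open[of "\<lambda>s. Hf (n (t-1)) b + integral {t-1..s} g" "g t" t "{t-1<..<t+1}" "\<lambda>s. Hf (n s) b"]
      by simp
    then show ?thesis by (simp add: g_def)
  qed
  have z: "jcont (\<lambda>t x. 0) z" for z by simp
  show ?thesis unfolding totdiff_def
    by (intro allI transport_total_derivative[where lam="\<lambda>t x. 0" and s="\<lambda>t x. Hf (m t) x - m t x", OF Dt filter_derivative[OF cs(1) i(1)] _ ja z js]) simp
qed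

lemma totdiff_of_time:
  assumes "\<And>t. (F has_real_derivative F' t) (at t)"
  shows "totdiff (\<lambda>t x. F t) (\<lambda>t x. F' t) (\<lambda>t x. 0)"
  unfolding totdiff_def
proof (intro allI)
  fix t x :: real
  have "((\<lambda>z. F (fst z)) has_derivative (\<lambda>z. F' t * fst z)) (at (t, x))"
    by (rule has_derivative_compose[where f=fst and g=F and g'="\<lambda>h. F' t * h" and f'=fst])
      (use assms[of t] in \<open>auto simp: has_field_derivative_def intro!: has_derivative_fst[OF has_derivative_ident]\<close>)
  then show "((\<lambda>z. F (fst z)) has_derivative (\<lambda>z. F' t * fst z + 0 * snd z)) (at (t, x))" by simp
qed

text \<open>A nonempty open set has positive measure.\<close>

lemma everywhere_of_AE:
  fixes f :: "real \<Rightarrow> real"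
  assumes c: "continuous_on UNIV f" and ae: "AE x in lborel. f x \<le> b"
  shows "f x \<le> b"
proof (rule ccontr)
  assume "\<not> f x \<le> b"
  then have "x \<in> {x. b < f x}" by simp
  then have ne: "{x. b < f x} \<noteq> {}" by blast
  have o: "open {x. b < f x}" by (rule open_Collect_less[OF continuous_on_const c])
  have "AE x in lborel. x \<notin> {x. b < f x}" using ae by eventually_elim auto
  then have "{x. b < f x} \<in> null_sets lborel" using o by (subst AE_iff_null_sets) auto
  then have "{x. b < f x} \<in> null_sets lebesgue" by (rule null_sets_completionI)
  then have "negligible {x. b < f x}" by (simp add: negligible_iff_null_sets)
  then show False using open_not_negligible[OF o ne] by blast
qed

lemma L2_of_norm:
  assumes c: "continuous_on UNIV f" and b: "L2_norm f \<le> ennreal b" "0 \<le> b"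
  shows "integrable lborel (\<lambda>x. (f x)\<^sup>2)" "(LINT x|lborel. (f x)\<^sup>2) \<le> b\<^sup>2"
proof -
  define I where "I = (\<integral>\<^sup>+x. ennreal ((f x)\<^sup>2) \<partial>lborel)"
  have m: "(\<lambda>x. (f x)\<^sup>2) \<in> borel_measurable lborel" using borel_measurable_continuous_onI[OF c] by measurable
  have fin: "I \<noteq> \<infinity>"
  proof
    assume "I = \<infinity>"
    then have "L2_norm f = \<infinity>" by (simp add: L2_norm_def I_def)
    then show False using b(1) by (simp add: top_unique)
  qed
  then have e: "L2_norm f = ennreal (sqrt (enn2real I))" by (simp add: L2_norm_def I_def)
  have I: "I = ennreal (enn2real I)" using fin by (simp add: less_top)
  show "integrable lborel (\<lambda>x. (f x)\<^sup>2)"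
    by (rule integrableI_nn_integral_finite[OF m _ I[unfolded I_def]]) simp
  have "(LINT x|lborel. (f x)\<^sup>2) = enn2real I" unfolding I_def by (rule integral_eq_nn_integral[OF m]) simp
  moreover have "sqrt (enn2real I) \<le> b" using b unfolding e by (simp add: ennreal_le_iff)
  then have "(sqrt (enn2real I))\<^sup>2 \<le> b\<^sup>2" by (intro power_mono) auto
  ultimately show "(LINT x|lborel. (f x)\<^sup>2) \<le> b\<^sup>2" by simp
qed

lemma bound_of_Linf:
  assumes c: "continuous_on UNIV f" and b: "Linf_norm f \<le> ennreal b" "0 \<le> b"
  shows "\<bar>f x\<bar> \<le> b"
proof (rule everywhere_of_AE[where f="\<lambda>x. \<bar>f x\<bar>"])
  show "continuous_on UNIV (\<lambda>x. \<bar>f x\<bar>)" using c by (rule continuous_on_rabs)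
  have "AE x in lborel. ennreal \<bar>f x\<bar> \<le> Linf_norm f" unfolding Linf_norm_def by (rule esssup_AE)
  then show "AE x in lborel. \<bar>f x\<bar> \<le> b"
  proof eventually_elim
    case (elim x)
    then have "ennreal \<bar>f x\<bar> \<le> ennreal b" using b(1) by (rule order_trans)
    then show ?case using b(2) by (simp add: ennreal_le_iff)
  qed
qed

lemma bc_of_limit:
  assumes c: "continuous_on UNIV f" and l: "(f \<longlongrightarrow> (0::real)) at_infinity"
  shows "bc f"
proof -
  obtain B where B: "\<And>x. B \<le> norm x \<Longrightarrow> dist (f x) 0 < 1" using tendstoD[OF l, of 1] by (auto simp: eventually_at_infinity)
  have "bounded (f ` {-B..B})" by (intro compact_imp_bounded compact_continuous_image continuous_on_subset[OF c]) auto
  then obtain M where M: "\<forall>y\<in>f ` {-B..B}. norm y \<le> M" unfolding bounded_iff by blast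
  have "\<bar>f x\<bar> \<le> max M 1" for x
  proof (cases "B \<le> \<bar>x\<bar>")
    case True
    then show ?thesis using B[of x] by simp
  next
    case False
    then have "x \<in> {-B..B}" by auto
    then show ?thesis using M by force
  qed
  then show ?thesis using c by (rule bcI[rotated])
qed

section \<open>Regularity of small classical solutions\<close>

text \<open>The Riemann invariants form a \<open>wave_pair\<close>, since the source \<open>- \<partial>\<^sub>x \<phi>\<close> is bounded by the maximum principle before any regularity in time is
known. Joint continuity of \<open>n\<close> makes \<open>\<partial>\<^sub>x \<phi>\<close> continuous, and then the transport equations give
total derivatives of the invariants, hence of \<open>u\<close> and \<open>n\<close>.\<close>

lemma euler_poisson_regular:
  fixes n u \<phi> :: "real \<Rightarrow> real \<Rightarrow> real"
  assumes cs: "classical_solution p n u \<phi>" and pb: "pressure_bounds p k C c \<sigma> \<tau>"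
    and \<delta>: "0 < \<delta>" "\<delta> \<le> 1/4" "20 * (C * \<delta>) \<le> sqrt k" and n: "\<And>t x. \<bar>n t x\<bar> \<le> \<delta>"
  shows "\<exists>nt nx ut ux px. totdiff n nt nx \<and> totdiff u ut ux \<and> (\<forall>z. jcont px z)
    \<and> (\<forall>t x. nt t x + (nx t x * u t x + (1 + n t x) * ux t x) = 0)
    \<and> (\<forall>t x. ut t x + (u t x * ux t x + (c (n t x))\<^sup>2 / (1 + n t x) * nx t x) = - px t x)
    \<and> (\<forall>t x. (\<phi> t has_real_derivative px t x) (at x))
    \<and> (\<forall>t x. (px t has_real_derivative exp (\<phi> t x) - 1 - n t x) (at x))"
proof -
  have nh: "\<bar>n t x\<bar> < 1/2" for t x using n[of t x] \<delta> by linarith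
  have n1: "1 + n t x > 0" for t x using nh[of t x] by linarith
  have k: "k > 0" "C \<ge> 1" and pb1: "\<bar>s\<bar> < 1/2 \<Longrightarrow> c s > 0 \<and> (\<sigma> has_real_derivative c s / (1 + s)) (at s)
        \<and> \<tau> (\<sigma> s) = s \<and> (\<tau> has_real_derivative (1 + s) / c s) (at (\<sigma> s)) \<and> \<bar>\<sigma> s\<bar> \<le> C * \<bar>s\<bar> \<and> \<bar>c s - sqrt k\<bar> \<le> C * \<bar>s\<bar>
        \<and> (enthalpy p has_real_derivative (c s)\<^sup>2 / (1 + s)) (at s)" for s
    using pb unfolding pressure_bounds_def by blast+
  have pb2: "c s \<le> c s' \<and> \<bar>c s - c s'\<bar> \<le> C * (\<sigma> s' - \<sigma> s)" if "\<bar>s\<bar> < 1/2" "\<bar>s'\<bar> < 1/2" "\<sigma> s \<le> \<sigma> s'" for s s'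
    using pb that unfolding pressure_bounds_def by blast
  note pn = pb1[OF nh]
  have pe: "(enthalpy p has_real_derivative (c (n t x))\<^sup>2 / (1 + n t x)) (at (n t x))"
    and p\<sigma>: "(\<sigma> has_real_derivative c (n t x) / (1 + n t x)) (at (n t x))" for t x using pn[of t x] by blast+
  define nt where "nt t x = deriv (\<lambda>s. n s x) t" for t x
  define nx where "nx t x = deriv (n t) x" for t x
  define ut where "ut t x = deriv (\<lambda>s. u s x) t" for t x
  define ux where "ux t x = deriv (u t) x" for t x
  define px where "px t x = deriv (\<phi> t) x" for t x
  have df: "(\<lambda>s. n s x) differentiable (at t)" "n t differentiable (at x)" "(\<lambda>s. u s x) differentiable (at t)" "u t differentiable (at x)"
      "\<phi> t differentiable (at x)" "deriv (\<phi> t) differentiable (at x)" for t x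
    using cs unfolding classical_solution_def by blast+
  have D: "((\<lambda>s. n s x) has_real_derivative nt t x) (at t)" "(n t has_real_derivative nx t x) (at x)"
      "((\<lambda>s. u s x) has_real_derivative ut t x) (at t)" "(u t has_real_derivative ux t x) (at x)"
      "(\<phi> t has_real_derivative px t x) (at x)" for t x
    unfolding nt_def nx_def ut_def ux_def px_def by (intro DERIV_deriv_iff_real_differentiable[THEN iffD2] df)+
  have Dp: "(px t has_real_derivative exp (\<phi> t x) - 1 - n t x) (at x)" for t x
  proof -
    have "(deriv (\<phi> t) has_real_derivative deriv (deriv (\<phi> t)) x) (at x)"
      by (intro DERIV_deriv_iff_real_differentiable[THEN iffD2] df)
    moreover have "deriv (deriv (\<phi> t)) x = exp (\<phi> t x) - 1 - n t x"
      using cs unfolding classical_solution_def q_def by (metis add.commute add_diff_cancel_left' minus_diff_eq uminus_add_conv_diff)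
    ultimately show ?thesis by (simp add: px_def[abs_def])
  qed
  have lim: "(n t \<longlongrightarrow> 0) at_infinity" "(\<phi> t \<longlongrightarrow> 0) at_infinity" for t
    using cs unfolding classical_solution_def by auto
  note ps = poisson_slice[OF D(5) Dp \<delta>(1,2) n lim]
  have eq1: "nt t x + (nx t x * u t x + (1 + n t x) * ux t x) = 0" for t x
  proof -
    have "((\<lambda>z. (1 + n t z) * u t z) has_real_derivative nx t x * u t x + (1 + n t x) * ux t x) (at x)"
      by (auto intro!: derivative_eq_intros D)
    from DERIV_imp_deriv[OF this] show ?thesis
      using cs unfolding classical_solution_def nt_def by simp
  qed
  have eq2: "ut t x + (u t x * ux t x + (c (n t x))\<^sup>2 / (1 + n t x) * nx t x) = - px t x" for t x
  proof -
    have e: "((\<lambda>z. enthalpy p (n t z)) has_real_derivative (c (n t x))\<^sup>2 / (1 + n t x) * nx t x) (at x)"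
      by (rule DERIV_chain2[where f="enthalpy p" and g="n t", OF pe D(2)])
    have "((\<lambda>z. (u t z)\<^sup>2 / 2 + enthalpy p (n t z) + \<phi> t z) has_real_derivative
        u t x * ux t x + (c (n t x))\<^sup>2 / (1 + n t x) * nx t x + px t x) (at x)"
      by (auto intro!: derivative_eq_intros D e)
    from DERIV_imp_deriv[OF this] show ?thesis
      using cs unfolding classical_solution_def ut_def by simp
  qed
  define rp where "rp t x = u t x + \<sigma> (n t x)" for t x
  define rm where "rm t x = u t x - \<sigma> (n t x)" for t x
  define cn where "cn t x = c (n t x)" for t x
  define rpt where "rpt t x = ut t x + cn t x / (1 + n t x) * nt t x" for t x
  define rpx where "rpx t x = ux t x + cn t x / (1 + n t x) * nx t x" for t x
  define rmt where "rmt t x = ut t x - cn t x / (1 + n t x) * nt t x" for t x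
  define rmx where "rmx t x = ux t x - cn t x / (1 + n t x) * nx t x" for t x
  have \<sigma>n: "((\<lambda>s. \<sigma> (n s x)) has_real_derivative cn t x / (1 + n t x) * nt t x) (at t)"
      "((\<lambda>z. \<sigma> (n t z)) has_real_derivative cn t x / (1 + n t x) * nx t x) (at x)" for t x
    unfolding cn_def
    by (rule DERIV_chain2[where f=\<sigma> and g="\<lambda>s. n s x", OF p\<sigma> D(1)] DERIV_chain2[where f=\<sigma> and g="n t", OF p\<sigma> D(2)])+
  have Dr: "((\<lambda>s. rp s x) has_real_derivative rpt t x) (at t)" "(rp t has_real_derivative rpx t x) (at x)"
      "((\<lambda>s. rm s x) has_real_derivative rmt t x) (at t)" "(rm t has_real_derivative rmx t x) (at x)" for t x
    unfolding rp_def rm_def rpt_def rpx_def rmt_def rmx_def by (intro DERIV_add DERIV_diff D \<sigma>n)+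
  have tp: "rpt t x + (u t x + cn t x) * rpx t x = - px t x" "rmt t x + (u t x - cn t x) * rmx t x = - px t x" for t x
  proof -
    have a: "nt t x = - (nx t x * u t x + (1 + n t x) * ux t x)" using eq1[of t x] by simp
    have b: "ut t x = - px t x - (u t x * ux t x + (cn t x)\<^sup>2 / (1 + n t x) * nx t x)" using eq2[of t x] by (simp add: cn_def)
    have r: "cn t x / (1 + n t x) * (1 + n t x) = cn t x" using n1[of t x] by simp
    have cc: "(cn t x)\<^sup>2 / (1 + n t x) * nx t x = cn t x / (1 + n t x) * cn t x * nx t x" by (simp add: power2_eq_square)
    have gen: "(- P - (U * Ux + r * d * Nx) + r * (- (Nx * U + N1 * Ux))) + (U + d) * (Ux + r * Nx) = - P"
      "(- P - (U * Ux + r * d * Nx) - r * (- (Nx * U + N1 * Ux))) + (U - d) * (Ux - r * Nx) = - P"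
      if "r * N1 = d" for P U Ux Nx r d N1 :: real
      unfolding that[symmetric] by (simp_all add: algebra_simps)
    show "rpt t x + (u t x + cn t x) * rpx t x = - px t x" "rmt t x + (u t x - cn t x) * rmx t x = - px t x"
      unfolding rpt_def rmt_def rpx_def rmx_def a b cc
      by (rule gen(1)[OF r]) (rule gen(2)[OF r])
  qed
  have Cn: "C * \<bar>n t x\<bar> \<le> sqrt k / 20" for t x
    using mult_left_mono[OF n[of t x], of C] k(2) \<delta>(3) by linarith
  have p9: "\<bar>px t x\<bar> \<le> 9" for t x using ps(2)[of t x] \<delta>(2) by linarith
  have W: "wave_pair 1 (sqrt k) C 9 rp rm cn"
    unfolding wave_pair_def
  proof (intro conjI allI impI)
    fix t x
    have h: "(rp t x + rm t x) / 2 = u t x" by (simp add: rp_def rm_def)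
    show "\<exists>rt rx. ((\<lambda>s. rp s x) has_real_derivative rt) (at t) \<and> (rp t has_real_derivative rx) (at x)
        \<and> \<bar>rt + 1 * ((rp t x + rm t x) / 2 + cn t x) * rx\<bar> \<le> 9"
      unfolding h by (rule exI[of _ "rpt t x"], rule exI[of _ "rpx t x"]) (use Dr tp(1)[of t x] p9[of t x] in auto)
    show "\<exists>rt rx. ((\<lambda>s. rm s x) has_real_derivative rt) (at t) \<and> (rm t has_real_derivative rx) (at x)
        \<and> \<bar>rt + 1 * ((rp t x + rm t x) / 2 - cn t x) * rx\<bar> \<le> 9"
      unfolding h by (rule exI[of _ "rmt t x"], rule exI[of _ "rmx t x"]) (use Dr tp(2)[of t x] p9[of t x] in auto)
    have s: "\<bar>\<sigma> (n t x)\<bar> \<le> C * \<bar>n t x\<bar>" "\<bar>cn t x - sqrt k\<bar> \<le> C * \<bar>n t x\<bar>" using pn[of t x] by (auto simp: cn_def)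
    show "\<bar>rp t x - rm t x\<bar> \<le> sqrt k / 10" using s(1) Cn[of t x] by (simp add: rp_def rm_def)
    show "95 / 100 * sqrt k \<le> cn t x" "cn t x \<le> 105 / 100 * sqrt k" using s(2) Cn[of t x] by linarith+
  next
    fix t x t' x' assume "rp t x - rm t x \<le> rp t' x' - rm t' x'"
    then have le: "\<sigma> (n t x) \<le> \<sigma> (n t' x')" by (simp add: rp_def rm_def)
    note c2 = pb2[OF nh nh le]
    show "cn t x \<le> cn t' x'" using c2 by (simp add: cn_def)
    have "C * (\<sigma> (n t' x') - \<sigma> (n t x)) \<le> C * ((rp t' x' - rm t' x') - (rp t x - rm t x))"
      using le k(2) by (intro mult_left_mono) (auto simp: rp_def rm_def)
    then show "cn t' x' \<le> cn t x + C * ((rp t' x' - rm t' x') - (rp t x - rm t x))"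
      using c2 unfolding cn_def by linarith
  qed (use k in auto)
  have jr: "jcont rp z" "jcont rm z" for z using wave_pair_continuous[OF W] by auto
  have ju: "jcont u z" for z
  proof -
    have "jcont (\<lambda>t x. (rp t x + rm t x) / 2) z" by (intro continuous_intros jr) auto
    then show ?thesis by (simp add: rp_def rm_def)
  qed
  have js: "jcont (\<lambda>t x. \<sigma> (n t x)) z" for z
  proof -
    have "jcont (\<lambda>t x. (rp t x - rm t x) / 2) z" by (intro continuous_intros jr) auto
    then show ?thesis by (simp add: rp_def rm_def)
  qed
  have jn: "jcont n z" for z
  proof -
    have "isCont \<tau> (\<sigma> (n (fst z) (snd z)))" using pn[of "fst z" "snd z"] by (auto intro: DERIV_isCont)
    from isCont_o2[OF js this] show ?thesis using pn by simp
  qed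
  have jc: "jcont cn z" for z
  proof -
    have "((\<lambda>z'. cn (fst z') (snd z') - cn (fst z) (snd z)) \<longlongrightarrow> 0) (at z)"
    proof (rule Lim_null_comparison)
      have "((\<lambda>z'. C * \<bar>\<sigma> (n (fst z') (snd z')) - \<sigma> (n (fst z) (snd z))\<bar>) \<longlongrightarrow> C * \<bar>\<sigma> (n (fst z) (snd z)) - \<sigma> (n (fst z) (snd z))\<bar>) (at z)"
        by (intro tendsto_intros js[unfolded isCont_def])
      then show "((\<lambda>z'. C * \<bar>\<sigma> (n (fst z') (snd z')) - \<sigma> (n (fst z) (snd z))\<bar>) \<longlongrightarrow> 0) (at z)" by simp
      have "\<bar>c s - c s'\<bar> \<le> C * \<bar>\<sigma> s - \<sigma> s'\<bar>" if "\<bar>s\<bar> < 1/2" "\<bar>s'\<bar> < 1/2" for s s'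
        using pb2[OF that] pb2[OF that(2,1)] by (cases "\<sigma> s \<le> \<sigma> s'") (auto simp: abs_minus_commute)
      then show "\<forall>\<^sub>F z' in at z. norm (cn (fst z') (snd z') - cn (fst z) (snd z)) \<le> C * \<bar>\<sigma> (n (fst z') (snd z')) - \<sigma> (n (fst z) (snd z))\<bar>"
        using nh by (simp add: cn_def)
    qed
    then show ?thesis unfolding isCont_def by (simp add: LIM_zero_iff)
  qed
  have jp: "jcont px z" for z
    by (rule poisson_gradient_continuous[OF D(5) Dp \<delta>(1,2) n lim jn])
  have jl: "jcont (\<lambda>t x. u t x + cn t x) z" "jcont (\<lambda>t x. u t x - cn t x) z" "jcont (\<lambda>t x. - px t x) z" for z
    by (intro continuous_intros ju jc jp)+
  have Tp: "totdiff rp rpt rpx" unfolding totdiff_def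
    by (intro allI transport_total_derivative[OF Dr(1,2) tp(1) jr(1) jl(1,3)])
  have Tm: "totdiff rm rmt rmx" unfolding totdiff_def
    by (intro allI transport_total_derivative[OF Dr(3,4) tp(2) jr(2) jl(2,3)])
  have half: "((\<lambda>v. v / 2) has_real_derivative (\<lambda>_. 1/2) v) (at v)" for v :: real by (auto intro!: derivative_eq_intros)
  have neg: "((\<lambda>v. - v) has_real_derivative (\<lambda>_. -1) v) (at v)" for v :: real by (auto intro!: derivative_eq_intros)
  have Tu: "totdiff u ut ux"
    using totdiff_compose[OF totdiff_add[OF Tp Tm], where F="\<lambda>v. v / 2" and F'="\<lambda>_. 1/2", OF half]
    by (simp add: rp_def rm_def rpt_def rmt_def rpx_def rmx_def)
  have "totdiff (\<lambda>t x. (rp t x + - rm t x) / 2) (\<lambda>t x. 1/2 * (rpt t x + -1 * rmt t x)) (\<lambda>t x. 1/2 * (rpx t x + -1 * rmx t x))"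
    using totdiff_compose[OF totdiff_add[OF Tp totdiff_compose[OF Tm, where F="\<lambda>v. - v" and F'="\<lambda>_. -1", OF neg]],
        where F="\<lambda>v. v / 2" and F'="\<lambda>_. 1/2", OF half] .
  then have T\<sigma>: "totdiff (\<lambda>t x. \<sigma> (n t x)) (\<lambda>t x. cn t x / (1 + n t x) * nt t x) (\<lambda>t x. cn t x / (1 + n t x) * nx t x)"
    by (simp add: rp_def rm_def rpt_def rmt_def rpx_def rmx_def)
  have Tn: "totdiff n nt nx"
  proof -
    have "totdiff (\<lambda>t x. \<tau> (\<sigma> (n t x))) (\<lambda>t x. (1 + \<tau> (\<sigma> (n t x))) / c (\<tau> (\<sigma> (n t x))) * (cn t x / (1 + n t x) * nt t x))
       (\<lambda>t x. (1 + \<tau> (\<sigma> (n t x))) / c (\<tau> (\<sigma> (n t x))) * (cn t x / (1 + n t x) * nx t x))"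
      by (rule totdiff_compose[OF T\<sigma>, where F=\<tau> and F'="\<lambda>v. (1 + \<tau> v) / c (\<tau> v)"]) (use pn in simp)
    moreover have "(1 + n t x) / c (n t x) * (cn t x / (1 + n t x) * r) = r" for t x r
      using n1[of t x] pn[of t x] by (simp add: cn_def)
    ultimately show ?thesis using pn by simp
  qed
  show ?thesis
    by (rule exI[of _ nt], rule exI[of _ nx], rule exI[of _ ut], rule exI[of _ ux], rule exI[of _ px])
      (use Tn Tu jp eq1 eq2 D(5) Dp in blast)
qed

section \<open>Local decay along the center\<close>

definition tame :: "(real \<Rightarrow> real \<Rightarrow> real) \<Rightarrow> bool" where
  "tame F \<longleftrightarrow> (\<exists>B\<ge>0. \<forall>t x. \<bar>F t x\<bar> \<le> B)"

text \<open>All integrability and boundedness claims about the virial functional reduce to one envelope \<open>D\<close>, whose integral is bounded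
uniformly in time. Together with \<open>tame\<close> for the bounded factors this turns them into a syntax-directed calculation.\<close>

definition dominated :: "(real \<Rightarrow> real \<Rightarrow> real) \<Rightarrow> (real \<Rightarrow> real \<Rightarrow> real) \<Rightarrow> bool" where
  "dominated D F \<longleftrightarrow> (\<exists>B\<ge>0. \<forall>t x. \<bar>F t x\<bar> \<le> B * D t x)"

lemma tameI: "(\<And>t x. \<bar>F t x\<bar> \<le> B) \<Longrightarrow> tame F"
  unfolding tame_def using abs_ge_zero order_trans by blast

lemma tame_rules:
  assumes "tame F" "tame G"
  shows "tame (\<lambda>t x. F t x + G t x)" "tame (\<lambda>t x. F t x * G t x)" "tame (\<lambda>t x. - F t x)"
proof -
  obtain B where B: "B \<ge> 0" "\<And>t x. \<bar>F t x\<bar> \<le> B" using assms(1) unfolding tame_def by blast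
  obtain B' where B': "B' \<ge> 0" "\<And>t x. \<bar>G t x\<bar> \<le> B'" using assms(2) unfolding tame_def by blast
  show "tame (\<lambda>t x. F t x + G t x)"
    by (rule tameI[of _ "B + B'"]) (use B(2) B'(2) in \<open>blast intro: order_trans[OF abs_triangle_ineq] add_mono\<close>)
  show "tame (\<lambda>t x. F t x * G t x)"
    by (rule tameI[of _ "B * B'"]) (use B B' in \<open>auto simp: abs_mult intro!: mult_mono\<close>)
  show "tame (\<lambda>t x. - F t x)" by (rule tameI[of _ B]) (use B in simp)
qed

lemma dominatedE:
  assumes "dominated D F"
  obtains B where "B \<ge> 0" "\<And>t x. \<bar>F t x\<bar> \<le> B * D t x"
proof -
  from assms[unfolded dominated_def] obtain B where B: "B \<ge> 0 \<and> (\<forall>t x. \<bar>F t x\<bar> \<le> B * D t x)" ..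
  show thesis by (rule that[of B]) (use B in simp_all)
qed

lemma dominatedI: "(\<And>t x. \<bar>F t x\<bar> \<le> B * D t x) \<Longrightarrow> B \<ge> 0 \<Longrightarrow> dominated D F"
  unfolding dominated_def by (rule exI[of _ B]) simp

lemma dominated_rules:
  assumes "dominated D F"
  shows "dominated D G \<Longrightarrow> dominated D (\<lambda>t x. F t x + G t x)" "tame G \<Longrightarrow> dominated D (\<lambda>t x. G t x * F t x)"
    "dominated D (\<lambda>t x. - F t x)"
proof -
  obtain B where B: "B \<ge> 0" "\<And>t x. \<bar>F t x\<bar> \<le> B * D t x" by (rule dominatedE[OF assms(1)], rule that, simp_all)
  show "dominated D (\<lambda>t x. F t x + G t x)" if dG: "dominated D G"
  proof -
    obtain B' where B': "B' \<ge> 0" "\<And>t x. \<bar>G t x\<bar> \<le> B' * D t x" by (rule dominatedE[OF dG], rule that, simp_all)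
    have "\<bar>F t x + G t x\<bar> \<le> (B + B') * D t x" for t x
      unfolding distrib_right by (rule order_trans[OF abs_triangle_ineq add_mono[OF B(2) B'(2)]])
    then show ?thesis using B(1) B'(1) by (intro dominatedI[of _ "B + B'"]) auto
  qed
  show "dominated D (\<lambda>t x. G t x * F t x)" if tG: "tame G"
  proof -
    obtain B' where B': "B' \<ge> 0" "\<And>t x. \<bar>G t x\<bar> \<le> B'" using tG unfolding tame_def by blast
    have "\<bar>G t x * F t x\<bar> \<le> (B' * B) * D t x" for t x
      unfolding abs_mult mult.assoc by (rule mult_mono[OF B'(2) B(2) B'(1)]) simp
    then show ?thesis using B(1) B'(1) by (intro dominatedI[of _ "B' * B"]) auto
  qed
  show "dominated D (\<lambda>t x. - F t x)" using assms by (simp add: dominated_def)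
qed

lemma dominated_integral:
  assumes d: "dominated D F" and c: "\<And>t. continuous_on UNIV (F t)" and D: "\<And>t. integrable lborel (D t)" "\<And>t. (LINT x|lborel. D t x) \<le> M"
  shows "integrable lborel (F t)" "\<exists>B. \<forall>t. (LINT x|lborel. \<bar>F t x\<bar>) \<le> B"
proof -
  obtain B where B: "B \<ge> 0" "\<And>t x. \<bar>F t x\<bar> \<le> B * D t x" by (rule dominatedE[OF d], rule that, simp_all)
  have i: "integrable lborel (F t)" for t
  proof (rule Bochner_Integration.integrable_bound[OF integrable_mult_right[OF D(1), of B t]])
    show "F t \<in> borel_measurable lborel" using borel_measurable_continuous_onI[OF c] by simp
    show "AE x in lborel. norm (F t x) \<le> norm (B * D t x)" using order_trans[OF B(2) abs_ge_self] by (intro AE_I2) simp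
  qed
  then show "integrable lborel (F t)" .
  have "(LINT x|lborel. \<bar>F t x\<bar>) \<le> B * M" for t
  proof -
    have "(LINT x|lborel. \<bar>F t x\<bar>) \<le> (LINT x|lborel. B * D t x)" using B(2) by (intro integral_mono integrable_abs i integrable_mult_right D(1))
    also have "\<dots> \<le> B * M" using mult_left_mono[OF D(2)[of t] B(1)] by simp
    finally show ?thesis .
  qed
  then show "\<exists>B. \<forall>t. (LINT x|lborel. \<bar>F t x\<bar>) \<le> B" by blast
qed

lemma L2_dominated:
  fixes f g :: "real \<Rightarrow> real"
  assumes c: "continuous_on UNIV f" and i: "integrable lborel (\<lambda>x. (g x)\<^sup>2)" and b: "\<And>x. \<bar>f x\<bar> \<le> 2 * \<bar>g x\<bar>"
  shows "integrable lborel (\<lambda>x. (f x)\<^sup>2)" "(LINT x|lborel. (f x)\<^sup>2) \<le> 4 * (LINT x|lborel. (g x)\<^sup>2)"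
proof -
  have sq: "(f x)\<^sup>2 \<le> 4 * (g x)\<^sup>2" for x
  proof -
    have "\<bar>f x\<bar>\<^sup>2 \<le> (2 * \<bar>g x\<bar>)\<^sup>2" by (intro power_mono b) simp
    then show ?thesis by (simp add: power_mult_distrib)
  qed
  show 1: "integrable lborel (\<lambda>x. (f x)\<^sup>2)"
  proof (rule Bochner_Integration.integrable_bound[OF integrable_mult_right[OF i, of 4]])
    show "(\<lambda>x. (f x)\<^sup>2) \<in> borel_measurable lborel" using borel_measurable_continuous_onI[OF c] by measurable
    show "AE x in lborel. norm ((f x)\<^sup>2) \<le> norm (4 * (g x)\<^sup>2)" using sq by (intro AE_I2) simp
  qed
  have "(LINT x|lborel. (f x)\<^sup>2) \<le> (LINT x|lborel. 4 * (g x)\<^sup>2)" using i by (intro integral_mono 1 sq) auto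
  then show "(LINT x|lborel. (f x)\<^sup>2) \<le> 4 * (LINT x|lborel. (g x)\<^sup>2)" by simp
qed

text \<open>A bounded function cannot have a derivative that is bounded below by a positive constant for all times.\<close>

lemma growth_contradiction:
  fixes Gf J :: "real \<Rightarrow> real"
  assumes J: "\<And>T. 0 \<le> T \<Longrightarrow> (Gf has_integral J T - J 0) {0..T}" "\<And>t. \<bar>J t\<bar> \<le> B" and G: "\<And>t. c * I t \<le> Gf t" and c: "c > 0" "e > 0"
  shows "\<exists>t. I t < e"
proof (rule ccontr)
  assume "\<not> ?thesis"
  then have I: "e \<le> I t" for t by (simp add: not_less)
  \<comment> \<open>By this time the growth exceeds the oscillation \<open>2 * B\<close>.\<close>
  define T where "T = (2 * B + 1) / (c * e)"
  have B0: "0 \<le> B" using J(2)[of 0] by linarith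
  have T: "0 \<le> T" "c * e * T = 2 * B + 1" using B0 c by (simp_all add: T_def)
  have ge: "c * e \<le> Gf t" for t using order_trans[OF mult_left_mono[OF I[of t], of c] G[of t]] c by simp
  have hc: "((\<lambda>t. c * e) has_integral c * e * T) {0..T}"
    using has_integral_const_real[of "c * e" 0 T] T(1) by (simp add: mult.commute)
  have "c * e * T \<le> J T - J 0" by (rule has_integral_le[OF hc J(1)[OF T(1)]]) (rule ge)
  then show False using T J(2)[of T] J(2)[of 0] by simp
qed

text \<open>The virial functional is \<open>J1 + \<theta> / 2 * J2\<close>. Its two parts come from the balance laws of \<open>n * u\<close> and of \<open>u\<close>, integrated
against \<open>X (x - y t)\<close> and \<open>\<omega> (x - y t) * a\<close>. The rate of change is estimated by \<open>virial_static\<close>.\<close>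

proposition euler_poisson_local_decay:
  fixes n u \<phi> :: "real \<Rightarrow> real \<Rightarrow> real"
  assumes pb: "pressure_bounds p k C c \<sigma> \<tau>" and \<theta>: "\<theta> * (1 + k) = 1"
    and \<delta>: "0 < \<delta>" "\<delta> \<le> 1/4" "20 * (C * \<delta>) \<le> sqrt k" and A: "A \<ge> 4"
    and small: "0 < \<theta> * k / (2 * (4 * k + 5)) - C * (400 * \<delta> + 200 * (1 / A))"
    and cs: "classical_solution p n u \<phi>" and n: "\<And>t x. \<bar>n t x\<bar> \<le> \<delta>"
    and iL: "\<And>t. integrable lborel (\<lambda>x. (n t x)\<^sup>2)" "\<And>t. integrable lborel (\<lambda>x. (u t x)\<^sup>2)"
       "\<And>t. integrable lborel (\<lambda>x. (\<phi> t x)\<^sup>2)" "\<And>t. integrable lborel (\<lambda>x. (deriv (\<phi> t) x)\<^sup>2)"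
    and K: "\<And>t. (LINT x|lborel. (n t x)\<^sup>2) \<le> K" "\<And>t. (LINT x|lborel. (u t x)\<^sup>2) \<le> K"
    and y: "\<And>t. (y has_real_derivative v t) (at t)" "continuous_on UNIV v" "\<And>t. (v t)\<^sup>2 \<le> \<theta> * k\<^sup>2" and e: "e > 0"
  shows "\<exists>t. (LINT x|lborel. 1 / (1 + ((x - y t) / A)\<^sup>2) * ((u t x)\<^sup>2 + (n t x)\<^sup>2)) < e"
proof -
  obtain nt nx ut ux px where Tn: "totdiff n nt nx" and Tu: "totdiff u ut ux" and jp: "\<And>z. jcont px z"
    and eq1: "\<And>t x. nt t x + (nx t x * u t x + (1 + n t x) * ux t x) = 0"
    and eq2: "\<And>t x. ut t x + (u t x * ux t x + (c (n t x))\<^sup>2 / (1 + n t x) * nx t x) = - px t x"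
    and D\<phi>: "\<And>t x. (\<phi> t has_real_derivative px t x) (at x)" "\<And>t x. (px t has_real_derivative exp (\<phi> t x) - 1 - n t x) (at x)"
    using euler_poisson_regular[OF cs pb \<delta> n] by blast
  have nh: "\<bar>n t x\<bar> < 1/2" for t x using n[of t x] \<delta> by linarith
  have kC: "k > 0" "C \<ge> 1" "k \<le> C" and pb1: "\<bar>s\<bar> < 1/2 \<Longrightarrow>
        (enthalpy p has_real_derivative (c s)\<^sup>2 / (1 + s)) (at s) \<and> (W p has_real_derivative enthalpy p s) (at s)
        \<and> \<bar>enthalpy p s - k * s\<bar> \<le> C * s\<^sup>2 \<and> \<bar>s * enthalpy p s - W p s - k * s\<^sup>2 / 2\<bar> \<le> C * \<bar>s\<bar> * s\<^sup>2" for s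
    using pb unfolding pressure_bounds_def by blast+
  note pn = pb1[OF nh]
  have lim: "(n t \<longlongrightarrow> 0) at_infinity" "(u t \<longlongrightarrow> 0) at_infinity" "(\<phi> t \<longlongrightarrow> 0) at_infinity" for t
    using cs unfolding classical_solution_def by auto
  note ps = poisson_slice[OF D\<phi> \<delta>(1,2) n lim(1,3)]
  have pxd: "deriv (\<phi> t) = px t" for t using DERIV_imp_deriv[OF D\<phi>(1)] by auto
  note ip = iL(4)[unfolded pxd]
  note jn = totdiff_jcont[OF Tn] and ju = totdiff_jcont[OF Tu]
  have cn: "continuous_on S (n t)" and cu: "continuous_on S (u t)" and cp: "continuous_on S (px t)" for S t
    using jcont_slices(1)[of n, OF jn] jcont_slices(1)[of u, OF ju] jcont_slices(1)[of px, OF jp] by auto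
  have \<phi>h: "\<bar>\<phi> t x\<bar> \<le> 1/2" for t x using ps(1)[of t x] \<delta> by linarith
  have Kp: "(LINT x|lborel. (px t x)\<^sup>2) \<le> K" for t
    using poisson_slice_L2(1)[OF D\<phi> \<phi>h lim(3) ps(4) cn iL(1,3) ip] K(1)[of t] by (rule order_trans)
  have K0: "0 \<le> K" using K(1)[of 0] by (rule order_trans[rotated]) simp

  define w where "w s = enthalpy p s" for s
  define P where "P s = s * enthalpy p s - W p s" for s
  define cq where "cq s = (c s)\<^sup>2 / (1 + s)" for s
  have wD: "(w has_real_derivative cq (n t x)) (at (n t x))" for t x
    using pn[of t x] unfolding w_def[abs_def] cq_def by blast
  have PD: "(P has_real_derivative (\<lambda>s. s * cq s) (n t x)) (at (n t x))" for t x
  proof -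
    have "((\<lambda>s. s * enthalpy p s - W p s) has_real_derivative (1 * enthalpy p (n t x) + cq (n t x) * n t x) - enthalpy p (n t x)) (at (n t x))"
      using pn[of t x] unfolding cq_def by (intro DERIV_diff DERIV_mult DERIV_ident) auto
    then show ?thesis unfolding P_def[abs_def] by (simp add: mult.commute)
  qed
  have w1: "\<bar>w (n t x) - k * n t x\<bar> \<le> C * (n t x)\<^sup>2" for t x using pn[of t x] by (simp add: w_def)
  have P1: "\<bar>P (n t x) - k * (n t x)\<^sup>2 / 2\<bar> \<le> C * \<delta> * (n t x)\<^sup>2" for t x
  proof -
    have "C * \<bar>n t x\<bar> * (n t x)\<^sup>2 \<le> C * \<delta> * (n t x)\<^sup>2" using n[of t x] kC by (intro mult_right_mono mult_left_mono) auto
    then show ?thesis using pn[of t x] unfolding P_def by linarith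
  qed
  have cw: "continuous_on UNIV (\<lambda>x. w (n t x))" and cP: "continuous_on UNIV (\<lambda>x. P (n t x))" for t
  proof -
    have ic: "isCont (n t) x" for x using cn[of UNIV t] by (simp add: continuous_on_eq_continuous_at)
    show "continuous_on UNIV (\<lambda>x. w (n t x))"
      by (rule continuous_at_imp_continuous_on, rule ballI, rule isCont_o2[OF ic DERIV_isCont[OF wD]])
    show "continuous_on UNIV (\<lambda>x. P (n t x))"
      by (rule continuous_at_imp_continuous_on, rule ballI, rule isCont_o2[OF ic DERIV_isCont[OF PD]])
  qed

  define om where "om z = 1 / (1 + (z / A)\<^sup>2)" for z
  define om' where "om' z = - (2 * (z / A) / A) / (1 + (z / A)\<^sup>2)\<^sup>2" for z
  define X where "X z = A * arctan (z / A)" for z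
  have A0: "A > 0" using A by simp
  have wt: "weight (1 / A) (\<lambda>x. om (x - y t)) (\<lambda>x. om' (x - y t))" for t
    using weight_lorentz(1)[OF A0, of "y t"] by (simp add: om_def om'_def)
  have wt0: "weight (1 / A) om om'" using weight_lorentz(1)[OF A0, of 0] by (simp add: om_def[abs_def] om'_def[abs_def])
  have XD: "(X has_real_derivative om z) (at z)" for z using weight_lorentz(3)[OF A0, of 0 z] by (simp add: X_def[abs_def] om_def)
  note wd0 = weightD[OF wt0] and wd = weightD[OF wt]
  have oI: "(LINT x|lborel. om (x - y t)) = (LINT x|lborel. om x)" for t
    using weight_lorentz(2)[OF A0, of "y t"] by (simp add: om_def)
  have om1: "\<bar>om' z\<bar> \<le> om z" for z
  proof -
    have "1 / A * om z \<le> 1 * om z" using A wd0(2)[of z] by (intro mult_right_mono) auto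
    then show ?thesis using wd0(5)[of z] by linarith
  qed
  have Xb: "\<bar>X z\<bar> \<le> A * 2" for z
  proof -
    have "\<bar>arctan (z / A)\<bar> \<le> 2" using arctan_bounded[of "z / A"] pi_half_less_two by linarith
    then show ?thesis using A0 by (simp add: X_def abs_mult)
  qed
  have Ty: "totdiff (\<lambda>t x. x + - y t) (\<lambda>t x. 0 + - v t) (\<lambda>t x. 1 + 0)"
    by (rule totdiff_add[OF totdiff_of_space totdiff_of_time]) (auto intro!: derivative_eq_intros y(1))
  have TX: "totdiff (\<lambda>t x. X (x - y t)) (\<lambda>t x. - v t * om (x - y t)) (\<lambda>t x. om (x - y t))"
    using totdiff_compose[OF Ty, where F=X and F'=om, OF XD] by (simp add: mult.commute)
  have To: "totdiff (\<lambda>t x. om (x - y t)) (\<lambda>t x. - v t * om' (x - y t)) (\<lambda>t x. om' (x - y t))"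
    using totdiff_compose[OF Ty, where F=om and F'=om', OF wd0(4)] by (simp add: mult.commute)
  have jo: "jcont (\<lambda>t x. om (x - y t)) z" for z by (rule totdiff_jcont[OF To])
  have jv: "jcont (\<lambda>t x. v t) z" for z using isCont_o2[OF isCont_fst[OF continuous_ident], of z v] y(2) by (simp add: continuous_on_eq_continuous_at)
  have jo': "jcont (\<lambda>t x. om' (x - y t)) z" for z
  proof -
    have "jcont (\<lambda>t x. x + - y t) z" by (rule totdiff_jcont[OF Ty])
    moreover have "isCont om' s" for s using wd0(6) by (simp add: continuous_on_eq_continuous_at)
    ultimately show ?thesis using isCont_o2[of z "\<lambda>z. snd z + - y (fst z)" om'] by simp
  qed
  have co: "continuous_on UNIV (\<lambda>x. om (x - y t))" "continuous_on UNIV (\<lambda>x. om' (x - y t))" for t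
    using wd(9)[of t] wd(6)[of t] by auto
  have cX: "continuous_on UNIV (\<lambda>x. X (x - y t))" for t
    using jcont_slices(1)[of "\<lambda>t x. X (x - y t)", OF totdiff_jcont[OF TX]] by auto

  define a where "a t = Hf (n t)" for t
  define m where "m t x = u t x + n t x * u t x" for t x
  define nu where "nu t x = n t x * u t x" for t x
  define hu where "hu t = Hf (u t)" for t
  define hn where "hn t = Hf (nu t)" for t
  have Tnu: "totdiff nu (\<lambda>t x. nt t x * u t x + n t x * ut t x) (\<lambda>t x. nx t x * u t x + n t x * ux t x)"
    unfolding nu_def by (rule totdiff_mult[OF Tn Tu])
  have Tm: "totdiff m (\<lambda>t x. ut t x + (nt t x * u t x + n t x * ut t x)) (\<lambda>t x. ux t x + (nx t x * u t x + n t x * ux t x))"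
    using totdiff_add[OF Tu Tnu] by (simp add: m_def[abs_def] nu_def)
  have cnu: "continuous_on UNIV (nu t)" and cm: "continuous_on UNIV (m t)" for t
    unfolding nu_def m_def by (intro continuous_intros cn cu)+
  have nub: "\<bar>nu t x\<bar> \<le> \<bar>u t x\<bar>" for t x
    using mult_right_mono[of "\<bar>n t x\<bar>" 1 "\<bar>u t x\<bar>"] nh[of t x] by (simp add: nu_def abs_mult)
  have mb: "\<bar>m t x\<bar> \<le> 2 * \<bar>u t x\<bar>" for t x using nub[of t x] unfolding m_def nu_def by linarith
  have nub2: "\<bar>nu t x\<bar> \<le> 2 * \<bar>u t x\<bar>" for t x using nub[of t x] by linarith
  note im = L2_dominated[OF cm iL(2) mb] and inu = L2_dominated[OF cnu iL(2) nub2]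
  have Hm: "Hf (m t) x = hu t x + hn t x" for t x
    unfolding hu_def hn_def using filter_add[OF cu iL(2) cnu inu(1), of t t x] by (simp add: m_def[abs_def] nu_def[abs_def])
  have Ta: "totdiff a (\<lambda>t x. Hf (m t) x - m t x) (\<lambda>t x. n t x - a t x)"
    unfolding a_def
  proof (rule filter_transport[OF Tn Tm, where K="4 * K"])
    show "nt t x + (ux t x + (nx t x * u t x + n t x * ux t x)) = 0" for t x using eq1[of t x] by (simp add: algebra_simps)
    show "(LINT x|lborel. (n t x)\<^sup>2) \<le> 4 * K" for t using K(1)[of t] K0 by linarith
    show "(LINT x|lborel. (m t x)\<^sup>2) \<le> 4 * K" for t using im(2)[of t] K(2)[of t] by linarith
  qed (rule iL(1) im(1))+
  have jHm: "jcont (\<lambda>t. Hf (m t)) z" for z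
  proof (rule filter_jcont[OF totdiff_jcont[OF Tm] im(1)])
    show "(LINT x|lborel. (m t x)\<^sup>2) \<le> 4 * K" for t using im(2)[of t] K(2)[of t] by linarith
  qed
  have ja: "jcont a z" and jm: "jcont m z" for z using totdiff_jcont[OF Ta] totdiff_jcont[OF Tm] by auto
  have ab: "\<bar>a t x\<bar> \<le> \<delta>" for t x unfolding a_def by (rule filter_bounds(2)[OF cn iL(1) n])
  have hub: "\<bar>hu t x\<bar> \<le> 1 + 4 * K" for t x
    unfolding hu_def using filter_bounds(1)[OF cu iL(2), of t x] K(2)[of t] K0 unfolding add_divide_distrib by linarith
  have hnb: "\<bar>hn t x\<bar> \<le> 1 + 4 * K" for t x
    unfolding hn_def using filter_bounds(1)[OF cnu inu(1), of t x] inu(2)[of t] K(2)[of t] K0 unfolding add_divide_distrib by linarith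
  have bch: "bc (a t)" "bc (hu t)" "bc (hn t)" for t
    unfolding a_def hu_def hn_def by (intro filter_bc cn cu cnu iL inu(1))+
  have ca: "continuous_on UNIV (a t)" "continuous_on UNIV (hu t)" "continuous_on UNIV (hn t)" for t using bch unfolding bc_def by auto

  define Dm where "Dm t x = om (x - y t) + (n t x)\<^sup>2 + (u t x)\<^sup>2 + (px t x)\<^sup>2" for t x
  have iD: "integrable lborel (Dm t)" for t unfolding Dm_def[abs_def] using wd(7)[of t] iL(1,2) ip by auto
  have MD: "(LINT x|lborel. Dm t x) \<le> (LINT x|lborel. om x) + 3 * K" for t
    unfolding Dm_def using wd(7)[of t] iL(1,2)[of t] ip[of t] oI[of t] K(1)[of t] K(2)[of t] Kp[of t] by simp
  note di = dominated_integral[OF _ _ iD MD]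
  have o0: "0 \<le> om z" "om z \<le> 1" for z using wd0(2,3) by auto
  have v1: "\<bar>v t\<bar> \<le> k" for t
  proof -
    have "\<theta> > 0" using \<theta> kC(1) by (metis add_pos_pos mult_neg_pos mult_zero_left not_less_iff_gr_or_eq zero_less_one)
    then have "\<theta> \<le> 1" using \<theta> kC(1) mult_left_mono[of 1 "1 + k" \<theta>] by simp
    then have "\<theta> * k\<^sup>2 \<le> 1 * k\<^sup>2" by (intro mult_right_mono) auto
    then have "(v t)\<^sup>2 \<le> k\<^sup>2" using y(3)[of t] by linarith
    then show ?thesis using kC(1) abs_le_square_iff[of "v t" k] by simp
  qed
  have s0: "0 \<le> (n t x)\<^sup>2" "0 \<le> (u t x)\<^sup>2" "0 \<le> (px t x)\<^sup>2" for t x by simp_all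
  have pr: "\<bar>r * s\<bar> \<le> r\<^sup>2 + s\<^sup>2" for r s :: real
  proof -
    have "2 * \<bar>r * s\<bar> \<le> r\<^sup>2 + s\<^sup>2" using zero_le_power2[of "\<bar>r\<bar> - \<bar>s\<bar>"] unfolding power2_diff by (simp add: abs_mult)
    then show ?thesis using abs_ge_zero[of "r * s"] by linarith
  qed
  have Dlo: "(n t x)\<^sup>2 + (u t x)\<^sup>2 \<le> 1 * Dm t x" "(n t x)\<^sup>2 + (px t x)\<^sup>2 \<le> 1 * Dm t x" "om (x - y t) + (u t x)\<^sup>2 \<le> 1 * Dm t x"
       "(n t x)\<^sup>2 \<le> Dm t x" "(u t x)\<^sup>2 \<le> 1 * Dm t x" "om (x - y t) \<le> 1 * Dm t x" for t x
  proof -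
    note b = s0[of t x] o0(1)[of "x - y t"]
    show "(n t x)\<^sup>2 + (u t x)\<^sup>2 \<le> 1 * Dm t x" using b unfolding Dm_def mult_1 by linarith
    show "(n t x)\<^sup>2 + (px t x)\<^sup>2 \<le> 1 * Dm t x" using b unfolding Dm_def mult_1 by linarith
    show "om (x - y t) + (u t x)\<^sup>2 \<le> 1 * Dm t x" using b unfolding Dm_def mult_1 by linarith
    show "(n t x)\<^sup>2 \<le> Dm t x" using b unfolding Dm_def by linarith
    show "(u t x)\<^sup>2 \<le> 1 * Dm t x" using b unfolding Dm_def mult_1 by linarith
    show "om (x - y t) \<le> 1 * Dm t x" using b unfolding Dm_def mult_1 by linarith
  qed
  have dnu: "dominated Dm (\<lambda>t x. n t x * u t x)" by (rule dominatedI[OF order_trans[OF pr Dlo(1)]]) simp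
  have dnp: "dominated Dm (\<lambda>t x. n t x * px t x)" by (rule dominatedI[OF order_trans[OF pr Dlo(2)]]) simp
  have duu: "dominated Dm (\<lambda>t x. (u t x)\<^sup>2)" by (rule dominatedI[OF order_trans[OF _ Dlo(5)]]) simp_all
  have dom: "dominated Dm (\<lambda>t x. om (x - y t))" by (rule dominatedI[OF order_trans[OF _ Dlo(6)]]) (use o0 in simp_all)
  have dom': "dominated Dm (\<lambda>t x. om' (x - y t))" by (rule dominatedI[OF order_trans[OF om1 Dlo(6)]]) simp
  have ou: "om z * \<bar>r\<bar> \<le> om z + r\<^sup>2" for z r
  proof -
    have "\<bar>r\<bar> \<le> 1 + r\<^sup>2" using pr[of 1 r] by simp
    then have "om z * \<bar>r\<bar> \<le> om z * (1 + r\<^sup>2)" using o0(1)[of z] by (intro mult_left_mono) auto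
    also have "\<dots> \<le> om z + r\<^sup>2" using mult_right_mono[OF o0(2)[of z], of "r\<^sup>2"] by (simp add: distrib_left)
    finally show ?thesis .
  qed
  have dou: "dominated Dm (\<lambda>t x. om (x - y t) * u t x)"
    by (rule dominatedI[OF order_trans[OF _ Dlo(3)]]) (use ou o0(1) in \<open>simp_all add: abs_mult\<close>)
  have dou': "dominated Dm (\<lambda>t x. om' (x - y t) * u t x)"
  proof (rule dominatedI[OF order_trans[OF _ Dlo(3)]])
    show "\<bar>om' (x - y t) * u t x\<bar> \<le> om (x - y t) + (u t x)\<^sup>2" for t x
      using order_trans[OF mult_right_mono[OF om1[of "x - y t"]] ou[of "x - y t" "u t x"]] by (simp add: abs_mult)
  qed simp
  have nC: "\<bar>w (n t x)\<bar> \<le> 2 * C" for t x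
  proof -
    have "(n t x)\<^sup>2 \<le> 1\<^sup>2" using nh[of t x] abs_le_square_iff[of "n t x" 1] by simp
    then have 1: "C * (n t x)\<^sup>2 \<le> C * 1" using kC by (intro mult_left_mono) auto
    have "\<bar>k * n t x\<bar> \<le> C * 1" unfolding abs_mult using kC nh[of t x] by (intro mult_mono) auto
    then show ?thesis using w1[of t x] 1 by linarith
  qed
  have dP: "dominated Dm (\<lambda>t x. P (n t x))"
  proof (rule dominatedI[of _ "2 * C"])
    fix t x
    have "C * \<delta> * (n t x)\<^sup>2 \<le> C * 1 * (n t x)\<^sup>2" using kC \<delta> by (intro mult_right_mono mult_left_mono) auto
    moreover have "k * (n t x)\<^sup>2 \<le> C * (n t x)\<^sup>2" using kC by (intro mult_right_mono) auto
    moreover have "C * (n t x)\<^sup>2 \<le> C * Dm t x" using Dlo(4)[of t x] kC by (intro mult_left_mono) auto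
    moreover have "0 \<le> k * (n t x)\<^sup>2" using kC by simp
    ultimately show "\<bar>P (n t x)\<bar> \<le> 2 * C * Dm t x" using P1[of t x] unfolding mult.assoc[of 2] by linarith
  qed (use kC in simp)
  have tv: "tame (\<lambda>t x. v t)" and to: "tame (\<lambda>t x. om (x - y t))" and to': "tame (\<lambda>t x. om' (x - y t))" and tX: "tame (\<lambda>t x. X (x - y t))"
    and ta: "tame a" and tn: "tame n" and tp: "tame px" and thu: "tame hu" and thn: "tame hn" and tw: "tame (\<lambda>t x. w (n t x))"
    and tc: "tame (\<lambda>t x. b)" for b
  proof -
    show "tame (\<lambda>t x. v t)" by (rule tameI[OF v1])
    show "tame (\<lambda>t x. om (x - y t))" by (rule tameI[of _ 1]) (use o0 in simp)
    show "tame (\<lambda>t x. om' (x - y t))" by (rule tameI[of _ 1]) (use order_trans[OF om1 o0(2)] in simp)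
    show "tame (\<lambda>t x. X (x - y t))" by (rule tameI[OF Xb])
    show "tame a" "tame n" "tame px" "tame hu" "tame hn" "tame (\<lambda>t x. w (n t x))"
      by (rule tameI[OF ab] tameI[OF n] tameI[OF ps(2)] tameI[OF hub] tameI[OF hnb] tameI[OF nC])+
    show "tame (\<lambda>t x. b)" by (rule tameI[of _ "\<bar>b\<bar>"]) simp
  qed
  note tt = tv to to' tX ta tn tp thu thn tw tc
  note dd = dnu dnp duu dom dom' dou dou' dP
  note cc = cn cu cp ca cw cP co cX

  define G1 where "G1 t x = (u t x)\<^sup>2 / 2 + n t x * (u t x)\<^sup>2 + P (n t x)" for t x
  define G2 where "G2 t x = (u t x)\<^sup>2 / 2 + w (n t x)" for t x
  define k1 where "k1 t x = (- v t * om (x - y t)) * (n t x * u t x) + om (x - y t) * G1 t x + X (x - y t) * (- (n t x * px t x))" for t x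
  define k2 where "k2 t x = (- v t * om' (x - y t) * a t x + om (x - y t) * ((hu t x + hn t x) - (u t x + n t x * u t x))) * u t x
        + (om' (x - y t) * a t x + om (x - y t) * (n t x - a t x)) * G2 t x + (om (x - y t) * a t x) * (- px t x)" for t x
  have cG: "continuous_on UNIV (G1 t)" "continuous_on UNIV (G2 t)" for t unfolding G1_def G2_def by (intro continuous_intros cc; simp)+
  have ck: "continuous_on UNIV (k1 t)" "continuous_on UNIV (k2 t)" for t unfolding k1_def k2_def by (intro continuous_intros cc cG)+
  have dG1: "dominated Dm G1"
  proof -
    have "dominated Dm (\<lambda>t x. (1/2) * (u t x)\<^sup>2 + n t x * (u t x)\<^sup>2 + P (n t x))"
      by (rule dd tt | rule dominated_rules(1) dominated_rules(2) dominated_rules(3) tame_rules)+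
    then show ?thesis by (simp add: G1_def[abs_def])
  qed
  have dk1: "dominated Dm k1"
    unfolding k1_def[abs_def] by (rule dd tt dG1 | rule dominated_rules(1) dominated_rules(2) dominated_rules(3) tame_rules)+
  have doG2: "dominated Dm (\<lambda>t x. om (x - y t) * G2 t x)" "dominated Dm (\<lambda>t x. om' (x - y t) * G2 t x)"
  proof -
    have "dominated Dm (\<lambda>t x. om (x - y t) * ((1/2) * (u t x)\<^sup>2) + w (n t x) * om (x - y t))"
      "dominated Dm (\<lambda>t x. om' (x - y t) * ((1/2) * (u t x)\<^sup>2) + w (n t x) * om' (x - y t))"
      by (rule dd tt | rule dominated_rules(1) dominated_rules(2) dominated_rules(3) tame_rules)+
    then show "dominated Dm (\<lambda>t x. om (x - y t) * G2 t x)" "dominated Dm (\<lambda>t x. om' (x - y t) * G2 t x)"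
      by (simp_all add: G2_def distrib_left mult.commute)
  qed
  have dk2: "dominated Dm k2"
  proof -
    have "dominated Dm (\<lambda>t x. ((- v t) * a t x) * (om' (x - y t) * u t x) + (hu t x + hn t x) * (om (x - y t) * u t x)
        + - (om (x - y t) * (u t x)\<^sup>2) + - ((om (x - y t) * n t x) * (u t x)\<^sup>2)
        + (a t x * (om' (x - y t) * G2 t x) + (n t x + - a t x) * (om (x - y t) * G2 t x)) + (a t x * (- px t x)) * om (x - y t))"
      by (rule dd tt doG2 | rule dominated_rules(1) dominated_rules(2) dominated_rules(3) tame_rules)+
    also have "(\<lambda>t x. ((- v t) * a t x) * (om' (x - y t) * u t x) + (hu t x + hn t x) * (om (x - y t) * u t x)
        + - (om (x - y t) * (u t x)\<^sup>2) + - ((om (x - y t) * n t x) * (u t x)\<^sup>2)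
        + (a t x * (om' (x - y t) * G2 t x) + (n t x + - a t x) * (om (x - y t) * G2 t x)) + (a t x * (- px t x)) * om (x - y t)) = k2"
      unfolding k2_def by (simp add: fun_eq_iff algebra_simps power2_eq_square)
    finally show ?thesis .
  qed

  define J1 where "J1 t = (LINT x|lborel. X (x - y t) * (n t x * u t x))" for t
  define J2 where "J2 t = (LINT x|lborel. (om (x - y t) * a t x) * u t x)" for t
  have dz1: "dominated Dm (\<lambda>t x. X (x - y t) * (n t x * u t x))" "dominated Dm (\<lambda>t x. X (x - y t) * G1 t x)"
    by (rule dd tt dG1 | rule dominated_rules(1) dominated_rules(2) dominated_rules(3) tame_rules)+
  have dz2: "dominated Dm (\<lambda>t x. (om (x - y t) * a t x) * u t x)" "dominated Dm (\<lambda>t x. (om (x - y t) * a t x) * G2 t x)"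
    using dominated_rules(2)[OF dou ta] dominated_rules(2)[OF doG2(1) ta] by (simp_all add: mult_ac)
  have cz1: "continuous_on UNIV (\<lambda>x. X (x - y t) * (n t x * u t x))" "continuous_on UNIV (\<lambda>x. X (x - y t) * G1 t x)" for t
    by (intro continuous_intros cc cG)+
  have cz2: "continuous_on UNIV (\<lambda>x. (om (x - y t) * a t x) * u t x)" "continuous_on UNIV (\<lambda>x. (om (x - y t) * a t x) * G2 t x)" for t
    by (intro continuous_intros cc cG)+
  have Thalf: "totdiff (\<lambda>t x. 1/2 + n t x) (\<lambda>t x. 1 * nt t x) (\<lambda>t x. 1 * nx t x)"
    by (rule totdiff_compose[OF Tn, where F="\<lambda>s. 1/2 + s" and F'="\<lambda>_. 1"]) (auto intro!: derivative_eq_intros)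
  have TG1: "totdiff G1 (\<lambda>t x. ((ut t x * u t x + u t x * ut t x) * (1/2 + n t x) + (u t x * u t x) * (1 * nt t x)) + n t x * cq (n t x) * nt t x)
     (\<lambda>t x. ((ux t x * u t x + u t x * ux t x) * (1/2 + n t x) + (u t x * u t x) * (1 * nx t x)) + n t x * cq (n t x) * nx t x)"
  proof -
    have e: "G1 = (\<lambda>t x. (u t x * u t x) * (1/2 + n t x) + P (n t x))"
      by (simp add: G1_def fun_eq_iff power2_eq_square algebra_simps)
    show ?thesis unfolding e
      by (rule totdiff_add[OF totdiff_mult[OF totdiff_mult[OF Tu Tu] Thalf] totdiff_compose[OF Tn, where F=P and F'="\<lambda>s. s * cq s", OF PD]])
  qed
  have TG2: "totdiff G2 (\<lambda>t x. 1/2 * (ut t x * u t x + u t x * ut t x) + cq (n t x) * nt t x)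
     (\<lambda>t x. 1/2 * (ux t x * u t x + u t x * ux t x) + cq (n t x) * nx t x)"
  proof -
    have e: "G2 = (\<lambda>t x. (u t x * u t x) / 2 + w (n t x))" by (simp add: G2_def fun_eq_iff power2_eq_square)
    have half: "((\<lambda>v. v / 2) has_real_derivative (\<lambda>_. 1/2) v) (at v)" for v :: real by (auto intro!: derivative_eq_intros)
    show ?thesis unfolding e
      by (rule totdiff_add[OF totdiff_compose[OF totdiff_mult[OF Tu Tu], where F="\<lambda>v. v / 2" and F'="\<lambda>_. 1/2", OF half] totdiff_compose[OF Tn, where F=w and F'=cq, OF wD]])
  qed
  have nte: "nt t x = - (nx t x * u t x + (1 + n t x) * ux t x)" and ute: "ut t x = - px t x - (u t x * ux t x + cq (n t x) * nx t x)" for t x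
    using eq1[of t x] eq2[of t x] by (simp_all add: cq_def)
  obtain M1 where M1: "\<And>t. (LINT x|lborel. \<bar>X (x - y t) * G1 t x\<bar>) \<le> M1" using di(2)[OF dz1(2) cz1(2)] by blast
  obtain M2 where M2: "\<And>t. (LINT x|lborel. \<bar>k1 t x\<bar>) \<le> M2" using di(2)[OF dk1 ck(1)] by blast
  obtain M3 where M3: "\<And>t. (LINT x|lborel. \<bar>(om (x - y t) * a t x) * G2 t x\<bar>) \<le> M3" using di(2)[OF dz2(2) cz2(2)] by blast
  obtain M4 where M4: "\<And>t. (LINT x|lborel. \<bar>k2 t x\<bar>) \<le> M4" using di(2)[OF dk2 ck(2)] by blast
  obtain M5 where M5: "\<And>t. (LINT x|lborel. \<bar>X (x - y t) * (n t x * u t x)\<bar>) \<le> M5" using di(2)[OF dz1(1) cz1(1)] by blast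
  obtain M6 where M6: "\<And>t. (LINT x|lborel. \<bar>(om (x - y t) * a t x) * u t x\<bar>) \<le> M6" using di(2)[OF dz2(1) cz2(1)] by blast
  have law1: "((\<lambda>t. LINT x|lborel. k1 t x) has_integral J1 T - J1 0) {0..T}" if "0 \<le> T" for T
    unfolding J1_def
  proof (rule balance_law_line[OF Tnu[unfolded nu_def] TG1 TX, where h="\<lambda>t x. - (n t x * px t x)" and M="max M1 M2"])
    show "nt t x * u t x + n t x * ut t x + ((ux t x * u t x + u t x * ux t x) * (1 / 2 + n t x) + u t x * u t x * (1 * nx t x) + n t x * cq (n t x) * nx t x) = - (n t x * px t x)" for t x
      unfolding nte ute by (simp add: field_simps)
    show "k1 t x = - v t * om (x - y t) * (n t x * u t x) + om (x - y t) * G1 t x + X (x - y t) * - (n t x * px t x)" for t x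
      by (simp add: k1_def)
    show "(LINT x|lborel. \<bar>X (x - y t) * G1 t x\<bar>) \<le> max M1 M2" "(LINT x|lborel. \<bar>k1 t x\<bar>) \<le> max M1 M2" for t
      using M1[of t] M2[of t] by auto
    show "jcont (\<lambda>t x. - (n t x * px t x)) z" "jcont (\<lambda>t x. - v t * om (x - y t)) z" "jcont (\<lambda>t x. om (x - y t)) z" for z
      by (intro continuous_intros jn jp jv jo)+
    show "integrable lborel (\<lambda>x. X (x - y t) * (n t x * u t x))" "integrable lborel (\<lambda>x. X (x - y t) * G1 t x)" "integrable lborel (k1 t)" for t
      by (rule di(1)[OF dz1(1) cz1(1)] di(1)[OF dz1(2) cz1(2)] di(1)[OF dk1 ck(1)])+
  qed (rule that)
  have Tz2: "totdiff (\<lambda>t x. om (x - y t) * a t x) (\<lambda>t x. - v t * om' (x - y t) * a t x + om (x - y t) * (Hf (m t) x - m t x))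
     (\<lambda>t x. om' (x - y t) * a t x + om (x - y t) * (n t x - a t x))"
    by (rule totdiff_mult[OF To Ta])
  have law2: "((\<lambda>t. LINT x|lborel. k2 t x) has_integral J2 T - J2 0) {0..T}" if "0 \<le> T" for T
    unfolding J2_def
  proof (rule balance_law_line[OF Tu TG2 Tz2, where h="\<lambda>t x. - px t x" and M="max M3 M4"])
    show "ut t x + (1 / 2 * (ux t x * u t x + u t x * ux t x) + cq (n t x) * nx t x) = - px t x" for t x
      unfolding ute by (simp add: field_simps)
    show "k2 t x = (- v t * om' (x - y t) * a t x + om (x - y t) * (Hf (m t) x - m t x)) * u t x
        + (om' (x - y t) * a t x + om (x - y t) * (n t x - a t x)) * G2 t x + om (x - y t) * a t x * - px t x" for t x
      by (simp add: k2_def Hm m_def)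
    show "(LINT x|lborel. \<bar>om (x - y t) * a t x * G2 t x\<bar>) \<le> max M3 M4" "(LINT x|lborel. \<bar>k2 t x\<bar>) \<le> max M3 M4" for t
      using M3[of t] M4[of t] by auto
    show "jcont (\<lambda>t x. - px t x) z" "jcont (\<lambda>t x. - v t * om' (x - y t) * a t x + om (x - y t) * (Hf (m t) x - m t x)) z"
      "jcont (\<lambda>t x. om' (x - y t) * a t x + om (x - y t) * (n t x - a t x)) z" for z
      by (intro continuous_intros jn jp jv jo jo' ja jm jHm)+
    show "integrable lborel (\<lambda>x. om (x - y t) * a t x * u t x)" "integrable lborel (\<lambda>x. om (x - y t) * a t x * G2 t x)" "integrable lborel (k2 t)" for t
      by (rule di(1)[OF dz2(1) cz2(1)] di(1)[OF dz2(2) cz2(2)] di(1)[OF dk2 ck(2)])+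
  qed (rule that)
  have absint: "\<bar>LINT x|lborel. F x\<bar> \<le> (LINT x|lborel. \<bar>F x\<bar>)" for F :: "real \<Rightarrow> real"
    using integral_norm_bound[of lborel F] by simp
  have J1b: "\<bar>J1 t\<bar> \<le> M5" for t unfolding J1_def by (rule order_trans[OF absint M5])
  have J2b: "\<bar>J2 t\<bar> \<le> M6" for t unfolding J2_def by (rule order_trans[OF absint M6])
  show ?thesis
  proof (rule growth_contradiction[where J="\<lambda>t. J1 t + \<theta> / 2 * J2 t" and B="M5 + \<bar>\<theta> / 2\<bar> * M6"
        and Gf="\<lambda>t. (LINT x|lborel. k1 t x) + \<theta> / 2 * (LINT x|lborel. k2 t x)"
        and c="\<theta> * k / (2 * (4 * k + 5)) - C * (400 * \<delta> + 200 * (1 / A))"])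
    fix T :: real assume T: "0 \<le> T"
    from has_integral_add[OF law1[OF T] has_integral_mult_right[OF law2[OF T], of "\<theta> / 2"]]
    show "((\<lambda>t. (LINT x|lborel. k1 t x) + \<theta> / 2 * (LINT x|lborel. k2 t x)) has_integral J1 T + \<theta> / 2 * J2 T - (J1 0 + \<theta> / 2 * J2 0)) {0..T}"
      by (simp add: algebra_simps diff_divide_distrib)
  next
    fix t
    have "\<bar>\<theta> / 2 * J2 t\<bar> \<le> \<bar>\<theta> / 2\<bar> * M6" unfolding abs_mult[of "\<theta> / 2"] by (intro mult_left_mono J2b) simp
    then show "\<bar>J1 t + \<theta> / 2 * J2 t\<bar> \<le> M5 + \<bar>\<theta> / 2\<bar> * M6" using J1b[of t] by linarith
    have XDt: "((\<lambda>x. X (x - y t)) has_real_derivative om (x - y t)) (at x)" for x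
      using weight_lorentz(3)[OF A0, of "y t" x] by (simp add: X_def om_def)
    have bcs: "bc (n t)" "bc (u t)" "bc (\<phi> t)" "bc (px t)" "bc (\<lambda>x. P (n t x))" "bc (\<lambda>x. w (n t x))" "bc (\<lambda>x. X (x - y t))"
    proof -
      show "bc (n t)" by (rule bcI[OF cn n])
      show "bc (u t)" by (rule bc_of_limit[OF cu lim(2)])
      show "bc (\<phi> t)" by (rule bcI[OF _ ps(1)]) (use D\<phi>(1) in \<open>auto intro!: continuous_at_imp_continuous_on DERIV_isCont\<close>)
      show "bc (px t)" by (rule bcI[OF cp ps(2)])
      show "bc (\<lambda>x. w (n t x))" by (rule bcI[OF cw nC])
      show "bc (\<lambda>x. X (x - y t))" by (rule bcI[OF cX Xb])
      have eP: "\<bar>P (n t x)\<bar> \<le> 2 * C" for x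
      proof -
        have "(n t x)\<^sup>2 \<le> 1\<^sup>2" using nh[of t x] abs_le_square_iff[of "n t x" 1] by simp
        then have s: "(n t x)\<^sup>2 \<le> 1" by simp
        have "C * \<delta> * (n t x)\<^sup>2 \<le> C * 1 * 1" using kC \<delta> s by (intro mult_mono) auto
        moreover have "k * (n t x)\<^sup>2 \<le> C * 1" using kC s by (intro mult_mono) auto
        moreover have "0 \<le> k * (n t x)\<^sup>2" using kC by simp
        ultimately show ?thesis using P1[of t x] kC by linarith
      qed
      show "bc (\<lambda>x. P (n t x))" by (rule bcI[OF cP eP])
    qed
    have inp: "integrable lborel (\<lambda>x. n t x * px t x)"
      by (rule di(1)[OF dnp]) (intro continuous_intros cc)
    have A4: "1 / A \<le> 1 / 4" using A by (simp add: field_simps)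
    have hD: "(a t has_real_derivative n t x - a t x) (at x)" "(hu t has_real_derivative u t x - hu t x) (at x)"
       "(hn t has_real_derivative n t x * u t x - hn t x) (at x)" for x
      unfolding a_def hu_def hn_def using filter_derivative[OF cn iL(1)] filter_derivative[OF cu iL(2)]
        filter_derivative[OF cnu inu(1), of t x] by (auto simp: nu_def[abs_def])
    have "(\<theta> * k / (2 * (4 * k + 5)) - C * (400 * \<delta> + 200 * (1 / A))) * (LINT x|lborel. om (x - y t) * ((u t x)\<^sup>2 + (n t x)\<^sup>2))
       \<le> (LINT x|lborel. k1 t x) + \<theta> / 2 * (LINT x|lborel. k2 t x)"
      unfolding k1_def k2_def G1_def G2_def
      by (rule virial_static[where f="\<phi> t" and P="\<lambda>x. P (n t x)" and w="\<lambda>x. w (n t x)" and X="\<lambda>x. X (x - y t)" and a="a t" and hu="hu t" and hn="hn t",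
            OF wt A4 kC(1,3,2) \<theta> y(3) \<delta>(1,2) n ab ps(1) w1 P1 D\<phi> hD XDt bcs(1-4) bch bcs(5-7) inp lim(3) ps(4)])
    then show "(\<theta> * k / (2 * (4 * k + 5)) - C * (400 * \<delta> + 200 * (1 / A))) * (LINT x|lborel. 1 / (1 + ((x - y t) / A)\<^sup>2) * ((u t x)\<^sup>2 + (n t x)\<^sup>2))
       \<le> (LINT x|lborel. k1 t x) + \<theta> / 2 * (LINT x|lborel. k2 t x)" by (simp add: om_def)
  qed (rule small e)+
qed

section \<open>Vanishing of small compact solutions\<close>

lemma zero_of_integral:
  fixes S :: "real \<Rightarrow> real"
  assumes c: "continuous_on UNIV S" and i: "integrable lborel S" "(LINT x|lborel. S x) \<le> 0" and S: "\<And>x. 0 \<le> S x"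
  shows "S x = 0"
proof -
  have "0 \<le> (LINT x|lborel. S x)" using S by simp
  then have "(LINT x|lborel. S x) = 0" using i(2) by linarith
  then have "AE x in lborel. S x = 0" using integral_nonneg_eq_0_iff_AE[OF i(1)] S by simp
  then have "AE x in lborel. S x \<le> 0" by eventually_elim simp
  from everywhere_of_AE[OF c this, of x] S[of x] show ?thesis by linarith
qed

text \<open>Near zero the potential part of the energy density is comparable with the square of the potential.\<close>

lemma R_bounds:
  assumes "\<bar>v\<bar> \<le> 1/8"
  shows "v\<^sup>2 / 4 \<le> R v" "R v \<le> 2 * v\<^sup>2"
proof -
  have h: "\<bar>v\<bar> \<le> 1/2" using assms by linarith
  note e = exp_small_bounds[OF h]
  have s: "\<bar>v\<bar> * v\<^sup>2 \<le> 1/8 * v\<^sup>2" using assms by (intro mult_right_mono) auto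
  have "v * (exp v - 1) = v\<^sup>2 + v * (exp v - 1 - v)" by (simp add: power2_eq_square algebra_simps)
  moreover have "\<bar>v * (exp v - 1 - v)\<bar> \<le> \<bar>v\<bar> * v\<^sup>2" unfolding abs_mult using e(1) by (intro mult_left_mono) auto
  ultimately show "v\<^sup>2 / 4 \<le> R v" "R v \<le> 2 * v\<^sup>2" unfolding R_eq using e(2,4) s by linarith+
qed

text \<open>At the times of \<open>euler_poisson_local_decay\<close> the mass near the center is small, and compactness bounds the rest. The
energy is comparable with the mass because the perturbation is small, so its constant value is zero.\<close>

proposition small_compact_solution_vanishes:
  fixes n u \<phi> :: "real \<Rightarrow> real \<Rightarrow> real"
  assumes pb: "pressure_bounds p k C c \<sigma> \<tau>" and \<theta>: "\<theta> * (1 + k) = 1"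
    and \<delta>: "0 < \<delta>" "\<delta> \<le> 1/16" "20 * (C * \<delta>) \<le> sqrt k" "4 * (C * \<delta>) \<le> k" and A: "A \<ge> 4"
    and small: "0 < \<theta> * k / (2 * (4 * k + 5)) - C * (400 * \<delta> + 200 * (1 / A))"
    and cs: "classical_solution p n u \<phi>" and en: "conserves_energy p n u \<phi>" and n: "\<And>t x. \<bar>n t x\<bar> \<le> \<delta>"
    and iL: "\<And>t. integrable lborel (\<lambda>x. (n t x)\<^sup>2)" "\<And>t. integrable lborel (\<lambda>x. (u t x)\<^sup>2)"
    and K: "\<And>t. (LINT x|lborel. (n t x)\<^sup>2) \<le> K" "\<And>t. (LINT x|lborel. (u t x)\<^sup>2) \<le> K"
    and y: "\<And>t. (y has_real_derivative v t) (at t)" "continuous_on UNIV v" "\<And>t. (v t)\<^sup>2 \<le> \<theta> * k\<^sup>2"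
    and tail: "\<And>e. e > 0 \<Longrightarrow> \<exists>r. \<forall>t. (LINT x|lborel. indicat_real {x. \<bar>x - y t\<bar> > r} x * ((u t x)\<^sup>2 + (n t x)\<^sup>2)) \<le> e"
  shows "n t x = 0 \<and> u t x = 0 \<and> \<phi> t x = 0"
proof -
  have \<delta>4: "\<delta> \<le> 1/4" using \<delta>(2) by simp
  obtain nt nx ut ux px where Tn: "totdiff n nt nx" and Tu: "totdiff u ut ux" and jp: "\<And>z. jcont px z"
    and D\<phi>: "\<And>t x. (\<phi> t has_real_derivative px t x) (at x)" "\<And>t x. (px t has_real_derivative exp (\<phi> t x) - 1 - n t x) (at x)"
    using euler_poisson_regular[OF cs pb \<delta>(1) \<delta>4 \<delta>(3) n] by blast
  have kC: "k > 0" "C \<ge> 1" "k \<le> C" and pb1: "\<bar>s\<bar> < 1/2 \<Longrightarrow> (W p has_real_derivative enthalpy p s) (at s) \<and> \<bar>W p s - k * s\<^sup>2 / 2\<bar> \<le> C * \<bar>s\<bar> * s\<^sup>2" for s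
    using pb unfolding pressure_bounds_def by blast+
  have nh: "\<bar>n t x\<bar> < 1/2" for t x using n[of t x] \<delta> by linarith
  have lim: "(n t \<longlongrightarrow> 0) at_infinity" "(\<phi> t \<longlongrightarrow> 0) at_infinity" for t
    using cs unfolding classical_solution_def by auto
  note ps = poisson_slice[OF D\<phi> \<delta>(1) \<delta>4 n lim]
  have pxd: "deriv (\<phi> t) = px t" for t using DERIV_imp_deriv[OF D\<phi>(1)] by auto
  have cn: "continuous_on UNIV (n t)" and cu: "continuous_on UNIV (u t)" and cp: "continuous_on UNIV (px t)" for t
    using jcont_slices(1)[of n, OF totdiff_jcont[OF Tn]] jcont_slices(1)[of u, OF totdiff_jcont[OF Tu]] jcont_slices(1)[of px, OF jp] by auto
  have cf: "continuous_on UNIV (\<phi> t)" for t using D\<phi>(1) by (auto intro!: continuous_at_imp_continuous_on DERIV_isCont)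
  have \<phi>8: "\<bar>\<phi> t x\<bar> \<le> 1/8" for t x using ps(1)[of t x] \<delta> by linarith
  have \<phi>2: "\<bar>\<phi> t x\<bar> \<le> 1/2" for t x using \<phi>8[of t x] by linarith
  define ed where "ed t x = energy_density p (n t) (u t) (\<phi> t) x" for t x
  have ie: "integrable lborel (ed t)" for t using en unfolding conserves_energy_def ed_def[abs_def] by blast
  have Wb: "k / 4 * (n t x)\<^sup>2 \<le> W p (n t x)" "W p (n t x) \<le> C * (n t x)\<^sup>2" for t x
  proof -
    have "C * \<bar>n t x\<bar> * (n t x)\<^sup>2 \<le> C * \<delta> * (n t x)\<^sup>2" using n[of t x] kC by (intro mult_right_mono mult_left_mono) auto
    also have "\<dots> \<le> k / 4 * (n t x)\<^sup>2" using \<delta>(4) by (intro mult_right_mono) auto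
    finally have 1: "C * \<bar>n t x\<bar> * (n t x)\<^sup>2 \<le> k / 4 * (n t x)\<^sup>2" .
    have 2: "\<bar>W p (n t x) - k * (n t x)\<^sup>2 / 2\<bar> \<le> k / 4 * (n t x)\<^sup>2" using pb1[OF nh[of t x]] 1 by linarith
    have 3: "k * (n t x)\<^sup>2 \<le> C * (n t x)\<^sup>2" using kC by (intro mult_right_mono) auto
    have 4: "0 \<le> k * (n t x)\<^sup>2" using kC by simp
    have 5: "k / 4 * (n t x)\<^sup>2 = k * (n t x)\<^sup>2 / 4" by simp
    show "k / 4 * (n t x)\<^sup>2 \<le> W p (n t x)" "W p (n t x) \<le> C * (n t x)\<^sup>2" using 2 3 4 unfolding 5 by linarith+
  qed
  have ub: "(u t x)\<^sup>2 / 4 \<le> (1 + n t x) * (u t x)\<^sup>2 / 2" "(1 + n t x) * (u t x)\<^sup>2 / 2 \<le> (u t x)\<^sup>2" for t x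
  proof -
    have "1/2 * (u t x)\<^sup>2 \<le> (1 + n t x) * (u t x)\<^sup>2" "(1 + n t x) * (u t x)\<^sup>2 \<le> 2 * (u t x)\<^sup>2"
      using nh[of t x] by (intro mult_right_mono; simp add: abs_less_iff)+
    then show "(u t x)\<^sup>2 / 4 \<le> (1 + n t x) * (u t x)\<^sup>2 / 2" "(1 + n t x) * (u t x)\<^sup>2 / 2 \<le> (u t x)\<^sup>2" by linarith+
  qed
  have ed: "ed t x = (1 + n t x) * (u t x)\<^sup>2 / 2 + W p (n t x) + (px t x)\<^sup>2 / 2 + R (\<phi> t x)" for t x
    by (simp add: ed_def energy_density_def pxd)
  have lo: "(u t x)\<^sup>2 / 4 + k / 4 * (n t x)\<^sup>2 + (px t x)\<^sup>2 / 2 + (\<phi> t x)\<^sup>2 / 4 \<le> ed t x" for t x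
    unfolding ed using Wb(1)[of t x] ub(1)[of t x] R_bounds(1)[OF \<phi>8[of t x]] by linarith
  have hi: "ed t x \<le> (u t x)\<^sup>2 + C * (n t x)\<^sup>2 + (px t x)\<^sup>2 + 2 * (\<phi> t x)\<^sup>2" for t x
    unfolding ed using Wb(2)[of t x] ub(2)[of t x] R_bounds(2)[OF \<phi>8[of t x]] zero_le_power2[of "px t x"] by linarith
  have sq: "0 \<le> (u t x)\<^sup>2" "0 \<le> (px t x)\<^sup>2" "0 \<le> (\<phi> t x)\<^sup>2" "0 \<le> k / 4 * (n t x)\<^sup>2" for t x using kC by simp_all
  have ip: "integrable lborel (\<lambda>x. (px t x)\<^sup>2)" "integrable lborel (\<lambda>x. (\<phi> t x)\<^sup>2)" for t
  proof -
    have m: "(\<lambda>x. (px t x)\<^sup>2) \<in> borel_measurable lborel" "(\<lambda>x. (\<phi> t x)\<^sup>2) \<in> borel_measurable lborel"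
      using borel_measurable_continuous_onI[OF cp[of t]] borel_measurable_continuous_onI[OF cf[of t]] by simp_all
    have b: "(px t x)\<^sup>2 \<le> 4 * ed t x" "(\<phi> t x)\<^sup>2 \<le> 4 * ed t x" for x using lo[of t x] sq[of t x] by linarith+
    show "integrable lborel (\<lambda>x. (px t x)\<^sup>2)"
      by (rule Bochner_Integration.integrable_bound[OF integrable_mult_right[OF ie, of 4 t] m(1)])
        (use order_trans[OF b(1) abs_ge_self] in simp)
    show "integrable lborel (\<lambda>x. (\<phi> t x)\<^sup>2)"
      by (rule Bochner_Integration.integrable_bound[OF integrable_mult_right[OF ie, of 4 t] m(2)])
        (use order_trans[OF b(2) abs_ge_self] in simp)
  qed
  define S where "S t x = (u t x)\<^sup>2 + (n t x)\<^sup>2" for t x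
  have iS: "integrable lborel (S t)" for t unfolding S_def[abs_def] using iL by auto
  have S0: "0 \<le> S t x" for t x by (simp add: S_def)
  have upper: "(LINT x|lborel. ed t x) \<le> (C + 9) * (LINT x|lborel. S t x)" for t
  proof -
    note el = poisson_slice_L2[OF D\<phi> \<phi>2 lim(2) ps(4) cn iL(1) ip(2,1), of t]
    have "(LINT x|lborel. ed t x) \<le> (LINT x|lborel. (u t x)\<^sup>2 + C * (n t x)\<^sup>2 + (px t x)\<^sup>2 + 2 * (\<phi> t x)\<^sup>2)"
      using iL[of t] ip[of t] by (intro integral_mono ie hi) auto
    also have "\<dots> = (LINT x|lborel. (u t x)\<^sup>2) + C * (LINT x|lborel. (n t x)\<^sup>2) + (LINT x|lborel. (px t x)\<^sup>2) + 2 * (LINT x|lborel. (\<phi> t x)\<^sup>2)"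
      using iL[of t] ip[of t] by simp
    also have "\<dots> \<le> (LINT x|lborel. (u t x)\<^sup>2) + (C + 9) * (LINT x|lborel. (n t x)\<^sup>2)"
      using el by (simp add: distrib_right)
    also have "\<dots> \<le> (C + 9) * (LINT x|lborel. (u t x)\<^sup>2) + (C + 9) * (LINT x|lborel. (n t x)\<^sup>2)"
    proof -
      have "1 * (LINT x|lborel. (u t x)\<^sup>2) \<le> (C + 9) * (LINT x|lborel. (u t x)\<^sup>2)" using kC by (intro mult_right_mono) auto
      then show ?thesis by simp
    qed
    also have "\<dots> = (C + 9) * (LINT x|lborel. S t x)" using iL[of t] by (simp add: S_def distrib_left)
    finally show ?thesis .
  qed
  define k4 where "k4 = min (1/4) (k/4)"
  have k4: "k4 > 0" using kC by (simp add: k4_def)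
  have lower: "k4 * (LINT x|lborel. S t x) \<le> (LINT x|lborel. ed t x)" for t
  proof -
    have "k4 * S t x \<le> ed t x" for x
    proof -
      have "k4 * (u t x)\<^sup>2 \<le> 1/4 * (u t x)\<^sup>2" "k4 * (n t x)\<^sup>2 \<le> k/4 * (n t x)\<^sup>2" by (intro mult_right_mono; simp add: k4_def)+
      then show ?thesis using lo[of t x] sq[of t x] unfolding S_def distrib_left by linarith
    qed
    then have "(LINT x|lborel. k4 * S t x) \<le> (LINT x|lborel. ed t x)" using iS[of t] by (intro integral_mono ie) auto
    then show ?thesis by simp
  qed
  have const: "(LINT x|lborel. ed s x) = (LINT x|lborel. ed t x)" for s t
    using en unfolding conserves_energy_def energy_def ed_def by blast
  have conc: "\<exists>t. (LINT x|lborel. S t x) \<le> 2 * e" if e: "e > 0" for e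
  proof -
    obtain r where r: "\<And>t. (LINT x|lborel. indicat_real {x. \<bar>x - y t\<bar> > r} x * S t x) \<le> e" using tail[OF e] unfolding S_def by blast
    define w0 where "w0 = 1 / (1 + (r / A)\<^sup>2)"
    have pos: "0 < 1 + z\<^sup>2" for z :: real using zero_le_power2[of z] by linarith
    have w0: "w0 > 0" unfolding w0_def using pos by simp
    define om where "om z = 1 / (1 + (z / A)\<^sup>2)" for z
    have om0: "0 \<le> om z" for z unfolding om_def using pos[of "z / A"] by simp
    have om: "w0 \<le> om z" if "\<bar>z\<bar> \<le> r" for z
    proof -
      have "\<bar>z / A\<bar> \<le> \<bar>r / A\<bar>"
        using that A by (simp add: abs_divide divide_right_mono)
      then have "(z / A)\<^sup>2 \<le> (r / A)\<^sup>2" by (simp only: abs_le_square_iff)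
      then show ?thesis unfolding w0_def om_def using pos[of "z / A"] by (intro divide_left_mono) auto
    qed
    obtain t where t: "(LINT x|lborel. om (x - y t) * S t x) < w0 * e"
      using euler_poisson_local_decay[OF pb \<theta> \<delta>(1) \<delta>4 \<delta>(3) A small cs n iL ip(2) ip(1)[folded pxd] K y, of "w0 * e"] w0 e
      unfolding om_def S_def by auto
    have so: "weight (1 / A) (\<lambda>x. om (x - y t)) (\<lambda>x. - (2 * ((x - y t) / A) / A) / (1 + ((x - y t) / A)\<^sup>2)\<^sup>2)"
      using weight_lorentz(1)[of A "y t"] A by (simp add: om_def)
    have co: "(\<lambda>x. om (x - y t)) \<in> borel_measurable lborel" using borel_measurable_continuous_onI[OF weightD(9)[OF so]] by simp
    have io: "integrable lborel (\<lambda>x. om (x - y t) * S t x)"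
    proof (rule Bochner_Integration.integrable_bound[OF iS[of t]])
      show "(\<lambda>x. om (x - y t) * S t x) \<in> borel_measurable lborel" using co iS[of t] by (intro borel_measurable_times) auto
      have "om (x - y t) * S t x \<le> 1 * S t x" for x by (intro mult_right_mono S0 weightD(3)[OF so])
      then show "AE x in lborel. norm (om (x - y t) * S t x) \<le> norm (S t x)" using om0 S0 by (intro AE_I2) (simp add: abs_mult)
    qed
    have ii: "integrable lborel (\<lambda>x. indicat_real {x. \<bar>x - y t\<bar> > r} x * S t x)"
      using integrable_mult_indicator[OF _ iS[of t], of "{x. \<bar>x - y t\<bar> > r}"] by simp
    have "(LINT x|lborel. S t x) \<le> (LINT x|lborel. 1 / w0 * (om (x - y t) * S t x) + indicat_real {x. \<bar>x - y t\<bar> > r} x * S t x)"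
    proof (intro integral_mono iS)
      show "integrable lborel (\<lambda>x. 1 / w0 * (om (x - y t) * S t x) + indicat_real {x. \<bar>x - y t\<bar> > r} x * S t x)" using io ii by auto
      show "S t x \<le> 1 / w0 * (om (x - y t) * S t x) + indicat_real {x. \<bar>x - y t\<bar> > r} x * S t x" for x
      proof (cases "\<bar>x - y t\<bar> > r")
        case True
        then show ?thesis using om0[of "x - y t"] S0[of t x] w0 by simp
      next
        case False
        then have "w0 * S t x \<le> om (x - y t) * S t x" using om[of "x - y t"] S0 by (intro mult_right_mono) auto
        then show ?thesis using False w0 by (simp add: field_simps)
      qed
    qed
    also have "\<dots> = 1 / w0 * (LINT x|lborel. om (x - y t) * S t x) + (LINT x|lborel. indicat_real {x. \<bar>x - y t\<bar> > r} x * S t x)"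
      using io ii by simp
    also have "\<dots> \<le> 1 / w0 * (w0 * e) + e" using t r[of t] w0 by (intro add_mono mult_left_mono) auto
    also have "\<dots> = 2 * e" using w0 by simp
    finally show ?thesis by blast
  qed
  have E0: "(LINT x|lborel. ed t x) \<le> 0" for t
  proof (rule ccontr)
    assume "\<not> ?thesis"
    then have p: "0 < (LINT x|lborel. ed t x)" by simp
    define e where "e = (LINT x|lborel. ed t x) / (4 * (C + 9))"
    have e: "e > 0" using p kC by (simp add: e_def)
    obtain s where s: "(LINT x|lborel. S s x) \<le> 2 * e" using conc[OF e] by blast
    have "(LINT x|lborel. ed t x) \<le> (C + 9) * (2 * e)"
      unfolding const[of t s] using order_trans[OF upper[of s] mult_left_mono[OF s, of "C + 9"]] kC by simp
    also have "\<dots> = (LINT x|lborel. ed t x) / 2" using kC by (simp add: e_def field_simps)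
    finally show False using p by simp
  qed
  have Sz: "S t x = 0" for t x
  proof (rule zero_of_integral[OF _ iS _ S0])
    show "continuous_on UNIV (S t)" unfolding S_def[abs_def] by (intro continuous_intros cu cn)
    have "k4 * (LINT x|lborel. S t x) \<le> 0" using lower[of t] E0[of t] by linarith
    then show "(LINT x|lborel. S t x) \<le> 0" using k4 by (simp add: mult_le_0_iff)
  qed
  have nz: "n t x = 0" and uz: "u t x = 0" for t x
    using Sz[of t x] unfolding S_def by (simp_all add: sum_power2_eq_zero_iff)
  have "\<phi> t x = 0"
  proof (rule ccontr)
    assume ne: "\<phi> t x \<noteq> 0"
    have "\<bar>\<phi> t x\<bar> \<le> 2 * min (1/4) (\<bar>\<phi> t x\<bar> / 4)"
      by (rule poisson_slice(1)[OF D\<phi> _ _ _ lim]) (use ne nz in auto)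
    then show False using ne by (auto simp: min_def split: if_splits)
  qed
  then show ?thesis using nz uz by blast
qed

theorem theorem1p3:
  fixes p :: "real \<Rightarrow> real" and k \<epsilon> :: real
  assumes "pressure_law p"
    and "k = deriv p 1"
    and "\<epsilon> > 0"
  shows "\<exists>\<delta>>0. \<forall>(n :: real \<Rightarrow> real \<Rightarrow> real) (u :: real \<Rightarrow> real \<Rightarrow> real) (\<phi> :: real \<Rightarrow> real \<Rightarrow> real)
      (y :: real \<Rightarrow> real).
      L2_compact_solution p n u \<phi> y \<longrightarrow>
      conserves_energy p n u \<phi> \<longrightarrow>
      (SUP t. L2_norm (u t)) < \<infinity> \<longrightarrow>
      (SUP t. L2_Linf_norm (n t)) < ennreal \<delta> \<longrightarrow>
      (SUP t. ereal \<bar>deriv y t\<bar>) < ereal (k / sqrt (1 + k) - \<epsilon>) \<longrightarrow>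
      (\<forall>t x. n t x = 0 \<and> u t x = 0 \<and> \<phi> t x = 0)"
proof -
  obtain C c \<sigma> \<tau> where pb: "pressure_bounds p k C c \<sigma> \<tau>" using pressure_bounds_exist[OF assms(1,2)] by blast
  have kC: "k > 0" "C \<ge> 1" using pb unfolding pressure_bounds_def by blast+
  define \<theta> where "\<theta> = 1 / (1 + k)"
  have \<theta>: "\<theta> * (1 + k) = 1" "\<theta> > 0" using kC by (simp_all add: \<theta>_def)
  define c0 where "c0 = \<theta> * k / (2 * (4 * k + 5))"
  have c0: "c0 > 0" using kC \<theta> by (simp add: c0_def)
  \<comment> \<open>The width \<open>A\<close> and the size \<open>\<delta>\<close> each use up at most a quarter of the coercivity constant \<open>c0\<close>.\<close>
  define A where "A = max 4 (800 * C / c0)"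
  have A: "A \<ge> 4" "800 * C / c0 \<le> A" by (simp_all add: A_def)
  have A1: "C * (200 * (1 / A)) \<le> c0 / 4" using A c0 by (simp add: field_simps)
  define \<delta> where "\<delta> = min (min (1/16) (sqrt k / (20 * C))) (min (k / (4 * C)) (c0 / (1600 * C)))"
  have "0 < \<delta>" unfolding \<delta>_def min_less_iff_conj using kC c0 by simp
  moreover have "\<delta> \<le> 1/16" "\<delta> \<le> sqrt k / (20 * C)" "\<delta> \<le> k / (4 * C)" "\<delta> \<le> c0 / (1600 * C)" by (simp_all add: \<delta>_def)
  ultimately have \<delta>: "0 < \<delta>" "\<delta> \<le> 1/16" "20 * (C * \<delta>) \<le> sqrt k" "4 * (C * \<delta>) \<le> k" and \<delta>1: "C * (400 * \<delta>) \<le> c0 / 4"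
    using kC by (simp_all add: field_simps)
  have small: "0 < \<theta> * k / (2 * (4 * k + 5)) - C * (400 * \<delta> + 200 * (1 / A))"
  proof -
    have "C * (400 * \<delta> + 200 * (1 / A)) = C * (400 * \<delta>) + C * (200 * (1 / A))" by (simp only: distrib_left)
    then show ?thesis unfolding c0_def[symmetric] using A1 \<delta>1 c0 by linarith
  qed
  show ?thesis
  proof (intro exI[of _ \<delta>] conjI allI impI \<delta>(1))
    fix n u \<phi> :: "real \<Rightarrow> real \<Rightarrow> real" and y :: "real \<Rightarrow> real" and t x :: real
    assume sol: "L2_compact_solution p n u \<phi> y" and en: "conserves_energy p n u \<phi>"
      and bu: "(SUP t. L2_norm (u t)) < \<infinity>" and bn: "(SUP t. L2_Linf_norm (n t)) < ennreal \<delta>"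
      and bdy: "(SUP t. ereal \<bar>deriv y t\<bar>) < ereal (k / sqrt (1 + k) - \<epsilon>)"
    have cs: "classical_solution p n u \<phi>" and ce: "associated_center n u y"
      using sol unfolding L2_compact_solution_def by auto
    have cont: "continuous_on UNIV (n t)" "continuous_on UNIV (u t)" for t
    proof -
      have "n t differentiable (at x)" "u t differentiable (at x)" for x using cs unfolding classical_solution_def by auto
      then show "continuous_on UNIV (n t)" "continuous_on UNIV (u t)"
        by (auto intro!: continuous_at_imp_continuous_on differentiable_imp_continuous_within)
    qed
    have nn: "L2_norm (n t) \<le> ennreal \<delta>" "Linf_norm (n t) \<le> ennreal \<delta>" for t
    proof -
      have "L2_Linf_norm (n t) \<le> ennreal \<delta>" using bn by (meson SUP_upper UNIV_I less_imp_le order_trans)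
      then show "L2_norm (n t) \<le> ennreal \<delta>" "Linf_norm (n t) \<le> ennreal \<delta>"
        unfolding L2_Linf_norm_def by (meson add_increasing add_increasing2 order_refl order_trans zero_le)+
    qed
    obtain b where b: "0 \<le> b" "(SUP t. L2_norm (u t)) = ennreal b" using bu by (cases "SUP t. L2_norm (u t)") auto
    have un: "L2_norm (u t) \<le> ennreal b" for t unfolding b(2)[symmetric] by (rule SUP_upper) simp
    note Ln = L2_of_norm[OF cont(1) nn(1) less_imp_le[OF \<delta>(1)]] and Lu = L2_of_norm[OF cont(2) un b(1)]
    obtain v where v: "\<And>t. (y has_real_derivative v t) (at t)" "continuous_on UNIV v"
      using ce unfolding associated_center_def C1_differentiable_on_def by (auto simp: has_real_derivative_iff_has_vector_derivative)
    have vb: "(v t)\<^sup>2 \<le> \<theta> * k\<^sup>2" for t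
    proof -
      have "ereal \<bar>deriv y t\<bar> < ereal (k / sqrt (1 + k) - \<epsilon>)" using bdy by (meson SUP_upper UNIV_I le_less_trans)
      then have "\<bar>v t\<bar> \<le> k / sqrt (1 + k)" using assms(3) DERIV_imp_deriv[OF v(1)[of t]] by simp
      then have "\<bar>v t\<bar>\<^sup>2 \<le> (k / sqrt (1 + k))\<^sup>2" by (intro power_mono) auto
      then show ?thesis using kC by (simp add: \<theta>_def power_divide)
    qed
    have tail: "\<exists>r. \<forall>t. (LINT x|lborel. indicat_real {x. \<bar>x - y t\<bar> > r} x * ((u t x)\<^sup>2 + (n t x)\<^sup>2)) \<le> e" if e: "e > 0" for e
    proof -
      obtain r where r: "(SUP t. \<integral>\<^sup>+x\<in>{x. \<bar>x - y t\<bar> > r}. ennreal ((n t x)\<^sup>2 + (u t x)\<^sup>2) \<partial>lborel) < ennreal e"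
        using ce e unfolding associated_center_def by blast
      have "(LINT x|lborel. indicat_real {x. \<bar>x - y t\<bar> > r} x * ((u t x)\<^sup>2 + (n t x)\<^sup>2)) \<le> e" for t
      proof -
        have i: "integrable lborel (\<lambda>x. indicat_real {x. \<bar>x - y t\<bar> > r} x * ((u t x)\<^sup>2 + (n t x)\<^sup>2))"
          using integrable_mult_indicator[of "{x. \<bar>x - y t\<bar> > r}" lborel "\<lambda>x. (u t x)\<^sup>2 + (n t x)\<^sup>2"] Ln(1)[of t] Lu(1)[of t] by simp
        have "ennreal (LINT x|lborel. indicat_real {x. \<bar>x - y t\<bar> > r} x * ((u t x)\<^sup>2 + (n t x)\<^sup>2))
            = (\<integral>\<^sup>+x. ennreal (indicat_real {x. \<bar>x - y t\<bar> > r} x * ((u t x)\<^sup>2 + (n t x)\<^sup>2)) \<partial>lborel)"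
          by (rule nn_integral_eq_integral[OF i, symmetric]) simp
        also have "\<dots> = (\<integral>\<^sup>+x\<in>{x. \<bar>x - y t\<bar> > r}. ennreal ((n t x)\<^sup>2 + (u t x)\<^sup>2) \<partial>lborel)"
          by (rule nn_integral_cong) (auto split: split_indicator simp: add.commute)
        also have "\<dots> \<le> ennreal e" using r by (meson SUP_upper UNIV_I less_imp_le order_trans)
        finally show ?thesis using e by (simp add: ennreal_le_iff)
      qed
      then show ?thesis by blast
    qed
    have K: "(LINT x|lborel. (n t x)\<^sup>2) \<le> \<delta>\<^sup>2 + b\<^sup>2" "(LINT x|lborel. (u t x)\<^sup>2) \<le> \<delta>\<^sup>2 + b\<^sup>2" for t
      using Ln(2)[of t] Lu(2)[of t] zero_le_power2[of \<delta>] zero_le_power2[of b] by linarith+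
    have "n t x = 0 \<and> u t x = 0 \<and> \<phi> t x = 0"
      by (rule small_compact_solution_vanishes[OF pb \<theta>(1) \<delta> A(1) small cs en bound_of_Linf[OF cont(1) nn(2) less_imp_le[OF \<delta>(1)]] Ln(1) Lu(1) K v vb tail])
    then show "n t x = 0" "u t x = 0" "\<phi> t x = 0" by auto
  qed
qed

end
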